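(* There is an algorithm which, given a finite presentation of an almost polycyclic brace $B$, decides whether $B$ is supersoluble.
   Context: A brace (skew left brace) is a set $B$ with two binary operations $+$ and $\cdot$ such that $(B,+)$ and $(B,\cdot)$ are groups and $a(b+c)=ab-a+ac$ for all $a,b,c\in B$. $\lambda_a(b)=-a+ab$ defines a homomorphism $\lambda\colon(B,\cdot)\to\operatorname{Aut}(B,+)$. A subbrace is a subset that is a subgroup of both groups; an ideal is a subbrace normal in both groups and invariant under all $\lambda_b$; quotients by ideals are braces. $\operatorname{Soc}(B)=\operatorname{Ker}\lambda\cap Z(B,+)$. $B$ is supersoluble if there is a finite chain of ideals $\{0\}=I_0\le\dots\le I_n=B$ such that for each $i$, either $(I_{i+1}/I_i,+)$ is infinite cyclic and $I_{i+1}/I_i\le\operatorname{Soc}(B/I_i)$, or $I_{i+1}/I_i$ has prime order. $B$ is almost polycyclic if there is a finite chain of ideals $\{0\}=J_0\le\dots\le J_n=B$ such that for each $i$, either $J_{i+1}/J_i\le\operatorname{Soc}(B/J_i)$ and $J_{i+1}/J_i$ is finitely generated, or $J_{i+1}/J_i$ is finite. A finite presentation of $B$ is an exact sequence of braces $0\to R\to F\xrightarrow{\theta}B\to 0$ with $F$ the free brace on a finite set $X=\{x_1,\dots,x_m\}$ and $\operatorname{Ker}\theta$ generated as an ideal of $F$ by finitely many elements $\rho_1,\dots,\rho_n$; it is given as the finite list of generators and of relators, the latter written as $b$-words, i.e. formal expressions built recursively from the empty word and the symbols $x_i$ using $w_1\cdot w_2$, $w_1+w_2$, $-w_1$, $w_1^{-1}$.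 *)

theory Defs
  imports Main "HOL-Library.Nat_Bijection" "HOL-Computational_Algebra.Primes"
begin

definition is_group :: "'a set \<Rightarrow> ('a \<Rightarrow> 'a \<Rightarrow> 'a) \<Rightarrow> bool" where
  "is_group C f \<longleftrightarrow>
     (\<forall>a\<in>C. \<forall>b\<in>C. f a b \<in> C) \<and>
     (\<forall>a\<in>C. \<forall>b\<in>C. \<forall>c\<in>C. f (f a b) c = f a (f b c)) \<and>
     (\<exists>e\<in>C. (\<forall>a\<in>C. f e a = a \<and> f a e = a) \<and> (\<forall>a\<in>C. \<exists>b\<in>C. f a b = e \<and> f b a = e))"

definition gid :: "'a set \<Rightarrow> ('a \<Rightarrow> 'a \<Rightarrow> 'a) \<Rightarrow> 'a" where
  "gid C f = (THE e. e \<in> C \<and> (\<forall>a\<in>C. f e a = a \<and> f a e = a))"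

definition ginv :: "'a set \<Rightarrow> ('a \<Rightarrow> 'a \<Rightarrow> 'a) \<Rightarrow> 'a \<Rightarrow> 'a" where
  "ginv C f a = (THE b. b \<in> C \<and> f a b = gid C f \<and> f b a = gid C f)"

definition gnpow :: "'a set \<Rightarrow> ('a \<Rightarrow> 'a \<Rightarrow> 'a) \<Rightarrow> 'a \<Rightarrow> nat \<Rightarrow> 'a" where
  "gnpow C f g k = ((f g) ^^ k) (gid C f)"

definition gipow :: "'a set \<Rightarrow> ('a \<Rightarrow> 'a \<Rightarrow> 'a) \<Rightarrow> 'a \<Rightarrow> int \<Rightarrow> 'a" where
  "gipow C f g n = (if 0 \<le> n then gnpow C f g (nat n) else ginv C f (gnpow C f g (nat (- n))))"

definition is_brace :: "'a set \<Rightarrow> ('a \<Rightarrow> 'a \<Rightarrow> 'a) \<Rightarrow> ('a \<Rightarrow> 'a \<Rightarrow> 'a) \<Rightarrow> bool" where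
  "is_brace C add mul \<longleftrightarrow> is_group C add \<and> is_group C mul \<and>
     (\<forall>a\<in>C. \<forall>b\<in>C. \<forall>c\<in>C.
        mul a (add b c) = add (add (mul a b) (ginv C add a)) (mul a c))"

definition blam :: "'a set \<Rightarrow> ('a \<Rightarrow> 'a \<Rightarrow> 'a) \<Rightarrow> ('a \<Rightarrow> 'a \<Rightarrow> 'a) \<Rightarrow> 'a \<Rightarrow> 'a \<Rightarrow> 'a" where
  "blam C add mul a b = add (ginv C add a) (mul a b)"

definition is_subbrace :: "'a set \<Rightarrow> ('a \<Rightarrow> 'a \<Rightarrow> 'a) \<Rightarrow> ('a \<Rightarrow> 'a \<Rightarrow> 'a) \<Rightarrow> 'a set \<Rightarrow> bool" where
  "is_subbrace C add mul S \<longleftrightarrow> S \<subseteq> C \<and> is_group S add \<and> is_group S mul"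

definition is_ideal :: "'a set \<Rightarrow> ('a \<Rightarrow> 'a \<Rightarrow> 'a) \<Rightarrow> ('a \<Rightarrow> 'a \<Rightarrow> 'a) \<Rightarrow> 'a set \<Rightarrow> bool" where
  "is_ideal C add mul I \<longleftrightarrow> is_subbrace C add mul I \<and>
     (\<forall>a\<in>C. \<forall>x\<in>I. add (add a x) (ginv C add a) \<in> I) \<and>
     (\<forall>a\<in>C. \<forall>x\<in>I. mul (mul a x) (ginv C mul a) \<in> I) \<and>
     (\<forall>b\<in>C. \<forall>x\<in>I. blam C add mul b x \<in> I)"

definition cosets :: "('a \<Rightarrow> 'a \<Rightarrow> 'a) \<Rightarrow> 'a set \<Rightarrow> 'a set \<Rightarrow> 'a set set" where
  "cosets add J I = (\<lambda>x. (\<lambda>y. add x y) ` I) ` J"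

text \<open>\<open>J/I \<le> Soc(B/I)\<close>, where \<open>Soc = Ker \<lambda> \<inter> Z(B,+)\<close>.\<close>
definition in_soc_mod :: "'a set \<Rightarrow> ('a \<Rightarrow> 'a \<Rightarrow> 'a) \<Rightarrow> ('a \<Rightarrow> 'a \<Rightarrow> 'a) \<Rightarrow> 'a set \<Rightarrow> 'a set \<Rightarrow> bool" where
  "in_soc_mod C add mul I J \<longleftrightarrow>
     (\<forall>x\<in>J. \<forall>b\<in>C. add (ginv C add b) (blam C add mul x b) \<in> I \<and>
                    add (add x b) (ginv C add (add b x)) \<in> I)"

definition inf_cyclic_mod :: "'a set \<Rightarrow> ('a \<Rightarrow> 'a \<Rightarrow> 'a) \<Rightarrow> 'a set \<Rightarrow> 'a set \<Rightarrow> bool" where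
  "inf_cyclic_mod C add I J \<longleftrightarrow>
     (\<exists>g\<in>J. (\<forall>x\<in>J. \<exists>n::int. add (ginv C add (gipow C add g n)) x \<in> I) \<and>
            (\<forall>n::int. n \<noteq> 0 \<longrightarrow> gipow C add g n \<notin> I))"

inductive_set gen_subgroup :: "'a set \<Rightarrow> ('a \<Rightarrow> 'a \<Rightarrow> 'a) \<Rightarrow> 'a set \<Rightarrow> 'a set"
  for C add S where
  gid_in: "gid C add \<in> gen_subgroup C add S"
| gen_in: "s \<in> S \<Longrightarrow> s \<in> gen_subgroup C add S"
| add_in: "a \<in> gen_subgroup C add S \<Longrightarrow> b \<in> gen_subgroup C add S \<Longrightarrow> add a b \<in> gen_subgroup C add S"
| inv_in: "a \<in> gen_subgroup C add S \<Longrightarrow> ginv C add a \<in> gen_subgroup C add S"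

text \<open>\<open>J/I\<close> finitely generated (as an additive group; for \<open>J/I\<close> in the socle this is the
  same as finitely generated as a brace).\<close>
definition fg_mod :: "'a set \<Rightarrow> ('a \<Rightarrow> 'a \<Rightarrow> 'a) \<Rightarrow> 'a set \<Rightarrow> 'a set \<Rightarrow> bool" where
  "fg_mod C add I J \<longleftrightarrow> (\<exists>F. finite F \<and> F \<subseteq> J \<and> J \<subseteq> gen_subgroup C add (F \<union> I))"

definition ideal_chain :: "'a set \<Rightarrow> ('a \<Rightarrow> 'a \<Rightarrow> 'a) \<Rightarrow> ('a \<Rightarrow> 'a \<Rightarrow> 'a)
    \<Rightarrow> ('a set \<Rightarrow> 'a set \<Rightarrow> bool) \<Rightarrow> bool" where
  "ideal_chain C add mul step \<longleftrightarrow>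
     (\<exists>L. L \<noteq> [] \<and> hd L = {gid C add} \<and> last L = C \<and>
          (\<forall>I\<in>set L. is_ideal C add mul I) \<and>
          (\<forall>i. Suc i < length L \<longrightarrow> L ! i \<subseteq> L ! Suc i \<and> step (L ! i) (L ! Suc i)))"

definition supersoluble :: "'a set \<Rightarrow> ('a \<Rightarrow> 'a \<Rightarrow> 'a) \<Rightarrow> ('a \<Rightarrow> 'a \<Rightarrow> 'a) \<Rightarrow> bool" where
  "supersoluble C add mul \<longleftrightarrow> ideal_chain C add mul
     (\<lambda>I J. (inf_cyclic_mod C add I J \<and> in_soc_mod C add mul I J) \<or> prime (card (cosets add J I)))"

definition almost_polycyclic :: "'a set \<Rightarrow> ('a \<Rightarrow> 'a \<Rightarrow> 'a) \<Rightarrow> ('a \<Rightarrow> 'a \<Rightarrow> 'a) \<Rightarrow> bool" where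
  "almost_polycyclic C add mul \<longleftrightarrow> ideal_chain C add mul
     (\<lambda>I J. (in_soc_mod C add mul I J \<and> fg_mod C add I J) \<or> finite (cosets add J I))"

datatype bword = Emp | Gen nat | BMul bword bword | BAdd bword bword | BNeg bword | BInv bword

fun wf :: "nat \<Rightarrow> bword \<Rightarrow> bool" where
  "wf m Emp = True"
| "wf m (Gen i) = (i < m)"
| "wf m (BMul a b) = (wf m a \<and> wf m b)"
| "wf m (BAdd a b) = (wf m a \<and> wf m b)"
| "wf m (BNeg a) = wf m a"
| "wf m (BInv a) = wf m a"

definition valid_pres :: "nat \<Rightarrow> bword list \<Rightarrow> bool" where
  "valid_pres m rels \<longleftrightarrow> (\<forall>r\<in>set rels. wf m r)"

text \<open>The congruence on words generated by the brace axioms and the relations \<open>\<rho> = 0\<close>;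
  the quotient is \<open>F/R\<close>, \<open>R\<close> the ideal of the free brace \<open>F\<close> generated by the relators
  (note \<open>0 = 1\<close> in any brace, both represented by the empty word).\<close>
inductive bcong :: "nat \<Rightarrow> bword list \<Rightarrow> bword \<Rightarrow> bword \<Rightarrow> bool" for m rels where
  refl: "wf m a \<Longrightarrow> bcong m rels a a"
| sym: "bcong m rels a b \<Longrightarrow> bcong m rels b a"
| trans: "bcong m rels a b \<Longrightarrow> bcong m rels b c \<Longrightarrow> bcong m rels a c"
| cMul: "bcong m rels a a' \<Longrightarrow> bcong m rels b b' \<Longrightarrow> bcong m rels (BMul a b) (BMul a' b')"
| cAdd: "bcong m rels a a' \<Longrightarrow> bcong m rels b b' \<Longrightarrow> bcong m rels (BAdd a b) (BAdd a' b')"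
| cNeg: "bcong m rels a a' \<Longrightarrow> bcong m rels (BNeg a) (BNeg a')"
| cInv: "bcong m rels a a' \<Longrightarrow> bcong m rels (BInv a) (BInv a')"
| add_assoc: "wf m a \<Longrightarrow> wf m b \<Longrightarrow> wf m c \<Longrightarrow>
    bcong m rels (BAdd (BAdd a b) c) (BAdd a (BAdd b c))"
| add_lid: "wf m a \<Longrightarrow> bcong m rels (BAdd Emp a) a"
| add_rid: "wf m a \<Longrightarrow> bcong m rels (BAdd a Emp) a"
| add_linv: "wf m a \<Longrightarrow> bcong m rels (BAdd (BNeg a) a) Emp"
| add_rinv: "wf m a \<Longrightarrow> bcong m rels (BAdd a (BNeg a)) Emp"
| mul_assoc: "wf m a \<Longrightarrow> wf m b \<Longrightarrow> wf m c \<Longrightarrow>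
    bcong m rels (BMul (BMul a b) c) (BMul a (BMul b c))"
| mul_lid: "wf m a \<Longrightarrow> bcong m rels (BMul Emp a) a"
| mul_rid: "wf m a \<Longrightarrow> bcong m rels (BMul a Emp) a"
| mul_linv: "wf m a \<Longrightarrow> bcong m rels (BMul (BInv a) a) Emp"
| mul_rinv: "wf m a \<Longrightarrow> bcong m rels (BMul a (BInv a)) Emp"
| brace: "wf m a \<Longrightarrow> wf m b \<Longrightarrow> wf m c \<Longrightarrow>
    bcong m rels (BMul a (BAdd b c)) (BAdd (BAdd (BMul a b) (BNeg a)) (BMul a c))"
| rel: "r \<in> set rels \<Longrightarrow> wf m r \<Longrightarrow> bcong m rels r Emp"

definition bcls :: "nat \<Rightarrow> bword list \<Rightarrow> bword \<Rightarrow> bword set" where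
  "bcls m rels w = {v. bcong m rels w v}"

definition pres_carrier :: "nat \<Rightarrow> bword list \<Rightarrow> bword set set" where
  "pres_carrier m rels = bcls m rels ` {w. wf m w}"

definition pres_add :: "nat \<Rightarrow> bword list \<Rightarrow> bword set \<Rightarrow> bword set \<Rightarrow> bword set" where
  "pres_add m rels X Y = bcls m rels (BAdd (SOME w. w \<in> X) (SOME w. w \<in> Y))"

definition pres_mul :: "nat \<Rightarrow> bword list \<Rightarrow> bword set \<Rightarrow> bword set \<Rightarrow> bword set" where
  "pres_mul m rels X Y = bcls m rels (BMul (SOME w. w \<in> X) (SOME w. w \<in> Y))"

datatype recf = RZero | RSuc | RProj nat | RComp recf "recf list" | RPrec recf recf | RMin recf

inductive reval :: "recf \<Rightarrow> nat list \<Rightarrow> nat \<Rightarrow> bool" where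
  zero: "reval RZero xs 0"
| suc: "reval RSuc (x # xs) (Suc x)"
| proj: "i < length xs \<Longrightarrow> reval (RProj i) xs (xs ! i)"
| comp: "list_all2 (\<lambda>g y. reval g xs y) gs ys \<Longrightarrow> reval f ys z \<Longrightarrow> reval (RComp f gs) xs z"
| prec0: "reval f xs y \<Longrightarrow> reval (RPrec f g) (0 # xs) y"
| precS: "reval (RPrec f g) (n # xs) y \<Longrightarrow> reval g (n # y # xs) z \<Longrightarrow>
    reval (RPrec f g) (Suc n # xs) z"
| min: "reval f (n # xs) 0 \<Longrightarrow> (\<forall>k<n. \<exists>y. 0 < y \<and> reval f (k # xs) y) \<Longrightarrow>
    reval (RMin f) xs n"
monos list_all2_mono

fun enc_word :: "bword \<Rightarrow> nat" where
  "enc_word Emp = prod_encode (0, 0)"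
| "enc_word (Gen i) = prod_encode (1, i)"
| "enc_word (BMul a b) = prod_encode (2, prod_encode (enc_word a, enc_word b))"
| "enc_word (BAdd a b) = prod_encode (3, prod_encode (enc_word a, enc_word b))"
| "enc_word (BNeg a) = prod_encode (4, enc_word a)"
| "enc_word (BInv a) = prod_encode (5, enc_word a)"

definition enc_pres :: "nat \<Rightarrow> bword list \<Rightarrow> nat" where
  "enc_pres m rels = prod_encode (m, list_encode (map enc_word rels))"

end

(* Membership in a presented brace is recursively enumerable, so both answers get enumerable witnesses.

   Supersoluble: words g_1, ..., g_n with additive spans A_1 <= ... <= A_n = B such that each g_i is modulo
   A_(i-1) in the socle or of prime exponent.  Finitely many memberships force the A_i to be ideals, since
   the additive and multiplicative subgroups generated by g_1, ..., g_i then agree.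

   Not supersoluble: a table of a nonzero finite quotient without an ideal of prime order.  If there is none,
   climb from 0 to B: finite factors inside a finite quotient separating them; on a free abelian socle factor,
   B acts on the lattice with a flag of scalar actions modulo every prime.  An integer polynomial that
   splits modulo almost all primes has a rational root, so there is a common integral eigenvector, which
   spans an infinite cyclic ideal in the socle. *)
theory Submission
  imports Defs "HOL-Number_Theory.Cong" "HOL-Computational_Algebra.Polynomial"
    "HOL-Library.Function_Algebras" "HOL-Algebra.Group"
begin

section \<open>Computable functions and recursively enumerable predicates\<close>

text \<open>The enumeration yields only equalities of words, so a positive certificate cannot assert
  that a factor is infinite or nontrivial; it establishes only a weak chain (\<open>wreach\<close>).
  This suffices by a circle of implications: a supersoluble brace has a weak chain, a weak chain
  gives \<open>prime_quotients\<close> (every nonzero finite quotient has an ideal of prime order),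
  and in an almost polycyclic brace that property gives back a genuine chain. Failure of
  \<open>prime_quotients\<close> is the other enumerable answer.

  That a polynomial splitting modulo almost all primes has a root is usually drawn from the density
  theorems of Frobenius or Chebotarev. Here it is a counting argument: without a root, the nonzero
  values on an interval of n integers would have a product divisible by nearly n!^d, which is more
  than their size allows.\<close>

definition cf :: "(nat \<Rightarrow> nat) \<Rightarrow> bool" where
  "cf f \<longleftrightarrow> (\<exists>r. \<forall>x. reval r [x] (f x))"

definition cf2 :: "(nat \<Rightarrow> nat \<Rightarrow> nat) \<Rightarrow> bool" where
  "cf2 f \<longleftrightarrow> (\<exists>r. \<forall>x y. reval r [x, y] (f x y))"

definition cf3 :: "(nat \<Rightarrow> nat \<Rightarrow> nat \<Rightarrow> nat) \<Rightarrow> bool" where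
  "cf3 f \<longleftrightarrow> (\<exists>r. \<forall>x y z. reval r [x, y, z] (f x y z))"

lemma reval_comp1: "reval g xs a \<Longrightarrow> reval f [a] v \<Longrightarrow> reval (RComp f [g]) xs v"
  by (rule reval.comp[where ys = "[a]"]) auto

lemma reval_comp2:
  "reval g xs a \<Longrightarrow> reval h xs b \<Longrightarrow> reval f [a, b] v \<Longrightarrow> reval (RComp f [g, h]) xs v"
  by (rule reval.comp[where ys = "[a, b]"]) auto

lemma reval_proj: "i < length xs \<Longrightarrow> v = xs ! i \<Longrightarrow> reval (RProj i) xs v"
  using reval.proj by simp

lemma cf_id: "cf (\<lambda>x. x)"
  unfolding cf_def by (rule exI[of _ "RProj 0"]) (simp add: reval_proj)

lemma cf_comp:
  assumes "cf f" "cf g"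
  shows "cf (\<lambda>x. f (g x))"
proof -
  obtain r s where "\<And>x. reval r [x] (f x)" "\<And>x. reval s [x] (g x)"
    using assms unfolding cf_def by blast
  then have "reval (RComp r [s]) [x] (f (g x))" for x by (intro reval_comp1)
  then show ?thesis unfolding cf_def by blast
qed

lemma cf2_comp:
  assumes "cf2 f" "cf g" "cf h"
  shows "cf (\<lambda>x. f (g x) (h x))"
proof -
  obtain r s t where "\<And>x y. reval r [x, y] (f x y)" "\<And>x. reval s [x] (g x)"
    "\<And>x. reval t [x] (h x)"
    using assms unfolding cf_def cf2_def cf3_def by blast
  then have "reval (RComp r [s, t]) [x] (f (g x) (h x))" for x by (intro reval_comp2)
  then show ?thesis unfolding cf_def cf2_def cf3_def by blast
qed

lemma cf2_comp1:
  assumes "cf f" "cf2 g"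
  shows "cf2 (\<lambda>x y. f (g x y))"
proof -
  obtain r s where "\<And>x. reval r [x] (f x)" "\<And>x y. reval s [x, y] (g x y)"
    using assms unfolding cf_def cf2_def cf3_def by blast
  then have "reval (RComp r [s]) [x, y] (f (g x y))" for x y by (intro reval_comp1)
  then show ?thesis unfolding cf_def cf2_def cf3_def by blast
qed

lemma cf2_comp2:
  assumes "cf2 f" "cf2 g" "cf2 h"
  shows "cf2 (\<lambda>x y. f (g x y) (h x y))"
proof -
  obtain r s t where "\<And>x y. reval r [x, y] (f x y)" "\<And>x y. reval s [x, y] (g x y)"
    "\<And>x y. reval t [x, y] (h x y)"
    using assms unfolding cf_def cf2_def cf3_def by blast
  then have "reval (RComp r [s, t]) [x, y] (f (g x y) (h x y))" for x y by (intro reval_comp2)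
  then show ?thesis unfolding cf_def cf2_def cf3_def by blast
qed

lemma cf3_comp1:
  assumes "cf f" "cf3 g"
  shows "cf3 (\<lambda>x y z. f (g x y z))"
proof -
  obtain r s where "\<And>x. reval r [x] (f x)" "\<And>x y z. reval s [x, y, z] (g x y z)"
    using assms unfolding cf_def cf2_def cf3_def by blast
  then have "reval (RComp r [s]) [x, y, z] (f (g x y z))" for x y z by (intro reval_comp1)
  then show ?thesis unfolding cf_def cf2_def cf3_def by blast
qed

lemma cf3_comp2:
  assumes "cf2 f" "cf3 g" "cf3 h"
  shows "cf3 (\<lambda>x y z. f (g x y z) (h x y z))"
proof -
  obtain r s t where "\<And>x y. reval r [x, y] (f x y)" "\<And>x y z. reval s [x, y, z] (g x y z)"
    "\<And>x y z. reval t [x, y, z] (h x y z)"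
    using assms unfolding cf_def cf2_def cf3_def by blast
  then have "reval (RComp r [s, t]) [x, y, z] (f (g x y z) (h x y z))" for x y z by (intro reval_comp2)
  then show ?thesis unfolding cf_def cf2_def cf3_def by blast
qed

lemma cf2_proj: "cf2 (\<lambda>x y. x)" "cf2 (\<lambda>x y. y)"
  unfolding cf2_def
  by (rule exI[of _ "RProj 0"], simp add: reval_proj)
    (rule exI[of _ "RProj 1"], simp add: reval_proj)

lemma cf3_proj: "cf3 (\<lambda>x y z. x)" "cf3 (\<lambda>x y z. y)" "cf3 (\<lambda>x y z. z)"
  unfolding cf3_def
  by (rule exI[of _ "RProj 0"], simp add: reval_proj)
    ((rule exI[of _ "RProj 1"], simp add: reval_proj),
     (rule exI[of _ "RProj 2"], simp add: reval_proj))

lemma cf_Suc: "cf Suc"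
  unfolding cf_def by (rule exI[of _ RSuc]) (simp add: reval.suc)

lemma cf_const: "cf (\<lambda>x. c)"
proof (induction c)
  case 0
  show ?case unfolding cf_def by (rule exI[of _ RZero]) (simp add: reval.zero)
next
  case (Suc c)
  then show ?case by (rule cf_comp[OF cf_Suc])
qed

lemma cf2_rec:
  assumes "cf f" "cf3 g"
  shows "cf2 (\<lambda>n x. rec_nat (f x) (\<lambda>k y. g k y x) n)"
proof -
  obtain rf rg where rf: "\<And>x. reval rf [x] (f x)" and rg: "\<And>x y z. reval rg [x, y, z] (g x y z)"
    using assms unfolding cf_def cf3_def by blast
  have "reval (RPrec rf rg) [n, x] (rec_nat (f x) (\<lambda>k y. g k y x) n)" for n x
  proof (induction n)
    case 0
    show ?case using reval.prec0[OF rf] by simp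
  next
    case (Suc n)
    show ?case using reval.precS[OF Suc rg] by simp
  qed
  then show ?thesis unfolding cf2_def by blast
qed

lemma cf2_add: "cf2 (+)"
proof -
  have "rec_nat x (\<lambda>k y. Suc y) n = n + x" for x n :: nat by (induction n) auto
  then show ?thesis
    using cf2_rec[OF cf_id cf3_comp1[OF cf_Suc cf3_proj(2)]] by simp
qed

lemma cf2_mult: "cf2 (*)"
proof -
  have "rec_nat 0 (\<lambda>k y. y + x) n = n * x" for x n :: nat by (induction n) auto
  then show ?thesis
    using cf2_rec[OF cf_const[of 0] cf3_comp2[OF cf2_add cf3_proj(2) cf3_proj(3)]] by simp
qed

lemma cf_pred: "cf (\<lambda>n. n - 1)"
proof -
  have "rec_nat 0 (\<lambda>k y. k) n = n - 1" for n :: nat by (cases n) auto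
  then show ?thesis
    using cf2_comp[OF cf2_rec[OF cf_const[of 0] cf3_proj(1)] cf_id cf_id] by simp
qed

lemma cf2_diff: "cf2 (-)"
proof -
  have "rec_nat x (\<lambda>k y. y - 1) n = x - n" for x n :: nat by (induction n) auto
  then have "cf2 (\<lambda>n x. x - n)"
    using cf2_rec[OF cf_id cf3_comp1[OF cf_pred cf3_proj(2)]] by simp
  then show ?thesis by (rule cf2_comp2[OF _ cf2_proj(2) cf2_proj(1)])
qed

lemma cf_triangle: "cf triangle"
proof -
  have "rec_nat 0 (\<lambda>k y. y + Suc k) n = triangle n" for n by (induction n) auto
  then show ?thesis
    using cf2_comp[OF cf2_rec[OF cf_const[of 0]
      cf3_comp2[OF cf2_add cf3_proj(2) cf3_comp1[OF cf_Suc cf3_proj(1)]]] cf_id cf_id]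
    by simp
qed

lemma cf_min:
  assumes "cf2 F" "\<And>x. \<exists>n. F n x = 0"
  shows "cf (\<lambda>x. LEAST n. F n x = 0)"
proof -
  obtain r where r: "\<And>x y. reval r [x, y] (F x y)" using assms unfolding cf2_def by blast
  have "reval (RMin r) [x] (LEAST n. F n x = 0)" for x
  proof (rule reval.min)
    show "reval r [LEAST n. F n x = 0, x] 0"
      using r[of "LEAST n. F n x = 0" x] LeastI_ex[OF assms(2)[of x]] by simp
    show "\<forall>k<(LEAST n. F n x = 0). \<exists>y>0. reval r [k, x] y"
    proof (intro allI impI)
      fix k assume "k < (LEAST n. F n x = 0)"
      then have "F k x \<noteq> 0" by (rule not_less_Least)
      then show "\<exists>y>0. reval r [k, x] y" using r[of k x] by (intro exI[of _ "F k x"]) simp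
    qed
  qed
  then show ?thesis unfolding cf_def by blast
qed

section \<open>Pairing functions and list codes\<close>

definition pfst :: "nat \<Rightarrow> nat" where "pfst z = fst (prod_decode z)"
definition psnd :: "nat \<Rightarrow> nat" where "psnd z = snd (prod_decode z)"
abbreviation pr :: "nat \<Rightarrow> nat \<Rightarrow> nat" where "pr a b \<equiv> prod_encode (a, b)"

lemma pfst_pr [simp]: "pfst (pr a b) = a" and psnd_pr [simp]: "psnd (pr a b) = b"
  by (simp_all add: pfst_def psnd_def)

lemma pr_pfst_psnd [simp]: "pr (pfst z) (psnd z) = z"
  by (simp add: pfst_def psnd_def)

lemma cf2_pr: "cf2 pr"
proof -
  have "pr = (\<lambda>a b. triangle (a + b) + a)" by (auto simp: prod_encode_def)
  then show ?thesis
    using cf2_comp2[OF cf2_add cf2_comp1[OF cf_triangle cf2_add] cf2_proj(1)] by simp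
qed

lemma triangle_mono: "a \<le> b \<Longrightarrow> triangle a \<le> triangle b"
  by (induction b) (auto simp: le_Suc_eq)

text \<open>The index of the diagonal of z in the Cantor enumeration, found by minimisation; both
  projections are then differences.\<close>

definition diag :: "nat \<Rightarrow> nat" where "diag z = (LEAST n. Suc z - triangle (Suc n) = 0)"

lemma diag_pr: "diag (pr a b) = a + b"
  unfolding diag_def
proof (rule Least_equality)
  show "Suc (pr a b) - triangle (Suc (a + b)) = 0" by (simp add: prod_encode_def)
  fix n assume "Suc (pr a b) - triangle (Suc n) = 0"
  then have "triangle (a + b) < triangle (Suc n)" by (simp add: prod_encode_def)
  then show "a + b \<le> n" using triangle_mono[of "Suc n" "a + b"] by linarith
qed

lemma cf_pfst: "cf pfst" and cf_psnd: "cf psnd"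
proof -
  have d: "cf diag"
    unfolding diag_def
  proof (rule cf_min)
    show "cf2 (\<lambda>n x. Suc x - triangle (Suc n))"
      by (intro cf2_comp2[OF cf2_diff] cf2_comp1[OF cf_Suc] cf2_comp1[OF cf_triangle] cf2_proj)
    show "\<exists>n. Suc x - triangle (Suc n) = 0" for x
      by (rule exI[of _ x]) simp
  qed
  have e: "diag z = pfst z + psnd z" for z
    using diag_pr[of "pfst z" "psnd z"] by simp
  have z: "z = triangle (pfst z + psnd z) + pfst z" for z
  proof -
    have "pr (pfst z) (psnd z) = triangle (pfst z + psnd z) + pfst z" by (simp add: prod_encode_def)
    then show ?thesis by simp
  qed
  have f: "pfst = (\<lambda>z. z - triangle (diag z))"
    unfolding e using z by (intro ext) (metis diff_add_inverse)
  have s: "psnd = (\<lambda>z. diag z - pfst z)"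
    by (intro ext) (simp add: e)
  show 1: "cf pfst"
    by (subst f) (intro cf2_comp[OF cf2_diff] cf_id cf_comp[OF cf_triangle] d)
  show "cf psnd"
    by (subst s) (intro cf2_comp[OF cf2_diff] d 1)
qed

named_theorems cf_intros

declare cf_id [cf_intros] cf_const [cf_intros]
declare cf_comp[OF cf_Suc, cf_intros] cf_comp[OF cf_pfst, cf_intros] cf_comp[OF cf_psnd, cf_intros]
declare cf2_comp[OF cf2_add, cf_intros] cf2_comp[OF cf2_mult, cf_intros]
  cf2_comp[OF cf2_diff, cf_intros] cf2_comp[OF cf2_pr, cf_intros]

text \<open>Closure rules are stated for unary functions, with bound variables packed into nested
  pairs: here x with the counter and the accumulator. A single set of introduction rules then
  decomposes every term, however deep its binders.\<close>

lemma cf_rec [cf_intros]: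
  assumes "cf a" "cf b" "cf (\<lambda>z. g (pfst z) (pfst (psnd z)) (psnd (psnd z)))"
  shows "cf (\<lambda>x. rec_nat (b x) (\<lambda>k y. g x k y) (a x))"
proof -
  let ?g = "\<lambda>z. g (pfst z) (pfst (psnd z)) (psnd (psnd z))"
  have "cf3 (\<lambda>k y x. ?g (pr x (pr k y)))"
    by (intro cf3_comp1[OF assms(3)] cf3_comp2[OF cf2_pr] cf3_proj)
  then have "cf3 (\<lambda>k y x. g x k y)" by simp
  from cf2_comp[OF cf2_rec[OF assms(2) this] assms(1) cf_id] show ?thesis .
qed

text \<open>\<open>list_encode\<close> sends the empty list to 0 and a nonempty one to the successor
  of a pair, hence the subtraction of 1. Past the end the code stays 0, so \<open>dropc\<close>
  doubles as a test of the length.\<close>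

fun dropc :: "nat \<Rightarrow> nat \<Rightarrow> nat" where
  "dropc c 0 = c"
| "dropc c (Suc i) = psnd (dropc c i - 1)"

definition nthc :: "nat \<Rightarrow> nat \<Rightarrow> nat" where "nthc c i = pfst (dropc c i - 1)"

lemma cf_dropc [cf_intros]: "cf f \<Longrightarrow> cf g \<Longrightarrow> cf (\<lambda>x. dropc (f x) (g x))"
proof -
  assume "cf f" "cf g"
  moreover have "dropc c i = rec_nat c (\<lambda>k y. psnd (y - 1)) i" for c i by (induction i) auto
  ultimately show ?thesis by (simp add: cf_intros)
qed

lemma cf_nthc [cf_intros]: "cf f \<Longrightarrow> cf g \<Longrightarrow> cf (\<lambda>x. nthc (f x) (g x))"
  unfolding nthc_def by (intro cf_intros)

lemma dropc_list_encode: "i \<le> length xs \<Longrightarrow> dropc (list_encode xs) i = list_encode (drop i xs)"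
proof (induction i)
  case (Suc i)
  then obtain y ys where "drop i xs = y # ys" by (metis Cons_nth_drop_Suc Suc_le_lessD)
  moreover from this have "drop (Suc i) xs = ys" by (metis drop_Suc list.sel(3) tl_drop)
  ultimately show ?case using Suc by simp
qed simp

lemma nthc_list_encode: "i < length xs \<Longrightarrow> nthc (list_encode xs) i = xs ! i"
  by (simp add: nthc_def dropc_list_encode Cons_nth_drop_Suc[symmetric])

lemma psnd_0: "psnd (0 - 1) = 0"
proof -
  have "pr 0 0 = 0" by (simp add: prod_encode_def)
  then show ?thesis by (metis diff_0_eq_0 psnd_pr)
qed

lemma dropc_list_encode_ge: "length xs \<le> i \<Longrightarrow> dropc (list_encode xs) i = 0"
proof (induction i)
  case (Suc i)
  show ?case
  proof (cases "length xs = Suc i")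
    case True
    then show ?thesis using dropc_list_encode[of "Suc i" xs] by simp
  next
    case False
    then show ?thesis using Suc psnd_0 by simp
  qed
qed simp

lemma dropc_list_encode_eq_0: "dropc (list_encode xs) i = 0 \<longleftrightarrow> length xs \<le> i"
proof
  assume "dropc (list_encode xs) i = 0"
  then show "length xs \<le> i"
    using dropc_list_encode[of i xs]
    by (metis drop_eq_Nil inj_list_encode[THEN injD] linear list_encode.simps(1))
qed (rule dropc_list_encode_ge)

lemma length_le_list_encode: "length xs \<le> list_encode xs"
proof (induction xs)
  case (Cons x xs)
  then show ?case using le_prod_encode_2[of "list_encode xs" x] by simp
qed simp

text \<open>Plays the part of Goedel's beta function: a quantifier over finite sequences becomes one
  over numbers.\<close>

lemma nthc_surj: "\<exists>c. \<forall>i<n. nthc c i = f i"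
  by (rule exI[of _ "list_encode (map f [0..<n])"]) (simp add: nthc_list_encode)

section \<open>Closure properties of recursively enumerable predicates\<close>

definition RE :: "(nat \<Rightarrow> bool) \<Rightarrow> bool" where
  "RE P \<longleftrightarrow> (\<exists>f. cf f \<and> (\<forall>x. P x \<longleftrightarrow> (\<exists>y. f (pr x y) = 0)))"

named_theorems RE_intros

lemma RE_I: "cf f \<Longrightarrow> (\<And>x. P x \<longleftrightarrow> (\<exists>y. f (pr x y) = 0)) \<Longrightarrow> RE P"
  unfolding RE_def by blast

lemma RE_eq [RE_intros]:
  assumes "cf f" "cf g"
  shows "RE (\<lambda>x. f x = g x)"
  by (rule RE_I[of "\<lambda>z. (f (pfst z) - g (pfst z)) + (g (pfst z) - f (pfst z))"])
    (intro cf_intros assms[THEN cf_comp], auto)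

lemma RE_less [RE_intros]:
  assumes "cf f" "cf g"
  shows "RE (\<lambda>x. f x < g x)"
  by (rule RE_I[of "\<lambda>z. Suc (f (pfst z)) - g (pfst z)"])
    (intro cf_intros assms[THEN cf_comp], auto)

lemma RE_subst: "RE P \<Longrightarrow> cf f \<Longrightarrow> RE (\<lambda>x. P (f x))"
proof -
  assume P: "RE P" and f: "cf f"
  then obtain h where h: "cf h" "\<And>x. P x \<longleftrightarrow> (\<exists>y. h (pr x y) = 0)" unfolding RE_def by blast
  show ?thesis
    by (rule RE_I[of "\<lambda>z. h (pr (f (pfst z)) (psnd z))"])
      (intro cf_intros cf_comp[OF h(1)] cf_comp[OF f], use h(2) in auto)
qed

lemma RE_conj [RE_intros]: "RE P \<Longrightarrow> RE Q \<Longrightarrow> RE (\<lambda>x. P x \<and> Q x)"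
proof -
  assume "RE P" "RE Q"
  then obtain f g where h: "cf f" "\<And>x. P x \<longleftrightarrow> (\<exists>y. f (pr x y) = 0)"
    "cf g" "\<And>x. Q x \<longleftrightarrow> (\<exists>y. g (pr x y) = 0)" unfolding RE_def by blast
  show ?thesis
  proof (rule RE_I[of "\<lambda>z. f (pr (pfst z) (pfst (psnd z))) + g (pr (pfst z) (psnd (psnd z)))"])
    show "(P x \<and> Q x) \<longleftrightarrow> (\<exists>y. f (pr (pfst (pr x y)) (pfst (psnd (pr x y)))) +
        g (pr (pfst (pr x y)) (psnd (psnd (pr x y)))) = 0)" for x
      unfolding h by simp (metis pfst_pr psnd_pr)
  qed (intro cf_intros cf_comp[OF h(1)] cf_comp[OF h(3)])
qed

lemma RE_disj [RE_intros]: "RE P \<Longrightarrow> RE Q \<Longrightarrow> RE (\<lambda>x. P x \<or> Q x)"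
proof -
  assume "RE P" "RE Q"
  then obtain f g where h: "cf f" "\<And>x. P x \<longleftrightarrow> (\<exists>y. f (pr x y) = 0)"
    "cf g" "\<And>x. Q x \<longleftrightarrow> (\<exists>y. g (pr x y) = 0)" unfolding RE_def by blast
  show ?thesis
    by (rule RE_I[of "\<lambda>z. f z * g z"]) (intro cf_intros h(1,3), use h(2,4) in auto)
qed

lemma RE_ex [RE_intros]:
  assumes "RE (\<lambda>z. P (pfst z) (psnd z))"
  shows "RE (\<lambda>x. \<exists>y. P x y)"
proof -
  obtain f where h: "cf f" "\<And>x. P (pfst x) (psnd x) \<longleftrightarrow> (\<exists>y. f (pr x y) = 0)"
    using assms unfolding RE_def by blast
  have h2: "P x w \<longleftrightarrow> (\<exists>y. f (pr (pr x w) y) = 0)" for x w using h(2)[of "pr x w"] by simp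
  show ?thesis
  proof (rule RE_I[of "\<lambda>z. f (pr (pr (pfst z) (pfst (psnd z))) (psnd (psnd z)))"])
    show "(\<exists>y. P x y) \<longleftrightarrow> (\<exists>y. f (pr (pr (pfst (pr x y)) (pfst (psnd (pr x y)))) (psnd (psnd (pr x y)))) = 0)" for x
      unfolding h2 by simp (metis pfst_pr psnd_pr)
  qed (intro cf_intros cf_comp[OF h(1)])
qed

text \<open>The witnesses for all y below the bound are gathered in one list code \<open>c\<close>;
  the sum \<open>s\<close> of the tests vanishes exactly when each of them does.\<close>

lemma RE_all_less [RE_intros]:
  assumes "cf b" "RE (\<lambda>z. P (pfst z) (psnd z))"
  shows "RE (\<lambda>x. \<forall>y<b x. P x y)"
proof -
  obtain f where h: "cf f" "\<And>x. P (pfst x) (psnd x) \<longleftrightarrow> (\<exists>y. f (pr x y) = 0)"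
    using assms unfolding RE_def by blast
  have h2: "P x w \<longleftrightarrow> (\<exists>y. f (pr (pr x w) y) = 0)" for x w using h(2)[of "pr x w"] by simp
  define s where "s x c n = rec_nat 0 (\<lambda>k v. v + f (pr (pr x k) (nthc c k))) n" for x c n
  have s: "s x c n = 0 \<longleftrightarrow> (\<forall>k<n. f (pr (pr x k) (nthc c k)) = 0)" for x c n
    by (induction n) (auto simp: s_def less_Suc_eq)
  show ?thesis
  proof (rule RE_I[of "\<lambda>z. s (pfst z) (psnd z) (b (pfst z))"])
    show "cf (\<lambda>z. s (pfst z) (psnd z) (b (pfst z)))"
      unfolding s_def by (intro cf_intros cf_comp[OF h(1)] cf_comp[OF assms(1)])
    show "(\<forall>y<b x. P x y) \<longleftrightarrow> (\<exists>y. s (pfst (pr x y)) (psnd (pr x y)) (b (pfst (pr x y))) = 0)" for x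
    proof
      assume "\<forall>y<b x. P x y"
      then obtain w where w: "\<forall>k<b x. f (pr (pr x k) (w k)) = 0" unfolding h2 by metis
      obtain c where "\<forall>i<b x. nthc c i = w i" using nthc_surj by blast
      then show "\<exists>y. s (pfst (pr x y)) (psnd (pr x y)) (b (pfst (pr x y))) = 0"
        using w by (auto simp: s intro!: exI[of _ c])
    qed (auto simp: s h2)
  qed
qed

lemma RE_neq [RE_intros]: "cf f \<Longrightarrow> cf g \<Longrightarrow> RE (\<lambda>x. f x \<noteq> g x)"
  using RE_disj[OF RE_less RE_less, of f g g f] by (simp add: neq_iff)

text \<open>Every rule has at most two premises; a one-premise rule is used with \<open>y = z\<close>.\<close>
inductive deriv :: "(nat \<Rightarrow> nat \<Rightarrow> bool) \<Rightarrow> (nat \<Rightarrow> nat \<Rightarrow> nat \<Rightarrow> nat \<Rightarrow> bool) \<Rightarrow> nat \<Rightarrow> nat \<Rightarrow> bool"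
  for base step p where
  base: "base p x \<Longrightarrow> deriv base step p x"
| step: "deriv base step p y \<Longrightarrow> deriv base step p z \<Longrightarrow> step p x y z \<Longrightarrow> deriv base step p x"

text \<open>Derivation trees are linearised: every entry of the sequence is a base fact or follows
  from two earlier entries. A sequence has a code, so derivability becomes an existential statement
  with bounded quantifiers.\<close>

lemma deriv_iff_sequence:
  "deriv base step p x \<longleftrightarrow>
    (\<exists>c n. nthc c n = x \<and> (\<forall>i<Suc n. base p (nthc c i) \<or>
       (\<exists>j<i. \<exists>k<i. step p (nthc c i) (nthc c j) (nthc c k))))"
  (is "_ \<longleftrightarrow> (\<exists>c n. ?S (nthc c) n x)")
proof
  assume "deriv base step p x"
  then have "\<exists>s n. ?S s n x"
  proof induction
    case (base x)
    then show ?case by (intro exI[of _ "\<lambda>_. x"] exI[of _ 0]) auto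
  next
    case (step y z x)
    obtain s n t m where s: "?S s n y" and t: "?S t m z" using step.IH by blast
    \<comment> \<open>The derivation of \<open>y\<close> fills the places 0..n, that of
      \<open>z\<close> the places n+1..n+m+1, and \<open>x\<close> comes last; its premises stand at
      n and at \<open>n + Suc m\<close>.\<close>
    define r where "r i = (if i \<le> n then s i else if i \<le> n + Suc m then t (i - Suc n) else x)" for i
    have "base p (r i) \<or> (\<exists>j<i. \<exists>k<i. step p (r i) (r j) (r k))" if i: "i < Suc (n + Suc (Suc m))" for i
    proof -
      consider "i \<le> n" | "n < i" "i \<le> n + Suc m" | "i = n + Suc (Suc m)" using i by linarith
      then show ?thesis
      proof cases
        case 1
        then have "base p (s i) \<or> (\<exists>j<i. \<exists>k<i. step p (s i) (s j) (s k))" using s by auto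
        moreover have "r j = s j" if "j \<le> i" for j using that 1 by (auto simp: r_def)
        ultimately show ?thesis by (metis le_refl less_imp_le)
      next
        case 2
        define i' where "i' = i - Suc n"
        have i': "i = Suc n + i'" "i' < Suc m" using 2 by (auto simp: i'_def)
        then have "base p (t i') \<or> (\<exists>j<i'. \<exists>k<i'. step p (t i') (t j) (t k))" using t by blast
        moreover have "r (Suc n + j) = t j" if "j \<le> i'" for j using that i' by (auto simp: r_def)
        ultimately show ?thesis unfolding i'(1) by (metis le_refl less_imp_le nat_add_left_cancel_less)
      next
        case 3
        have "r n = y" "r (n + Suc m) = z" "r i = x" using s t 3 by (auto simp: r_def)
        then show ?thesis using step.hyps 3
          by (metis add_Suc_right less_SucI less_add_Suc1 lessI)
      qed
    qed
    moreover have "r (n + Suc (Suc m)) = x" by (simp add: r_def)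
    ultimately show ?case by blast
  qed
  then obtain s n where s: "?S s n x" by blast
  obtain c where c: "\<forall>i<Suc n. nthc c i = s i" using nthc_surj by blast
  have "base p (nthc c i) \<or> (\<exists>j<i. \<exists>k<i. step p (nthc c i) (nthc c j) (nthc c k))"
    if i: "i < Suc n" for i
  proof -
    have "base p (s i) \<or> (\<exists>j<i. \<exists>k<i. step p (s i) (s j) (s k))" using s i by blast
    moreover have "nthc c j = s j" if "j \<le> i" for j using c i that by simp
    ultimately show ?thesis by (metis le_refl less_imp_le)
  qed
  then have "?S (nthc c) n x" using s c by simp
  then show "\<exists>c n. ?S (nthc c) n x" by blast
next
  assume "\<exists>c n. ?S (nthc c) n x"
  then obtain c n where s: "?S (nthc c) n x" by blast
  have "i < Suc n \<longrightarrow> deriv base step p (nthc c i)" for i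
  proof (induction i rule: less_induct)
    case (less i)
    show ?case
    proof
      assume i: "i < Suc n"
      then consider "base p (nthc c i)"
        | j k where "j < i" "k < i" "step p (nthc c i) (nthc c j) (nthc c k)"
        using s by blast
      then show "deriv base step p (nthc c i)"
      proof cases
        case 2
        then show ?thesis using less.IH i deriv.step[of base step p "nthc c j" "nthc c k"] by simp
      qed (rule deriv.base)
    qed
  qed
  then show "deriv base step p x" using s by blast
qed

text \<open>The parameter \<open>p\<close> of the derivation system may itself be computed from the
  input, so one system serves all presentations uniformly.\<close>

lemma RE_deriv:
  assumes "RE (\<lambda>u. base (pfst u) (psnd u))"
    and "RE (\<lambda>u. step (pfst (pfst u)) (psnd (pfst u)) (pfst (psnd u)) (psnd (psnd u)))"
    and "cf f" "cf g"
  shows "RE (\<lambda>x. deriv base step (f x) (g x))"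
proof -
  have b: "RE (\<lambda>x. base (f' x) (g' x))" if "cf f'" "cf g'" for f' g'
    using RE_subst[OF assms(1), of "\<lambda>x. pr (f' x) (g' x)"] that by (simp add: cf_intros)
  have s: "RE (\<lambda>x. step (f' x) (g' x) (h x) (k x))" if "cf f'" "cf g'" "cf h" "cf k" for f' g' h k
    using RE_subst[OF assms(2), of "\<lambda>x. pr (pr (f' x) (g' x)) (pr (h x) (k x))"] that
    by (simp add: cf_intros)
  show ?thesis
    unfolding deriv_iff_sequence
    by (intro RE_intros b s cf_intros cf_comp[OF assms(3)] cf_comp[OF assms(4)])
qed

text \<open>Both enumerations are searched in parallel. The search has to halt only where exactly
  one of P and Q holds: there, at the first stage \<open>l\<close> at which either succeeds,
  \<open>f\<close> vanishes precisely when P holds.\<close>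

lemma RE_decide:
  assumes "RE P" "RE Q"
  shows "\<exists>r. \<forall>x. (P x \<longleftrightarrow> \<not> Q x) \<longrightarrow> reval r [x] (if P x then 1 else 0)"
proof -
  obtain f g where h: "cf f" "\<And>x. P x \<longleftrightarrow> (\<exists>y. f (pr x y) = 0)"
    "cf g" "\<And>x. Q x \<longleftrightarrow> (\<exists>y. g (pr x y) = 0)" using assms unfolding RE_def by blast
  have "cf2 (\<lambda>y x. f (pr x y) * g (pr x y))"
    by (intro cf2_comp2[OF cf2_mult] cf2_comp1[OF h(1)] cf2_comp1[OF h(3)] cf2_comp2[OF cf2_pr] cf2_proj)
  then obtain r1 where r1: "\<And>y x. reval r1 [y, x] (f (pr x y) * g (pr x y))" unfolding cf2_def by blast
  have "cf2 (\<lambda>y x. 1 - f (pr x y))"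
    by (intro cf2_comp2[OF cf2_diff] cf2_comp1[OF h(1)] cf2_comp1[OF cf_const] cf2_comp2[OF cf2_pr] cf2_proj)
      (rule cf2_comp1[OF cf_const[of 1] cf2_proj(1)])
  then obtain r2 where r2: "\<And>y x. reval r2 [y, x] (1 - f (pr x y))" unfolding cf2_def by blast
  have "reval (RComp r2 [RMin r1, RProj 0]) [x] (if P x then 1 else 0)" if x: "P x \<longleftrightarrow> \<not> Q x" for x
  proof -
    define F where "F y = f (pr x y) * g (pr x y)" for y
    have "\<exists>y. F y = 0" using x unfolding h F_def by auto
    then have L: "F (LEAST y. F y = 0) = 0" by (rule LeastI_ex)
    define l where "l = (LEAST y. F y = 0)"
    have m: "reval (RMin r1) [x] (LEAST y. F y = 0)"
    proof (rule reval.min)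
      have "reval r1 [LEAST y. F y = 0, x] (F (LEAST y. F y = 0))" unfolding F_def by (rule r1)
      then show "reval r1 [LEAST y. F y = 0, x] 0" unfolding L .
      show "\<forall>k<(LEAST y. F y = 0). \<exists>y>0. reval r1 [k, x] y"
      proof (intro allI impI)
        fix k assume "k < (LEAST y. F y = 0)"
        then have "F k \<noteq> 0" by (rule not_less_Least)
        then show "\<exists>y>0. reval r1 [k, x] y"
          using r1[of k x] by (intro exI[of _ "F k"]) (simp add: F_def)
      qed
    qed
    have l: "f (pr x l) = 0 \<or> g (pr x l) = 0" using L[folded l_def] by (simp add: F_def)
    have e: "1 - f (pr x l) = (if P x then 1 else 0)"
    proof (cases "P x")
      case True
      then have "\<not> (\<exists>y. g (pr x y) = 0)" using x h(4)[of x] by simp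
      then have "f (pr x l) = 0" using l by metis
      then show ?thesis using True by simp
    next
      case False
      then have "\<not> (\<exists>y. f (pr x y) = 0)" using h(2)[of x] by simp
      then have "f (pr x l) \<noteq> 0" by metis
      then show ?thesis using False by simp
    qed
    have p: "reval (RProj 0) [x] x" by (simp add: reval_proj)
    show ?thesis
      unfolding e[symmetric] by (rule reval_comp2[OF m[folded l_def] p r2])
  qed
  then show ?thesis by blast
qed

section \<open>Integer polynomials splitting modulo almost all primes\<close>

lemma poly_add_expand:
  fixes g :: "int poly"
  shows "\<exists>q. poly g (a + h) = poly g a + h * poly (pderiv g) a + h\<^sup>2 * q"
proof (induction g)
  case (pCons c g)
  then obtain q where q: "poly g (a + h) = poly g a + h * poly (pderiv g) a + h\<^sup>2 * q" by blast
  have "poly (pCons c g) (a + h) = poly (pCons c g) a + h * poly (pderiv (pCons c g)) a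
      + h\<^sup>2 * (a * q + poly (pderiv g) a + h * q)"
    by (simp add: q pderiv_pCons power2_eq_square algebra_simps)
  then show ?case by blast
qed simp

lemma poly_cong:
  fixes g :: "int poly"
  assumes "[a = b] (mod m)"
  shows "[poly g a = poly g b] (mod m)"
  by (induction g) (auto intro!: cong_add cong_mult assms)

lemma hensel_root:
  fixes p :: int
  assumes p: "prime p" and "p dvd poly g c" and g': "\<not> p dvd poly (pderiv g) c"
  shows "\<exists>r. [r = c] (mod p) \<and> p ^ J dvd poly g r"
proof -
  have "\<exists>r. [r = c] (mod p) \<and> p ^ Suc J dvd poly g r"
  proof (induction J)
    case 0
    show ?case using assms by (intro exI[of _ c]) auto
  next
    case (Suc J)
    then obtain r where r: "[r = c] (mod p)" "p ^ Suc J dvd poly g r" by blast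
    then obtain s where s: "poly g r = p ^ Suc J * s" by (auto elim: dvdE)
    have "\<not> p dvd poly (pderiv g) r"
      using g' cong_dvd_iff[OF poly_cong[OF r(1)]] by blast
    then have "coprime (poly (pderiv g) r) p" using p prime_imp_coprime coprime_commute by blast
    then obtain t' where "[poly (pderiv g) r * t' = 1] (mod p)" using cong_solve_coprime_int by blast
    then have "[poly (pderiv g) r * t' * (- s) = 1 * (- s)] (mod p)" by (intro cong_mult cong_refl)
    then have "p dvd poly (pderiv g) r * t' * (- s) - 1 * (- s)" using cong_iff_dvd_diff by blast
    then obtain u where u: "s - poly (pderiv g) r * t' * s = p * u" by (auto elim!: dvdE)
    \<comment> \<open>Newton's correction: \<open>t'\<close> inverts the derivative modulo p, so
      value and linear term together gain one more factor p, while the quadratic remainder carries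
      p^(2J+2).\<close>
    define h where "h = p ^ Suc J * (- s * t')"
    obtain q where q: "poly g (r + h) = poly g r + h * poly (pderiv g) r + h\<^sup>2 * q"
      using poly_add_expand by blast
    have "poly g r + h * poly (pderiv g) r = p ^ Suc J * (s - poly (pderiv g) r * t' * s)"
      by (simp add: s h_def algebra_simps)
    also have "\<dots> = p ^ Suc (Suc J) * u" unfolding u by simp
    finally have 1: "p ^ Suc (Suc J) dvd poly g r + h * poly (pderiv g) r" by simp
    have "p ^ Suc (Suc J) dvd p ^ Suc J * p ^ Suc J"
      unfolding power_add[symmetric] by (rule le_imp_power_dvd) simp
    then have "p ^ Suc (Suc J) dvd (p ^ Suc J * p ^ Suc J) * ((s * t')\<^sup>2 * q)" by (rule dvd_mult2)
    moreover have "h\<^sup>2 * q = (p ^ Suc J * p ^ Suc J) * ((s * t')\<^sup>2 * q)"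
      by (simp add: h_def power2_eq_square)
    ultimately have "p ^ Suc (Suc J) dvd h\<^sup>2 * q" by (simp only:)
    with 1 have "p ^ Suc (Suc J) dvd poly g (r + h)" unfolding q by (rule dvd_add)
    moreover have "[r + h = c] (mod p)"
      using cong_add[OF r(1), of h 0] by (simp add: h_def cong_0_iff)
    ultimately show ?case by blast
  qed
  then obtain r where r: "[r = c] (mod p)" "p ^ Suc J dvd poly g r" by blast
  have "p ^ J dvd p ^ Suc J" by simp
  with r show ?thesis using dvd_trans by blast
qed

lemma monic_synthetic_div:
  fixes g :: "int poly"
  assumes "lead_coeff g = 1" "degree g = Suc d"
  shows "lead_coeff (synthetic_div g c) = 1" "degree (synthetic_div g c) = d"
proof -
  define q where "q = synthetic_div g c"
  show dq: "degree (synthetic_div g c) = d" using assms by (simp add: degree_synthetic_div)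
  have q0: "q \<noteq> 0" unfolding q_def using synthetic_div_eq_0_iff assms by force
  have g: "[:poly g c:] + [:- c, 1:] * q = g" using synthetic_div_correct'[of c g] by (simp add: q_def)
  have "degree [:poly g c:] < degree ([:- c, 1:] * q)"
    using q0 by (subst degree_mult_eq) auto
  then have "lead_coeff ([:poly g c:] + [:- c, 1:] * q) = lead_coeff ([:- c, 1:] * q)"
    by (rule lead_coeff_add_le)
  then have "lead_coeff g = lead_coeff [:- c, 1:] * lead_coeff q" unfolding g lead_coeff_mult .
  moreover have "lead_coeff [:- c, 1:] = 1" by simp
  ultimately show "lead_coeff (synthetic_div g c) = 1"
    using assms(1) unfolding q_def by simp
qed

text \<open>The modulus will be a prime power, so there are zero divisors among the residues; the
  roots can be split off one after the other because their differences are units.\<close>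

lemma monic_roots_factor:
  fixes g :: "int poly"
  assumes "lead_coeff g = 1" "degree g = d"
    and "\<And>i. i < d \<Longrightarrow> m dvd poly g (r i)"
    and "\<And>i j. i < d \<Longrightarrow> j < d \<Longrightarrow> i \<noteq> j \<Longrightarrow> coprime (r i - r j) m"
  shows "[poly g x = (\<Prod>i<d. (x - r i))] (mod m)"
  using assms
proof (induction d arbitrary: g)
  case 0
  then obtain a where "g = [:a:]" using degree_eq_zeroE by blast
  then show ?case using 0 by simp
next
  case (Suc d)
  define q where "q = synthetic_div g (r d)"
  have q: "lead_coeff q = 1" "degree q = d"
    using monic_synthetic_div[OF Suc.prems(1,2)] by (auto simp: q_def)
  have g: "poly g y = (y - r d) * poly q y + poly g (r d)" for y
    using arg_cong[OF synthetic_div_correct'[of "r d" g], of "\<lambda>h. poly h y"] by (simp add: q_def algebra_simps)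
  have d: "m dvd poly g (r d)" using Suc.prems(3) by simp
  have "m dvd poly q (r i)" if "i < d" for i
  proof -
    have "m dvd poly g (r i)" using Suc.prems(3) that by simp
    then have "m dvd (r i - r d) * poly q (r i)" using d unfolding g[of "r i"] by (simp add: dvd_add_left_iff)
    then show ?thesis using Suc.prems(4)[of i d] that by (simp add: coprime_commute coprime_dvd_mult_right_iff)
  qed
  then have "[poly q x = (\<Prod>i<d. (x - r i))] (mod m)" using Suc.IH[OF q] Suc.prems(4) by simp
  then have "[(x - r d) * poly q x + poly g (r d) = (x - r d) * (\<Prod>i<d. (x - r i)) + 0] (mod m)"
    using d by (intro cong_add cong_mult cong_refl) (auto simp: cong_0_iff)
  then show ?case unfolding g[of x] by (simp add: mult.commute)
qed

text \<open>Congruence modulo \<open>p\<close> is witnessed by an explicit multiple of \<open>p\<close>.\<close>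
lemma monic_dvd_linear_factors_mod:
  fixes g q h :: "int poly"
  assumes p: "prime p" and "lead_coeff g = 1" "lead_coeff q = 1"
    and "g * q = (\<Prod>c\<leftarrow>cs. [:- c, 1:]) + smult p h"
  shows "\<exists>cs' h'. length cs' = degree g \<and> g = (\<Prod>c\<leftarrow>cs'. [:- c, 1:]) + smult p h'"
  using assms(2-)
proof (induction cs arbitrary: g q h)
  case Nil
  have lc: "lead_coeff (g * q) = 1" unfolding lead_coeff_mult Nil(1,2) by simp
  have "degree (g * q) = 0"
  proof (rule ccontr)
    assume n: "degree (g * q) \<noteq> 0"
    obtain k where k: "k = degree (g * q)" by blast
    have "coeff (g * q) k = p * coeff h k" using n k Nil(3) by (cases k) (auto simp: coeff_1)
    then have "p * coeff h k = 1" using lc k by simp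
    then have "p dvd 1" by (metis dvd_triv_left)
    then show False using p not_prime_unit by blast
  qed
  moreover have "g \<noteq> 0" "q \<noteq> 0" using Nil by auto
  ultimately have "degree g = 0" by (simp add: degree_mult_eq)
  moreover from this have "g = 1" using Nil(1)
    by (metis degree_eq_zeroE lead_coeff_pCons(2) one_pCons pCons_0_0)
  ultimately show ?case by (intro exI[of _ "[]"] exI[of _ 0]) simp
next
  case (Cons c cs)
  \<comment> \<open>p stays prime in the polynomial ring and does not divide the monic
    \<open>[:- c, 1:]\<close>, so this linear factor can be cancelled from a congruence modulo
    p.\<close>
  have cancel: "\<exists>u'. u = smult p u'" if "[:- c, 1:] * u = smult p w" for u w
  proof -
    have "[:p:] dvd [:- c, 1:] * u" unfolding that by (intro dvdI[of _ _ w]) simp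
    moreover have "\<not> [:p:] dvd [:- c, 1:]"
      using p not_prime_unit by (auto simp: const_poly_dvd_iff intro!: exI[of _ 1])
    ultimately have "[:p:] dvd u"
      using lift_prime_elem_poly[of p] p prime_elem_dvd_mult_iff by (metis prime_def)
    then show ?thesis by (auto elim!: dvdE)
  qed
  have nz: "g \<noteq> 0" "q \<noteq> 0" using Cons.prems by auto
  have "poly g c * poly q c = p * poly h c"
    using arg_cong[OF Cons.prems(3), of "\<lambda>f. poly f c"] by simp
  \<comment> \<open>The root c belongs modulo p to \<open>g\<close> or to \<open>q\<close>. It is
    divided out of that factor, and recorded in the list for \<open>g\<close> only in the first
    case.\<close>
  then have "p dvd poly g c \<or> p dvd poly q c" using p by (metis dvd_triv_left prime_dvd_mult_iff)
  then show ?case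
  proof
    assume "p dvd poly g c"
    then obtain a where a: "poly g c = p * a" by (auto elim: dvdE)
    have "degree g \<noteq> 0"
    proof
      assume "degree g = 0"
      then have "g = 1" using Cons.prems(1)
        by (metis degree_eq_zeroE lead_coeff_pCons(2) one_pCons pCons_0_0)
      then show False using \<open>p dvd poly g c\<close> p not_prime_unit by auto
    qed
    then obtain d where d: "degree g = Suc d" using not0_implies_Suc by blast
    define g1 where "g1 = synthetic_div g c"
    have g1: "lead_coeff g1 = 1" "degree g1 = d"
      using monic_synthetic_div[OF Cons.prems(1) d] by (auto simp: g1_def)
    have g: "g = [:- c, 1:] * g1 + smult p [:a:]"
      using synthetic_div_correct'[of c g] by (simp add: g1_def a)
    have "[:- c, 1:] * (g1 * q - (\<Prod>c\<leftarrow>cs. [:- c, 1:])) = smult p (h - [:a:] * q)"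
      using Cons.prems(3) unfolding g by (simp add: algebra_simps smult_diff_right)
    then obtain u where "g1 * q - (\<Prod>c\<leftarrow>cs. [:- c, 1:]) = smult p u" using cancel by blast
    then have "g1 * q = (\<Prod>c\<leftarrow>cs. [:- c, 1:]) + smult p u" by (simp add: algebra_simps)
    from Cons.IH[OF g1(1) Cons.prems(2) this] obtain cs' h' where
      IH: "length cs' = degree g1" "g1 = (\<Prod>c\<leftarrow>cs'. [:- c, 1:]) + smult p h'" by blast
    have "g = [:- c, 1:] * ((\<Prod>c\<leftarrow>cs'. [:- c, 1:]) + smult p h') + smult p [:a:]"
      using g unfolding IH(2) by simp
    then have "g = (\<Prod>c\<leftarrow>c # cs'. [:- c, 1:]) + smult p ([:- c, 1:] * h' + [:a:])"
      by (simp only: distrib_left mult_smult_right smult_add_right add.assoc list.map prod_list.Cons)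
    moreover have "length (c # cs') = degree g" using IH(1) g1 d by simp
    ultimately show ?thesis by blast
  next
    assume "p dvd poly q c"
    then obtain a where a: "poly q c = p * a" by (auto elim: dvdE)
    have "degree q \<noteq> 0"
    proof
      assume "degree q = 0"
      then have "q = 1" using Cons.prems(2)
        by (metis degree_eq_zeroE lead_coeff_pCons(2) one_pCons pCons_0_0)
      then show False using \<open>p dvd poly q c\<close> p not_prime_unit by auto
    qed
    then obtain d where d: "degree q = Suc d" using not0_implies_Suc by blast
    define q1 where "q1 = synthetic_div q c"
    have q1: "lead_coeff q1 = 1" "degree q1 = d"
      using monic_synthetic_div[OF Cons.prems(2) d] by (auto simp: q1_def)
    have q: "q = [:- c, 1:] * q1 + smult p [:a:]"
      using synthetic_div_correct'[of c q] by (simp add: q1_def a)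
    have "[:- c, 1:] * (g * q1 - (\<Prod>c\<leftarrow>cs. [:- c, 1:])) = smult p (h - [:a:] * g)"
      using Cons.prems(3) unfolding q by (simp add: algebra_simps smult_diff_right)
    then obtain u where "g * q1 - (\<Prod>c\<leftarrow>cs. [:- c, 1:]) = smult p u" using cancel by blast
    then have "g * q1 = (\<Prod>c\<leftarrow>cs. [:- c, 1:]) + smult p u" by (simp add: algebra_simps)
    from Cons.IH[OF Cons.prems(1) q1(1) this] show ?thesis .
  qed
qed

text \<open>The Bezout identity makes the roots modulo \<open>p\<close> simple, so that Hensel lifting applies.\<close>
lemma split_mod_prime_power:
  fixes g q h u w :: "int poly"
  assumes p: "prime p" and g: "lead_coeff g = 1" "degree g = d" and "lead_coeff q = 1"
    and "g * q = (\<Prod>c\<leftarrow>cs. [:- c, 1:]) + smult p h"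
    and bez: "u * g + w * pderiv g = [:D:]" and D: "\<not> p dvd D"
  shows "\<exists>r. \<forall>x. [poly g x = (\<Prod>i<d. (x - r i))] (mod p ^ J)"
proof -
  obtain cs' h' where cs': "length cs' = d" "g = (\<Prod>c\<leftarrow>cs'. [:- c, 1:]) + smult p h'"
    using monic_dvd_linear_factors_mod[OF p g(1) assms(4,5)] g(2) by blast
  define c where "c i = cs' ! i" for i
  have gp: "g = (\<Prod>i<d. [:- c i, 1:]) + smult p h'"
    using cs' by (simp add: c_def prod.list_conv_set_nth atLeast0LessThan)
  have root: "p dvd poly g (c i)" if "i < d" for i
  proof -
    have "(\<Prod>i<d. poly [:- c i, 1:] (c k)) = 0" if "k < d" for k
      using that by (auto simp: prod_zero_iff)
    then have "poly g (c i) = p * poly h' (c i)" unfolding gp using that by (simp add: poly_prod)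
    then show ?thesis by simp
  qed
  have simple: "\<not> p dvd poly (pderiv g) (c i)" if "i < d" for i
  proof
    assume "p dvd poly (pderiv g) (c i)"
    then have "p dvd poly u (c i) * poly g (c i) + poly w (c i) * poly (pderiv g) (c i)"
      using root[OF that] by simp
    also have "\<dots> = D" using arg_cong[OF bez, of "\<lambda>f. poly f (c i)"] by simp
    finally show False using D by simp
  qed
  \<comment> \<open>A repeated root modulo p would also be a root of the derivative, against
    \<open>simple\<close>.\<close>
  have distinct: "\<not> p dvd c i - c j" if "i < d" "j < d" "i \<noteq> j" for i j
  proof
    assume dv: "p dvd c i - c j"
    define R where "R = (\<Prod>k\<in>{..<d} - {i} - {j}. [:- c k, 1:])"
    have "(\<Prod>i<d. [:- c i, 1:]) = [:- c i, 1:] * ([:- c j, 1:] * R)"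
    proof -
      have "(\<Prod>i<d. [:- c i, 1:]) = [:- c i, 1:] * (\<Prod>k\<in>{..<d} - {i}. [:- c k, 1:])"
        using that by (intro prod.remove) auto
      also have "(\<Prod>k\<in>{..<d} - {i}. [:- c k, 1:]) = [:- c j, 1:] * R"
        unfolding R_def using that by (intro prod.remove) auto
      finally show ?thesis .
    qed
    then have "g = [:- c i, 1:] * ([:- c j, 1:] * R) + smult p h'" using gp by simp
    then have "poly (pderiv g) (c i) = (c i - c j) * poly R (c i) + p * poly (pderiv h') (c i)"
      by (simp only: pderiv_add pderiv_mult pderiv_smult) (simp add: pderiv_pCons algebra_simps)
    then have "p dvd poly (pderiv g) (c i)" using dv by simp
    then show False using simple that by blast
  qed
  have "\<forall>i. \<exists>r. i < d \<longrightarrow> [r = c i] (mod p) \<and> p ^ J dvd poly g r"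
    using hensel_root[OF p root simple] by blast
  then obtain r where r: "\<And>i. i < d \<Longrightarrow> [r i = c i] (mod p) \<and> p ^ J dvd poly g (r i)" by metis
  have "coprime (r i - r j) (p ^ J)" if "i < d" "j < d" "i \<noteq> j" for i j
  proof -
    have "[r i - r j = c i - c j] (mod p)" using r that by (intro cong_diff) auto
    then have "\<not> p dvd r i - r j" using distinct[OF that] cong_dvd_iff by blast
    then have "coprime p (r i - r j)" using p prime_imp_coprime by blast
    then show ?thesis by (simp add: coprime_commute coprime_power_right_iff)
  qed
  then have "[poly g x = (\<Prod>i<d. (x - r i))] (mod p ^ J)" for x
    using monic_roots_factor[OF g] r by blast
  then show ?thesis by blast
qed

section \<open>The homogenised values K^d g(x/K) of a monic polynomial g of degree d\<close>

definition homog :: "int poly \<Rightarrow> int \<Rightarrow> int \<Rightarrow> int" where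
  "homog g x k = (\<Sum>i\<le>degree g. coeff g i * x ^ i * k ^ (degree g - i))"

lemma homog_scale: "homog g (q * a) (q * b) = q ^ degree g * homog g a b"
  unfolding homog_def sum_distrib_left
proof (rule sum.cong[OF HOL.refl])
  fix i assume "i \<in> {..degree g}"
  then have "q ^ degree g = q ^ i * q ^ (degree g - i)" by (simp flip: power_add)
  then show "coeff g i * (q * a) ^ i * (q * b) ^ (degree g - i) =
      q ^ degree g * (coeff g i * a ^ i * b ^ (degree g - i))"
    by (simp add: power_mult_distrib mult.assoc mult.left_commute mult.commute)
qed

lemma homog_one: "homog g a 1 = poly g a"
  by (simp add: homog_def poly_altdef)

lemma homog_split_top:
  assumes "lead_coeff g = 1"
  shows "homog g a b = a ^ degree g + b * (\<Sum>i<degree g. coeff g i * a ^ i * b ^ (degree g - Suc i))"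
proof -
  have "homog g a b = (\<Sum>i<degree g. coeff g i * a ^ i * b ^ (degree g - i)) + a ^ degree g"
    unfolding homog_def using assms by (simp add: lessThan_Suc_atMost[symmetric])
  also have "(\<Sum>i<degree g. coeff g i * a ^ i * b ^ (degree g - i)) =
      b * (\<Sum>i<degree g. coeff g i * a ^ i * b ^ (degree g - Suc i))"
    unfolding sum_distrib_left
    by (rule sum.cong[OF HOL.refl]) (auto simp: Suc_diff_Suc[symmetric])
  finally show ?thesis by simp
qed

text \<open>The rational root theorem: in lowest terms b' divides a'^d, since all other terms of the
  form contain b'; hence b' = 1.\<close>

lemma homog_eq_0_imp_root:
  assumes "lead_coeff g = 1" "b > 0" "homog g a b = 0"
  shows "\<exists>c. poly g c = 0"
proof -
  define q where "q = gcd a b"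
  have q: "q > 0" using assms by (simp add: q_def)
  obtain a' b' where ab: "a = q * a'" "b = q * b'" "coprime a' b'"
    using gcd_coprime_exists[of a b] q unfolding q_def by (metis less_irrefl mult.commute)
  have b': "b' > 0" using assms(2) q ab(2) by (simp add: zero_less_mult_iff)
  have h: "homog g a' b' = 0" using assms(3) q unfolding ab homog_scale by simp
  then have "a' ^ degree g = b' * - (\<Sum>i<degree g. coeff g i * a' ^ i * b' ^ (degree g - Suc i))"
    unfolding homog_split_top[OF assms(1)] by simp
  then have "b' dvd a' ^ degree g" by (metis dvd_triv_left)
  then have "b' dvd 1" using ab(3) by (metis coprime_commute coprime_dvd_mult_left_iff coprime_power_right_iff mult_1)
  then have "b' = 1" using b' by simp
  then show ?thesis using h homog_one by metis
qed

text \<open>Because the leading coefficient is 1, the bound is a power of |x| plus a constant and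
  not of a multiple of |x|. This keeps the product over an interval within a polynomial factor of
  factorials.\<close>

lemma abs_homog_le:
  assumes "lead_coeff g = 1" "K \<ge> 1" "c \<ge> 1 + (\<Sum>i<degree g. \<bar>coeff g i\<bar>)"
  shows "\<bar>homog g x K\<bar> \<le> (\<bar>x\<bar> + c * K) ^ degree g"
proof (cases "degree g")
  case 0
  then show ?thesis using homog_split_top[OF assms(1)] by simp
next
  case (Suc e)
  define B where "B = \<bar>x\<bar> + c * K"
  have c: "c \<ge> 1" 
  proof -
    have "0 \<le> (\<Sum>i<degree g. \<bar>coeff g i\<bar>)" by (rule sum_nonneg) simp
    then show ?thesis using assms(3) by linarith
  qed
  have K: "c * K \<ge> K" using assms(2) c by (simp add: mult_le_cancel_right1)
  have B: "\<bar>x\<bar> \<le> B" "K \<le> B" "0 \<le> B" using c K assms(2) unfolding B_def by linarith+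
  have "\<bar>coeff g i * x ^ i * K ^ (degree g - Suc i)\<bar> \<le> \<bar>coeff g i\<bar> * B ^ e" if "i < degree g" for i
  proof -
    have "\<bar>x\<bar> ^ i * K ^ (degree g - Suc i) \<le> B ^ i * B ^ (degree g - Suc i)"
      using B assms(2) by (intro mult_mono power_mono) auto
    also have "\<dots> = B ^ e" using that Suc by (simp flip: power_add)
    finally show ?thesis using assms(2)
      by (simp add: abs_mult power_abs mult.assoc mult_left_mono)
  qed
  then have "(\<Sum>i<degree g. \<bar>coeff g i * x ^ i * K ^ (degree g - Suc i)\<bar>) \<le> (\<Sum>i<degree g. \<bar>coeff g i\<bar> * B ^ e)"
    by (intro sum_mono) auto
  also have "\<dots> = (\<Sum>i<degree g. \<bar>coeff g i\<bar>) * B ^ e" by (simp add: sum_distrib_right)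
  also have "\<dots> \<le> c * B ^ e" using assms(3) B by (intro mult_right_mono) auto
  finally have S: "\<bar>\<Sum>i<degree g. coeff g i * x ^ i * K ^ (degree g - Suc i)\<bar> \<le> c * B ^ e"
    by (rule order_trans[OF sum_abs])
  have "\<bar>homog g x K\<bar> \<le> \<bar>x\<bar> ^ degree g + K * \<bar>\<Sum>i<degree g. coeff g i * x ^ i * K ^ (degree g - Suc i)\<bar>"
    unfolding homog_split_top[OF assms(1)] using assms(2)
    by (intro order_trans[OF abs_triangle_ineq]) (simp add: abs_mult power_abs)
  also have "\<dots> \<le> \<bar>x\<bar> * \<bar>x\<bar> ^ e + K * (c * B ^ e)"
    using S assms(2) Suc by (intro add_mono mult_left_mono) auto
  also have "\<dots> \<le> \<bar>x\<bar> * B ^ e + K * (c * B ^ e)"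
    using B c assms(2) by (intro add_mono mult_left_mono power_mono) auto
  also have "\<dots> = (\<bar>x\<bar> + c * K) * B ^ e" by (simp add: algebra_simps)
  also have "\<dots> = B ^ degree g" by (simp add: Suc B_def)
  finally show ?thesis unfolding B_def .
qed

text \<open>With K' inverse to K modulo m, the factorisation of g is evaluated at x K' and
  multiplied by K^d.\<close>

lemma homog_cong_prod:
  assumes "coprime K m" and g: "degree g = d"
    and "\<forall>x. [poly g x = (\<Prod>i<d. (x - r i))] (mod m)"
  shows "[homog g x K = (\<Prod>i<d. (x - K * r i))] (mod m)"
proof -
  obtain K' where K': "[K * K' = 1] (mod m)" using cong_solve_coprime_int[OF assms(1)] ..
  have "[coeff g i * x ^ i * K ^ (d - i) = K ^ d * (coeff g i * (x * K') ^ i)] (mod m)" if i: "i \<le> d" for i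
  proof -
    obtain e where e: "d = i + e" using le_Suc_ex[OF i] ..
    have "K ^ d * (coeff g i * (x * K') ^ i) = coeff g i * x ^ i * K ^ (d - i) * (K * K') ^ i"
      unfolding e by (simp add: power_mult_distrib power_add mult_ac)
    moreover have "[coeff g i * x ^ i * K ^ (d - i) * (K * K') ^ i = coeff g i * x ^ i * K ^ (d - i) * 1 ^ i] (mod m)"
      by (intro cong_mult cong_pow K' cong_refl)
    ultimately have "[K ^ d * (coeff g i * (x * K') ^ i) = coeff g i * x ^ i * K ^ (d - i) * 1 ^ i] (mod m)"
      by (simp only:)
    then show ?thesis unfolding power_one mult_1_right by (rule cong_sym)
  qed
  then have "[homog g x K = (\<Sum>i\<le>d. K ^ d * (coeff g i * (x * K') ^ i))] (mod m)"
    unfolding homog_def g by (intro cong_sum) auto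
  also have "(\<Sum>i\<le>d. K ^ d * (coeff g i * (x * K') ^ i)) = K ^ d * poly g (x * K')"
    by (simp add: poly_altdef g sum_distrib_left)
  also have "[K ^ d * poly g (x * K') = K ^ d * (\<Prod>i<d. (x * K' - r i))] (mod m)"
    using assms(3) by (intro cong_mult cong_refl) auto
  also have "K ^ d * (\<Prod>i<d. (x * K' - r i)) = (\<Prod>i<d. K * (x * K' - r i))"
    by (simp add: prod.distrib)
  also have "\<dots> = (\<Prod>i<d. (x * (K * K') - K * r i))"
    by (rule prod.cong) (auto simp: algebra_simps)
  also have "[(\<Prod>i<d. (x * (K * K') - K * r i)) = (\<Prod>i<d. (x * 1 - K * r i))] (mod m)"
    by (intro cong_prod cong_diff cong_mult K' cong_refl)
  finally show ?thesis by simp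
qed

section \<open>Estimates for factorials and multiplicities\<close>

lemma fact_dvd_prod_shift:
  "(fact n :: int) dvd (\<Prod>x\<in>{a + 1..a + int n}. (x - c))"
proof -
  have "(\<Prod>x\<in>{a + 1..a + int n}. (x - c)) = (\<Prod>i<n. (a + 1 + int i - c))"
    by (rule prod.reindex_bij_witness[of _ "\<lambda>i. a + 1 + int i" "\<lambda>x. nat (x - a - 1)"]) auto
  also have "\<dots> = pochhammer (a + 1 - c) n"
    by (simp add: pochhammer_prod atLeast0LessThan algebra_simps)
  finally show ?thesis using fact_dvd_pochhammer by simp
qed

lemma sum_div_pow2_le: "(\<Sum>i=1..M. u div 2 ^ i) + u div 2 ^ M \<le> (u::nat)"
proof (induction M)
  case (Suc M)
  have "u div 2 ^ Suc M = u div 2 ^ M div 2" by (simp only: power_Suc2 div_mult2_eq)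
  then have "u div 2 ^ Suc M + u div 2 ^ Suc M \<le> u div 2 ^ M" by linarith
  then show ?case using Suc by simp
qed simp

lemma card_filter_eq_sum:
  "finite S \<Longrightarrow> card {j \<in> S. P j} = (\<Sum>j\<in>S. if P j then 1 else 0)"
  by (simp only: card_eq_sum sum.inter_filter)

text \<open>Legendre's count started above e: the excess of y is the number of j > e for which p^j
  divides y, and at most n div 2^j of the numbers up to n have that property. The geometric sum over
  j leaves at most n div 2^e.\<close>

lemma sum_multiplicity_excess_le:
  fixes p :: nat
  assumes p: "prime p" and "k \<le> e"
  shows "(\<Sum>y=1..n. multiplicity p y - e) \<le> n div 2 ^ k"
proof -
  have p2: "2 \<le> p" using p prime_ge_2_nat by blast
  have pj: "p ^ j dvd y \<longleftrightarrow> j \<le> multiplicity p y" if "y > 0" for y j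
    using that p by (intro power_dvd_iff_le_multiplicity) auto
  have "multiplicity p y - e = card {j \<in> {e + 1..e + n}. p ^ j dvd y}" if "y \<in> {1..n}" for y
  proof -
    have "p ^ multiplicity p y \<le> y" using that by (intro dvd_imp_le multiplicity_dvd) auto
    moreover have "multiplicity p y < 2 ^ multiplicity p y" by (rule less_exp)
    moreover have "2 ^ multiplicity p y \<le> p ^ multiplicity p y" using p2 by (intro power_mono) auto
    moreover have "y \<le> n" using that by simp
    ultimately have "multiplicity p y \<le> n" by linarith
    then have "{j \<in> {e + 1..e + n}. p ^ j dvd y} = {e + 1..multiplicity p y}"
      using that pj by auto
    then show ?thesis by simp
  qed
  then have "(\<Sum>y=1..n. multiplicity p y - e) = (\<Sum>y=1..n. card {j \<in> {e + 1..e + n}. p ^ j dvd y})"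
    by (intro sum.cong) auto
  also have "\<dots> = (\<Sum>y=1..n. \<Sum>j=e + 1..e + n. if p ^ j dvd y then 1 else 0)"
    by (intro sum.cong HOL.refl card_filter_eq_sum) simp
  also have "\<dots> = (\<Sum>j=e + 1..e + n. \<Sum>y=1..n. if p ^ j dvd y then 1 else 0)"
    by (rule sum.swap)
  also have "\<dots> = (\<Sum>j=e + 1..e + n. card {y \<in> {1..n}. p ^ j dvd y})"
    by (intro sum.cong HOL.refl card_filter_eq_sum[symmetric]) simp
  also have "\<dots> \<le> (\<Sum>j=e + 1..e + n. n div 2 ^ j)"
  proof (rule sum_mono)
    fix j
    have "{y \<in> {1..n}. p ^ j dvd y} \<subseteq> (\<lambda>z. p ^ j * z) ` {1..n div p ^ j}"
    proof
      fix y assume y: "y \<in> {y \<in> {1..n}. p ^ j dvd y}"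
      then obtain z where z: "y = p ^ j * z" by (auto elim: dvdE)
      have "z \<le> n div p ^ j" using y z p2
        by (metis (no_types, lifting) atLeastAtMost_iff div_le_mono mem_Collect_eq nonzero_mult_div_cancel_left not_numeral_le_zero power_not_zero)
      moreover have "z \<ge> 1" using y z by (cases z) auto
      ultimately show "y \<in> (\<lambda>z. p ^ j * z) ` {1..n div p ^ j}" using z by auto
    qed
    then have "card {y \<in> {1..n}. p ^ j dvd y} \<le> card {1..n div p ^ j}"
      by (meson card_image_le card_mono finite_atLeastAtMost finite_imageI le_trans)
    also have "\<dots> \<le> n div 2 ^ j" using p2 by (simp add: div_le_mono2 power_mono)
    finally show "card {y \<in> {1..n}. p ^ j dvd y} \<le> n div 2 ^ j" .
  qed
  also have "\<dots> = (\<Sum>i=1..n. (n div 2 ^ e) div 2 ^ i)"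
    by (rule sum.reindex_bij_witness[of _ "\<lambda>i. e + i" "\<lambda>j. j - e"])
      (auto simp: div_mult2_eq[symmetric] power_add[symmetric])
  also have "\<dots> \<le> n div 2 ^ e" using sum_div_pow2_le[of "n div 2 ^ e" n] by simp
  also have "\<dots> \<le> n div 2 ^ k" using assms(2) by (simp add: div_le_mono2)
  finally show ?thesis .
qed

text \<open>The product is (A+c)!/c!, and (A+c)! arises from A! by c further factors of size at most
  A+c.\<close>

lemma prod_add_le_fact: "(\<Prod>j=1..A. (j + c)) \<le> fact A * (A + c) ^ c" for A c :: nat
proof -
  have "(\<Prod>j=1..A. (j + c)) * fact c = fact (A + c)"
    by (induction A) (auto simp: algebra_simps)
  moreover have "fact (A + c') \<le> fact A * (A + c) ^ c'" if "c' \<le> c" for c'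
    using that
  proof (induction c')
    case (Suc c')
    have "fact (A + Suc c') = (A + Suc c') * fact (A + c')" by simp
    also have "\<dots> \<le> (A + c) * (fact A * (A + c) ^ c')" using Suc by (intro mult_le_mono) auto
    finally show ?case by (simp add: mult_ac)
  qed simp
  ultimately have "(\<Prod>j=1..A. (j + c)) * fact c \<le> fact A * (A + c) ^ c" by (metis order_refl)
  moreover have "(\<Prod>j=1..A. (j + c)) * 1 \<le> (\<Prod>j=1..A. (j + c)) * fact c"
    by (rule mult_le_mono2) (rule fact_ge_1)
  ultimately show ?thesis by (metis le_trans mult_1_right)
qed

text \<open>2^n is at least the binomial coefficient of n over k+1, hence at least (n/(k+1))^(k+1);
  once n exceeds (k+1)^(k+1) this beats n^k.\<close>

lemma power_less_exp2_eventually: "\<exists>N. \<forall>n\<ge>N. n ^ k < (2::nat) ^ n"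
proof (intro exI allI impI)
  fix n :: nat assume n: "Suc (Suc k ^ Suc k) \<le> n"
  have kn: "Suc k \<le> n" using n self_le_power[of "Suc k" "Suc k"] by simp
  have "real n ^ k * real (Suc k ^ Suc k) < real n ^ k * real n"
    using n kn by (intro mult_strict_left_mono) (simp_all only: of_nat_less_iff zero_less_power of_nat_0_less_iff)
  then have "real n ^ k < real n ^ Suc k / real (Suc k) ^ Suc k"
    by (subst pos_less_divide_eq) (simp_all only: of_nat_power of_nat_mult power_Suc2 of_nat_0_less_iff zero_less_power zero_less_Suc zero_less_mult_iff simp_thms)
  also have "\<dots> = (real n / real (Suc k)) ^ Suc k" by (simp add: power_divide)
  also have "\<dots> \<le> real (n choose Suc k)" using binomial_ge_n_over_k_pow_k[OF kn, where ?'a = real] by simp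
  also have "\<dots> \<le> real (2 ^ n)"
    using kn member_le_sum[of "Suc k" "{..n}" "\<lambda>i. n choose i"] by (simp add: choose_row_sum del: of_nat_power)
  finally show "n ^ k < 2 ^ n" by (metis of_nat_less_iff of_nat_power)
qed

text \<open>M = A + c + 2 dominates every factor. The exponent 2c + 3 leaves one spare M, which
  absorbs the constant 2^(c+2) that separates 2^M from 2^A.\<close>

lemma poly_growth_less_exp2: "\<exists>N. \<forall>A\<ge>N. 2 * A * (A + c) ^ (2 * c) < (2::nat) ^ A"
proof -
  obtain N where N: "\<And>n. n \<ge> N \<Longrightarrow> n ^ (2 * c + 3) < (2::nat) ^ n"
    using power_less_exp2_eventually by blast
  have "2 * A * (A + c) ^ (2 * c) < 2 ^ A" if A: "A \<ge> N + 2 ^ (c + 2)" for A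
  proof -
    define M where "M = A + c + 2"
    have "2 * A * (A + c) ^ (2 * c) \<le> M ^ 2 * M ^ (2 * c)"
      by (intro mult_le_mono power_mono) (auto simp: M_def power2_eq_square)
    moreover have "2 ^ (c + 2) \<le> M" using A by (simp add: M_def)
    ultimately have "2 * A * (A + c) ^ (2 * c) * 2 ^ (c + 2) \<le> M ^ 2 * M ^ (2 * c) * M"
      by (rule mult_le_mono)
    also have "\<dots> = M ^ (2 * c + 3)" by (simp add: power_add power2_eq_square power3_eq_cube mult_ac)
    also have "\<dots> < 2 ^ M" using A by (intro N) (simp add: M_def)
    also have "\<dots> = 2 ^ A * 2 ^ (c + 2)" by (simp add: M_def power_add)
    finally show ?thesis by simp
  qed
  then show ?thesis by blast
qed

text \<open>The primes not dividing \<open>D\<close> force a large factorial into the product of the values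
  \<open>homog g x K\<close> over a symmetric interval; \<open>K = D ^ k\<close> makes up for the remaining primes.
  Centering the interval gains a factor \<open>4 ^ A\<close>, which contradicts the growth of the product.\<close>
lemma monic_split_imp_root:
  fixes g :: "int poly" and D :: nat
  assumes monic: "lead_coeff g = 1" and d: "degree g = d" "d > 0" and D: "D > 0"
    and split: "\<And>p J. prime p \<Longrightarrow> \<not> p dvd int D \<Longrightarrow>
      \<exists>r. \<forall>x. [poly g x = (\<Prod>i<d. (x - r i))] (mod p ^ J)"
  shows "\<exists>c. poly g c = 0"
proof (rule ccontr)
  assume no_root: "\<not> (\<exists>c. poly g c = 0)"
  \<comment> \<open>With this k the loss D^m, where m = n div 2^k, satisfies (D^m)^4 \<le> 2^n,
    because D^4 \<le> 2^(2^k). As n = 2A, the loss cannot exceed 2^A.\<close>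
  define k where "k = D ^ 4"
  define K where "K = D ^ k"
  have K: "K > 0" using D by (simp add: K_def)
  define c where "c = nat (1 + (\<Sum>i<degree g. \<bar>coeff g i\<bar>)) * K"
  obtain N where N: "\<And>A. A \<ge> N \<Longrightarrow> 2 * A * (A + c) ^ (2 * c) < (2::nat) ^ A"
    using poly_growth_less_exp2 by blast
  \<comment> \<open>Divisible by 2^k, so that 2^k * m = n exactly; by K, so that shifting by n
    preserves gcds with K; and at least N, for the growth estimate.\<close>
  define A where "A = 2 ^ k * K * (N + 1)"
  have "1 * (N + 1) \<le> A" unfolding A_def by (rule mult_le_mono1) (use K in \<open>simp add: Suc_le_eq\<close>)
  then have A: "A \<ge> N" "A > 0" by simp_all
  define n where "n = 2 * A"
  define I where "I = {- int A + 1..- int A + int n}"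
  have I: "I = {1 - int A..int A}" by (auto simp: I_def n_def)
  have finI: "finite I" by (simp add: I_def)
  define H where "H x = nat \<bar>homog g x (int K)\<bar>" for x
  define q where "q x = nat (gcd x (int K))" for x
  have q: "q x > 0" "int (q x) dvd int K" "int (q x) dvd x" for x using K by (auto simp: q_def)
  \<comment> \<open>The power q^d coming from the common divisor q of x and K is taken out of the
    value, and \<open>hd\<close> is what remains. For primes dividing D the factors q alone supply
    the required multiplicity, up to D^m.\<close>
  define hd where "hd x = nat \<bar>homog g (x div int (q x)) (int K div int (q x))\<bar>" for x
  have Hq: "H x = q x ^ d * hd x" for x
  proof -
    have "homog g x (int K) = homog g (int (q x) * (x div int (q x))) (int (q x) * (int K div int (q x)))"
      using q(2,3)[of x] by simp
    also have "\<dots> = int (q x) ^ d * homog g (x div int (q x)) (int K div int (q x))"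
      unfolding homog_scale d by simp
    finally show ?thesis unfolding H_def hd_def by (simp add: abs_mult nat_mult_distrib nat_power_eq)
  qed
  \<comment> \<open>No value vanishes, since x/K would be a rational root of the monic g.\<close>
  have H0: "H x > 0" for x
    using homog_eq_0_imp_root[OF monic, of "int K" x] no_root K by (auto simp: H_def)
  then have hd0: "hd x > 0" for x using Hq[of x] by (metis gr0I mult_0_right less_irrefl)
  define Q where "Q = (\<Prod>x\<in>I. hd x)"
  have Q0: "Q > 0" using hd0 by (simp add: Q_def prod_pos)
  define Y where "Y = (\<Prod>y=1..n. gcd y K)"
  define m where "m = n div 2 ^ k"
  define W where "W = Y * D ^ m"
  have W0: "W > 0" using K D by (auto simp: W_def Y_def intro!: prod_pos)
  \<comment> \<open>For p not dividing D, each of the d linear factors runs through n consecutive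
    integers over the interval, so its product is divisible by n! up to the relevant power of p. The
    gcd factors are prime to p, so this power is left to Q.\<close>
  have good: "p ^ (d * multiplicity p (fact n)) dvd Q * W ^ d" if p: "prime p" "\<not> p dvd D" for p :: nat
  proof -
    define v where "v = multiplicity p (fact n :: nat)"
    have pi: "prime (int p)" "\<not> int p dvd int D" using p by auto
    obtain r where r: "\<forall>x. [poly g x = (\<Prod>i<d. (x - r i))] (mod int p ^ (d * v))"
      using split[OF pi] by blast
    have "coprime p K" using p by (simp add: K_def prime_imp_coprime coprime_power_right_iff)
    then have cop: "coprime (int K) (int p ^ (d * v))"
      by (simp add: coprime_commute coprime_power_right_iff coprime_int_iff)
    have "[(\<Prod>x\<in>I. homog g x (int K)) = (\<Prod>x\<in>I. \<Prod>i<d. (x - int K * r i))] (mod int p ^ (d * v))"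
      by (intro cong_prod homog_cong_prod[OF cop d(1) r])
    moreover have "int p ^ (d * v) dvd (\<Prod>x\<in>I. \<Prod>i<d. (x - int K * r i))"
    proof -
      have "int p ^ v dvd (\<Prod>x\<in>I. (x - int K * r i))" for i
      proof -
        have "p ^ v dvd fact n" unfolding v_def by (rule multiplicity_dvd)
        then have "int p ^ v dvd fact n" by (metis of_nat_dvd_iff of_nat_fact of_nat_power)
        also have "fact n dvd (\<Prod>x\<in>I. (x - int K * r i))" unfolding I_def by (rule fact_dvd_prod_shift)
        finally show ?thesis .
      qed
      then have "(\<Prod>i<d. int p ^ v) dvd (\<Prod>i<d. \<Prod>x\<in>I. (x - int K * r i))" by (intro prod_dvd_prod) auto
      then show ?thesis unfolding prod.swap[of _ I] by (simp add: power_mult[symmetric] mult.commute)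
    qed
    ultimately have "int p ^ (d * v) dvd (\<Prod>x\<in>I. homog g x (int K))" using cong_dvd_iff by blast
    moreover have "\<bar>\<Prod>x\<in>I. homog g x (int K)\<bar> = int (\<Prod>x\<in>I. H x)"
      by (simp add: abs_prod H_def)
    ultimately have "int (p ^ (d * v)) dvd int (\<Prod>x\<in>I. H x)" by (metis dvd_abs_iff of_nat_power)
    then have "p ^ (d * v) dvd (\<Prod>x\<in>I. H x)" by (simp only: of_nat_dvd_iff)
    also have "(\<Prod>x\<in>I. H x) = (\<Prod>x\<in>I. q x ^ d) * Q" unfolding Hq Q_def by (rule prod.distrib)
    finally have dv: "p ^ (d * v) dvd (\<Prod>x\<in>I. q x ^ d) * Q" .
    have "coprime (p ^ (d * v)) (\<Prod>x\<in>I. q x ^ d)"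
    proof (intro prod_coprime_right)
      fix x
      have "q x dvd K" using q(2)[of x] by simp
      then have "coprime p (q x)" using \<open>coprime p K\<close> coprime_divisors dvd_refl by blast
      then show "coprime (p ^ (d * v)) (q x ^ d)" by simp
    qed
    then have "p ^ (d * v) dvd Q" using dv coprime_dvd_mult_right_iff by blast
    then show ?thesis unfolding v_def by simp
  qed
  \<comment> \<open>For p dividing D, p^k divides K, so gcd y K keeps the multiplicity of p in y up
    to e \<ge> k. What is cut off sums to at most m and is paid for by D^m.\<close>
  have bad: "multiplicity p (fact n) \<le> multiplicity p W" if p: "prime p" "p dvd D" for p :: nat
  proof -
    have pe: "prime_elem p" using p by simp
    define e where "e = multiplicity p K"
    have "p ^ k dvd K" unfolding K_def using p(2) by (rule dvd_power_same)
    then have ke: "k \<le> e" unfolding e_def using p K by (intro multiplicity_geI) auto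
    have "multiplicity p (fact n) = (\<Sum>y=1..n. multiplicity p y)"
      unfolding fact_prod of_nat_id by (subst prime_elem_multiplicity_prod_distrib[OF pe]) auto
    also have "\<dots> \<le> (\<Sum>y=1..n. multiplicity p (gcd y K) + (multiplicity p y - e))"
    proof (rule sum_mono)
      fix y assume y: "y \<in> {1..n}"
      have "p ^ min (multiplicity p y) e dvd gcd y K"
        unfolding e_def by (intro gcd_greatest multiplicity_dvd') auto
      then have "min (multiplicity p y) e \<le> multiplicity p (gcd y K)"
        using p K by (intro multiplicity_geI) auto
      then show "multiplicity p y \<le> multiplicity p (gcd y K) + (multiplicity p y - e)" by linarith
    qed
    also have "\<dots> \<le> (\<Sum>y=1..n. multiplicity p (gcd y K)) + m"
      unfolding sum.distrib m_def using sum_multiplicity_excess_le[OF p(1) ke, of n] by simp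
    also have "(\<Sum>y=1..n. multiplicity p (gcd y K)) = multiplicity p Y"
      unfolding Y_def using K by (subst prime_elem_multiplicity_prod_distrib[OF pe]) auto
    also have "multiplicity p Y + m \<le> multiplicity p Y + multiplicity p (D ^ m)"
    proof -
      have "p ^ m dvd D ^ m" using p(2) by (rule dvd_power_same)
      then show ?thesis using p D by (intro add_left_mono multiplicity_geI) auto
    qed
    also have "\<dots> = multiplicity p W"
      unfolding W_def using K D by (subst prime_elem_multiplicity_mult_distrib[OF pe]) (auto simp: Y_def)
    finally show ?thesis .
  qed
  have "fact n ^ d dvd Q * W ^ d"
  proof (rule multiplicity_le_imp_dvd)
    fix p :: nat assume p: "prime p"
    then have pe: "prime_elem p" by simp
    have f: "multiplicity p (fact n ^ d) = d * multiplicity p (fact n)"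
      by (rule prime_elem_multiplicity_power_distrib[OF pe]) simp
    show "multiplicity p (fact n ^ d) \<le> multiplicity p (Q * W ^ d)"
    proof (cases "p dvd D")
      case False
      then show ?thesis using good[OF p False] p Q0 W0 unfolding f by (intro multiplicity_geI) auto
    next
      case True
      have "d * multiplicity p (fact n) \<le> d * multiplicity p W" using bad[OF p True] by simp
      also have "\<dots> = multiplicity p (W ^ d)"
        using W0 by (subst prime_elem_multiplicity_power_distrib[OF pe]) auto
      also have "\<dots> \<le> multiplicity p (Q * W ^ d)" using Q0 W0 by (intro dvd_imp_multiplicity_le) auto
      finally show ?thesis unfolding f .
    qed
  qed simp
  then have 1: "fact n ^ d \<le> Q * W ^ d" using Q0 W0 by (intro dvd_imp_le) auto
  \<comment> \<open>The nonpositive half of the interval is shifted by n, a multiple of K, which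
    leaves the gcds with K unchanged.\<close>
  have "(\<Prod>x\<in>I. q x) = Y"
  proof -
    have "(\<Prod>x\<in>I. q x) = (\<Prod>y\<in>{1..n}. gcd y K)"
    proof (rule prod.reindex_bij_witness[of _ "\<lambda>y. if y \<le> A then int y else int y - int n" "\<lambda>x. nat (if 1 \<le> x then x else x + int n)"])
      fix x assume x: "x \<in> I"
      have "int K dvd int n" by (simp add: n_def A_def)
      then have "gcd (x + int n) (int K) = gcd x (int K)"
        by (metis dvd_def gcd.commute gcd_add_mult mult.commute add.commute)
      moreover have "int (gcd (nat y) K) = gcd y (int K)" if "0 \<le> y" for y
        using that by (simp flip: gcd_int_int_eq)
      ultimately have "int (gcd (nat (if 1 \<le> x then x else x + int n)) K) = gcd x (int K)"
        using x by (auto simp: I n_def)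
      then show "gcd (nat (if 1 \<le> x then x else x + int n)) K = q x" by (simp add: q_def flip: nat_int)
    qed (auto simp: I n_def)
    then show ?thesis by (simp add: Y_def)
  qed
  then have "(\<Prod>x\<in>I. q x ^ d) = Y ^ d" by (simp flip: prod_power_distrib)
  moreover have "(\<Prod>x\<in>I. H x) = (\<Prod>x\<in>I. q x ^ d) * Q" unfolding Hq Q_def by (rule prod.distrib)
  ultimately have "Q * W ^ d = (\<Prod>x\<in>I. H x) * (D ^ m) ^ d" by (simp add: W_def power_mult_distrib)
  also have "\<dots> \<le> (\<Prod>x\<in>I. (nat \<bar>x\<bar> + c) ^ d) * (D ^ m) ^ d"
  proof (intro mult_right_mono prod_mono conjI)
    fix x
    have "\<bar>homog g x (int K)\<bar> \<le> (\<bar>x\<bar> + (1 + (\<Sum>i<degree g. \<bar>coeff g i\<bar>)) * int K) ^ degree g"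
      using K by (intro abs_homog_le[OF monic]) auto
    also have "\<dots> = int ((nat \<bar>x\<bar> + c) ^ d)"
      using sum_nonneg[of "{..<degree g}" "\<lambda>i. \<bar>coeff g i\<bar>"] by (simp add: c_def d)
    finally show "H x \<le> (nat \<bar>x\<bar> + c) ^ d" by (simp add: H_def nat_le_iff)
  qed auto
  also have "\<dots> = ((\<Prod>x\<in>I. nat \<bar>x\<bar> + c) * D ^ m) ^ d" by (simp add: power_mult_distrib flip: prod_power_distrib)
  finally have "fact n ^ d \<le> ((\<Prod>x\<in>I. nat \<bar>x\<bar> + c) * D ^ m) ^ d" using 1 by simp
  then have 2: "fact n \<le> (\<Prod>x\<in>I. nat \<bar>x\<bar> + c) * D ^ m"
    using d(2) by (metis power_le_imp_le_base gr0_implies_Suc zero_le)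
  define P where "P = (\<Prod>j=1..A. (j + c))"
  have "(\<Prod>x\<in>I. nat \<bar>x\<bar> + c) = (\<Prod>x\<in>{1..int A}. nat \<bar>x\<bar> + c) * (\<Prod>x\<in>{1 - int A..0}. nat \<bar>x\<bar> + c)"
    unfolding I by (subst prod.union_disjoint[symmetric]) (auto intro!: prod.cong)
  also have "(\<Prod>x\<in>{1..int A}. nat \<bar>x\<bar> + c) = P"
    unfolding P_def by (rule prod.reindex_bij_witness[of _ int nat]) auto
  also have "(\<Prod>x\<in>{1 - int A..0}. nat \<bar>x\<bar> + c) = (\<Prod>j=1..A. (j - 1 + c))"
    by (rule prod.reindex_bij_witness[of _ "\<lambda>j. 1 - int j" "\<lambda>x. nat (1 - x)"]) auto
  also have "\<dots> \<le> P" unfolding P_def by (intro prod_mono) auto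
  finally have "(\<Prod>x\<in>I. nat \<bar>x\<bar> + c) \<le> P * P" by simp
  also have "P * P \<le> (fact A * (A + c) ^ c) * (fact A * (A + c) ^ c)"
    unfolding P_def by (intro mult_le_mono prod_add_le_fact)
  finally have "fact n \<le> (fact A * (A + c) ^ c) * (fact A * (A + c) ^ c) * D ^ m"
    using 2 by (meson le_trans mult_le_mono1)
  moreover have "fact n = (n choose A) * (fact A * fact A)"
    using binomial_fact_lemma[of A n] by (simp add: n_def mult_ac)
  ultimately have "(n choose A) * (fact A * fact A) \<le> ((A + c) ^ (2 * c) * D ^ m) * (fact A * fact A)"
    by (simp add: mult_ac power_mult power2_eq_square power_mult_distrib mult_2 power_add)
  then have 3: "(n choose A) \<le> (A + c) ^ (2 * c) * D ^ m" by simp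
  have "4 ^ A / (2 * real A) \<le> real (n choose A)"
    unfolding n_def using A(2) by (rule central_binomial_lower_bound)
  then have "4 ^ A \<le> 2 * real A * real (n choose A)" using A(2) by (simp add: field_simps)
  then have "real (4 ^ A) \<le> real (2 * A * (n choose A))" by simp
  then have "4 ^ A \<le> 2 * A * (n choose A)" by (simp only: of_nat_le_iff)
  also have "\<dots> \<le> 2 * A * ((A + c) ^ (2 * c) * D ^ m)" using 3 by (rule mult_le_mono2)
  also have "\<dots> = 2 * A * (A + c) ^ (2 * c) * D ^ m" by simp
  also have "\<dots> < 2 ^ A * D ^ m" using N[OF A(1)] D by simp
  finally have "(2 ^ A) * (2 ^ A) < 2 ^ A * D ^ m" by (simp flip: power_mult_distrib)
  then have 4: "2 ^ A < D ^ m" by simp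
  have "D ^ 4 \<le> 2 ^ 2 ^ k"
    unfolding k_def by (meson less_exp less_imp_le order_trans power_increasing one_le_numeral)
  then have "(D ^ 4) ^ m \<le> (2 ^ 2 ^ k) ^ m" by (rule power_mono) simp
  also have "\<dots> = 2 ^ n"
  proof -
    have "n = 2 ^ k * (2 * K * (N + 1))" by (simp only: n_def A_def mult_ac)
    then have "2 ^ k * m = n" unfolding m_def by simp
    then show ?thesis unfolding power_mult[symmetric] by simp
  qed
  finally have "(D ^ m) ^ 4 \<le> 2 ^ n" by (simp add: power_mult[symmetric] mult.commute)
  also have "(2 :: nat) ^ n \<le> (2 ^ A) ^ 4" unfolding power_mult[symmetric] n_def by (intro power_increasing) auto
  finally have "D ^ m \<le> 2 ^ A" by (rule power_le_imp_le_base[where n = 3, simplified]) simp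
  with 4 show False by simp
qed

section \<open>Lattices of integer vectors\<close>

type_synonym zvec = "nat \<Rightarrow> int"

definition zsm :: "int \<Rightarrow> zvec \<Rightarrow> zvec" where "zsm c v = (\<lambda>i. c * v i)"

lemma zsm_apply: "zsm c v i = c * v i" by (simp add: zsm_def)

lemmas zvec_apply = zsm_apply plus_fun_apply zero_fun_apply minus_apply uminus_apply

declare plus_fun_apply [simp del] zero_fun_apply [simp del] minus_apply [simp del] uminus_apply [simp del]

lemma zsm_add_right: "zsm c (u + v) = zsm c u + zsm c v" by (auto simp: zvec_apply algebra_simps)
lemma zsm_diff_right: "zsm c (u - v) = zsm c u - zsm c v" by (auto simp: zvec_apply algebra_simps)
lemma zsm_add_left: "zsm (c + d) v = zsm c v + zsm d v" by (auto simp: zvec_apply algebra_simps)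
lemma zsm_diff_left: "zsm (c - d) v = zsm c v - zsm d v" by (auto simp: zvec_apply algebra_simps)
lemma zsm_zsm [simp]: "zsm c (zsm d v) = zsm (c * d) v" by (auto simp: zvec_apply mult.assoc)
lemma zsm_1 [simp]: "zsm 1 v = v" by (auto simp: zvec_apply)
lemma zsm_0_left [simp]: "zsm 0 v = 0" by (auto simp: zvec_apply)
lemma zsm_0_right [simp]: "zsm c 0 = 0" by (auto simp: zvec_apply)
lemma zsm_minus_left: "zsm (- c) v = - zsm c v" by (auto simp: zvec_apply)
lemma zsm_eq_0: "zsm c v = 0 \<longleftrightarrow> c = 0 \<or> v = 0" by (auto simp: zvec_apply fun_eq_iff)

lemma sum_fun_apply: "(\<Sum>a\<in>A. f a) i = (\<Sum>a\<in>A. f a i)" for f :: "'a \<Rightarrow> zvec"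
  by (induction A rule: infinite_finite_induct) (auto simp: zvec_apply)

lemma zsm_sum: "zsm c (\<Sum>a\<in>A. f a) = (\<Sum>a\<in>A. zsm c (f a))"
  by (induction A rule: infinite_finite_induct) (simp_all add: zsm_add_right)

lemma zsm_sum_left: "zsm (\<Sum>a\<in>A. f a) v = (\<Sum>a\<in>A. zsm (f a) v)"
  by (induction A rule: infinite_finite_induct) (simp_all add: zsm_add_left)

text \<open>Gaussian elimination without division: cross-multiplication with a pivot vector clears
  the coordinate \<open>s\<close> and uses up one vector.\<close>

lemma zvec_dependent:
  assumes "finite S" "finite T" "card S < card T" "\<And>k i. k \<in> T \<Longrightarrow> i \<notin> S \<Longrightarrow> vs k i = 0"
  shows "\<exists>c. (\<exists>k\<in>T. c k \<noteq> 0) \<and> (\<Sum>k\<in>T. zsm (c k) (vs k)) = 0"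
  using assms
proof (induction S arbitrary: T vs rule: finite_induct)
  case empty
  then obtain k where k: "k \<in> T" by fastforce
  have "vs k = 0" if "k \<in> T" for k using empty(3)[OF that] by (auto simp: fun_eq_iff zvec_apply)
  then have "(\<Sum>k\<in>T. zsm 1 (vs k)) = 0" by (intro sum.neutral) auto
  then show ?case using k by (intro exI[of _ "\<lambda>_. 1"]) auto
next
  case (insert s S)
  show ?case
  proof (cases "\<forall>k\<in>T. vs k s = 0")
    case True
    have "vs k i = 0" if "k \<in> T" "i \<notin> S" for k i
      using insert.prems(3)[of k i] True that by (cases "i = s") auto
    then show ?thesis using insert.prems insert.hyps by (intro insert.IH) auto
  next
    case False
    then obtain l where l: "l \<in> T" "vs l s \<noteq> 0" by blast
    define a where "a = vs l s"
    define w where "w k = zsm a (vs k) - zsm (vs k s) (vs l)" for k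
    have "card S < card (T - {l})" using insert.prems insert.hyps l by simp
    moreover have "w k i = 0" if "k \<in> T - {l}" "i \<notin> S" for k i
      using insert.prems(3)[of k i] insert.prems(3)[of l i] that l
      by (cases "i = s") (auto simp: w_def a_def zvec_apply)
    ultimately obtain c where c: "\<exists>k\<in>T - {l}. c k \<noteq> 0" "(\<Sum>k\<in>T - {l}. zsm (c k) (w k)) = 0"
      using insert.IH[of "T - {l}" w] insert.prems(1) by blast
    define e where "e k = (if k = l then - (\<Sum>k\<in>T - {l}. c k * vs k s) else a * c k)" for k
    have "(\<Sum>k\<in>T. zsm (e k) (vs k)) = zsm (e l) (vs l) + (\<Sum>k\<in>T - {l}. zsm (e k) (vs k))"
      using insert.prems(1) l(1) by (rule sum.remove)
    also have "(\<Sum>k\<in>T - {l}. zsm (e k) (vs k)) = (\<Sum>k\<in>T - {l}. zsm (c k) (w k) + zsm (c k * vs k s) (vs l))"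
      by (rule sum.cong) (auto simp: e_def w_def zsm_diff_right mult.commute)
    also have "\<dots> = - zsm (e l) (vs l)"
      unfolding sum.distrib c(2) by (simp add: e_def zsm_minus_left zsm_sum_left)
    finally have "(\<Sum>k\<in>T. zsm (e k) (vs k)) = 0" by simp
    moreover have "\<exists>k\<in>T. e k \<noteq> 0" using c(1) l(2) by (auto simp: e_def a_def)
    ultimately show ?thesis by blast
  qed
qed

definition indep :: "nat \<Rightarrow> (nat \<Rightarrow> zvec) \<Rightarrow> bool" where
  "indep n vs \<longleftrightarrow> (\<forall>c. (\<Sum>i<n. zsm (c i) (vs i)) = 0 \<longrightarrow> (\<forall>i<n. c i = 0))"

text \<open>e is the product of the pivots met in the elimination. For a prime not dividing e the
  vectors remain independent modulo that prime, and one e serves all primes.\<close>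

lemma indep_mod:
  assumes "indep n vs"
  shows "\<exists>e. e \<noteq> 0 \<and> (\<forall>p c. (\<forall>j. p dvd (\<Sum>i<n. zsm (c i) (vs i)) j) \<longrightarrow> (\<forall>i<n. p dvd e * c i))"
  using assms
proof (induction n arbitrary: vs)
  case 0
  show ?case by (intro exI[of _ 1]) auto
next
  case (Suc n)
  have "vs n \<noteq> 0"
  proof
    assume "vs n = 0"
    then have "(\<Sum>i<Suc n. zsm (if i = n then 1 else 0) (vs i)) = 0" by (intro sum.neutral) auto
    then show False using Suc.prems unfolding indep_def by (auto dest!: spec[of _ "\<lambda>i. if i = n then 1 else 0"])
  qed
  then obtain s where s: "vs n s \<noteq> 0" by (auto simp: fun_eq_iff zvec_apply)
  define a where "a = vs n s"
  define w where "w i = zsm a (vs i) - zsm (vs i s) (vs n)" for i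
  have w_sum: "(\<Sum>i<n. zsm (c i) (w i)) =
      zsm a (\<Sum>i<Suc n. zsm (c i) (vs i)) - zsm ((\<Sum>i<Suc n. zsm (c i) (vs i)) s) (vs n)" for c
  proof -
    have "(\<Sum>i<n. zsm (c i) (w i)) = (\<Sum>i<Suc n. zsm (c i) (w i))"
      by (simp add: w_def a_def)
    also have "\<dots> = (\<Sum>i<Suc n. zsm a (zsm (c i) (vs i)) - zsm (c i * vs i s) (vs n))"
      by (rule sum.cong) (auto simp: w_def zsm_diff_right mult.commute)
    also have "\<dots> = zsm a (\<Sum>i<Suc n. zsm (c i) (vs i)) - zsm ((\<Sum>i<Suc n. zsm (c i) (vs i)) s) (vs n)"
      unfolding sum_subtractf zsm_sum[symmetric] zsm_sum_left[symmetric] sum_fun_apply zvec_apply ..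
    finally show ?thesis .
  qed
  have "indep n w"
    unfolding indep_def
  proof (intro allI impI)
    fix c i assume c: "(\<Sum>i<n. zsm (c i) (w i)) = 0" and i: "i < n"
    define e where "e i = (if i < n then a * c i else - (\<Sum>i<n. c i * vs i s))" for i
    have "(\<Sum>i<Suc n. zsm (e i) (vs i)) = (\<Sum>i<n. zsm (c i) (w i))"
    proof -
      have "(\<Sum>i<n. zsm (e i) (vs i)) = (\<Sum>i<n. zsm (c i) (w i) + zsm (c i * vs i s) (vs n))"
        by (rule sum.cong) (auto simp: e_def w_def zsm_diff_right mult.commute)
      then show ?thesis by (simp add: sum.distrib e_def zsm_minus_left zsm_sum_left)
    qed
    then have "e i = 0" using Suc.prems c i unfolding indep_def by (metis less_SucI)
    then show "c i = 0" using i s by (simp add: e_def a_def)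
  qed
  then obtain e where e: "e \<noteq> 0"
    "\<forall>p c. (\<forall>j. p dvd (\<Sum>i<n. zsm (c i) (w i)) j) \<longrightarrow> (\<forall>i<n. p dvd e * c i)"
    using Suc.IH[OF \<open>indep n w\<close>] by (elim exE conjE)
  have "p dvd e * a * c i" if V: "\<forall>j. p dvd (\<Sum>i<Suc n. zsm (c i) (vs i)) j" and i: "i < Suc n" for p c i
  proof -
    have "\<forall>j. p dvd (\<Sum>i<n. zsm (c i) (w i)) j" unfolding w_sum using V by (simp add: zvec_apply)
    then have low: "p dvd e * c i" if "i < n" for i
      using e(2)[rule_format, where p = p and c = c and i = i] that by simp
    show ?thesis
    proof (cases "i < n")
      case True
      have "p dvd e * c i * a" using low[OF True] by (rule dvd_mult2)
      then show ?thesis by (simp only: mult_ac)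
    next
      case False
      have "(\<Sum>i<Suc n. zsm (c i) (vs i)) s = (\<Sum>i<n. c i * vs i s) + c n * a"
        by (simp add: sum_fun_apply zvec_apply a_def)
      then have "e * a * c n = e * (\<Sum>i<Suc n. zsm (c i) (vs i)) s - (\<Sum>i<n. e * c i * vs i s)"
        by (simp add: algebra_simps sum_distrib_left)
      moreover have "p dvd (\<Sum>i<n. e * c i * vs i s)" using low by (intro dvd_sum) auto
      ultimately have "p dvd e * a * c n" using V by simp
      moreover have "i = n" using False i by simp
      ultimately show ?thesis by simp
    qed
  qed
  then show ?case using e(1) s by (intro exI[of _ "e * a"]) (auto simp: a_def)
qed

section \<open>Additive operators and the polynomials in them\<close>

definition zsub :: "zvec set \<Rightarrow> bool" where
  "zsub X \<longleftrightarrow> 0 \<in> X \<and> (\<forall>u\<in>X. \<forall>v\<in>X. u - v \<in> X)"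

lemma zsub_0: "zsub X \<Longrightarrow> 0 \<in> X" and zsub_diff: "zsub X \<Longrightarrow> u \<in> X \<Longrightarrow> v \<in> X \<Longrightarrow> u - v \<in> X"
  by (auto simp: zsub_def)

lemma zsub_minus: "zsub X \<Longrightarrow> u \<in> X \<Longrightarrow> - u \<in> X"
  using zsub_diff[of X 0 u] zsub_0 by simp

lemma zsub_add: "zsub X \<Longrightarrow> u \<in> X \<Longrightarrow> v \<in> X \<Longrightarrow> u + v \<in> X"
  using zsub_diff[of X u "- v"] zsub_minus by simp

lemma zsub_zsm: assumes "zsub X" "u \<in> X" shows "zsm c u \<in> X"
proof (induction c rule: int_induct[of _ 0])
  case base
  then show ?case using zsub_0[OF assms(1)] by simp
next
  case (step1 i)
  then show ?case using zsub_add[OF assms(1) _ assms(2)] by (simp add: zsm_add_left)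
next
  case (step2 i)
  then show ?case using zsub_diff[OF assms(1) _ assms(2)] by (simp add: zsm_diff_left)
qed

lemma zsub_sum: "zsub X \<Longrightarrow> (\<And>a. a \<in> A \<Longrightarrow> f a \<in> X) \<Longrightarrow> (\<Sum>a\<in>A. f a) \<in> X"
  by (induction A rule: infinite_finite_induct) (auto intro: zsub_0 zsub_add)

definition zadd :: "zvec set \<Rightarrow> (zvec \<Rightarrow> zvec) \<Rightarrow> bool" where
  "zadd X f \<longleftrightarrow> (\<forall>u\<in>X. f u \<in> X) \<and> (\<forall>u\<in>X. \<forall>v\<in>X. f (u + v) = f u + f v)"

lemma zadd_in: "zadd X f \<Longrightarrow> u \<in> X \<Longrightarrow> f u \<in> X"
  and zadd_add: "zadd X f \<Longrightarrow> u \<in> X \<Longrightarrow> v \<in> X \<Longrightarrow> f (u + v) = f u + f v"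
  by (auto simp: zadd_def)

lemma zadd_0: "zsub X \<Longrightarrow> zadd X f \<Longrightarrow> f 0 = 0"
  using zadd_add[of X f 0 0] zsub_0 by simp

lemma zadd_diff: "zsub X \<Longrightarrow> zadd X f \<Longrightarrow> u \<in> X \<Longrightarrow> v \<in> X \<Longrightarrow> f (u - v) = f u - f v"
  using zadd_add[of X f "u - v" v] zsub_diff by (simp add: algebra_simps)

lemma zadd_zsm: assumes "zsub X" "zadd X f" "u \<in> X" shows "f (zsm c u) = zsm c (f u)"
proof (induction c rule: int_induct[of _ 0])
  case base
  then show ?case using zadd_0[OF assms(1,2)] by simp
next
  case (step1 i)
  then show ?case using zadd_add[OF assms(2) zsub_zsm[OF assms(1,3)] assms(3)] by (simp add: zsm_add_left)
next
  case (step2 i)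
  then show ?case using zadd_diff[OF assms(1,2) zsub_zsm[OF assms(1,3)] assms(3)] by (simp add: zsm_diff_left)
qed

text \<open>The vector h(b) v, by Horner's scheme.\<close>

definition pact :: "int poly \<Rightarrow> (zvec \<Rightarrow> zvec) \<Rightarrow> zvec \<Rightarrow> zvec" where
  "pact h b v = fold_coeffs (\<lambda>a w. zsm a v + b w) h 0"

lemma pact_0 [simp]: "pact 0 b v = 0" by (simp add: pact_def)

context
  fixes X b assumes X: "zsub X" and b: "zadd X b"
begin

lemma pact_pCons: "pact (pCons a h) b v = zsm a v + b (pact h b v)"
  by (cases "a = 0 \<and> h = 0") (auto simp: pact_def zadd_0[OF X b])

lemma pact_in: "v \<in> X \<Longrightarrow> pact h b v \<in> X"
  by (induction h) (auto simp: pact_pCons intro: zsub_0[OF X] zsub_add[OF X] zsub_zsm[OF X] zadd_in[OF b])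

lemma pact_add: assumes "v \<in> X" shows "pact (g + h) b v = pact g b v + pact h b v"
proof (induction g h rule: poly_induct2)
  case (pCons a p c q)
  have "pact (pCons a p + pCons c q) b v = zsm (a + c) v + b (pact (p + q) b v)"
    by (simp only: add_pCons pact_pCons)
  also have "b (pact (p + q) b v) = b (pact p b v) + b (pact q b v)"
    unfolding pCons by (rule zadd_add[OF b pact_in[OF assms] pact_in[OF assms]])
  finally show ?case by (simp only: pact_pCons zsm_add_left add_ac)
qed simp

lemma pact_smult: assumes "v \<in> X" shows "pact (smult c h) b v = zsm c (pact h b v)"
proof (induction h)
  case (pCons a h)
  have "pact (smult c (pCons a h)) b v = zsm (c * a) v + b (pact (smult c h) b v)"
    by (simp only: smult_pCons pact_pCons)
  also have "b (pact (smult c h) b v) = zsm c (b (pact h b v))"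
    unfolding pCons(2) by (rule zadd_zsm[OF X b pact_in[OF assms]])
  finally show ?case by (simp only: pact_pCons zsm_add_right zsm_zsm)
qed simp

lemma pact_const: "pact [:a:] b v = zsm a v"
  by (simp add: pact_pCons zadd_0[OF X b])

lemma pact_mult: assumes "v \<in> X" shows "pact (g * h) b v = pact g b (pact h b v)"
proof (induction g)
  case (pCons a g)
  have "pact (pCons a g * h) b v = pact (smult a h) b v + pact (pCons 0 (g * h)) b v"
    by (simp only: mult_pCons_left pact_add[OF assms])
  then show ?case by (simp only: pact_smult[OF assms] pact_pCons pCons(2) zsm_0_left add_0_left)
qed simp

lemma pact_sum: assumes "v \<in> X" shows "pact (\<Sum>a\<in>A. f a) b v = (\<Sum>a\<in>A. pact (f a) b v)"
  by (induction A rule: infinite_finite_induct) (simp_all add: pact_add[OF assms])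

lemma pact_monom: assumes "v \<in> X" shows "pact (monom c k) b v = zsm c ((b ^^ k) v)"
proof (induction k)
  case (Suc k)
  have "(b ^^ k) v \<in> X" for k using assms by (induction k) (auto intro: zadd_in[OF b])
  from zadd_zsm[OF X b this] show ?case
    by (simp only: monom_Suc pact_pCons Suc zsm_0_left add_0_left funpow.simps comp_def)
qed (simp add: monom_0 pact_const)

text \<open>Lets the operator be rescaled: a polynomial in the operator a b is a polynomial in
  b.\<close>

lemma pact_pcompose: assumes "v \<in> X" shows "pact (pcompose h q) b v = pact h (pact q b) v"
proof (induction h)
  case (pCons a h)
  have "pact (pCons a h) (pact q b) v = zsm a v + pact q b (pact h (pact q b) v)"
  proof (cases "a = 0 \<and> h = 0")
    case True
    have "pact q b 0 = 0" using pact_mult[OF zsub_0[OF X], of q 0] by simp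
    with True show ?thesis by (simp add: pact_def)
  qed (auto simp: pact_def)
  then show ?case
    by (simp only: pcompose_pCons pact_add[OF assms] pact_const pact_mult[OF assms] pCons(2))
qed (simp add: pact_def)

end

lemma zadd_funpow: "zadd X b \<Longrightarrow> v \<in> X \<Longrightarrow> (b ^^ k) v \<in> X"
  by (induction k) (auto intro: zadd_in)

section \<open>An integral eigenvector of a single operator\<close>

lemma pseudo_divmod_obtain:
  fixes f g :: "int poly"
  assumes "g \<noteq> 0"
  obtains c q r where "c = coeff g (degree g) ^ (Suc (degree f) - degree g)"
    "smult c f = g * q + r" "r = 0 \<or> degree r < degree g"
proof -
  obtain q r where qr: "pseudo_divmod f g = (q, r)" by fastforce
  show ?thesis by (rule that[OF HOL.refl pseudo_divmod[OF assms qr]])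
qed

text \<open>The minimal-degree nonzero element of the ideal generated by \<open>g\<close> and its derivative is constant.\<close>
lemma bezout_pderiv:
  assumes X: "zsub X" and b: "zadd X b" and v: "v \<in> X" "v \<noteq> 0"
    and g: "degree g = d" "d > 0" "pact g b v = 0"
    and min: "\<And>k w. k \<noteq> 0 \<Longrightarrow> degree k < d \<Longrightarrow> w \<in> X \<Longrightarrow> w \<noteq> 0 \<Longrightarrow> pact k b w \<noteq> 0"
  shows "\<exists>D u w. D \<noteq> 0 \<and> u * g + w * pderiv g = [:D:]"
proof -
  define Id where "Id = {u * g + w * pderiv g | u w. True}"
  have g0: "g \<noteq> 0" using g by auto
  have g': "pderiv g \<noteq> 0" "degree (pderiv g) < d"
    using g by (auto simp: pderiv_eq_0_iff degree_pderiv)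
  have in_Id: "g \<in> Id" "pderiv g \<in> Id"
    unfolding Id_def by (auto intro: exI[of _ 1] exI[of _ 0])
      (metis add_0_left mult_1 mult_zero_left, metis add_0_left mult_1 mult_zero_left)?
  obtain k where k: "k \<in> Id" "k \<noteq> 0" "\<And>k'. k' \<in> Id \<Longrightarrow> k' \<noteq> 0 \<Longrightarrow> degree k \<le> degree k'"
    using exists_least_iff[of "\<lambda>n. \<exists>k\<in>Id. k \<noteq> 0 \<and> degree k = n"] in_Id(1) g0
    by (metis not_le_imp_less)
  have kd: "degree k < d" using k(3)[OF in_Id(2) g'(1)] g'(2) by simp
  obtain u w where uw: "k = u * g + w * pderiv g" using k(1) unfolding Id_def by blast
  obtain c q r where c: "c = coeff k (degree k) ^ (Suc (degree g) - degree k)"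
    "smult c g = k * q + r" "r = 0 \<or> degree r < degree k"
    using pseudo_divmod_obtain[OF k(2)] .
  have c0: "c \<noteq> 0" using c(1) k(2) by simp
  have "r = ([:c:] - u * q) * g + (- w * q) * pderiv g"
    using c(2) unfolding uw by (simp add: algebra_simps)
  then have "r \<in> Id" unfolding Id_def by blast
  then have r: "r = 0" using k(3)[of r] c(3) by force
  have q0: "q \<noteq> 0" using c(2) r c0 g0 by auto
  have deg: "degree k + degree q = d"
    using arg_cong[OF c(2), of degree] r c0 k(2) q0 g(1) by (simp add: degree_mult_eq)
  \<comment> \<open>Otherwise c g = k q with both degrees below d. By minimality q(b) v is nonzero,
    and so is k(b) q(b) v, although g(b) v = 0.\<close>
  have "degree k = 0"
  proof (rule ccontr)
    assume "degree k \<noteq> 0"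
    then have "pact q b v \<noteq> 0" using min[OF q0 _ v] deg by simp
    then have "pact k b (pact q b v) \<noteq> 0" using min[OF k(2) kd pact_in[OF X b v(1)]] by simp
    moreover have "pact k b (pact q b v) = pact (smult c g) b v"
      unfolding c(2) r by (simp add: pact_mult[OF X b v(1)])
    moreover have "pact (smult c g) b v = 0" unfolding pact_smult[OF X b v(1)] g(3) by simp
    ultimately show False by simp
  qed
  then obtain D where "k = [:D:]" using degree_eq_zeroE by blast
  then show ?thesis using uw k(2) by (intro exI[of _ D] exI[of _ u] exI[of _ w]) auto
qed

text \<open>g is a minimal polynomial of v. If a split monic f has f(b) X inside pX, then the
  remainder r of f by g has r(b) v in pX; for almost all p the vectors v, b v, ..., b^(d-1) v are
  independent modulo p, so p divides r and g divides f modulo p. Hence g splits, has an integer root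
  c, and g/(x - c) applied to v is an eigenvector.\<close>

lemma operator_monic_eigenvector:
  assumes X: "zsub X" and b: "zadd X b"
    and split: "\<And>p::int. prime p \<Longrightarrow> \<exists>cs. \<forall>x\<in>X. \<exists>y\<in>X. pact (\<Prod>c\<leftarrow>cs. [:- c, 1:]) b x = zsm p y"
    and v: "v \<in> X" "v \<noteq> 0" and g: "lead_coeff g = 1" "degree g = d" "d > 0" "pact g b v = 0"
    and min: "\<And>k w. k \<noteq> 0 \<Longrightarrow> degree k < d \<Longrightarrow> w \<in> X \<Longrightarrow> w \<noteq> 0 \<Longrightarrow> pact k b w \<noteq> 0"
  shows "\<exists>w\<in>X. w \<noteq> 0 \<and> (\<exists>c. b w = zsm c w)"
proof -
  obtain D u w where D: "D \<noteq> 0" "u * g + w * pderiv g = [:D:]"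
    using bezout_pderiv[OF X b v g(2-4) min] by blast
  define vs where "vs i = (b ^^ i) v" for i
  have pact_low: "pact r b v = (\<Sum>i<d. zsm (coeff r i) (vs i))" if "degree r < d" for r
  proof -
    have "pact r b v = pact (\<Sum>i\<le>d - 1. monom (coeff r i) i) b v"
      using that poly_as_sum_of_monoms'[of r "d - 1"] by simp
    also have "\<dots> = (\<Sum>i\<le>d - 1. zsm (coeff r i) (vs i))"
      by (simp add: pact_sum[OF X b v(1)] pact_monom[OF X b v(1)] vs_def)
    also have "{..d - 1} = {..<d}" using g(3) by auto
    finally show ?thesis .
  qed
  have "indep d vs"
    unfolding indep_def
  proof (intro allI impI)
    fix c i assume c: "(\<Sum>i<d. zsm (c i) (vs i)) = 0" and i: "i < d"
    define r where "r = (\<Sum>i<d. monom (c i) i)"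
    have cr: "coeff r j = (if j < d then c j else 0)" for j
      unfolding r_def by (simp add: coeff_sum)
    then have "degree r < d" using g(3)
      by (metis bot_nat_0.not_eq_extremum coeff_0_degree_minus_1 degree_0 leading_coeff_0_iff)
    moreover from this have "pact r b v = 0" using c i by (simp add: pact_low cr)
    ultimately have "r = 0" using min v by blast
    then show "c i = 0" using cr[of i] i by simp
  qed
  then obtain e where e: "e \<noteq> 0"
    "\<forall>p c. (\<forall>j. p dvd (\<Sum>i<d. zsm (c i) (vs i)) j) \<longrightarrow> (\<forall>i<d. p dvd e * c i)"
    using indep_mod by blast
  \<comment> \<open>The primes left out divide D, where roots may collide, or e, where the iterates
    of v may become dependent.\<close>
  have "\<exists>r. \<forall>x. [poly g x = (\<Prod>i<d. (x - r i))] (mod p ^ J)"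
    if p: "prime p" "\<not> p dvd int (nat \<bar>D * e\<bar>)" for p J
  proof -
    have pD: "\<not> p dvd D" and pe: "\<not> p dvd e" using p(2) by auto
    obtain cs where cs: "\<forall>x\<in>X. \<exists>y\<in>X. pact (\<Prod>c\<leftarrow>cs. [:- c, 1:]) b x = zsm p y"
      using split[OF p(1)] by blast
    define f where "f = (\<Prod>c\<leftarrow>cs. [:- c, 1:])"
    have f1: "lead_coeff f = 1" unfolding f_def by (induction cs) (auto simp only: list.map prod_list.Nil prod_list.Cons lead_coeff_mult lead_coeff_1, auto)
    have g0: "g \<noteq> 0" using g by auto
    obtain c q r where "c = coeff g (degree g) ^ (Suc (degree f) - degree g)"
      and qr: "smult c f = g * q + r" "r = 0 \<or> degree r < degree g"
      using pseudo_divmod_obtain[OF g0] .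
    then have "c = 1" using g(1) by simp
    then have fqr: "f = g * q + r" using qr(1) by simp
    have dr: "degree r < d" using qr(2) g(2,3) by auto
    obtain y where y: "y \<in> X" "pact f b v = zsm p y" using cs v(1) unfolding f_def by blast
    have "pact f b v = pact q b (pact g b v) + pact r b v"
      unfolding fqr pact_add[OF X b v(1)] by (subst mult.commute) (simp only: pact_mult[OF X b v(1)])
    also have "pact q b (pact g b v) = 0"
      unfolding g(4) using pact_mult[OF X b zsub_0[OF X], of q 0] by (simp add: pact_0)
    finally have "(\<Sum>i<d. zsm (coeff r i) (vs i)) = zsm p y"
      using y(2) pact_low[OF dr] by simp
    then have "\<forall>j. p dvd (\<Sum>i<d. zsm (coeff r i) (vs i)) j" by (simp add: zsm_apply)
    then have "p dvd e * coeff r i" if "i < d" for i using e(2) that by blast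
    then have "p dvd coeff r i" if "i < d" for i using that pe p(1) by (metis prime_dvd_mult_iff)
    then have "p dvd coeff r i" for i using dr by (cases "i < d") (auto simp: coeff_eq_0)
    then have "[:p:] dvd r" by (simp add: const_poly_dvd_iff)
    then obtain h where h: "r = [:p:] * h" by (elim dvdE)
    have gq: "g * q = f + smult p (- h)" using fqr h by simp
    \<comment> \<open>Ensures that f - r = g q is monic: r must not disturb the leading term of f. A
      larger degree of g would force q = 0, and p would divide the monic f.\<close>
    have "degree g \<le> degree f"
    proof (rule ccontr)
      assume lt: "\<not> degree g \<le> degree f"
      have "q = 0"
      proof (rule ccontr)
        assume "q \<noteq> 0"
        then have "degree (g * q) \<ge> degree g" using g0 by (simp add: degree_mult_eq)
        moreover have "g * q = f - r" using fqr by simp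
        moreover have "degree (f - r) < degree g" using lt dr g(2) by (intro degree_diff_less) auto
        ultimately show False by simp
      qed
      then have "f = [:p:] * h" using fqr h by simp
      then have "lead_coeff f = p * lead_coeff h" by (simp add: lead_coeff_mult)
      then have "p dvd 1" using f1 by (metis dvd_triv_left)
      then show False using p(1) not_prime_unit by blast
    qed
    then have "lead_coeff (f - r) = 1"
    proof -
      assume le: "degree g \<le> degree f"
      have "degree (- r) < degree f" using dr le g(2) by simp
      then have "lead_coeff (- r + f) = lead_coeff f" by (rule lead_coeff_add_le)
      then show ?thesis using f1 by simp
    qed
    moreover have "f - r = g * q" using fqr by simp
    ultimately have "lead_coeff q = 1" using g(1) by (simp add: lead_coeff_mult)
    then show ?thesis
      using split_mod_prime_power[OF p(1) g(1,2) _ gq[unfolded f_def] D(2) pD] by blast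
  qed
  then obtain c where c: "poly g c = 0"
    using monic_split_imp_root[OF g(1-3), of "nat \<bar>D * e\<bar>"] D(1) e(1) by auto
  obtain d' where d': "d = Suc d'" using g(3) gr0_implies_Suc by blast
  define q where "q = synthetic_div g c"
  have q: "lead_coeff q = 1" "degree q = d'"
    using monic_synthetic_div[OF g(1), of d'] g(2) d' by (auto simp: q_def)
  have gq: "g = [:- c, 1:] * q" using synthetic_div_correct'[of c g] c by (simp add: q_def)
  define x where "x = pact q b v"
  have xX: "x \<in> X" unfolding x_def by (rule pact_in[OF X b v(1)])
  have "q \<noteq> 0" using q(1) by (metis leading_coeff_0_iff zero_neq_one)
  then have "x \<noteq> 0" unfolding x_def using min[of q v] q(2) d' v by simp
  moreover have "b x = zsm c x"
  proof -
    have "0 = pact [:- c, 1:] b x" using g(4) unfolding gq pact_mult[OF X b v(1)] x_def by simp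
    also have "\<dots> = zsm (- c) x + b x" by (simp add: pact_pCons[OF X b] zadd_0[OF X b])
    finally show ?thesis by (simp add: zsm_minus_left)
  qed
  ultimately show ?thesis using xX by blast
qed

text \<open>Write the eigenvalue in lowest terms as c'/a'. Iterating b shows that a'^k divides every
  coordinate of v for every k; a nonzero coordinate then leaves only |a'| = 1.\<close>

lemma rational_eigenvalue_integral:
  assumes X: "zsub X" and b: "zadd X b" and v: "v \<in> X" "v \<noteq> 0" and a: "a \<noteq> 0"
    and eq: "zsm a (b v) = zsm c v"
  shows "\<exists>c'. b v = zsm c' v"
proof -
  obtain a' c' where ac: "a = gcd a c * a'" "c = gcd a c * c'" "coprime a' c'"
    using gcd_coprime_exists[of a c] a by (metis gcd_eq_0_iff mult.commute)
  have "zsm (gcd a c) (zsm a' (b v)) = zsm (gcd a c) (zsm c' v)" using eq ac by simp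
  then have "zsm (gcd a c) (zsm a' (b v) - zsm c' v) = 0" by (simp only: zsm_diff_right diff_self)
  then have eq': "zsm a' (b v) = zsm c' v" using a by (simp only: zsm_eq_0) simp
  have pow: "zsm (a' ^ k) ((b ^^ k) v) = zsm (c' ^ k) v" for k
  proof (induction k)
    case (Suc k)
    have "zsm (a' ^ Suc k) ((b ^^ Suc k) v) = zsm a' (b (zsm (a' ^ k) ((b ^^ k) v)))"
      using zadd_zsm[OF X b zadd_funpow[OF b v(1)]] by simp
    also have "\<dots> = zsm a' (zsm (c' ^ k) (b v))" unfolding Suc using zadd_zsm[OF X b v(1)] by simp
    also have "\<dots> = zsm (c' ^ k) (zsm a' (b v))" by (simp add: mult.commute)
    also have "\<dots> = zsm (c' ^ Suc k) v" unfolding eq' by (simp add: mult.commute)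
    finally show ?case .
  qed simp
  obtain i where i: "v i \<noteq> 0" using v(2) by (auto simp: fun_eq_iff zero_fun_apply)
  have "\<bar>a'\<bar> = 1"
  proof (rule ccontr)
    assume "\<bar>a'\<bar> \<noteq> 1"
    moreover have "a' \<noteq> 0" using a ac(1) by auto
    ultimately have a2: "\<bar>a'\<bar> \<ge> 2" by linarith
    define k where "k = nat \<bar>v i\<bar>"
    have "a' ^ k * (b ^^ k) v i = c' ^ k * v i"
      using fun_cong[OF pow[of k], of i] by (simp add: zsm_apply)
    then have "a' ^ k dvd c' ^ k * v i" by (metis dvd_triv_left)
    moreover have "coprime (a' ^ k) (c' ^ k)" using ac(3) by simp
    ultimately have "a' ^ k dvd v i" using coprime_dvd_mult_right_iff by blast
    then have "\<bar>a'\<bar> ^ k \<le> \<bar>v i\<bar>" using i by (metis dvd_imp_le_int power_abs)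
    moreover have "(2::int) ^ k \<le> \<bar>a'\<bar> ^ k" using a2 by (intro power_mono) auto
    moreover have "int k < 2 ^ k" using less_exp[of k] by (metis of_nat_less_iff of_nat_numeral of_nat_power)
    ultimately show False by (simp add: k_def)
  qed
  then have "a' * a' = 1" by (metis abs_mult_self_eq mult_1)
  then have "b v = zsm a' (zsm a' (b v))" by simp
  also have "\<dots> = zsm (a' * c') v" unfolding eq' by simp
  finally show ?thesis by blast
qed

text \<open>A nonzero h of least degree annihilating some nonzero vector of X is chosen. It need not
  be monic: with a its leading coefficient, the operator b' = a b is annihilated at v by the monic
  polynomial g(y) = a^(d-1) h(y/a). An eigenvector of b' has a rational, hence integral, eigenvalue
  under b.\<close>

lemma operator_eigenvector:
  assumes S: "finite S" and X: "zsub X" and supp: "\<And>v i. v \<in> X \<Longrightarrow> i \<notin> S \<Longrightarrow> v i = 0"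
    and b: "zadd X b" and nz: "v0 \<in> X" "v0 \<noteq> 0"
    and split: "\<And>p::int. prime p \<Longrightarrow> \<exists>cs. \<forall>x\<in>X. \<exists>y\<in>X. pact (\<Prod>c\<leftarrow>cs. [:- c, 1:]) b x = zsm p y"
  shows "\<exists>v\<in>X. v \<noteq> 0 \<and> (\<exists>c. b v = zsm c v)"
proof -
  define P where "P d \<longleftrightarrow> (\<exists>h v. h \<noteq> 0 \<and> degree h = d \<and> v \<in> X \<and> v \<noteq> 0 \<and> pact h b v = 0)" for d
  \<comment> \<open>The card S + 1 vectors v0, ..., b^(card S) v0 have only card S coordinates, so
    they are dependent.\<close>
  have "\<exists>d. P d"
  proof -
    obtain c where c: "\<exists>k\<in>{..card S}. c k \<noteq> 0" "(\<Sum>k\<in>{..card S}. zsm (c k) ((b ^^ k) v0)) = 0"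
      using zvec_dependent[OF S, of "{..card S}" "\<lambda>k. (b ^^ k) v0"]
        supp[OF zadd_funpow[OF b nz(1)]] by auto
    define h where "h = (\<Sum>k\<in>{..card S}. monom (c k) k)"
    have "pact h b v0 = 0"
      using c(2) unfolding h_def by (simp add: pact_sum[OF X b nz(1)] pact_monom[OF X b nz(1)])
    moreover have "coeff h k = (if k \<le> card S then c k else 0)" for k
      unfolding h_def by (simp add: coeff_sum)
    then have "h \<noteq> 0" using c(1) by (metis atMost_iff coeff_0)
    ultimately show ?thesis using nz unfolding P_def by blast
  qed
  then obtain d where d: "P d" "\<And>d'. d' < d \<Longrightarrow> \<not> P d'" using exists_least_iff[of P] by blast
  then obtain h v where h: "h \<noteq> 0" "degree h = d" "v \<in> X" "v \<noteq> 0" "pact h b v = 0"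
    unfolding P_def by blast
  have min: "pact k b w \<noteq> 0" if "k \<noteq> 0" "degree k < d" "w \<in> X" "w \<noteq> 0" for k w
    using d(2) that unfolding P_def by blast
  have d0: "d > 0"
  proof (rule ccontr)
    assume "\<not> d > 0"
    then obtain a where "h = [:a:]" using h(2) degree_eq_zeroE by blast
    then show False using h pact_const[OF X b] by (auto simp: zsm_eq_0)
  qed
  define a where "a = lead_coeff h"
  have a0: "a \<noteq> 0" using h(1) by (simp add: a_def)
  define b' where "b' = pact [:0, a:] b"
  have b'_eq: "b' x = zsm a (b x)" if "x \<in> X" for x
  proof -
    have "b' x = b (zsm a x)" unfolding b'_def by (simp add: pact_pCons[OF X b] zadd_0[OF X b])
    then show ?thesis using zadd_zsm[OF X b that] by simp
  qed
  have b': "zadd X b'"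
    unfolding zadd_def
  proof (intro conjI ballI)
    fix x y assume x: "x \<in> X" and y: "y \<in> X"
    show "b' x \<in> X" unfolding b'_eq[OF x] by (rule zsub_zsm[OF X zadd_in[OF b x]])
    show "b' (x + y) = b' x + b' y"
      unfolding b'_eq[OF zsub_add[OF X x y]] b'_eq[OF x] b'_eq[OF y] zadd_add[OF b x y] by (rule zsm_add_right)
  qed
  have pact': "pact k b' x = pact (pcompose k [:0, a:]) b x" if "x \<in> X" for k x
    unfolding b'_def by (rule pact_pcompose[OF X b that, symmetric])
  define g where "g = monom 1 d + (\<Sum>i<d. monom (coeff h i * a ^ (d - Suc i)) i)"
  have cg: "coeff g i = (if i = d then 1 else if i < d then coeff h i * a ^ (d - Suc i) else 0)" for i
    unfolding g_def by (simp add: coeff_sum)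
  have dg: "degree g = d" by (rule order.antisym, rule degree_le, use cg in simp, rule le_degree, use cg in simp)
  have lg: "lead_coeff g = 1" using dg cg by simp
  have "pcompose g [:0, a:] = smult (a ^ (d - 1)) h"
  proof (rule poly_eqI)
    fix i
    consider "i = d" | "i < d" | "i > d" by linarith
    then show "coeff (pcompose g [:0, a:]) i = coeff (smult (a ^ (d - 1)) h) i"
    proof cases
      case 1
      have "a ^ d = a ^ (d - 1) * a" using d0 by (metis power_minus_mult)
      then show ?thesis using 1 cg h(2) by (simp add: coeff_pcompose_linear a_def)
    next
      case 2
      have "d - 1 = i + (d - Suc i)" using 2 by simp
      then have "a ^ (d - 1) = a ^ i * a ^ (d - Suc i)" by (metis power_add)
      then show ?thesis using 2 cg by (simp add: coeff_pcompose_linear)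
    next
      case 3
      then show ?thesis using cg h(2) by (simp add: coeff_pcompose_linear coeff_eq_0)
    qed
  qed
  then have g0: "pact g b' v = 0" using pact'[OF h(3), of g] h(5) pact_smult[OF X b h(3)] by simp
  have min': "pact k b' w \<noteq> 0" if "k \<noteq> 0" "degree k < d" "w \<in> X" "w \<noteq> 0" for k w
  proof -
    have "pcompose k [:0, a:] \<noteq> 0" using that(1) a0 pcompose_eq_0[of k "[:0, a:]"] by auto
    moreover have "degree (pcompose k [:0, a:]) < d" using that(2) a0 by (simp add: degree_pcompose)
    ultimately show ?thesis unfolding pact'[OF that(3)] using min that by blast
  qed
  have split': "\<exists>cs. \<forall>x\<in>X. \<exists>y\<in>X. pact (\<Prod>c\<leftarrow>cs. [:- c, 1:]) b' x = zsm p y" if p: "prime p" for p :: int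
  proof -
    obtain cs where cs: "\<forall>x\<in>X. \<exists>y\<in>X. pact (\<Prod>c\<leftarrow>cs. [:- c, 1:]) b x = zsm p y" using split[OF p] by blast
    \<comment> \<open>The roots are scaled with the operator: y - a c at y = a x is a (x -
      c).\<close>
    have pc: "pcompose (\<Prod>c\<leftarrow>map ((*) a) cs. [:- c, 1:]) [:0, a:] = smult (a ^ length cs) (\<Prod>c\<leftarrow>cs. [:- c, 1:])" for cs
    proof (induction cs)
      case (Cons c cs)
      have "pcompose [:- (a * c), 1:] [:0, a:] = smult a [:- c, 1:]" by (simp add: pcompose_pCons)
      then show ?case using Cons by (simp only: list.map prod_list.Cons pcompose_mult mult_smult_left mult_smult_right smult_smult list.size power_Suc power_add add_Suc_right add_0_right mult.commute[of a])
    qed (simp add: pcompose_1)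
    have "\<exists>y\<in>X. pact (\<Prod>c\<leftarrow>map ((*) a) cs. [:- c, 1:]) b' x = zsm p y" if x: "x \<in> X" for x
    proof -
      obtain y where y: "y \<in> X" "pact (\<Prod>c\<leftarrow>cs. [:- c, 1:]) b x = zsm p y" using cs x by blast
      have "pact (\<Prod>c\<leftarrow>map ((*) a) cs. [:- c, 1:]) b' x = zsm p (zsm (a ^ length cs) y)"
        unfolding pact'[OF x] pc pact_smult[OF X b x] y(2) by (simp add: mult.commute)
      then show ?thesis using zsub_zsm[OF X y(1)] by blast
    qed
    then show ?thesis by blast
  qed
  obtain w c where w: "w \<in> X" "w \<noteq> 0" "b' w = zsm c w"
    using operator_monic_eigenvector[OF X b' split' h(3,4) lg dg d0 g0 min'] by blast
  then have "zsm a (b w) = zsm c w" using b'_eq by simp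
  then show ?thesis using rational_eigenvalue_integral[OF X b w(1,2) a0] w by blast
qed

lemma indep_le_card:
  assumes "finite S" "indep n vs" "\<And>k i. k < n \<Longrightarrow> i \<notin> S \<Longrightarrow> vs k i = 0"
  shows "n \<le> card S"
proof (rule ccontr)
  assume "\<not> n \<le> card S"
  then obtain c where "\<exists>k\<in>{..<n}. c k \<noteq> 0" "(\<Sum>k<n. zsm (c k) (vs k)) = 0"
    using zvec_dependent[OF assms(1), of "{..<n}" vs] assms(3) by auto
  then show False using assms(2) unfolding indep_def by blast
qed

section \<open>A group acting on a lattice: flags and common eigenvectors\<close>

locale lattice_action =
  fixes S :: "nat set" and X :: "zvec set" and B :: "'g set" and m :: "'g \<Rightarrow> 'g \<Rightarrow> 'g" and iv :: "'g \<Rightarrow> 'g"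
    and act :: "'g \<Rightarrow> zvec \<Rightarrow> zvec"
  assumes finS: "finite S" and X: "zsub X" and supp: "\<And>v i. v \<in> X \<Longrightarrow> i \<notin> S \<Longrightarrow> v i = 0"
    and act: "\<And>g. g \<in> B \<Longrightarrow> zadd X (act g)"
    and m_closed: "\<And>g h. g \<in> B \<Longrightarrow> h \<in> B \<Longrightarrow> m g h \<in> B"
    and act_m: "\<And>g h x. g \<in> B \<Longrightarrow> h \<in> B \<Longrightarrow> x \<in> X \<Longrightarrow> act (m g h) x = act g (act h x)"
    and iv_closed: "\<And>g. g \<in> B \<Longrightarrow> iv g \<in> B"
    and act_iv: "\<And>g x. g \<in> B \<Longrightarrow> x \<in> X \<Longrightarrow> act (iv g) (act g x) = x"
      "\<And>g x. g \<in> B \<Longrightarrow> x \<in> X \<Longrightarrow> act g (act (iv g) x) = x"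
begin

definition inv_sub :: "zvec set \<Rightarrow> bool" where
  "inv_sub L \<longleftrightarrow> zsub L \<and> L \<subseteq> X \<and> (\<forall>g\<in>B. \<forall>x\<in>L. act g x \<in> L)"

text \<open>A chain of stable subgroups from pX to X on whose factors the group acts by scalars. Its
  length can be fixed as card S because steps may be trivial; the construction takes
  \<open>v i = 0\<close> once X is reached.\<close>

definition is_flag :: "int \<Rightarrow> (nat \<Rightarrow> zvec set) \<Rightarrow> (nat \<Rightarrow> zvec) \<Rightarrow> bool" where
  "is_flag p L v \<longleftrightarrow> L 0 = zsm p ` X \<and> L (card S) = X \<and> (\<forall>i. inv_sub (L i) \<and> v i \<in> X \<and>
    L (Suc i) = {l + zsm c (v i) | l c. l \<in> L i} \<and> (\<forall>g\<in>B. \<exists>c. act g (v i) - zsm c (v i) \<in> L i))"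

lemma is_flagD:
  assumes "is_flag p L v"
  shows "L 0 = zsm p ` X" "L (card S) = X" "inv_sub (L i)" "v i \<in> X"
    "L (Suc i) = {l + zsm c (v i) | l c. l \<in> L i}" "\<forall>g\<in>B. \<exists>c. act g (v i) - zsm c (v i) \<in> L i"
    "zsub (L i)" "L i \<subseteq> X" "\<And>g x. g \<in> B \<Longrightarrow> x \<in> L i \<Longrightarrow> act g x \<in> L i"
  using assms[unfolded is_flag_def, THEN conjunct1] assms[unfolded is_flag_def, THEN conjunct2, THEN conjunct1]
    assms[unfolded is_flag_def, THEN conjunct2, THEN conjunct2, rule_format, of i] unfolding inv_sub_def by blast+

text \<open>The flag grows by one vector at a time. If X were still missed after card S steps, there
  would be card S + 1 vectors, each outside the subgroup before it; being that many in card S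
  coordinates they satisfy a relation, which puts one of them inside after all.\<close>

lemma flag:
  assumes p: "prime (p::int)"
    and step: "\<forall>L. inv_sub L \<longrightarrow> L \<noteq> X \<longrightarrow> (\<forall>x\<in>X. zsm p x \<in> L) \<longrightarrow>
      (\<exists>v\<in>X - L. \<forall>g\<in>B. \<exists>c. act g v - zsm c v \<in> L)"
  shows "\<exists>L v. is_flag p L v"
proof -
  define good where "good L v \<longleftrightarrow> v \<in> X - L \<and> (\<forall>g\<in>B. \<exists>c. act g v - zsm c v \<in> L)" for L v
  define nxt where "nxt L = (if L = X then 0 else SOME v. good L v)" for L
  define L where "L = rec_nat (zsm p ` X) (\<lambda>_ L. {l + zsm c (nxt L) | l c. l \<in> L})"
  have L0: "L 0 = zsm p ` X" and LS: "L (Suc i) = {l + zsm c (nxt (L i)) | l c. l \<in> L i}" for i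
    by (simp_all add: L_def)
  have nxt: "nxt M \<in> X" "\<forall>g\<in>B. \<exists>c. act g (nxt M) - zsm c (nxt M) \<in> M" "M \<noteq> X \<Longrightarrow> nxt M \<notin> M"
    if M: "inv_sub M" "\<forall>x\<in>X. zsm p x \<in> M" for M
  proof -
    have "good M (nxt M)" if "M \<noteq> X"
    proof -
      have "\<exists>v. good M v" using step M that unfolding good_def by blast
      then show ?thesis unfolding nxt_def using that by (simp add: someI_ex)
    qed
    moreover have "nxt M = 0" if "M = X" using that by (simp add: nxt_def)
    moreover have "0 \<in> M" using M(1) zsub_0 unfolding inv_sub_def by blast
    moreover have "act g 0 - zsm c 0 = 0" if "g \<in> B" for g c using zadd_0[OF X act[OF that]] by simp
    ultimately show "nxt M \<in> X" "\<forall>g\<in>B. \<exists>c. act g (nxt M) - zsm c (nxt M) \<in> M" "M \<noteq> X \<Longrightarrow> nxt M \<notin> M"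
      unfolding good_def using zsub_0[OF X] by (metis DiffD1, metis, metis DiffD2)
  qed
  have inv: "inv_sub (L i) \<and> (\<forall>x\<in>X. zsm p x \<in> L i)" for i
  proof (induction i)
    case 0
    have "zsub (zsm p ` X)"
      unfolding zsub_def
    proof (intro conjI ballI)
      show "0 \<in> zsm p ` X" using zsub_0[OF X] zsm_0_right[of p] by (metis imageI)
      fix u v assume "u \<in> zsm p ` X" "v \<in> zsm p ` X"
      then show "u - v \<in> zsm p ` X" using zsub_diff[OF X] by (auto simp flip: zsm_diff_right)
    qed
    moreover have "act g x \<in> zsm p ` X" if "g \<in> B" "x \<in> zsm p ` X" for g x
      using that zadd_zsm[OF X act] zadd_in[OF act] by auto
    ultimately show ?case unfolding L0 inv_sub_def using zsub_zsm[OF X] by blast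
  next
    case (Suc i)
    define w where "w = nxt (L i)"
    have w: "w \<in> X" "\<forall>g\<in>B. \<exists>c. act g w - zsm c w \<in> L i" using nxt Suc unfolding w_def by blast+
    have Li: "zsub (L i)" "L i \<subseteq> X" "\<And>g x. g \<in> B \<Longrightarrow> x \<in> L i \<Longrightarrow> act g x \<in> L i"
      using Suc unfolding inv_sub_def by blast+
    have LS': "L (Suc i) = {l + zsm c w | l c. l \<in> L i}" unfolding w_def by (rule LS)
    have sub: "L i \<subseteq> L (Suc i)"
    proof
      fix l assume l: "l \<in> L i"
      have "l = l + zsm 0 w" by simp
      with l show "l \<in> L (Suc i)" unfolding LS' by blast
    qed
    have z: "zsub (L (Suc i))"
      unfolding zsub_def
    proof (intro conjI ballI)
      show "0 \<in> L (Suc i)" using sub zsub_0[OF Li(1)] by blast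
      fix a b assume "a \<in> L (Suc i)" "b \<in> L (Suc i)"
      then obtain l c l' c' where *: "a = l + zsm c w" "b = l' + zsm c' w" "l \<in> L i" "l' \<in> L i" unfolding LS' by blast
      then have "a - b = (l - l') + zsm (c - c') w" by (simp add: zsm_diff_left)
      then show "a - b \<in> L (Suc i)" unfolding LS' using zsub_diff[OF Li(1) *(3,4)] by blast
    qed
    have "act g x \<in> L (Suc i)" if g: "g \<in> B" and x: "x \<in> L (Suc i)" for g x
    proof -
      obtain l c where l: "x = l + zsm c w" "l \<in> L i" using x unfolding LS' by blast
      obtain c' where c': "act g w - zsm c' w \<in> L i" using w g by blast
      have lX: "l \<in> X" using l(2) Li(2) by blast
      have "act g x = act g l + zsm c (act g w)"
        unfolding l(1) zadd_add[OF act[OF g] lX zsub_zsm[OF X w(1)]] zadd_zsm[OF X act[OF g] w(1)] ..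
      also have "\<dots> = (act g l + zsm c (act g w - zsm c' w)) + zsm (c * c') w"
        by (simp add: zsm_diff_right)
      finally show ?thesis unfolding LS' using zsub_add[OF Li(1) Li(3)[OF g l(2)] zsub_zsm[OF Li(1) c']] by blast
    qed
    moreover have "L (Suc i) \<subseteq> X" unfolding LS' using Li(2) zsub_add[OF X _ zsub_zsm[OF X w(1)]] by blast
    ultimately show ?case using z sub Suc unfolding inv_sub_def by blast
  qed
  define v where "v i = nxt (L i)" for i
  have v: "v i \<in> X" "\<forall>g\<in>B. \<exists>c. act g (v i) - zsm c (v i) \<in> L i" "L i \<noteq> X \<Longrightarrow> v i \<notin> L i" for i
    unfolding v_def using nxt inv by blast+
  have zL: "zsub (L i)" for i using inv unfolding inv_sub_def by blast
  have LSv: "L (Suc i) = {l + zsm c (v i) | l c. l \<in> L i}" for i unfolding v_def by (rule LS)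
  have incr: "L i \<subseteq> L (Suc i)" for i
  proof
    fix l assume l: "l \<in> L i"
    have "l = l + zsm 0 (v i)" by simp
    with l show "l \<in> L (Suc i)" unfolding LSv by blast
  qed
  have mono: "i \<le> j \<Longrightarrow> L i \<subseteq> L j" for i j using incr by (rule lift_Suc_mono_le)
  have v_in: "v i \<in> L (Suc i)" for i
  proof -
    have "v i = 0 + zsm 1 (v i)" by simp
    then show ?thesis unfolding LSv using zsub_0[OF zL[of i]] by blast
  qed
  have "L (card S) = X"
  proof (rule ccontr)
    assume ne: "L (card S) \<noteq> X"
    have neq: "L i \<noteq> X" if "i \<le> card S" for i
      using mono[OF that] ne inv[of "card S"] unfolding inv_sub_def by blast
    define n where "n = Suc (card S)"
    have "\<exists>c. (\<exists>k<n. \<not> p dvd c k) \<and> (\<Sum>k<n. zsm (c k) (v k)) = 0"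
    proof -
      \<comment> \<open>A relation of least total size cannot have all its coefficients divisible by
        p, for it could then be divided by p.\<close>
      define Q where "Q s \<longleftrightarrow> (\<exists>c. (\<exists>k<n. c k \<noteq> 0) \<and> (\<Sum>k<n. zsm (c k) (v k)) = 0 \<and> (\<Sum>k<n. nat \<bar>c k\<bar>) = s)" for s
      have "\<exists>s. Q s"
        using zvec_dependent[OF finS, of "{..<n}" v] supp[OF v(1)] unfolding Q_def n_def by auto
      then obtain s where s: "Q s" "\<And>t. t < s \<Longrightarrow> \<not> Q t" using exists_least_iff[of Q] by blast
      obtain c where c: "\<exists>k<n. c k \<noteq> 0" "(\<Sum>k<n. zsm (c k) (v k)) = 0" "(\<Sum>k<n. nat \<bar>c k\<bar>) = s"
        using s(1) unfolding Q_def by blast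
      have "\<exists>k<n. \<not> p dvd c k"
      proof (rule ccontr)
        assume "\<not> (\<exists>k<n. \<not> p dvd c k)"
        then have "\<forall>k. \<exists>e. k < n \<longrightarrow> c k = p * e" by (meson dvdE)
        then obtain e where e: "\<And>k. k < n \<Longrightarrow> c k = p * e k" by metis
        have "zsm p (\<Sum>k<n. zsm (e k) (v k)) = (\<Sum>k<n. zsm (c k) (v k))"
          unfolding zsm_sum by (rule sum.cong) (auto simp: e)
        then have e0: "(\<Sum>k<n. zsm (e k) (v k)) = 0" using c(2) p by (simp add: zsm_eq_0)
        obtain k where k: "k < n" "c k \<noteq> 0" using c(1) by blast
        have p2: "p > 1" using p prime_gt_1_int by blast
        have le: "nat \<bar>e j\<bar> \<le> nat \<bar>c j\<bar>" if "j < n" for j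
        proof -
          have "1 * \<bar>e j\<bar> \<le> p * \<bar>e j\<bar>" using p2 by (intro mult_right_mono) auto
          then show ?thesis using e[OF that] p2 by (simp add: abs_mult nat_mono)
        qed
        have "\<bar>e k\<bar> < \<bar>c k\<bar>" using e[OF k(1)] k(2) p2 by (simp add: abs_mult)
        then have "nat \<bar>e k\<bar> < nat \<bar>c k\<bar>" by linarith
        then have "(\<Sum>k<n. nat \<bar>e k\<bar>) < (\<Sum>k<n. nat \<bar>c k\<bar>)"
          using le k(1) by (intro sum_strict_mono_ex1) auto
        then have "\<not> Q (\<Sum>k<n. nat \<bar>e k\<bar>)" using s(2) c(3) by simp
        moreover have "e k \<noteq> 0" using e[OF k(1)] k(2) by auto
        ultimately show False unfolding Q_def using e0 k(1) by blast
      qed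
      then show ?thesis using c(2) by blast
    qed
    then obtain c where c: "\<exists>k<n. \<not> p dvd c k" "(\<Sum>k<n. zsm (c k) (v k)) = 0" by blast
    define K where "K = {k. k < n \<and> \<not> p dvd c k}"
    have K: "finite K" "K \<noteq> {}" using c(1) by (auto simp: K_def)
    \<comment> \<open>At the last coefficient prime to p all other terms lie in \<open>L k\<close>:
      the later ones in pX, the earlier ones by growth of the chain. Bezout then puts
      \<open>v k\<close> into \<open>L k\<close>.\<close>
    define k where "k = Max K"
    have k: "k < n" "\<not> p dvd c k" using Max_in[OF K] by (auto simp: K_def k_def)
    have above: "p dvd c j" if "k < j" "j < n" for j
    proof (rule ccontr)
      assume "\<not> p dvd c j"
      then have "j \<le> k" unfolding k_def using that K(1) by (intro Max_ge) (auto simp: K_def)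
      then show False using that by simp
    qed
    have terms: "zsm (c j) (v j) \<in> L k" if j: "j < n" "j \<noteq> k" for j
    proof (cases "j < k")
      case True
      then have "v j \<in> L k" using v_in[of j] mono[of "Suc j" k] by auto
      then show ?thesis by (rule zsub_zsm[OF zL])
    next
      case False
      then have "p dvd c j" using above j by simp
      then obtain e where "c j = p * e" by (elim dvdE)
      then have "zsm (c j) (v j) = zsm p (zsm e (v j))" by simp
      moreover have "zsm p (zsm e (v j)) \<in> L k" using inv[of k] zsub_zsm[OF X v(1)] by blast
      ultimately show ?thesis by (simp only:)
    qed
    have "(\<Sum>j<n. zsm (c j) (v j)) = zsm (c k) (v k) + (\<Sum>j\<in>{..<n} - {k}. zsm (c j) (v j))"
      using k(1) by (intro sum.remove) auto
    then have "zsm (c k) (v k) = - (\<Sum>j\<in>{..<n} - {k}. zsm (c j) (v j))" using c(2) by (simp add: eq_neg_iff_add_eq_0)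
    moreover have "(\<Sum>j\<in>{..<n} - {k}. zsm (c j) (v j)) \<in> L k" using terms by (intro zsub_sum[OF zL]) auto
    ultimately have ck: "zsm (c k) (v k) \<in> L k" using zsub_minus[OF zL] by simp
    have "coprime p (c k)" using p k(2) prime_imp_coprime by blast
    then obtain x y where xy: "x * p + y * c k = 1" using bezout_int[of p "c k"] by auto
    have "v k = zsm (x * p + y * c k) (v k)" unfolding xy by simp
    also have "\<dots> = zsm x (zsm p (v k)) + zsm y (zsm (c k) (v k))" by (simp add: zsm_add_left)
    finally have "v k = zsm x (zsm p (v k)) + zsm y (zsm (c k) (v k))" .
    moreover have "zsm p (v k) \<in> L k" using inv[of k] v(1) by blast
    ultimately have "v k \<in> L k" using zsub_add[OF zL zsub_zsm[OF zL] zsub_zsm[OF zL ck]] by metis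
    then show False using v(3)[of k] neq[of k] k(1) by (simp add: n_def)
  qed
  then show ?thesis unfolding is_flag_def using L0 LSv inv v by (intro exI[of _ L] exI[of _ v]) blast
qed

end

context lattice_action
begin

text \<open>On a flag modulo \<open>p\<close> the group acts by scalars, so commutator differences
  \<open>g h - h g\<close> lower it; \<open>card S\<close> of them annihilate \<open>X\<close> modulo every prime.\<close>
lemma common_eigenvector:
  assumes nz: "v0 \<in> X" "v0 \<noteq> 0"
    and step: "\<And>p::int. prime p \<Longrightarrow> \<forall>L. inv_sub L \<longrightarrow> L \<noteq> X \<longrightarrow> (\<forall>x\<in>X. zsm p x \<in> L) \<longrightarrow>
      (\<exists>v\<in>X - L. \<forall>g\<in>B. \<exists>c. act g v - zsm c v \<in> L)"
  shows "\<exists>v\<in>X. v \<noteq> 0 \<and> (\<forall>g\<in>B. \<exists>c. act g v = zsm c v)"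
proof -
  define dl where "dl g h x = act g (act h x) - act h (act g x)" for g h x
  have dl_in: "dl g h x \<in> X" if "g \<in> B" "h \<in> B" "x \<in> X" for g h x
    unfolding dl_def by (intro zsub_diff[OF X] zadd_in[OF act] that)
  \<comment> \<open>Values of j nested commutator differences; these are plain sets, and all that is
    asked of them is whether they reduce to zero.\<close>
  define D where "D = rec_nat X (\<lambda>_ E. {dl g h x | g h x. g \<in> B \<and> h \<in> B \<and> x \<in> E})"
  have D0: "D 0 = X" and DS: "D (Suc j) = {dl g h x | g h x. g \<in> B \<and> h \<in> B \<and> x \<in> D j}" for j
    by (simp_all add: D_def)
  have DX: "D j \<subseteq> X" for j
  proof (induction j)
    case (Suc j)
    then show ?case unfolding DS using dl_in by blast
  qed (simp add: D0)
  have Dn: "D (card S) \<subseteq> {0}"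
  proof
    fix x assume x: "x \<in> D (card S)"
    have all: "p dvd x i" if p: "prime p" for i and p :: int
    proof -
      obtain L v where F: "is_flag p L v" using flag[OF p step[OF p]] by (elim exE)
      note L = is_flagD(1-6)[OF F] and Li = is_flagD(7-9)[OF F]
      have lower: "dl g h x \<in> L i" if g: "g \<in> B" and h: "h \<in> B" and x: "x \<in> L (Suc i)" for g h x i
      proof -
        obtain l c where l: "x = l + zsm c (v i)" "l \<in> L i" using x unfolding L(5) by blast
        obtain cg ch where cg: "act g (v i) - zsm cg (v i) \<in> L i" and ch: "act h (v i) - zsm ch (v i) \<in> L i"
          using L(6)[rule_format, OF g, of i] L(6)[rule_format, OF h, of i] by blast
        have lX: "l \<in> X" using l(2) Li(2) by blast
        have vX: "v i \<in> X" by (rule L(4))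
        have two: "act g (act h (v i)) - zsm (ch * cg) (v i) \<in> L i"
          if g: "g \<in> B" and h: "h \<in> B" and cg: "act g (v i) - zsm cg (v i) \<in> L i" and ch: "act h (v i) - zsm ch (v i) \<in> L i"
          for g h cg ch
        proof -
          have "act g (act h (v i) - zsm ch (v i)) = act g (act h (v i)) - zsm ch (act g (v i))"
            unfolding zadd_diff[OF X act[OF g] zadd_in[OF act[OF h] vX] zsub_zsm[OF X vX]]
              zadd_zsm[OF X act[OF g] vX] ..
          moreover have "act g (act h (v i) - zsm ch (v i)) \<in> L i" using Li(3)[OF g ch] .
          moreover have "zsm ch (act g (v i) - zsm cg (v i)) \<in> L i" using zsub_zsm[OF Li(1) cg] .
          ultimately have "(act g (act h (v i)) - zsm ch (act g (v i))) + zsm ch (act g (v i) - zsm cg (v i)) \<in> L i"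
            using zsub_add[OF Li(1)] by metis
          then show ?thesis by (simp add: zsm_diff_right)
        qed
        have "dl g h (v i) = (act g (act h (v i)) - zsm (ch * cg) (v i)) - (act h (act g (v i)) - zsm (cg * ch) (v i))"
          by (simp add: dl_def mult.commute)
        then have dv: "dl g h (v i) \<in> L i"
          using zsub_diff[OF Li(1) two[OF g h cg ch] two[OF h g ch cg]] by simp
        have aa: "act g (act h x) = act g (act h l) + zsm c (act g (act h (v i)))" if g: "g \<in> B" and h: "h \<in> B" for g h
          unfolding l(1) zadd_add[OF act[OF h] lX zsub_zsm[OF X vX]] zadd_zsm[OF X act[OF h] vX]
            zadd_add[OF act[OF g] zadd_in[OF act[OF h] lX] zsub_zsm[OF X zadd_in[OF act[OF h] vX]]]
            zadd_zsm[OF X act[OF g] zadd_in[OF act[OF h] vX]] ..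
        have "dl g h x = dl g h l + zsm c (dl g h (v i))"
          unfolding dl_def aa[OF g h] aa[OF h g] by (simp add: zsm_diff_right)
        moreover have "dl g h l \<in> L i"
          unfolding dl_def by (intro zsub_diff[OF Li(1)] Li(3) g h l(2))
        ultimately show ?thesis using zsub_add[OF Li(1) _ zsub_zsm[OF Li(1) dv]] by simp
      qed
      have "D j \<subseteq> L (card S - j)" if "j \<le> card S" for j
        using that
      proof (induction j)
        case (Suc j)
        have "card S - j = Suc (card S - Suc j)" using Suc.prems by simp
        then have sub: "D j \<subseteq> L (Suc (card S - Suc j))" using Suc by simp
        show ?case
        proof
          fix y assume "y \<in> D (Suc j)"
          then obtain g h x where y: "y = dl g h x" "g \<in> B" "h \<in> B" "x \<in> D j" unfolding DS by blast
          show "y \<in> L (card S - Suc j)" unfolding y(1) using y(4) sub by (intro lower y(2,3)) blast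
        qed
      qed (simp add: D0 L(2))
      from this[of "card S"] have "x \<in> zsm p ` X" using x L(1) by auto
      then show ?thesis by (auto simp: zsm_apply)
    qed
    \<comment> \<open>An integer divisible by every prime is zero: a prime beyond its absolute value
      divides it.\<close>
    have "x i = 0" for i
    proof (rule ccontr)
      assume ne: "x i \<noteq> 0"
      obtain q :: nat where q: "prime q" "nat \<bar>x i\<bar> < q" using bigger_prime by blast
      then have "int q dvd x i" using all[of "int q"] by simp
      then have "int q \<le> \<bar>x i\<bar>" using ne by (metis dvd_imp_le_int abs_of_nat)
      then show False using q(2) by simp
    qed
    then show "x \<in> {0}" by (auto simp: fun_eq_iff zero_fun_apply)
  qed
  define V where "V = {x \<in> X. \<forall>g\<in>B. \<forall>h\<in>B. dl g h x = 0}"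
  \<comment> \<open>A nonzero element of the last \<open>D j\<close> that does not vanish is
    annihilated by all commutator differences.\<close>
  obtain w0 where w0: "w0 \<in> V" "w0 \<noteq> 0"
  proof -
    have "D 0 \<noteq> {0} \<and> \<not> D 0 \<subseteq> {0}" using nz D0 by blast
    then obtain j where j: "D (Suc j) \<subseteq> {0}" "\<not> D j \<subseteq> {0}"
      using exists_least_iff[of "\<lambda>j. D j \<subseteq> {0}"] Dn by (metis lessI not0_implies_Suc)
    then obtain w where w: "w \<in> D j" "w \<noteq> 0" by blast
    have "w \<in> V" unfolding V_def using w(1) DX j(1) unfolding DS by blast
    then show ?thesis using that w(2) by blast
  qed
  have dl_diff: "dl g h (x - y) = dl g h x - dl g h y" if "g \<in> B" "h \<in> B" "x \<in> X" "y \<in> X" for g h x y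
    unfolding dl_def using that by (simp add: zadd_diff[OF X act] zadd_in[OF act])
  have dl_zsm: "dl g h (zsm c x) = zsm c (dl g h x)" if "g \<in> B" "h \<in> B" "x \<in> X" for g h x c
    unfolding dl_def using that by (simp add: zadd_zsm[OF X act] zadd_in[OF act] zsm_diff_right)
  have V_sub: "zsub V"
    unfolding zsub_def
  proof (intro conjI ballI)
    have "dl g h 0 = 0" if "g \<in> B" "h \<in> B" for g h
      unfolding dl_def using that by (simp add: zadd_0[OF X act])
    then show "0 \<in> V" unfolding V_def using zsub_0[OF X] by blast
    fix u v assume "u \<in> V" "v \<in> V"
    then show "u - v \<in> V" unfolding V_def using zsub_diff[OF X] dl_diff by simp
  qed
  have V_comm: "act g (act h x) = act h (act g x)" if "g \<in> B" "h \<in> B" "x \<in> V" for g h x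
    using that unfolding V_def dl_def by simp
  \<comment> \<open>Moving k past g and h replaces them by their conjugates, which are again group
    elements, so they commute at x.\<close>
  have V_inv: "act k x \<in> V" if k: "k \<in> B" and x: "x \<in> V" for k x
  proof -
    have xX: "x \<in> X" using x unfolding V_def by blast
    have "act g (act h (act k x)) = act h (act g (act k x))" if g: "g \<in> B" and h: "h \<in> B" for g h
    proof -
      define g' h' where "g' = m (iv k) (m g k)" and "h' = m (iv k) (m h k)"
      have gh: "g' \<in> B" "h' \<in> B" unfolding g'_def h'_def using g h k m_closed iv_closed by blast+
      have c: "act k (act (m (iv k) (m g k)) y) = act g (act k y)" if "y \<in> X" "g \<in> B" for y g
        using that k m_closed iv_closed act_iv(2) zadd_in[OF act] by (simp add: act_m)
      have "act g (act h (act k x)) = act g (act k (act h' x))" unfolding h'_def c[OF xX h] ..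
      also have "\<dots> = act k (act g' (act h' x))"
        unfolding g'_def c[OF zadd_in[OF act[OF gh(2)] xX] g] ..
      also have "\<dots> = act k (act h' (act g' x))" using V_comm[OF gh x] by simp
      also have "\<dots> = act h (act k (act g' x))"
        unfolding h'_def c[OF zadd_in[OF act[OF gh(1)] xX] h] ..
      also have "\<dots> = act h (act g (act k x))" unfolding g'_def c[OF xX g] ..
      finally show ?thesis .
    qed
    then show ?thesis unfolding V_def dl_def using zadd_in[OF act[OF k] xX] by simp
  qed
  \<comment> \<open>The nonzero stable subgroups of V that are pure in X. In one of minimal rank the
    eigenspace of any g belongs to the family again, so it has the same rank and, being pure, is the
    whole. Thus every g acts there by a scalar.\<close>
  define fam where "fam W \<longleftrightarrow> inv_sub W \<and> W \<subseteq> V \<and> (\<exists>w\<in>W. w \<noteq> 0) \<and>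
    (\<forall>n x. n \<noteq> 0 \<longrightarrow> x \<in> X \<longrightarrow> zsm n x \<in> W \<longrightarrow> x \<in> W)" for W
  define R where "R W k \<longleftrightarrow> (\<exists>vs. (\<forall>i<k. vs i \<in> W) \<and> indep k vs)" for W and k :: nat
  have famV: "fam V"
  proof -
    have "x \<in> V" if "n \<noteq> 0" "x \<in> X" "zsm n x \<in> V" for n x
      using that unfolding V_def by (auto simp: dl_zsm zsm_eq_0)
    moreover have "inv_sub V" unfolding inv_sub_def using V_sub V_inv unfolding V_def by blast
    ultimately show ?thesis unfolding fam_def using w0 by blast
  qed
  have "\<not> R W (Suc (card S))" if "fam W" for W
  proof
    assume "R W (Suc (card S))"
    then obtain vs where vs: "\<forall>i<Suc (card S). vs i \<in> W" "indep (Suc (card S)) vs" unfolding R_def by blast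
    have "W \<subseteq> X" using that unfolding fam_def inv_sub_def by blast
    then have "Suc (card S) \<le> card S" using vs supp by (intro indep_le_card[OF finS vs(2)]) blast
    then show False by simp
  qed
  then have "\<exists>k W. fam W \<and> \<not> R W (Suc k)" using famV by blast
  then obtain k where k: "\<exists>W. fam W \<and> \<not> R W (Suc k)" "\<And>j. j < k \<Longrightarrow> \<not> (\<exists>W. fam W \<and> \<not> R W (Suc j))"
    using exists_least_iff[of "\<lambda>k. \<exists>W. fam W \<and> \<not> R W (Suc k)"] by blast
  then obtain W where W: "fam W" "\<not> R W (Suc k)" by blast
  have rank: "R W' k" if "fam W'" for W'
  proof (cases k)
    case 0
    then show ?thesis unfolding R_def indep_def by simp
  next
    case (Suc j)
    then show ?thesis using k(2)[of j] that by blast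
  qed
  have Ws: "zsub W" "W \<subseteq> X" "W \<subseteq> V" "\<And>g x. g \<in> B \<Longrightarrow> x \<in> W \<Longrightarrow> act g x \<in> W"
    "\<And>n x. n \<noteq> 0 \<Longrightarrow> x \<in> X \<Longrightarrow> zsm n x \<in> W \<Longrightarrow> x \<in> W"
    using W(1) unfolding fam_def inv_sub_def by blast+
  obtain w where w: "w \<in> W" "w \<noteq> 0" using W(1) unfolding fam_def by blast
  have scalar: "\<exists>c. \<forall>x\<in>W. act g x = zsm c x" if g: "g \<in> B" for g
  proof -
    have zW: "zadd W (act g)"
      using act[OF g] Ws(2) Ws(4)[OF g] unfolding zadd_def by blast
    have "\<exists>cs. \<forall>x\<in>W. \<exists>y\<in>W. pact (\<Prod>c\<leftarrow>cs. [:- c, 1:]) (act g) x = zsm p y" if p: "prime p" for p :: int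
    proof -
      obtain L v where F: "is_flag p L v" using flag[OF p step[OF p]] by (elim exE)
      note L = is_flagD(1-6)[OF F] and Li = is_flagD(7-9)[OF F]
      \<comment> \<open>The factors g - c, with c the scalars of the flag, push X down step by step
        into pX; their product is the split polynomial that \<open>operator_eigenvector\<close> asks
        for.\<close>
      have "\<exists>cs. \<forall>x\<in>L i. pact (\<Prod>c\<leftarrow>cs. [:- c, 1:]) (act g) x \<in> L 0" for i
      proof (induction i)
        case 0
        have "pact (\<Prod>c\<leftarrow>[]. [:- c, 1:]) (act g) x = x" for x
          using pact_const[OF X act[OF g], of 1 x] by (simp add: one_pCons)
        then show ?case by (intro exI[of _ "[]"]) simp
      next
        case (Suc i)
        then obtain cs where cs: "\<forall>x\<in>L i. pact (\<Prod>c\<leftarrow>cs. [:- c, 1:]) (act g) x \<in> L 0" by blast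
        obtain c where c: "act g (v i) - zsm c (v i) \<in> L i" using L(6)[rule_format, OF g, of i] by blast
        have "pact (\<Prod>c\<leftarrow>c # cs. [:- c, 1:]) (act g) x \<in> L 0" if x: "x \<in> L (Suc i)" for x
        proof -
          obtain l e where l: "x = l + zsm e (v i)" "l \<in> L i" using x unfolding L(5) by blast
          have lX: "l \<in> X" using l(2) Li(2) by blast
          have xX: "x \<in> X" using x Li(2) by blast
          have "act g x - zsm c x = (act g l - zsm c l) + zsm e (act g (v i) - zsm c (v i))"
            unfolding l(1) zadd_add[OF act[OF g] lX zsub_zsm[OF X L(4)]] zadd_zsm[OF X act[OF g] L(4)]
            by (simp add: zsm_diff_right zsm_add_right mult.commute)
          moreover have "act g l - zsm c l \<in> L i"
            using zsub_diff[OF Li(1) Li(3)[OF g l(2)] zsub_zsm[OF Li(1) l(2)]] .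
          ultimately have in_L: "act g x - zsm c x \<in> L i"
            using zsub_add[OF Li(1) _ zsub_zsm[OF Li(1) c]] by simp
          have "pact (\<Prod>c\<leftarrow>c # cs. [:- c, 1:]) (act g) x =
              pact ((\<Prod>c\<leftarrow>cs. [:- c, 1:]) * [:- c, 1:]) (act g) x"
            by (simp only: list.map prod_list.Cons mult.commute)
          also have "\<dots> = pact (\<Prod>c\<leftarrow>cs. [:- c, 1:]) (act g) (pact [:- c, 1:] (act g) x)"
            by (rule pact_mult[OF X act[OF g] xX])
          also have "pact [:- c, 1:] (act g) x = act g x - zsm c x"
            by (simp add: pact_pCons[OF X act[OF g]] zadd_0[OF X act[OF g]] zsm_minus_left)
          finally show ?thesis using cs in_L by simp
        qed
        then show ?case by blast
      qed
      from this[of "card S"] obtain cs where cs: "\<forall>x\<in>X. pact (\<Prod>c\<leftarrow>cs. [:- c, 1:]) (act g) x \<in> zsm p ` X"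
        unfolding L(1,2) by blast
      have "\<exists>y\<in>W. pact (\<Prod>c\<leftarrow>cs. [:- c, 1:]) (act g) x = zsm p y" if x: "x \<in> W" for x
      proof -
        obtain y where y: "y \<in> X" "pact (\<Prod>c\<leftarrow>cs. [:- c, 1:]) (act g) x = zsm p y"
          using cs x Ws(2) by blast
        have "zsm p y \<in> W" unfolding y(2)[symmetric] by (rule pact_in[OF Ws(1) zW x])
        then have "y \<in> W" using Ws(5) p y(1) by (metis not_prime_0)
        then show ?thesis using y(2) by blast
      qed
      then show ?thesis by blast
    qed
    then obtain v c where v: "v \<in> W" "v \<noteq> 0" "act g v = zsm c v"
      using operator_eigenvector[OF finS Ws(1) _ zW w] supp Ws(2) by blast
    define W1 where "W1 = {x \<in> W. act g x = zsm c x}"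
    have "zsub W1"
      unfolding zsub_def
    proof (intro conjI ballI)
      show "0 \<in> W1" unfolding W1_def using zsub_0[OF Ws(1)] zadd_0[OF Ws(1) zW] by simp
      fix x y assume "x \<in> W1" "y \<in> W1"
      then show "x - y \<in> W1"
        unfolding W1_def using zsub_diff[OF Ws(1)] zadd_diff[OF Ws(1) zW] by (simp add: zsm_diff_right)
    qed
    moreover have "act h x \<in> W1" if h: "h \<in> B" and x: "x \<in> W1" for h x
    proof -
      have xW: "x \<in> W" "act g x = zsm c x" using x unfolding W1_def by auto
      have "act g (act h x) = act h (act g x)" using V_comm[OF g h] xW(1) Ws(3) by blast
      also have "\<dots> = zsm c (act h x)" unfolding xW(2) using zadd_zsm[OF X act[OF h]] xW(1) Ws(2) by blast
      finally show ?thesis unfolding W1_def using Ws(4)[OF h xW(1)] by blast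
    qed
    moreover have pure: "x \<in> W1" if "n \<noteq> 0" "x \<in> X" "zsm n x \<in> W1" for n x
    proof -
      have xW: "x \<in> W" using Ws(5) that unfolding W1_def by blast
      have "zsm n (act g x) = zsm c (zsm n x)"
        using that(3) zadd_zsm[OF Ws(1) zW xW] unfolding W1_def by simp
      then have "zsm n (act g x - zsm c x) = 0" by (simp add: zsm_diff_right mult.commute)
      then show ?thesis unfolding W1_def using xW that(1) by (simp add: zsm_eq_0)
    qed
    ultimately have famW1: "fam W1"
      unfolding fam_def inv_sub_def using Ws(2,3) v unfolding W1_def by blast
    obtain vs where vs: "\<forall>i<k. vs i \<in> W1" "indep k vs" using rank[OF famW1] unfolding R_def by blast
    have "x \<in> W1" if x: "x \<in> W" for x
    proof -
      define us where "us i = (if i = k then x else vs i)" for i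
      have "\<forall>i<Suc k. us i \<in> W" using vs(1) x unfolding us_def W1_def by (auto simp: less_Suc_eq)
      then have "\<not> indep (Suc k) us" using W(2) unfolding R_def by blast
      then obtain e j where e: "(\<Sum>i<Suc k. zsm (e i) (us i)) = 0" "j < Suc k" "e j \<noteq> 0"
        unfolding indep_def by blast
      have s: "(\<Sum>i<Suc k. zsm (e i) (us i)) = (\<Sum>i<k. zsm (e i) (vs i)) + zsm (e k) x"
        by (simp add: us_def)
      have ek: "e k \<noteq> 0"
      proof
        assume "e k = 0"
        then have "(\<Sum>i<k. zsm (e i) (vs i)) = 0" using e(1) s by simp
        then have "\<forall>i<k. e i = 0" using vs(2) unfolding indep_def by blast
        then show False using e(2,3) \<open>e k = 0\<close> by (metis less_SucE)
      qed
      have "zsm (e k) x = - (\<Sum>i<k. zsm (e i) (vs i))"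
        using e(1) unfolding s by (simp add: eq_neg_iff_add_eq_0 add.commute)
      moreover have "- (\<Sum>i<k. zsm (e i) (vs i)) \<in> W1"
        using vs(1) famW1 unfolding fam_def inv_sub_def by (auto intro!: zsub_minus zsub_sum zsub_zsm)
      ultimately have "zsm (e k) x \<in> W1" by simp
      then show ?thesis using pure[OF ek] x Ws(2) by blast
    qed
    then show ?thesis unfolding W1_def by blast
  qed
  then show ?thesis using w Ws(2) by blast
qed

end

section \<open>Groups and braces on carrier sets\<close>

locale cgroup =
  fixes C :: "'a set" and f :: "'a \<Rightarrow> 'a \<Rightarrow> 'a"
  assumes is_grp: "is_group C f"
begin

abbreviation "G \<equiv> \<lparr>carrier = C, mult = f, one = gid C f\<rparr>"

lemma gid_eqI:
  assumes "e \<in> C" "\<forall>a\<in>C. f e a = a \<and> f a e = a"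
  shows "gid C f = e"
  unfolding gid_def
proof (rule the_equality)
  fix e' assume "e' \<in> C \<and> (\<forall>a\<in>C. f e' a = a \<and> f a e' = a)"
  then show "e' = e" using assms by metis
qed (use assms in blast)

lemma group_G: "group G"
proof -
  obtain e where e: "e \<in> C" "\<forall>a\<in>C. f e a = a \<and> f a e = a" "\<forall>a\<in>C. \<exists>b\<in>C. f a b = e \<and> f b a = e"
    using is_grp unfolding is_group_def by blast
  note ge = gid_eqI[OF e(1,2)]
  show ?thesis
  proof (rule groupI)
    fix x assume "x \<in> carrier G"
    then show "\<exists>y\<in>carrier G. y \<otimes>\<^bsub>G\<^esub> x = \<one>\<^bsub>G\<^esub>" using e ge by auto
  qed (use is_grp e ge in \<open>auto simp: is_group_def\<close>)
qed

lemma m_inv_G: "m_inv G = ginv C f"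
  by (intro ext) (simp add: m_inv_def ginv_def)

sublocale grp: group G
  rewrites "carrier G = C" and "mult G = f" and "one G = gid C f" and "m_inv G = ginv C f"
proof -
  show "group G" by (rule group_G)
  show "m_inv G = ginv C f" by (rule m_inv_G)
qed simp_all

lemma gnpow_eq: "x \<in> C \<Longrightarrow> gnpow C f x n = x [^]\<^bsub>G\<^esub> n"
proof (induction n)
  case (Suc n)
  then show ?case using grp.nat_pow_Suc2[of x n] by (simp add: gnpow_def)
qed (simp add: gnpow_def)

lemma gipow_eq:
  assumes x: "x \<in> C"
  shows "gipow C f x n = x [^]\<^bsub>G\<^esub> n"
proof (cases "n < 0")
  case True
  then have "\<not> 0 \<le> n" by simp
  then show ?thesis
    unfolding gipow_def int_pow_def2 gnpow_eq[OF x] m_inv_G by (simp only: True if_True if_False)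
next
  case False
  then have "0 \<le> n" by simp
  then show ?thesis
    unfolding gipow_def int_pow_def2 gnpow_eq[OF x] m_inv_G by (simp only: False if_True if_False)
qed

lemma is_group_subset_iff:
  assumes "K \<subseteq> C"
  shows "is_group K f \<longleftrightarrow>
    gid C f \<in> K \<and> (\<forall>x\<in>K. \<forall>y\<in>K. f x y \<in> K) \<and> (\<forall>x\<in>K. ginv C f x \<in> K)"
proof
  assume K: "is_group K f"
  then obtain e where e: "e \<in> K" "\<forall>a\<in>K. f e a = a \<and> f a e = a" "\<forall>a\<in>K. \<exists>b\<in>K. f a b = e \<and> f b a = e"
    unfolding is_group_def by blast
  have "f e e = e" using e by blast
  then have e1: "e = gid C f" using e(1) assms grp.r_cancel_one' by (metis subsetD)
  have "ginv C f x \<in> K" if x: "x \<in> K" for x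
  proof -
    obtain y where y: "y \<in> K" "f y x = e" using e(3) x by blast
    then have "ginv C f x = y" using grp.inv_equality[of y x] e1 assms x by blast
    then show ?thesis using y by simp
  qed
  then show "gid C f \<in> K \<and> (\<forall>x\<in>K. \<forall>y\<in>K. f x y \<in> K) \<and> (\<forall>x\<in>K. ginv C f x \<in> K)"
    using e(1) e1 K unfolding is_group_def by blast
next
  assume K: "gid C f \<in> K \<and> (\<forall>x\<in>K. \<forall>y\<in>K. f x y \<in> K) \<and> (\<forall>x\<in>K. ginv C f x \<in> K)"
  have "\<exists>b\<in>K. f a b = gid C f \<and> f b a = gid C f" if "a \<in> K" for a
    using K assms that by (intro bexI[of _ "ginv C f a"]) auto
  moreover have "f (f a b) c = f a (f b c)" if "a \<in> K" "b \<in> K" "c \<in> K" for a b c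
    using assms grp.m_assoc that by blast
  moreover have "f (gid C f) a = a \<and> f a (gid C f) = a" if "a \<in> K" for a
    using assms that by auto
  ultimately show "is_group K f"
    unfolding is_group_def using K by blast
qed

end

section \<open>Braces, their two left actions, ideals and cosets\<close>

locale brace =
  fixes C :: "'a set" and add mul :: "'a \<Rightarrow> 'a \<Rightarrow> 'a"
  assumes is_br: "is_brace C add mul"
begin

sublocale A: cgroup C add
  using is_br by unfold_locales (simp add: is_brace_def)

sublocale M: cgroup C mul
  using is_br by unfold_locales (simp add: is_brace_def)

abbreviation z where "z \<equiv> gid C add"
abbreviation neg where "neg \<equiv> ginv C add"
abbreviation iv where "iv \<equiv> ginv C mul"
abbreviation lam where "lam \<equiv> blam C add mul"
abbreviation zm :: "int \<Rightarrow> 'a \<Rightarrow> 'a" where "zm n x \<equiv> x [^]\<^bsub>A.G\<^esub> n"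

lemmas aclosed [simp, intro] = A.grp.m_closed A.grp.inv_closed A.grp.one_closed
lemmas mclosed [simp, intro] = M.grp.m_closed M.grp.inv_closed

lemma brace_law: "a \<in> C \<Longrightarrow> b \<in> C \<Longrightarrow> c \<in> C \<Longrightarrow> mul a (add b c) = add (add (mul a b) (neg a)) (mul a c)"
  using is_br by (simp add: is_brace_def)

lemma add_neg_cancel [simp]:
  assumes "a \<in> C" "b \<in> C"
  shows "add a (add (neg a) b) = b" "add (neg a) (add a b) = b"
    "add (add b a) (neg a) = b" "add (add b (neg a)) a = b"
  using assms by (simp_all add: A.grp.m_assoc[symmetric]) (simp_all add: A.grp.m_assoc)

lemma mul_iv_cancel [simp]:
  assumes "a \<in> C" "b \<in> C"
  shows "mul a (mul (iv a) b) = b" "mul (iv a) (mul a b) = b"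
    "mul (mul b a) (iv a) = b" "mul (mul b (iv a)) a = b"
  using assms by (simp_all add: M.grp.m_assoc[symmetric]) (simp_all add: M.grp.m_assoc)

lemma mul_z [simp]: "a \<in> C \<Longrightarrow> mul a z = a"
proof -
  assume a: "a \<in> C"
  have "add (neg (mul a z)) (mul a (add z z)) = add (neg (mul a z)) (add (mul a z) (add (neg a) (mul a z)))"
    using brace_law[OF a A.grp.one_closed A.grp.one_closed] a by (simp add: A.grp.m_assoc)
  then have "z = add (neg a) (mul a z)" using a by simp
  then have "add a z = add a (add (neg a) (mul a z))" by simp
  then show ?thesis using a by simp
qed

lemma gid_mul [simp]: "gid C mul = z"
  using mul_z[of "gid C mul"] M.grp.l_one[of z] by (metis A.grp.one_closed M.grp.one_closed)

lemma z_mul [simp]: "a \<in> C \<Longrightarrow> mul z a = a"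
  using M.grp.l_one[of a] by simp

lemma mul_iv [simp]: "a \<in> C \<Longrightarrow> mul a (iv a) = z" "a \<in> C \<Longrightarrow> mul (iv a) a = z"
  using M.grp.r_inv[of a] M.grp.l_inv[of a] by simp_all

lemma lam_closed [simp, intro]: "a \<in> C \<Longrightarrow> b \<in> C \<Longrightarrow> lam a b \<in> C"
  by (simp add: blam_def)

lemma mul_lam: "a \<in> C \<Longrightarrow> b \<in> C \<Longrightarrow> mul a b = add a (lam a b)"
  by (simp add: blam_def)

lemma lam_add: "a \<in> C \<Longrightarrow> b \<in> C \<Longrightarrow> c \<in> C \<Longrightarrow> lam a (add b c) = add (lam a b) (lam a c)"
  by (simp add: blam_def brace_law A.grp.m_assoc)

lemma lam_z [simp]: "a \<in> C \<Longrightarrow> lam a z = z" "a \<in> C \<Longrightarrow> lam z a = a"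
  by (simp_all add: blam_def)

lemma lam_mul: "a \<in> C \<Longrightarrow> b \<in> C \<Longrightarrow> c \<in> C \<Longrightarrow> lam (mul a b) c = lam a (lam b c)"
proof -
  assume abc: "a \<in> C" "b \<in> C" "c \<in> C"
  have "add (mul a b) (lam a (lam b c)) = add a (lam a (add b (lam b c)))"
    using abc by (simp add: lam_add mul_lam[of a b] A.grp.m_assoc)
  also have "\<dots> = mul (mul a b) c"
    using abc by (simp add: mul_lam[symmetric] M.grp.m_assoc)
  finally have "mul (mul a b) c = add (mul a b) (lam a (lam b c))" by simp
  then have "lam (mul a b) c = add (neg (mul a b)) (add (mul a b) (lam a (lam b c)))"
    by (simp add: blam_def)
  then show ?thesis using abc by simp
qed

lemma lam_iv [simp]:
  "a \<in> C \<Longrightarrow> b \<in> C \<Longrightarrow> lam (iv a) (lam a b) = b"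
  "a \<in> C \<Longrightarrow> b \<in> C \<Longrightarrow> lam a (lam (iv a) b) = b"
  by (simp_all add: lam_mul[symmetric])

lemma lam_neg: "a \<in> C \<Longrightarrow> b \<in> C \<Longrightarrow> lam a (neg b) = neg (lam a b)"
proof -
  assume ab: "a \<in> C" "b \<in> C"
  then have "add (lam a (neg b)) (lam a b) = z" by (simp add: lam_add[symmetric])
  then show ?thesis using ab A.grp.inv_equality[of "lam a (neg b)" "lam a b"] by simp
qed

lemma iv_eq: "a \<in> C \<Longrightarrow> iv a = neg (lam (iv a) a)"
proof -
  assume a: "a \<in> C"
  then have "add (iv a) (lam (iv a) a) = z" using mul_lam[of "iv a" a] by simp
  then show ?thesis using a A.grp.inv_equality[of "iv a" "lam (iv a) a"] by simp
qed

lemma zm_closed [simp, intro]: "x \<in> C \<Longrightarrow> zm n x \<in> C"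
  using A.grp.int_pow_closed by simp

lemma lam_zm: assumes "a \<in> C" "x \<in> C" shows "lam a (zm n x) = zm n (lam a x)"
proof (induction n rule: int_induct[of _ 0])
  case (step1 i)
  then show ?case using assms A.grp.int_pow_mult[of x i 1] A.grp.int_pow_mult[of "lam a x" i 1] by (simp add: lam_add)
next
  case (step2 i)
  then show ?case using assms A.grp.int_pow_mult[of x i "-1"] A.grp.int_pow_mult[of "lam a x" i "-1"]
    by (simp add: lam_add lam_neg A.grp.int_pow_neg)
qed (use assms in simp)

text \<open>The left action of the opposite brace.\<close>
definition tht :: "'a \<Rightarrow> 'a \<Rightarrow> 'a" where "tht a b = add (mul a b) (neg a)"

lemma tht_closed [simp, intro]: "a \<in> C \<Longrightarrow> b \<in> C \<Longrightarrow> tht a b \<in> C"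
  by (simp add: tht_def)

lemma tht_lam: "a \<in> C \<Longrightarrow> b \<in> C \<Longrightarrow> tht a b = add (add a (lam a b)) (neg a)"
  by (simp add: tht_def mul_lam)

lemma tht_add: "a \<in> C \<Longrightarrow> b \<in> C \<Longrightarrow> c \<in> C \<Longrightarrow> tht a (add b c) = add (tht a b) (tht a c)"
  by (simp add: tht_def brace_law A.grp.m_assoc)

lemma tht_z [simp]: "a \<in> C \<Longrightarrow> tht z a = a"
  by (simp add: tht_def A.grp.inv_one[simplified])

lemma tht_mul:
  assumes abc: "a \<in> C" "b \<in> C" "c \<in> C"
  shows "tht (mul a b) c = tht a (tht b c)"
proof -
  have "add (tht b c) b = mul b c" using abc by (simp add: tht_def)
  then have "mul a (mul b c) = mul a (add (tht b c) b)" by (simp only:)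
  also have "\<dots> = add (tht a (tht b c)) (mul a b)" using abc by (simp add: brace_law tht_def[of a])
  finally have "mul (mul a b) c = add (tht a (tht b c)) (mul a b)" using abc by (simp add: M.grp.m_assoc)
  then show ?thesis using abc by (simp add: tht_def[of "mul a b"])
qed

definition soc :: "'a set" where
  "soc = {x \<in> C. \<forall>b\<in>C. lam x b = b \<and> add x b = add b x}"

text \<open>The socle becomes the common kernel of two actions of the multiplicative group, and
  additive centrality a fixed-point condition that can be followed along powers.\<close>

lemma soc_iff_tht: "x \<in> soc \<longleftrightarrow> x \<in> C \<and> (\<forall>b\<in>C. lam x b = b \<and> tht x b = b)"
proof -
  have "tht x b = b \<longleftrightarrow> add x b = add b x" if "x \<in> C" "b \<in> C" "lam x b = b" for b
  proof -
    have "tht x b = b \<longleftrightarrow> add (add x b) (neg x) = b" using that by (simp add: tht_lam)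
    also have "\<dots> \<longleftrightarrow> add x b = add b x" using that A.grp.inv_solve_right'[of b "add x b" x] by auto
    finally show ?thesis .
  qed
  then show ?thesis unfolding soc_def by blast
qed

definition asub :: "'a set \<Rightarrow> bool" where
  "asub K \<longleftrightarrow> K \<subseteq> C \<and> z \<in> K \<and> (\<forall>x\<in>K. \<forall>y\<in>K. add x y \<in> K) \<and> (\<forall>x\<in>K. neg x \<in> K)"

lemma asubD:
  assumes "asub K"
  shows "K \<subseteq> C" "z \<in> K" "\<And>x. x \<in> K \<Longrightarrow> x \<in> C" "\<And>x y. x \<in> K \<Longrightarrow> y \<in> K \<Longrightarrow> add x y \<in> K"
    "\<And>x. x \<in> K \<Longrightarrow> neg x \<in> K"
  using assms unfolding asub_def by blast+

lemma asub_zm: assumes "asub K" "x \<in> K" shows "zm n x \<in> K"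
proof (induction n rule: int_induct[of _ 0])
  case base
  then show ?case using asubD(2)[OF assms(1)] by simp
next
  case (step1 i)
  then show ?case using assms A.grp.int_pow_mult[of x i 1] asubD[OF assms(1)] by simp
next
  case (step2 i)
  then show ?case using assms A.grp.int_pow_mult[of x i "-1"] asubD[OF assms(1)] by (simp add: A.grp.int_pow_neg)
qed

text \<open>By a b = a + \<open>lam a b\<close> and \<open>iv a = neg (lam (iv a) a)\<close>, an
  additive subgroup stable under \<open>lam\<close> is closed under products and inverses as
  well.\<close>

lemma ideal_iff:
  "is_ideal C add mul I \<longleftrightarrow> asub I \<and> (\<forall>a\<in>C. \<forall>x\<in>I. add (add a x) (neg a) \<in> I) \<and>
    (\<forall>a\<in>C. \<forall>x\<in>I. mul (mul a x) (iv a) \<in> I) \<and> (\<forall>b\<in>C. \<forall>x\<in>I. lam b x \<in> I)"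
proof -
  have "is_group I mul" if I: "asub I" "\<forall>b\<in>C. \<forall>x\<in>I. lam b x \<in> I"
  proof -
    note s = asubD[OF I(1)]
    have "mul x y \<in> I" if "x \<in> I" "y \<in> I" for x y using that s I(2) by (simp add: mul_lam)
    moreover have "iv x \<in> I" if "x \<in> I" for x using that s I(2) by (subst iv_eq) auto
    ultimately show ?thesis using M.is_group_subset_iff[OF s(1)] s(2) by simp
  qed
  then show ?thesis
    unfolding is_ideal_def is_subbrace_def asub_def using A.is_group_subset_iff by (auto simp: asub_def)
qed

lemma idealD:
  assumes "is_ideal C add mul I"
  shows "asub I" "I \<subseteq> C" "z \<in> I" "\<And>x. x \<in> I \<Longrightarrow> x \<in> C"
    "\<And>x y. x \<in> I \<Longrightarrow> y \<in> I \<Longrightarrow> add x y \<in> I" "\<And>x. x \<in> I \<Longrightarrow> neg x \<in> I"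
    "\<And>a x. a \<in> C \<Longrightarrow> x \<in> I \<Longrightarrow> add (add a x) (neg a) \<in> I"
    "\<And>a x. a \<in> C \<Longrightarrow> x \<in> I \<Longrightarrow> mul (mul a x) (iv a) \<in> I"
    "\<And>b x. b \<in> C \<Longrightarrow> x \<in> I \<Longrightarrow> lam b x \<in> I"
  using assms unfolding ideal_iff asub_def by blast+

lemma ideal_conj_neg:
  assumes "is_ideal C add mul I" "a \<in> C" "x \<in> I"
  shows "add (add (neg a) x) a \<in> I"
  using idealD(7)[OF assms(1), of "neg a" x] assms(2,3) by simp

lemma ideal_conj_iv:
  assumes "is_ideal C add mul I" "a \<in> C" "x \<in> I"
  shows "mul (mul (iv a) x) a \<in> I"
  using idealD(8)[OF assms(1), of "iv a" x] assms(2,3) by simp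

lemma ideal_zero: "is_ideal C add mul {z}"
  unfolding ideal_iff asub_def using A.grp.inv_one by auto

lemma ideal_Int:
  assumes "is_ideal C add mul I" "is_ideal C add mul J"
  shows "is_ideal C add mul (I \<inter> J)"
  using assms unfolding ideal_iff asub_def by auto

lemma coset_refl: "asub I \<Longrightarrow> x \<in> C \<Longrightarrow> add (neg x) x \<in> I"
  using asubD(2) by simp

lemma coset_sym:
  assumes "asub I" "x \<in> C" "y \<in> C" "add (neg x) y \<in> I" shows "add (neg y) x \<in> I"
  using asubD(5)[OF assms(1,4)] assms(2,3) by (simp add: A.grp.inv_mult_group)

lemma coset_trans:
  assumes "asub I" "x \<in> C" "y \<in> C" "w \<in> C" "add (neg x) y \<in> I" "add (neg y) w \<in> I"
  shows "add (neg x) w \<in> I"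
  using asubD(4)[OF assms(1,5,6)] assms(2-4) by (simp add: A.grp.m_assoc)

lemma coset_add:
  assumes I: "is_ideal C add mul I" and C: "x \<in> C" "x' \<in> C" "y \<in> C" "y' \<in> C"
    and "add (neg x) x' \<in> I" "add (neg y) y' \<in> I"
  shows "add (neg (add x y)) (add x' y') \<in> I"
proof -
  have "add (neg (add x y)) (add x' y') = add (add (add (neg y) (add (neg x) x')) y) (add (neg y) y')"
    using C by (simp add: A.grp.inv_mult_group A.grp.m_assoc)
  then show ?thesis using idealD(5)[OF I ideal_conj_neg[OF I C(3) assms(6)] assms(7)] by simp
qed

text \<open>\<open>lam (iv x)\<close> carries -x + y to x^-1 y, and \<open>lam x\<close> carries it
  back. So both groups have the same cosets, which makes the product of cosets well defined.\<close>

lemma coset_mul_iff: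
  assumes I: "is_ideal C add mul I" and C: "x \<in> C" "y \<in> C"
  shows "add (neg x) y \<in> I \<longleftrightarrow> mul (iv x) y \<in> I"
proof
  assume "add (neg x) y \<in> I"
  moreover have "mul (iv x) y = lam (iv x) (add (neg x) y)"
  proof -
    have "lam (iv x) (add (neg x) y) = add (iv x) (lam (iv x) y)"
      using C iv_eq[OF C(1)] by (simp add: lam_add lam_neg)
    then show ?thesis using C by (simp add: mul_lam)
  qed
  ultimately show "mul (iv x) y \<in> I" using idealD(9)[OF I, of "iv x"] C by simp
next
  assume "mul (iv x) y \<in> I"
  moreover have "add (neg x) y = lam x (mul (iv x) y)" using C by (simp add: blam_def)
  ultimately show "add (neg x) y \<in> I" using idealD(9)[OF I C(1)] by simp
qed

lemma coset_mul:
  assumes I: "is_ideal C add mul I" and C: "x \<in> C" "x' \<in> C" "y \<in> C" "y' \<in> C"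
    and "add (neg x) x' \<in> I" "add (neg y) y' \<in> I"
  shows "add (neg (mul x y)) (mul x' y') \<in> I"
proof -
  have 1: "mul (iv x) x' \<in> I" "mul (iv y) y' \<in> I"
    using assms coset_mul_iff[OF I] by blast+
  have "mul (iv (mul x y)) (mul x' y') = mul (mul (mul (iv y) (mul (iv x) x')) y) (mul (iv y) y')"
    using C by (simp add: M.grp.inv_mult_group M.grp.m_assoc)
  moreover have "mul a b \<in> I" if "a \<in> I" "b \<in> I" for a b
    using that idealD[OF I] by (simp add: mul_lam)
  ultimately have "mul (iv (mul x y)) (mul x' y') \<in> I" using ideal_conj_iv[OF I C(3) 1(1)] 1(2) by simp
  then show ?thesis using coset_mul_iff[OF I] C by simp
qed

end

section \<open>Surjective homomorphisms and quotients\<close>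

locale bhom = B: brace C add mul + B': brace C' add' mul'
  for C :: "'a set" and add mul and C' :: "'b set" and add' mul' +
  fixes h :: "'a \<Rightarrow> 'b"
  assumes h_onto: "h ` C = C'"
    and h_add: "x \<in> C \<Longrightarrow> y \<in> C \<Longrightarrow> h (add x y) = add' (h x) (h y)"
    and h_mul: "x \<in> C \<Longrightarrow> y \<in> C \<Longrightarrow> h (mul x y) = mul' (h x) (h y)"
begin

lemma h_in [simp, intro]: "x \<in> C \<Longrightarrow> h x \<in> C'"
  using h_onto by blast

lemma h_z [simp]: "h B.z = B'.z"
proof -
  have "add' (h B.z) (h B.z) = h B.z" using h_add[of B.z B.z] by simp
  then show ?thesis using B'.A.grp.r_cancel_one'[of "h B.z" "h B.z"] by simp
qed

lemma h_neg: "x \<in> C \<Longrightarrow> h (B.neg x) = B'.neg (h x)"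
proof -
  assume x: "x \<in> C"
  then have "add' (h (B.neg x)) (h x) = B'.z" by (simp flip: h_add)
  then show ?thesis using B'.A.grp.inv_equality[of "h (B.neg x)" "h x"] x by simp
qed

lemma h_iv: "x \<in> C \<Longrightarrow> h (B.iv x) = B'.iv (h x)"
proof -
  assume x: "x \<in> C"
  then have "mul' (h (B.iv x)) (h x) = B'.z" by (simp flip: h_mul)
  then show ?thesis using B'.M.grp.inv_equality[of "h (B.iv x)" "h x"] x by simp
qed

lemma h_lam: "x \<in> C \<Longrightarrow> y \<in> C \<Longrightarrow> h (B.lam x y) = B'.lam (h x) (h y)"
  by (simp add: blam_def h_add h_mul h_neg)

lemma h_zm: assumes "x \<in> C" shows "h (B.zm n x) = B'.zm n (h x)"
proof (induction n rule: int_induct[of _ 0])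
  case (step1 i)
  then show ?case using assms B.A.grp.int_pow_mult[of x i 1] B'.A.grp.int_pow_mult[of "h x" i 1] by (simp add: h_add)
next
  case (step2 i)
  then show ?case using assms B.A.grp.int_pow_mult[of x i "-1"] B'.A.grp.int_pow_mult[of "h x" i "-1"]
    by (simp add: h_add h_neg B.A.grp.int_pow_neg B'.A.grp.int_pow_neg)
qed simp

lemma h_eq_iff:
  assumes "x \<in> C" "y \<in> C"
  shows "h x = h y \<longleftrightarrow> h (add (B.neg x) y) = B'.z"
proof -
  have 1: "h (add (B.neg x) y) = add' (B'.neg (h x)) (h y)" using assms by (simp add: h_add h_neg)
  have 2: "add' (B'.neg (h x)) (h y) = B'.z \<longleftrightarrow> h x = h y"
    using assms B'.A.grp.inv_equality[of "B'.neg (h x)" "h y"] by (metis B'.A.grp.inv_inv B'.A.grp.l_inv B'.aclosed(2) h_in)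
  show ?thesis unfolding 1 2 ..
qed

lemma image_ideal:
  assumes "is_ideal C add mul J"
  shows "is_ideal C' add' mul' (h ` J)"
proof -
  note J = B.idealD[OF assms]
  have C': "\<exists>a\<in>C. b = h a" if "b \<in> C'" for b using that h_onto by blast
  show ?thesis
    unfolding B'.ideal_iff B'.asub_def
  proof (intro conjI ballI)
    show "h ` J \<subseteq> C'" using J(2) by auto
    show "B'.z \<in> h ` J" using J(3) h_z by (metis imageI)
  next
    fix x y assume "x \<in> h ` J" "y \<in> h ` J"
    then show "add' x y \<in> h ` J" using J(4,5) by (auto simp flip: h_add)
  next
    fix x assume "x \<in> h ` J"
    then show "B'.neg x \<in> h ` J" using J(4,6) by (auto simp flip: h_neg)
  next
    fix a x assume a: "a \<in> C'" and "x \<in> h ` J"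
    then obtain u v where uv: "a = h u" "u \<in> C" "x = h v" "v \<in> J" using C' by blast
    then have vC: "v \<in> C" using J(4) by blast
    have "add' (add' a x) (B'.neg a) = h (add (add u v) (B.neg u))" using uv vC by (simp add: h_add h_neg)
    then show "add' (add' a x) (B'.neg a) \<in> h ` J" using J(7)[OF uv(2,4)] by blast
    have "mul' (mul' a x) (B'.iv a) = h (mul (mul u v) (B.iv u))" using uv vC by (simp add: h_mul h_iv)
    then show "mul' (mul' a x) (B'.iv a) \<in> h ` J" using J(8)[OF uv(2,4)] by blast
    have "B'.lam a x = h (B.lam u v)" using uv vC by (simp add: h_lam)
    then show "B'.lam a x \<in> h ` J" using J(9)[OF uv(2,4)] by blast
  qed
qed

lemma preimage_ideal:
  assumes "is_ideal C' add' mul' K"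
  shows "is_ideal C add mul {x \<in> C. h x \<in> K}"
  unfolding B.ideal_iff B.asub_def
  using B'.idealD[OF assms] by (auto simp: h_add h_neg h_mul h_iv h_lam)

lemma kernel_ideal: "is_ideal C add mul {x \<in> C. h x = B'.z}"
  using preimage_ideal[OF B'.ideal_zero] by simp

end

text \<open>Equations transfer along a surjection, so a quotient or a numbered table is recognised
  as a brace from two compatibility equations alone.\<close>

lemma is_brace_image:
  assumes "brace C add mul" "h ` C = C'"
    and ha: "\<And>x y. x \<in> C \<Longrightarrow> y \<in> C \<Longrightarrow> h (add x y) = add' (h x) (h y)"
    and hm: "\<And>x y. x \<in> C \<Longrightarrow> y \<in> C \<Longrightarrow> h (mul x y) = mul' (h x) (h y)"
  shows "bhom C add mul C' add' mul' h"
proof -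
  interpret B: brace C add mul by fact
  have grp: "is_group C' f'"
    if "cgroup C f" and hf: "\<And>x y. x \<in> C \<Longrightarrow> y \<in> C \<Longrightarrow> h (f x y) = f' (h x) (h y)" for f f'
  proof -
    interpret F: cgroup C f by fact
    show ?thesis
      unfolding is_group_def
    proof (intro conjI bexI[of _ "h (gid C f)"])
      show "\<forall>a\<in>C'. \<forall>b\<in>C'. f' a b \<in> C'"
        unfolding assms(2)[symmetric] by (auto simp flip: hf)
      show "\<forall>a\<in>C'. \<forall>b\<in>C'. \<forall>c\<in>C'. f' (f' a b) c = f' a (f' b c)"
        unfolding assms(2)[symmetric] by (auto simp flip: hf simp: F.grp.m_assoc)
      show "\<forall>a\<in>C'. f' (h (gid C f)) a = a \<and> f' a (h (gid C f)) = a"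
        unfolding assms(2)[symmetric] by (auto simp flip: hf)
      show "\<forall>a\<in>C'. \<exists>b\<in>C'. f' a b = h (gid C f) \<and> f' b a = h (gid C f)"
      proof
        fix a assume "a \<in> C'"
        then obtain x where x: "x \<in> C" "a = h x" using assms(2) by blast
        then show "\<exists>b\<in>C'. f' a b = h (gid C f) \<and> f' b a = h (gid C f)"
          using assms(2) by (intro bexI[of _ "h (ginv C f x)"]) (auto simp flip: hf)
      qed
      show "h (gid C f) \<in> C'" using assms(2) by auto
    qed
  qed
  have ga: "is_group C' add'" and gm: "is_group C' mul'"
    using grp[OF B.A.cgroup_axioms ha] grp[OF B.M.cgroup_axioms hm] by auto
  interpret A': cgroup C' add' using ga by unfold_locales
  have hz: "h B.z = gid C' add'"
    by (rule A'.gid_eqI[symmetric]) (use assms(2) in \<open>auto simp flip: ha\<close>)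
  have hn: "h (B.neg x) = ginv C' add' (h x)" if "x \<in> C" for x
  proof -
    have "add' (h (B.neg x)) (h x) = gid C' add'" using that by (simp flip: ha add: hz)
    then show ?thesis using A'.grp.inv_equality[of "h (B.neg x)" "h x"] that assms(2) by auto
  qed
  have "is_brace C' add' mul'"
    unfolding is_brace_def assms(2)[symmetric]
    using ga gm B.brace_law unfolding assms(2)[symmetric]
    by (auto simp flip: ha hm) (simp add: hn[unfolded assms(2)[symmetric], symmetric] flip: ha hm)
  then interpret B': brace C' add' mul' by unfold_locales
  show ?thesis by unfold_locales (use assms in auto)
qed

text \<open>Quotients are realised on a set of coset representatives, so that they have the same type.\<close>
lemma (in brace) quotient_exists:
  assumes I: "is_ideal C add mul I"
  shows "\<exists>(C' :: 'a set) add' mul' h. bhom C add mul C' add' mul' h \<and>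
    (\<forall>x\<in>C. h x = gid C' add' \<longleftrightarrow> x \<in> I)"
proof -
  have s: "asub I" by (rule idealD(1)[OF I])
  define rep where "rep x = (SOME y. y \<in> C \<and> add (neg x) y \<in> I)" for x
  have rep: "rep x \<in> C \<and> add (neg x) (rep x) \<in> I" if "x \<in> C" for x
    unfolding rep_def by (rule someI[of _ x]) (use that coset_refl[OF s] in blast)
  have rep_eq: "rep x = rep y" if "x \<in> C" "y \<in> C" "add (neg x) y \<in> I" for x y
  proof -
    have "(y' \<in> C \<and> add (neg x) y' \<in> I) = (y' \<in> C \<and> add (neg y) y' \<in> I)" for y'
      using that coset_trans[OF s] coset_sym[OF s] by blast
    then show ?thesis unfolding rep_def by simp
  qed
  define add' where "add' x y = rep (add x y)" for x y
  define mul' where "mul' x y = rep (mul x y)" for x y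
  have "bhom C add mul (rep ` C) add' mul' rep"
  proof (rule is_brace_image[OF brace_axioms HOL.refl])
    fix x y assume xy: "x \<in> C" "y \<in> C"
    show "rep (add x y) = add' (rep x) (rep y)"
      unfolding add'_def using xy rep coset_add[OF I] by (intro rep_eq) auto
    show "rep (mul x y) = mul' (rep x) (rep y)"
      unfolding mul'_def using xy rep coset_mul[OF I] by (intro rep_eq) auto
  qed
  then interpret H: bhom C add mul "rep ` C" add' mul' rep .
  have "rep x = H.B'.z \<longleftrightarrow> x \<in> I" if x: "x \<in> C" for x
  proof
    assume "rep x = H.B'.z"
    then have e: "rep x = rep z" by simp
    have "add (neg (rep z)) z \<in> I"
      by (rule coset_sym[OF s A.grp.one_closed rep[THEN conjunct1] rep[THEN conjunct2]]) (rule A.grp.one_closed)+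
    then have "add (neg (rep x)) z \<in> I" by (simp only: e)
    then have "add (neg x) z \<in> I"
      by (rule coset_trans[OF s x rep[OF x, THEN conjunct1] A.grp.one_closed rep[OF x, THEN conjunct2]])
    then have "neg x \<in> I" using x by simp
    then have "neg (neg x) \<in> I" using idealD(6)[OF I] by blast
    then show "x \<in> I" using x by simp
  next
    assume "x \<in> I"
    then have "rep z = rep x" using x rep_eq[of z x] A.grp.inv_one by simp
    then show "rep x = H.B'.z" by simp
  qed
  then show ?thesis using H.bhom_axioms by blast
qed

lemma (in brace) quotientE:
  assumes "is_ideal C add mul I"
  obtains C' :: "'a set" and add' mul' h where "bhom C add mul C' add' mul' h"
    "\<And>x. x \<in> C \<Longrightarrow> h x = gid C' add' \<longleftrightarrow> x \<in> I"
  using quotient_exists[OF assms] by blast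

text \<open>Finiteness of J/I by representatives; this form moves along homomorphisms without
  speaking of sets of cosets.\<close>

definition fin_mod :: "'a set \<Rightarrow> ('a \<Rightarrow> 'a \<Rightarrow> 'a) \<Rightarrow> 'a set \<Rightarrow> 'a set \<Rightarrow> bool" where
  "fin_mod C add I J \<longleftrightarrow> (\<exists>F. finite F \<and> F \<subseteq> J \<and> (\<forall>x\<in>J. \<exists>f\<in>F. add (ginv C add f) x \<in> I))"

context brace
begin

lemma coset_eq_iff:
  assumes I: "asub I" and x: "x \<in> C" and y: "y \<in> C"
  shows "add x ` I = add y ` I \<longleftrightarrow> add (neg y) x \<in> I"
proof
  assume e: "add x ` I = add y ` I"
  have "add x z \<in> add x ` I" using asubD(2)[OF I] by (rule imageI)
  then have "x \<in> add y ` I" using e x by simp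
  then obtain i where i: "i \<in> I" "x = add y i" by blast
  then show "add (neg y) x \<in> I" using y asubD(3)[OF I] by simp
next
  have sub: "add u ` I \<subseteq> add w ` I" if uw: "u \<in> C" "w \<in> C" "add (neg w) u \<in> I" for u w
  proof
    fix v assume "v \<in> add u ` I"
    then obtain i where i: "i \<in> I" "v = add u i" by blast
    have "add w (add (add (neg w) u) i) = add u i"
      using uw asubD(3)[OF I i(1)] by (simp add: A.grp.m_assoc)
    then show "v \<in> add w ` I" using asubD(4)[OF I uw(3) i(1)] i(2) by (metis imageI)
  qed
  assume "add (neg y) x \<in> I"
  then show "add x ` I = add y ` I" using sub[OF x y] sub[OF y x] coset_sym[OF I y x] by blast
qed

lemma finite_cosets_iff:
  assumes I: "asub I" and J: "J \<subseteq> C"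
  shows "finite (cosets add J I) \<longleftrightarrow> fin_mod C add I J"
proof
  assume fin: "finite (cosets add J I)"
  then obtain F where F: "F \<subseteq> J" "finite F" "cosets add J I = (\<lambda>x. add x ` I) ` F"
    using finite_subset_image[of "cosets add J I" "\<lambda>x. add x ` I" J] unfolding cosets_def by blast
  have "\<exists>f\<in>F. add (neg f) x \<in> I" if x: "x \<in> J" for x
  proof -
    have "add x ` I \<in> (\<lambda>x. add x ` I) ` F" unfolding F(3)[symmetric] cosets_def using x by blast
    then obtain f where f: "f \<in> F" "add x ` I = add f ` I" by blast
    then show ?thesis using coset_eq_iff[OF I, of x f] x F(1) J by blast
  qed
  then show "fin_mod C add I J" unfolding fin_mod_def using F by blast
next
  assume "fin_mod C add I J"
  then obtain F where F: "finite F" "F \<subseteq> J" "\<forall>x\<in>J. \<exists>f\<in>F. add (neg f) x \<in> I" unfolding fin_mod_def by blast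
  have "cosets add J I \<subseteq> (\<lambda>x. add x ` I) ` F"
  proof
    fix K assume "K \<in> cosets add J I"
    then obtain x where x: "x \<in> J" "K = add x ` I" unfolding cosets_def by blast
    obtain f where f: "f \<in> F" "add (neg f) x \<in> I" using F(3) x(1) by blast
    then have "add x ` I = add f ` I" using coset_eq_iff[OF I, of x f] x(1) F(2) J by blast
    then show "K \<in> (\<lambda>x. add x ` I) ` F" using f(1) x(2) by blast
  qed
  then show "finite (cosets add J I)" using F(1) finite_surj by blast
qed

lemma fin_mod_subset:
  assumes I: "asub I" and "J' \<subseteq> J" "J \<subseteq> C" "fin_mod C add I J"
  shows "fin_mod C add I J'"
proof -
  have "cosets add J' I \<subseteq> cosets add J I" unfolding cosets_def using assms(2) by blast
  then show ?thesis
    using finite_cosets_iff[OF I] assms finite_subset by (metis order_trans)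
qed

lemma fin_mod_mono:
  assumes "fin_mod C add I J" "I \<subseteq> I'"
  shows "fin_mod C add I' J"
proof -
  obtain F where F: "finite F" "F \<subseteq> J" "\<forall>x\<in>J. \<exists>f\<in>F. add (neg f) x \<in> I" using assms(1) unfolding fin_mod_def by blast
  have "\<exists>f\<in>F. add (neg f) x \<in> I'" if x: "x \<in> J" for x
  proof -
    obtain f where "f \<in> F" "add (neg f) x \<in> I" using F(3) x by blast
    with assms(2) show ?thesis by (intro bexI[of _ f]) (rule subsetD)
  qed
  with F(1,2) show ?thesis unfolding fin_mod_def by blast
qed

lemma fin_mod_trans:
  assumes "asub J" "K \<subseteq> J" "K \<subseteq> C" "fin_mod C add I K" "fin_mod C add K J"
  shows "fin_mod C add I J"
proof -
  obtain F where F: "finite F" "F \<subseteq> K" "\<forall>x\<in>K. \<exists>f\<in>F. add (neg f) x \<in> I" using assms(4) unfolding fin_mod_def by blast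
  obtain F' where F': "finite F'" "F' \<subseteq> J" "\<forall>x\<in>J. \<exists>f\<in>F'. add (neg f) x \<in> K" using assms(5) unfolding fin_mod_def by blast
  note J = asubD[OF assms(1)]
  define E where "E = (\<lambda>(f', f). add f' f) ` (F' \<times> F)"
  have "\<exists>f\<in>E. add (neg f) x \<in> I" if x: "x \<in> J" for x
  proof -
    obtain f' where f': "f' \<in> F'" "add (neg f') x \<in> K" using F'(3) x by blast
    obtain f where f: "f \<in> F" "add (neg f) (add (neg f') x) \<in> I" using F(3) f'(2) by blast
    have C: "f \<in> C" "f' \<in> C" "x \<in> C" using f f' x F(2) F'(2) J(1) assms(3) by blast+
    have "add (neg (add f' f)) x = add (neg f) (add (neg f') x)"
      using C by (simp add: A.grp.inv_mult_group A.grp.m_assoc)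
    then have "add (neg (add f' f)) x \<in> I" using f(2) by simp
    moreover have "add f' f \<in> E" using f(1) f'(1) unfolding E_def by force
    ultimately show ?thesis by blast
  qed
  moreover have "add f' f \<in> J" if "f' \<in> F'" "f \<in> F" for f f'
    by (rule J(4)[OF subsetD[OF F'(2) that(1)] subsetD[OF assms(2) subsetD[OF F(2) that(2)]]])
  then have "E \<subseteq> J" unfolding E_def by auto
  moreover have "finite E" unfolding E_def using F(1) F'(1) by simp
  ultimately show ?thesis unfolding fin_mod_def by blast
qed

section \<open>The socle and finitely generated abelian subgroups\<close>

lemma socD:
  assumes "x \<in> soc"
  shows "x \<in> C" "\<And>b. b \<in> C \<Longrightarrow> lam x b = b" "\<And>b. b \<in> C \<Longrightarrow> add x b = add b x"
  using assms unfolding soc_def by auto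

text \<open>This is why a \<lambda>-stable additive subgroup of the socle is an ideal: the two
  conjugation conditions reduce to additive centrality and to \<lambda>-stability.\<close>

lemma soc_lam_eq_conj:
  assumes "x \<in> soc" "b \<in> C"
  shows "lam b x = mul (mul b x) (iv b)"
proof -
  have x: "x \<in> C" "lam x (iv b) = iv b" "add x (iv b) = add (iv b) x" using assms unfolding soc_def by auto
  have "mul (mul b x) (iv b) = mul b (mul x (iv b))" using x assms by (simp add: M.grp.m_assoc)
  also have "mul x (iv b) = add (iv b) x" using x assms by (simp add: mul_lam)
  also have "mul b (add (iv b) x) = add (neg b) (mul b x)" using x(1) assms(2) by (simp add: brace_law)
  finally show ?thesis by (simp add: blam_def)
qed

lemma soc_sub_ideal:
  assumes K: "asub K" "K \<subseteq> soc" "\<And>b x. b \<in> C \<Longrightarrow> x \<in> K \<Longrightarrow> lam b x \<in> K"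
  shows "is_ideal C add mul K"
  unfolding ideal_iff
proof (intro conjI ballI)
  fix a x assume ax: "a \<in> C" "x \<in> K"
  then have x: "x \<in> soc" "x \<in> C" using K(2) socD(1) by blast+
  then have "add a x = add x a" using socD(3)[OF x(1) ax(1)] by simp
  then show "add (add a x) (neg a) \<in> K" using ax x by simp
  show "mul (mul a x) (iv a) \<in> K" using soc_lam_eq_conj[OF x(1) ax(1)] K(3)[OF ax] by simp
  show "lam a x \<in> K" using K(3)[OF ax] .
qed (rule K(1))

lemma soc_mul: "x \<in> soc \<Longrightarrow> b \<in> C \<Longrightarrow> mul x b = add x b"
  unfolding soc_def by (simp add: mul_lam)

lemma asub_soc: "asub soc"
  unfolding asub_def
proof (intro conjI ballI)
  show "soc \<subseteq> C" unfolding soc_def by blast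
  show "z \<in> soc" unfolding soc_def by simp
next
  fix x y assume xy: "x \<in> soc" "y \<in> soc"
  then have C: "x \<in> C" "y \<in> C" unfolding soc_def by blast+
  have m: "add x y = mul x y" using soc_mul[OF xy(1) C(2)] by simp
  have "lam (add x y) b = b" if "b \<in> C" for b
    unfolding m lam_mul[OF C that] socD(2)[OF xy(2) that] by (rule socD(2)[OF xy(1) that])
  moreover have "add (add x y) b = add b (add x y)" if "b \<in> C" for b
  proof -
    have "add (add x y) b = add x (add y b)" by (rule A.grp.m_assoc[OF C that])
    also have "\<dots> = add x (add b y)" unfolding socD(3)[OF xy(2) that] ..
    also have "\<dots> = add (add x b) y" by (rule A.grp.m_assoc[OF C(1) that C(2), symmetric])
    also have "\<dots> = add (add b x) y" unfolding socD(3)[OF xy(1) that] ..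
    also have "\<dots> = add b (add x y)" by (rule A.grp.m_assoc[OF that C])
    finally show ?thesis .
  qed
  ultimately show "add x y \<in> soc" using C unfolding soc_def by simp
next
  fix x assume x: "x \<in> soc"
  then have C: "x \<in> C" unfolding soc_def by blast
  have "mul x (neg x) = z" using soc_mul[OF x, of "neg x"] C by simp
  then have i: "neg x = iv x" using C M.grp.inv_equality[of "iv x" x]
    by (metis M.grp.inv_comm M.grp.inv_equality aclosed(2) gid_mul)
  have "lam (neg x) b = b" if b: "b \<in> C" for b
  proof -
    have "lam (iv x) (lam x b) = b" using C b by simp
    then show ?thesis unfolding i socD(2)[OF x b] .
  qed
  moreover have "add (neg x) b = add b (neg x)" if b: "b \<in> C" for b
  proof -
    have "add (neg x) (add (add x b) (neg x)) = add (neg x) (add (add b x) (neg x))"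
      unfolding socD(3)[OF x b] ..
    then show ?thesis using C b by (simp add: A.grp.m_assoc)
  qed
  ultimately show "neg x \<in> soc" using C unfolding soc_def by simp
qed

lemma soc_lam_closed:
  assumes x: "x \<in> soc" and b: "b \<in> C"
  shows "lam b x \<in> soc"
proof -
  have C: "x \<in> C" using x unfolding soc_def by blast
  have "lam (lam b x) c = c" if c: "c \<in> C" for c
  proof -
    have "lam (lam b x) c = lam b (lam x (lam (iv b) c))"
      unfolding soc_lam_eq_conj[OF x b] using C b c by (simp add: lam_mul)
    also have "lam x (lam (iv b) c) = lam (iv b) c" by (rule socD(2)[OF x]) (use b c in simp)
    finally show ?thesis using b c by simp
  qed
  moreover have "add (lam b x) c = add c (lam b x)" if c: "c \<in> C" for c
  proof -
    have "add x (lam (iv b) c) = add (lam (iv b) c) x" by (rule socD(3)[OF x]) (use b c in simp)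
    then have "lam b (add x (lam (iv b) c)) = lam b (add (lam (iv b) c) x)" by simp
    then show ?thesis using C b c by (simp add: lam_add)
  qed
  ultimately show ?thesis using C b unfolding soc_def by simp
qed

lemma soc_ideal: "is_ideal C add mul soc"
  by (intro soc_sub_ideal asub_soc soc_lam_closed) auto

lemma soc_pow: "x \<in> soc \<Longrightarrow> x [^]\<^bsub>M.G\<^esub> (n::nat) = zm (int n) x"
proof (induction n)
  case (Suc n)
  have C: "x \<in> C" using Suc.prems unfolding soc_def by blast
  have "x [^]\<^bsub>M.G\<^esub> Suc n = mul x (x [^]\<^bsub>M.G\<^esub> n)"
    using M.grp.nat_pow_Suc2[OF C] by simp
  also have "\<dots> = add x (zm (int n) x)" using Suc C soc_mul[OF Suc.prems] by simp
  also have "\<dots> = zm (int (Suc n)) x" using C A.grp.int_pow_mult[of x 1 "int n"] by simp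
  finally show ?case .
qed simp

lemma zm_add_commute:
  assumes "x \<in> C" "y \<in> C" "add x y = add y x"
  shows "zm n (add x y) = add (zm n x) (zm n y)"
  using A.grp.int_pow_mult_distrib[of x y n] assms by simp

lemma zm_zm: "x \<in> C \<Longrightarrow> zm n (zm k x) = zm (k * n) x"
  using A.grp.int_pow_pow[of x k n] by simp

lemma zm_add: "x \<in> C \<Longrightarrow> zm (n + k) x = add (zm n x) (zm k x)"
  using A.grp.int_pow_mult[of x n k] by simp

lemma zm_1 [simp]: "x \<in> C \<Longrightarrow> zm 1 x = x"
  by simp

lemma zm_0 [simp]: "zm 0 x = z"
  by simp

lemma zm_minus: "x \<in> C \<Longrightarrow> zm (- n) x = neg (zm n x)"
  using A.grp.int_pow_neg[of x n] by simp

abbreviation gen where "gen \<equiv> gen_subgroup C add"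

lemma asub_gen: assumes "F \<subseteq> C" shows "asub (gen F)"
proof -
  have "gen F \<subseteq> C"
  proof
    fix x assume "x \<in> gen F"
    then show "x \<in> C" by induction (use assms in auto)
  qed
  then show ?thesis unfolding asub_def by (auto intro: gen_subgroup.intros)
qed

lemma gen_subset:
  assumes "asub K" "F \<subseteq> K" shows "gen F \<subseteq> K"
proof
  fix x assume "x \<in> gen F"
  then show "x \<in> K" by induction (use assms asubD[OF assms(1)] in auto)
qed

lemma gen_mono: "F \<subseteq> F' \<Longrightarrow> gen F \<subseteq> gen F'"
proof
  fix x assume "F \<subseteq> F'" "x \<in> gen F"
  from this(2,1) show "x \<in> gen F'" by induction (auto intro: gen_subgroup.intros)
qed

lemma gen_insert:
  assumes J: "asub J" "\<And>x y. x \<in> J \<Longrightarrow> y \<in> J \<Longrightarrow> add x y = add y x" and F: "F \<subseteq> J" "a \<in> J"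
  shows "gen (insert a F) = {add y (zm c a) | y c. y \<in> gen F}"
proof
  note JC = asubD[OF J(1)]
  have gF: "asub (gen F)" using F(1) JC(1) by (intro asub_gen) blast
  note gC = asubD[OF gF]
  have gJ: "gen F \<subseteq> J" by (rule gen_subset[OF J(1) F(1)])
  have aC: "a \<in> C" using F(2) JC(3) by blast
  have zJ: "zm c a \<in> J" for c by (rule asub_zm[OF J(1) F(2)])
  show "gen (insert a F) \<subseteq> {add y (zm c a) | y c. y \<in> gen F}"
  proof
    fix x assume "x \<in> gen (insert a F)"
    then show "x \<in> {add y (zm c a) | y c. y \<in> gen F}"
    proof induction
      case gid_in
      have "z = add z (zm 0 a)" by simp
      then show ?case using gC(2) by blast
    next
      case (gen_in s)
      then consider "s = a" | "s \<in> F" by blast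
      then show ?case
      proof cases
        case 1
        then have "s = add z (zm 1 a)" using aC by simp
        then show ?thesis using gC(2) by blast
      next
        case 2
        then have s: "s \<in> gen F" by (rule gen_subgroup.gen_in)
        then have "s = add s (zm 0 a)" using gC(3) by simp
        then show ?thesis using s by blast
      qed
    next
      case (add_in u v)
      then obtain y c y' c' where *: "u = add y (zm c a)" "v = add y' (zm c' a)" "y \<in> gen F" "y' \<in> gen F" by blast
      then have m: "y \<in> J" "y' \<in> J" "y \<in> C" "y' \<in> C" using gJ gC(3) by blast+
      have "add u v = add y (add (add (zm c a) y') (zm c' a))" using * m aC by (simp add: A.grp.m_assoc)
      also have "add (zm c a) y' = add y' (zm c a)" using J(2)[OF zJ m(2)] .
      also have "add y (add (add y' (zm c a)) (zm c' a)) = add (add y y') (zm (c + c') a)"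
        using m aC by (simp add: zm_add A.grp.m_assoc)
      finally show ?case using gC(4)[OF *(3,4)] by blast
    next
      case (inv_in u)
      then obtain y c where *: "u = add y (zm c a)" "y \<in> gen F" by blast
      then have m: "y \<in> J" "y \<in> C" "neg y \<in> J" using gJ gC(3) JC(5) by blast+
      have "neg u = add (zm (- c) a) (neg y)" using * m aC by (simp add: A.grp.inv_mult_group zm_minus)
      also have "\<dots> = add (neg y) (zm (- c) a)" using J(2)[OF zJ m(3)] .
      finally show ?case using gC(5)[OF *(2)] by blast
    qed
  qed
  have gi: "asub (gen (insert a F))" using F JC(1) by (intro asub_gen) blast
  have "a \<in> gen (insert a F)" by (rule gen_subgroup.gen_in) simp
  then have "zm c a \<in> gen (insert a F)" for c by (rule asub_zm[OF gi])
  moreover have "gen F \<subseteq> gen (insert a F)" by (rule gen_mono) blast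
  ultimately show "{add y (zm c a) | y c. y \<in> gen F} \<subseteq> gen (insert a F)" using asubD(4)[OF gi] by blast
qed

lemma finite_gen_torsion:
  assumes J: "asub J" "\<And>x y. x \<in> J \<Longrightarrow> y \<in> J \<Longrightarrow> add x y = add y x"
    and F: "finite F" "F \<subseteq> J" "\<And>a. a \<in> F \<Longrightarrow> \<exists>n>0. zm n a = z"
  shows "finite (gen F)"
  using F
proof (induction F rule: finite_induct)
  case empty
  have "gen {} \<subseteq> {z}" by (rule gen_subset) (auto simp: asub_def A.grp.inv_one)
  then show ?case using finite_subset by blast
next
  case (insert a F)
  then obtain n where n: "n > 0" "zm n a = z" by blast
  have aC: "a \<in> C" using insert.prems asubD(3)[OF J(1)] by blast
  have "gen (insert a F) \<subseteq> (\<lambda>(y, c). add y (zm c a)) ` (gen F \<times> {0..<n})"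
  proof
    fix x assume "x \<in> gen (insert a F)"
    then obtain y c where yc: "x = add y (zm c a)" "y \<in> gen F"
      using gen_insert[OF J, of F a] insert.prems by blast
    have "zm c a = zm (n * (c div n) + c mod n) a" by simp
    also have "\<dots> = add (zm (c div n) (zm n a)) (zm (c mod n) a)" unfolding zm_add[OF aC] zm_zm[OF aC] ..
    also have "\<dots> = zm (c mod n) a" unfolding n(2) using aC A.grp.int_pow_one by simp
    finally have "x = add y (zm (c mod n) a)" using yc by simp
    then show "x \<in> (\<lambda>(y, c). add y (zm c a)) ` (gen F \<times> {0..<n})" using yc(2) n(1) by (force simp: image_iff)
  qed
  then show ?case using insert by (metis (no_types, lifting) finite_SigmaI finite_atLeastLessThan_int finite_surj insert_subset insertCI)
qed

text \<open>Takes the place of the structure theorem for finitely generated abelian groups: the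
  kernel of \<phi> is annihilated by e. If some positive multiple n a of a new generator lies in the
  old subgroup, \<phi> is replaced by x \<mapsto> \<phi>(n x); otherwise a is free over it and
  receives a coordinate of its own.\<close>

lemma lattice_embedding:
  assumes J: "asub J" "\<And>x y. x \<in> J \<Longrightarrow> y \<in> J \<Longrightarrow> add x y = add y x"
    and F: "finite F" "F \<subseteq> J"
  shows "\<exists>(S :: nat set) (\<phi> :: 'a \<Rightarrow> zvec) e. finite S \<and> e > 0 \<and> (\<forall>x\<in>gen F. \<forall>i. i \<notin> S \<longrightarrow> \<phi> x i = 0) \<and>
    (\<forall>x\<in>gen F. \<forall>y\<in>gen F. \<phi> (add x y) = \<phi> x + \<phi> y) \<and> (\<forall>x\<in>gen F. \<phi> x = 0 \<longrightarrow> zm e x = z)"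
  using F
proof (induction F rule: finite_induct)
  case empty
  have "gen {} \<subseteq> {z}" by (rule gen_subset) (auto simp: asub_def A.grp.inv_one)
  then show ?case
    by (intro exI[of _ "{}"] exI[of _ "\<lambda>_. 0"] exI[of _ 1]) (auto simp: zero_fun_apply)
next
  case (insert a F)
  note JC = asubD[OF J(1)]
  have FJ: "F \<subseteq> J" and aJ: "a \<in> J" using insert.prems by auto
  have aC: "a \<in> C" using aJ JC(3) by blast
  have gF: "asub (gen F)" using FJ JC(1) by (intro asub_gen) blast
  note gC = asubD[OF gF]
  have gJ: "gen F \<subseteq> J" by (rule gen_subset[OF J(1) FJ])
  have zJ: "zm c a \<in> J" for c by (rule asub_zm[OF J(1) aJ])
  note gi = gen_insert[OF J FJ aJ]
  have giJ: "gen (insert a F) \<subseteq> J" using insert.prems by (intro gen_subset[OF J(1)]) blast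
  obtain S \<phi> e where IH0: "finite S \<and> e > 0 \<and> (\<forall>x\<in>gen F. \<forall>i. i \<notin> S \<longrightarrow> \<phi> x i = 0) \<and>
    (\<forall>x\<in>gen F. \<forall>y\<in>gen F. \<phi> (add x y) = \<phi> x + \<phi> y) \<and> (\<forall>x\<in>gen F. \<phi> x = (0 :: zvec) \<longrightarrow> zm e x = z)"
    using insert.IH[OF FJ] by (elim exE)
  note IH = IH0[THEN conjunct1] IH0[THEN conjunct2, THEN conjunct1]
    IH0[THEN conjunct2, THEN conjunct2, THEN conjunct1, rule_format]
    IH0[THEN conjunct2, THEN conjunct2, THEN conjunct2, THEN conjunct1, rule_format]
    IH0[THEN conjunct2, THEN conjunct2, THEN conjunct2, THEN conjunct2, rule_format]
  show ?case
  proof (cases "\<exists>n>0. zm n a \<in> gen F")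
    case True
    then obtain n where n: "n > 0" "zm n a \<in> gen F" by blast
    have nin: "zm n x \<in> gen F" if x: "x \<in> gen (insert a F)" for x
    proof -
      obtain y c where yc: "x = add y (zm c a)" "y \<in> gen F" using x gi by blast
      have yJ: "y \<in> J" "y \<in> C" using yc(2) gJ gC(3) by blast+
      have "zm n x = add (zm n y) (zm n (zm c a))"
        unfolding yc(1) using yJ aC by (intro zm_add_commute J(2) zJ) auto
      also have "zm n (zm c a) = zm c (zm n a)" using aC by (simp add: zm_zm mult.commute)
      finally show ?thesis using gC(4)[OF asub_zm[OF gF yc(2)] asub_zm[OF gF n(2)]] by simp
    qed
    have "\<phi> (zm n (add x y)) = \<phi> (zm n x) + \<phi> (zm n y)"
      if xy: "x \<in> gen (insert a F)" "y \<in> gen (insert a F)" for x y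
    proof -
      have m: "x \<in> J" "y \<in> J" using xy giJ by blast+
      have "zm n (add x y) = add (zm n x) (zm n y)"
        using m JC(3) by (intro zm_add_commute J(2)) auto
      then show ?thesis using IH(4)[OF nin[OF xy(1)] nin[OF xy(2)]] by simp
    qed
    moreover have "zm (n * e) x = z" if x: "x \<in> gen (insert a F)" "\<phi> (zm n x) = 0" for x
    proof -
      have "x \<in> C" using x(1) giJ JC(3) by blast
      then show ?thesis using IH(5)[OF nin[OF x(1)] x(2)] zm_zm[where n = e and k = n and x = x] by simp
    qed
    ultimately show ?thesis using IH(1,2,3) nin n(1)
      by (intro exI[of _ S] exI[of _ "\<lambda>x. \<phi> (zm n x)"] exI[of _ "n * e"]) auto
  next
    case False
    have uniq: "c = c'" if eq: "add y (zm c a) = add y' (zm c' a)" and y: "y \<in> gen F" "y' \<in> gen F" for y y' c c'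
    proof -
      have C: "y \<in> C" "y' \<in> C" using y gC(3) by blast+
      have key: "zm (c - c') a = add (neg y) y'"
      proof -
        have "add (neg y) (add (add y (zm c a)) (zm (- c') a)) = add (neg y) (add (add y' (zm c' a)) (zm (- c') a))"
          unfolding eq ..
        then show ?thesis using C aC by (simp add: A.grp.m_assoc zm_add[symmetric])
      qed
      have in1: "zm (c - c') a \<in> gen F" unfolding key using gC(4)[OF gC(5)[OF y(1)] y(2)] .
      then have in2: "zm (c' - c) a \<in> gen F" using gC(5)[OF in1] zm_minus[OF aC, of "c - c'"] by simp
      show ?thesis
      proof (rule ccontr)
        assume "c \<noteq> c'"
        then have "c - c' > 0 \<or> c' - c > 0" by linarith
        then show False using False in1 in2 by blast
      qed
    qed
    \<comment> \<open>The coefficient of a, unique because no positive multiple of a lies in the old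
      subgroup.\<close>
    define cf where "cf x = (THE c. \<exists>y\<in>gen F. x = add y (zm c a))" for x
    have cf_eq: "cf (add y (zm c a)) = c" if "y \<in> gen F" for y c
      unfolding cf_def
    proof (rule the_equality)
      show "\<exists>ya\<in>gen F. add y (zm c a) = add ya (zm c a)" using that by blast
    next
      fix c' assume "\<exists>ya\<in>gen F. add y (zm c a) = add ya (zm c' a)"
      then show "c' = c" using uniq that by metis
    qed
    define yf where "yf x = add x (zm (- cf x) a)" for x
    have yf_eq: "yf (add y (zm c a)) = y" if "y \<in> gen F" for y c
      unfolding yf_def cf_eq[OF that] using that gC(3) aC by (simp add: zm_minus)
    obtain s where s: "s \<notin> S" using IH(1) ex_new_if_finite infinite_UNIV_nat by blast
    define \<psi> where "\<psi> x = (\<phi> (yf x))(s := cf x)" for x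
    have psi: "\<psi> (add y (zm c a)) = (\<phi> y)(s := c)" if "y \<in> gen F" for y c
      unfolding \<psi>_def cf_eq[OF that] yf_eq[OF that] ..
    have "\<psi> (add x x') = \<psi> x + \<psi> x'" if x: "x \<in> gen (insert a F)" "x' \<in> gen (insert a F)" for x x'
    proof -
      obtain y c y' c' where *: "x = add y (zm c a)" "x' = add y' (zm c' a)" "y \<in> gen F" "y' \<in> gen F"
        using x gi by blast
      then have m: "y \<in> J" "y' \<in> J" "y \<in> C" "y' \<in> C" using gJ gC(3) by blast+
      have "add x x' = add y (add (add (zm c a) y') (zm c' a))" using * m aC by (simp add: A.grp.m_assoc)
      also have "add (zm c a) y' = add y' (zm c a)" using J(2)[OF zJ m(2)] .
      also have "add y (add (add y' (zm c a)) (zm c' a)) = add (add y y') (zm (c + c') a)"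
        using m aC by (simp add: zm_add A.grp.m_assoc)
      finally have "\<psi> (add x x') = (\<phi> (add y y'))(s := c + c')" using psi[OF gC(4)[OF *(3,4)]] by simp
      also have "\<dots> = \<psi> x + \<psi> x'"
        unfolding *(1,2) psi[OF *(3)] psi[OF *(4)] IH(4)[OF *(3,4)] by (auto simp: fun_eq_iff plus_fun_apply)
      finally show ?thesis .
    qed
    moreover have "zm e x = z" if x: "x \<in> gen (insert a F)" "\<psi> x = 0" for x
    proof -
      obtain y c where *: "x = add y (zm c a)" "y \<in> gen F" using x gi by blast
      have p: "(\<phi> y)(s := c) = 0" using x(2) unfolding *(1) psi[OF *(2)] .
      have c: "c = 0" using fun_cong[OF p, of s] by (simp add: zero_fun_apply)
      have "\<phi> y i = 0" for i using fun_cong[OF p, of i] IH(3)[OF *(2) s] by (cases "i = s") (auto simp: zero_fun_apply)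
      then have "\<phi> y = 0" by (auto simp: fun_eq_iff zero_fun_apply)
      then show ?thesis using IH(5)[OF *(2)] c * gC(3) by simp
    qed
    moreover have "\<psi> x i = 0" if x: "x \<in> gen (insert a F)" "i \<notin> insert s S" for x i
    proof -
      obtain y c where *: "x = add y (zm c a)" "y \<in> gen F" using x gi by blast
      show ?thesis unfolding *(1) psi[OF *(2)] using x(2) IH(3)[OF *(2)] by simp
    qed
    ultimately show ?thesis using IH(1,2)
      by (intro exI[of _ "insert s S"] exI[of _ \<psi>] exI[of _ e]) auto
  qed
qed

end

text \<open>The chain is read downwards from C: the inductions hold a set J together with a chain
  from J to the top, and carry that chain into quotients. n counts the steps, for an induction in
  which the brace itself changes.\<close>

inductive apc :: "'a set \<Rightarrow> ('a \<Rightarrow> 'a \<Rightarrow> 'a) \<Rightarrow> ('a \<Rightarrow> 'a \<Rightarrow> 'a) \<Rightarrow> nat \<Rightarrow> 'a set \<Rightarrow> bool"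
  for C add mul where
  apc_top: "apc C add mul 0 C"
| apc_step: "is_ideal C add mul A \<Longrightarrow> J \<subseteq> A \<Longrightarrow>
    (in_soc_mod C add mul J A \<and> fg_mod C add J A) \<or> fin_mod C add J A \<Longrightarrow>
    apc C add mul n A \<Longrightarrow> apc C add mul (Suc n) J"

context bhom
begin

lemma h_tht: "x \<in> C \<Longrightarrow> y \<in> C \<Longrightarrow> h (B.tht x y) = B'.tht (h x) (h y)"
  by (simp add: B.tht_def B'.tht_def h_add h_mul h_neg)

lemma h_eq_iff': assumes "u \<in> C" "w \<in> C" shows "h (add u (B.neg w)) = B'.z \<longleftrightarrow> h u = h w"
proof -
  have "h (add u (B.neg w)) = add' (h u) (B'.neg (h w))" using assms by (simp add: h_add h_neg)
  also have "\<dots> = B'.z \<longleftrightarrow> h u = h w"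
  proof
    assume "add' (h u) (B'.neg (h w)) = B'.z"
    then have "add' (add' (h u) (B'.neg (h w))) (h w) = add' B'.z (h w)" by (simp only:)
    then show "h u = h w" using assms by simp
  qed (use assms in simp)
  finally show ?thesis .
qed

lemma asub_image: assumes "B.asub J" shows "B'.asub (h ` J)"
proof -
  note J = B.asubD[OF assms]
  show ?thesis
    unfolding B'.asub_def
  proof (intro conjI ballI)
    show "h ` J \<subseteq> C'" using J(1) h_in by blast
    show "B'.z \<in> h ` J" using J(2) h_z by (metis imageI)
  next
    fix x y assume "x \<in> h ` J" "y \<in> h ` J"
    then show "add' x y \<in> h ` J" using J(3,4) by (auto simp flip: h_add)
  next
    fix x assume "x \<in> h ` J"
    then show "B'.neg x \<in> h ` J" using J(3,5) by (auto simp flip: h_neg)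
  qed
qed

lemma gen_image_subset: assumes "F \<subseteq> C" shows "h ` B.gen F \<subseteq> B'.gen (h ` F)"
proof
  have gC: "B.gen F \<subseteq> C" using B.asubD(1)[OF B.asub_gen[OF assms]] .
  fix y assume "y \<in> h ` B.gen F"
  then obtain x where x: "x \<in> B.gen F" "y = h x" by blast
  from x(1) have "h x \<in> B'.gen (h ` F)"
  proof induction
    case gid_in
    then show ?case unfolding h_z by (rule gen_subgroup.gid_in)
  next
    case (gen_in s)
    then show ?case by (intro gen_subgroup.gen_in imageI)
  next
    case (add_in a b)
    then have "a \<in> C" "b \<in> C" using gC by blast+
    then show ?case using gen_subgroup.add_in[OF add_in.IH] by (simp add: h_add)
  next
    case (inv_in a)
    then have "a \<in> C" using gC by blast
    then show ?case using gen_subgroup.inv_in[OF inv_in.IH] by (simp add: h_neg)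
  qed
  then show "y \<in> B'.gen (h ` F)" using x(2) by simp
qed

lemma fin_mod_image:
  assumes "fin_mod C add I J" "J \<subseteq> C"
  shows "fin_mod C' add' (h ` I) (h ` J)"
proof -
  obtain F where F: "finite F" "F \<subseteq> J" "\<forall>x\<in>J. \<exists>f\<in>F. add (B.neg f) x \<in> I" using assms(1) unfolding fin_mod_def by blast
  have "\<exists>f'\<in>h ` F. add' (B'.neg f') x' \<in> h ` I" if x': "x' \<in> h ` J" for x'
  proof -
    obtain x where x: "x \<in> J" "x' = h x" using x' by blast
    obtain f where f: "f \<in> F" "add (B.neg f) x \<in> I" using F(3) x(1) by blast
    have "f \<in> C" "x \<in> C" using f(1) x(1) F(2) assms(2) by blast+
    then have "add' (B'.neg (h f)) x' = h (add (B.neg f) x)" unfolding x(2) by (simp add: h_add h_neg)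
    then show ?thesis using f by (metis imageI)
  qed
  moreover have "h ` F \<subseteq> h ` J" using F(2) by (rule image_mono)
  ultimately show ?thesis unfolding fin_mod_def using F(1) by blast
qed

lemma fin_mod_preimage:
  assumes "fin_mod C' add' N C'"
  shows "fin_mod C add {x \<in> C. h x \<in> N} C"
proof -
  obtain F' where F': "finite F'" "F' \<subseteq> C'" "\<forall>x\<in>C'. \<exists>f\<in>F'. add' (B'.neg f) x \<in> N"
    using assms unfolding fin_mod_def by blast
  obtain F where F: "F \<subseteq> C" "finite F" "F' = h ` F"
    using finite_subset_image[OF F'(1), of h C] F'(2) h_onto by blast
  have "\<exists>f\<in>F. add (B.neg f) x \<in> {x \<in> C. h x \<in> N}" if x: "x \<in> C" for x
  proof -
    obtain f where f: "f \<in> F" "add' (B'.neg (h f)) (h x) \<in> N" using F'(3) h_in[OF x] F(3) by blast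
    have fC: "f \<in> C" using f(1) F(1) by blast
    have "h (add (B.neg f) x) \<in> N" using f(2) fC x by (simp add: h_add h_neg)
    then show ?thesis using f(1) fC x by (intro bexI[of _ f]) auto
  qed
  then show ?thesis unfolding fin_mod_def using F(1,2) by blast
qed

lemma in_soc_mod_image:
  assumes "in_soc_mod C add mul I J" "J \<subseteq> C"
  shows "in_soc_mod C' add' mul' (h ` I) (h ` J)"
  unfolding in_soc_mod_def
proof (intro ballI)
  fix x' b' assume "x' \<in> h ` J" and b': "b' \<in> C'"
  then obtain x where x: "x \<in> J" "x' = h x" by blast
  obtain b where b: "b \<in> C" "b' = h b" using b' h_onto by blast
  have xC: "x \<in> C" using x(1) assms(2) by blast
  have "add (B.neg b) (B.lam x b) \<in> I \<and> add (add x b) (B.neg (add b x)) \<in> I"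
    using assms(1) x(1) b(1) unfolding in_soc_mod_def by blast
  moreover have "add' (B'.neg b') (B'.lam x' b') = h (add (B.neg b) (B.lam x b))"
    "add' (add' x' b') (B'.neg (add' b' x')) = h (add (add x b) (B.neg (add b x)))"
    unfolding x(2) b(2) using xC b(1) by (simp_all add: h_add h_neg h_lam)
  ultimately show "add' (B'.neg b') (B'.lam x' b') \<in> h ` I \<and> add' (add' x' b') (B'.neg (add' b' x')) \<in> h ` I"
    by simp
qed

lemma fg_mod_image:
  assumes "fg_mod C add I J" "J \<subseteq> C" "I \<subseteq> J"
  shows "fg_mod C' add' (h ` I) (h ` J)"
proof -
  obtain F where F: "finite F" "F \<subseteq> J" "J \<subseteq> B.gen (F \<union> I)" using assms(1) unfolding fg_mod_def by blast
  have "h ` J \<subseteq> h ` B.gen (F \<union> I)" using F(3) by (rule image_mono)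
  also have "\<dots> \<subseteq> B'.gen (h ` (F \<union> I))" using F(2) assms(2,3) by (intro gen_image_subset) blast
  finally have "h ` J \<subseteq> B'.gen (h ` F \<union> h ` I)" unfolding image_Un .
  moreover have "h ` F \<subseteq> h ` J" using F(2) by (rule image_mono)
  ultimately show ?thesis unfolding fg_mod_def using F(1) by blast
qed

lemma apc_image:
  assumes "apc C add mul n J"
  shows "apc C' add' mul' n (h ` J)"
  using assms
proof induction
  case apc_top
  then show ?case unfolding h_onto by (rule apc.apc_top)
next
  case (apc_step A J n)
  have AC: "A \<subseteq> C" by (rule B.idealD(2)[OF apc_step.hyps(1)])
  show ?case
  proof (rule apc.apc_step[OF image_ideal[OF apc_step.hyps(1)] image_mono[OF apc_step.hyps(2)] _ apc_step.IH])
    show "(in_soc_mod C' add' mul' (h ` J) (h ` A) \<and> fg_mod C' add' (h ` J) (h ` A)) \<or> fin_mod C' add' (h ` J) (h ` A)"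
      using apc_step.hyps(3)
    proof (elim disjE conjE)
      assume "in_soc_mod C add mul J A" "fg_mod C add J A"
      then show ?thesis using in_soc_mod_image[OF _ AC] fg_mod_image[OF _ AC apc_step.hyps(2)] by blast
    next
      assume "fin_mod C add J A"
      then show ?thesis using fin_mod_image[OF _ AC] by blast
    qed
  qed
qed

context
  fixes I assumes ker: "\<And>x. x \<in> C \<Longrightarrow> h x = B'.z \<longleftrightarrow> x \<in> I"
begin

lemma in_soc_mod_iff:
  assumes "J \<subseteq> C"
  shows "in_soc_mod C add mul I J \<longleftrightarrow> h ` J \<subseteq> B'.soc"
proof -
  have e: "(add (B.neg b) (B.lam x b) \<in> I \<and> add (add x b) (B.neg (add b x)) \<in> I) \<longleftrightarrow>
      (B'.lam (h x) (h b) = h b \<and> add' (h x) (h b) = add' (h b) (h x))" if x: "x \<in> J" and b: "b \<in> C" for x b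
  proof -
    have xC: "x \<in> C" using x assms by blast
    have "add (B.neg b) (B.lam x b) \<in> I \<longleftrightarrow> h b = h (B.lam x b)"
      using ker[of "add (B.neg b) (B.lam x b)"] h_eq_iff[of b "B.lam x b"] xC b by simp
    moreover have "add (add x b) (B.neg (add b x)) \<in> I \<longleftrightarrow> h (add x b) = h (add b x)"
      using ker[of "add (add x b) (B.neg (add b x))"] h_eq_iff'[of "add x b" "add b x"] xC b by simp
    ultimately show ?thesis using xC b by (auto simp: h_lam h_add)
  qed
  have "in_soc_mod C add mul I J \<longleftrightarrow> (\<forall>x\<in>J. \<forall>b\<in>C. B'.lam (h x) (h b) = h b \<and> add' (h x) (h b) = add' (h b) (h x))"
    unfolding in_soc_mod_def using e by (intro ball_cong HOL.refl) auto
  also have "\<dots> \<longleftrightarrow> (\<forall>x\<in>J. h x \<in> B'.soc)"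
    unfolding B'.soc_def using assms by (intro ball_cong HOL.refl) (auto simp: h_onto[symmetric])
  finally show ?thesis by auto
qed

lemma fin_mod_kernel_iff:
  assumes "J \<subseteq> C"
  shows "fin_mod C add I J \<longleftrightarrow> finite (h ` J)"
proof
  assume "fin_mod C add I J"
  then obtain F where F: "finite F" "F \<subseteq> J" "\<forall>x\<in>J. \<exists>f\<in>F. add (B.neg f) x \<in> I" unfolding fin_mod_def by blast
  have "h ` J \<subseteq> h ` F"
  proof
    fix y assume "y \<in> h ` J"
    then obtain x where x: "x \<in> J" "y = h x" by blast
    obtain f where f: "f \<in> F" "add (B.neg f) x \<in> I" using F(3) x(1) by blast
    have C: "f \<in> C" "x \<in> C" using f(1) x(1) F(2) assms by blast+
    then have "h f = h x" using ker[of "add (B.neg f) x"] h_eq_iff[of f x] f(2) by simp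
    then show "y \<in> h ` F" using f(1) x(2) by (metis imageI)
  qed
  then show "finite (h ` J)" using F(1) finite_surj by blast
next
  assume "finite (h ` J)"
  then obtain F where F: "F \<subseteq> J" "finite F" "h ` J = h ` F"
    using finite_subset_image[of "h ` J" h J] by blast
  have "\<exists>f\<in>F. add (B.neg f) x \<in> I" if x: "x \<in> J" for x
  proof -
    obtain f where f: "f \<in> F" "h x = h f" using F(3) x by blast
    have C: "f \<in> C" "x \<in> C" using f(1) x F(1) assms by blast+
    then show ?thesis using ker[of "add (B.neg f) x"] h_eq_iff[of f x] f by auto
  qed
  then show "fin_mod C add I J" unfolding fin_mod_def using F(1,2) by blast
qed

lemma preimage_image:
  assumes "B.asub J" "I \<subseteq> J"
  shows "{x \<in> C. h x \<in> h ` J} = J"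
proof
  show "J \<subseteq> {x \<in> C. h x \<in> h ` J}" using B.asubD(3)[OF assms(1)] by blast
  show "{x \<in> C. h x \<in> h ` J} \<subseteq> J"
  proof
    fix x assume "x \<in> {x \<in> C. h x \<in> h ` J}"
    then obtain y where y: "x \<in> C" "y \<in> J" "h y = h x" by auto
    have yC: "y \<in> C" using B.asubD(3)[OF assms(1) y(2)] .
    then have "add (B.neg y) x \<in> I" using ker[of "add (B.neg y) x"] h_eq_iff[of y x] y by simp
    then have "add y (add (B.neg y) x) \<in> J" using B.asubD(4)[OF assms(1) y(2)] assms(2) by blast
    then show "x \<in> J" using y(1) yC by simp
  qed
qed

lemma h_kernel_zero: "i \<in> I \<Longrightarrow> i \<in> C \<Longrightarrow> h i = B'.z"
  using ker by blast

lemma fg_mod_kernel: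
  assumes "fg_mod C add I J" "J \<subseteq> C" "I \<subseteq> J"
  obtains F where "finite F" "F \<subseteq> h ` J" "h ` J \<subseteq> B'.gen F"
proof -
  obtain F where F: "finite F" "F \<subseteq> h ` J" "h ` J \<subseteq> B'.gen (F \<union> h ` I)"
    using fg_mod_image[OF assms] unfolding fg_mod_def by blast
  have FC: "F \<subseteq> C'" using F(2) assms(2) h_in by blast
  have "h ` I \<subseteq> {B'.z}" using h_kernel_zero assms(2,3) by blast
  moreover have "{B'.z} \<subseteq> B'.gen F" using gen_subgroup.gid_in[of C' add' F] by simp
  ultimately have "h ` I \<subseteq> B'.gen F" by (rule order_trans)
  moreover have "F \<subseteq> B'.gen F" by (rule subsetI) (rule gen_subgroup.gen_in)
  ultimately have "B'.gen (F \<union> h ` I) \<subseteq> B'.gen F" by (intro B'.gen_subset B'.asub_gen[OF FC] Un_least)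
  then show ?thesis using that[OF F(1,2)] F(3) by blast
qed

end

end

section \<open>Sums of ideals, torsion and lattices modulo an ideal\<close>

context brace
begin

lemma soc_mod_ideal:
  assumes I: "is_ideal C add mul I" and K: "asub K" "I \<subseteq> K" "in_soc_mod C add mul I K"
    and lamK: "\<And>b x. b \<in> C \<Longrightarrow> x \<in> K \<Longrightarrow> lam b x \<in> K"
  shows "is_ideal C add mul K"
proof -
  obtain C' :: "'a set" and add' mul' h where h: "bhom C add mul C' add' mul' h"
    and ker: "\<And>x. x \<in> C \<Longrightarrow> h x = gid C' add' \<longleftrightarrow> x \<in> I" by (fact quotientE[OF I])
  interpret H: bhom C add mul C' add' mul' h by (rule h)
  note KC = asubD[OF K(1)]
  have soc': "h ` K \<subseteq> H.B'.soc" using H.in_soc_mod_iff[OF ker KC(1)] K(3) by blast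
  have "H.B'.lam b' x' \<in> h ` K" if b': "b' \<in> C'" and x': "x' \<in> h ` K" for b' x'
  proof -
    obtain b where b: "b \<in> C" "b' = h b" using b' H.h_onto by blast
    obtain x where x: "x \<in> K" "x' = h x" using x' by blast
    have "H.B'.lam b' x' = h (lam b x)" unfolding b(2) x(2) using H.h_lam[OF b(1) KC(3)[OF x(1)]] by simp
    then show ?thesis using lamK[OF b(1) x(1)] by (metis imageI)
  qed
  then have "is_ideal C' add' mul' (h ` K)" by (rule H.B'.soc_sub_ideal[OF H.asub_image[OF K(1)] soc'])
  then have "is_ideal C add mul {x \<in> C. h x \<in> h ` K}" by (rule H.preimage_ideal)
  moreover have "{x \<in> C. h x \<in> h ` K} = K" by (rule H.preimage_image[OF ker K(1,2)])
  ultimately show ?thesis by (simp only:)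
qed

definition isum :: "'a set \<Rightarrow> 'a set \<Rightarrow> 'a set" where
  "isum K I = {add k i | k i. k \<in> K \<and> i \<in> I}"

lemma isum_ideal:
  assumes K: "is_ideal C add mul K" and I: "is_ideal C add mul I"
  shows "is_ideal C add mul (isum K I)"
proof -
  obtain C' :: "'a set" and add' mul' h where h: "bhom C add mul C' add' mul' h"
    "\<forall>x\<in>C. h x = gid C' add' \<longleftrightarrow> x \<in> I" using quotient_exists[OF I] by blast
  interpret H: bhom C add mul C' add' mul' h by (rule h(1))
  have "isum K I = {x \<in> C. h x \<in> h ` K}"
  proof
    show "isum K I \<subseteq> {x \<in> C. h x \<in> h ` K}"
    proof
      fix x assume "x \<in> isum K I"
      then obtain k i where ki: "x = add k i" "k \<in> K" "i \<in> I" unfolding isum_def by blast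
      have C: "k \<in> C" "i \<in> C" using ki idealD(4)[OF K] idealD(4)[OF I] by blast+
      have "h x = h k" using ki C h(2) by (simp add: H.h_add)
      then show "x \<in> {x \<in> C. h x \<in> h ` K}" using ki C by auto
    qed
    show "{x \<in> C. h x \<in> h ` K} \<subseteq> isum K I"
    proof
      fix x assume "x \<in> {x \<in> C. h x \<in> h ` K}"
      then obtain k where k: "x \<in> C" "k \<in> K" "h k = h x" by auto
      have kC: "k \<in> C" using k(2) idealD(4)[OF K] by blast
      have "h (add (neg k) x) = H.B'.z" using H.h_eq_iff[OF kC k(1)] k(3) by blast
      then have "add (neg k) x \<in> I" using h(2) kC k(1) by simp
      moreover have "x = add k (add (neg k) x)" using kC k(1) by simp
      ultimately show "x \<in> isum K I" unfolding isum_def using k(2) by blast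
    qed
  qed
  then show ?thesis using H.preimage_ideal[OF H.image_ideal[OF K]] by simp
qed

lemma isum_upper:
  assumes K: "is_ideal C add mul K" and I: "is_ideal C add mul I"
  shows "K \<subseteq> isum K I" "I \<subseteq> isum K I"
proof -
  have "k = add k z" if "k \<in> K" for k using that idealD(4)[OF K] by simp
  then show "K \<subseteq> isum K I" unfolding isum_def using idealD(3)[OF I] by blast
  have "i = add z i" if "i \<in> I" for i using that idealD(4)[OF I] by simp
  then show "I \<subseteq> isum K I" unfolding isum_def using idealD(3)[OF K] by blast
qed

lemma isum_least:
  assumes "asub J" "K \<subseteq> J" "I \<subseteq> J"
  shows "isum K I \<subseteq> J"
proof
  fix x assume "x \<in> isum K I"
  then obtain k i where "x = add k i" "k \<in> K" "i \<in> I" unfolding isum_def by blast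
  then show "x \<in> J" using asubD(4)[OF assms(1) subsetD[OF assms(2)] subsetD[OF assms(3)]] by simp
qed

text \<open>Modulo I, J is abelian with finitely many generators of finite order, so the
  coefficients can be reduced to finitely many.\<close>

lemma fin_mod_torsion:
  assumes I: "is_ideal C add mul I" and J: "asub J" "I \<subseteq> J" "in_soc_mod C add mul I J" "fg_mod C add I J"
    and tor: "\<And>a. a \<in> J \<Longrightarrow> \<exists>n>0. zm n a \<in> I"
  shows "fin_mod C add I J"
proof -
  obtain C' :: "'a set" and add' mul' h where h: "bhom C add mul C' add' mul' h"
    and ker: "\<And>x. x \<in> C \<Longrightarrow> h x = gid C' add' \<longleftrightarrow> x \<in> I" by (fact quotientE[OF I])
  interpret H: bhom C add mul C' add' mul' h by (rule h)
  note JC = asubD[OF J(1)]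
  have soc': "h ` J \<subseteq> H.B'.soc" using H.in_soc_mod_iff[OF ker JC(1)] J(3) by blast
  obtain F where F: "finite F" "F \<subseteq> h ` J" "h ` J \<subseteq> H.B'.gen F"
    using H.fg_mod_kernel[OF ker J(4) JC(1) J(2)] by blast
  have "add' x y = add' y x" if "x \<in> h ` J" "y \<in> h ` J" for x y
    using that soc' H.B'.socD(1,3) by blast
  moreover have "\<exists>n>0. H.B'.zm n a' = H.B'.z" if a': "a' \<in> F" for a'
  proof -
    obtain a where a: "a \<in> J" "a' = h a" using F(2) a' by blast
    obtain n where n: "n > 0" "zm n a \<in> I" using tor[OF a(1)] by blast
    have "H.B'.zm n a' = h (zm n a)" unfolding a(2) using H.h_zm[OF JC(3)[OF a(1)]] by simp
    also have "\<dots> = H.B'.z" using ker n(2) JC(3)[OF a(1)] by simp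
    finally show ?thesis using n(1) by blast
  qed
  ultimately have "finite (H.B'.gen F)"
    by (rule H.B'.finite_gen_torsion[OF H.asub_image[OF J(1)] _ F(1,2)])
  then have "finite (h ` J)" using F(3) finite_subset by blast
  then show ?thesis using H.fin_mod_kernel_iff[OF ker JC(1)] by blast
qed

lemma lattice_embedding_mod:
  assumes I: "is_ideal C add mul I" and J: "asub J" "I \<subseteq> J" "in_soc_mod C add mul I J" "fg_mod C add I J"
  shows "\<exists>(S :: nat set) (\<phi> :: 'a \<Rightarrow> zvec) e. finite S \<and> e > 0 \<and> (\<forall>x\<in>J. \<forall>i. i \<notin> S \<longrightarrow> \<phi> x i = 0) \<and>
    (\<forall>x\<in>J. \<forall>y\<in>J. \<phi> (add x y) = \<phi> x + \<phi> y) \<and> (\<forall>x\<in>I. \<phi> x = 0) \<and> (\<forall>x\<in>J. \<phi> x = 0 \<longrightarrow> zm e x \<in> I)"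
proof -
  obtain C' :: "'a set" and add' mul' h where h: "bhom C add mul C' add' mul' h"
    and ker: "\<And>x. x \<in> C \<Longrightarrow> h x = gid C' add' \<longleftrightarrow> x \<in> I" by (fact quotientE[OF I])
  interpret H: bhom C add mul C' add' mul' h by (rule h)
  note JC = asubD[OF J(1)]
  have soc': "h ` J \<subseteq> H.B'.soc" using H.in_soc_mod_iff[OF ker JC(1)] J(3) by blast
  obtain F where F: "finite F" "F \<subseteq> h ` J" "h ` J \<subseteq> H.B'.gen F"
    using H.fg_mod_kernel[OF ker J(4) JC(1) J(2)] by blast
  have comm: "add' x y = add' y x" if "x \<in> h ` J" "y \<in> h ` J" for x y
    using that soc' H.B'.socD(1,3) by blast
  obtain S :: "nat set" and \<psi> :: "'a \<Rightarrow> zvec" and e where L: "finite S \<and> e > 0 \<and> (\<forall>x\<in>H.B'.gen F. \<forall>i. i \<notin> S \<longrightarrow> \<psi> x i = 0) \<and>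
    (\<forall>x\<in>H.B'.gen F. \<forall>y\<in>H.B'.gen F. \<psi> (add' x y) = \<psi> x + \<psi> y) \<and> (\<forall>x\<in>H.B'.gen F. \<psi> x = 0 \<longrightarrow> H.B'.zm e x = H.B'.z)"
  proof -
    have "\<exists>(S :: nat set) (\<phi> :: 'a \<Rightarrow> zvec) e. finite S \<and> e > 0 \<and> (\<forall>x\<in>H.B'.gen F. \<forall>i. i \<notin> S \<longrightarrow> \<phi> x i = 0) \<and>
      (\<forall>x\<in>H.B'.gen F. \<forall>y\<in>H.B'.gen F. \<phi> (add' x y) = \<phi> x + \<phi> y) \<and> (\<forall>x\<in>H.B'.gen F. \<phi> x = 0 \<longrightarrow> H.B'.zm e x = H.B'.z)"
      by (rule H.B'.lattice_embedding[OF H.asub_image[OF J(1)] comm F(1,2)])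
    then show thesis by (elim exE) (rule that)
  qed
  note L1 = L[THEN conjunct1] L[THEN conjunct2, THEN conjunct1]
    L[THEN conjunct2, THEN conjunct2, THEN conjunct1, rule_format]
    L[THEN conjunct2, THEN conjunct2, THEN conjunct2, THEN conjunct1, rule_format]
    L[THEN conjunct2, THEN conjunct2, THEN conjunct2, THEN conjunct2, rule_format]
  have hg: "h x \<in> H.B'.gen F" if "x \<in> J" for x using F(3) that by blast
  have 1: "\<psi> (h (add x y)) = \<psi> (h x) + \<psi> (h y)" if "x \<in> J" "y \<in> J" for x y
    using L1(4)[OF hg[OF that(1)] hg[OF that(2)]] H.h_add[OF JC(3)[OF that(1)] JC(3)[OF that(2)]] by simp
  have 2: "\<psi> (h x) = 0" if x: "x \<in> I" for x
  proof -
    have xC: "x \<in> C" "x \<in> J" using x J(2) JC(3) by blast+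
    have "h x = H.B'.z" using ker[OF xC(1)] x by blast
    moreover have "\<psi> (add' H.B'.z H.B'.z) = \<psi> H.B'.z + \<psi> H.B'.z"
      by (intro L1(4) gen_subgroup.gid_in)
    ultimately show ?thesis by simp
  qed
  have 3: "zm e x \<in> I" if x: "x \<in> J" "\<psi> (h x) = 0" for x
  proof -
    have "h (zm e x) = H.B'.z" using L1(5)[OF hg[OF x(1)] x(2)] H.h_zm[OF JC(3)[OF x(1)]] by simp
    then show ?thesis using ker[of "zm e x"] JC(3)[OF x(1)] by simp
  qed
  have 4: "\<psi> (h x) i = 0" if "x \<in> J" "i \<notin> S" for x i by (rule L1(3)[OF hg[OF that(1)] that(2)])
  show ?thesis
    using L1(1,2) 1 2 3 4 by (intro exI[of _ S] exI[of _ "\<lambda>x. \<psi> (h x)"] exI[of _ e]) simp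
qed

lemma finite_exponent:
  assumes J: "asub J" "finite J"
  shows "\<exists>q::nat. q > 0 \<and> (\<forall>x\<in>J. zm (int q) x = z)"
proof -
  have "\<exists>n::nat. n > 0 \<and> zm (int n) x = z" if x: "x \<in> J" for x
  proof -
    have xC: "x \<in> C" by (rule asubD(3)[OF J(1) x])
    have "range (\<lambda>k::nat. zm (int k) x) \<subseteq> J" using asub_zm[OF J(1) x] by blast
    then have "finite (range (\<lambda>k::nat. zm (int k) x))" using J(2) finite_subset by blast
    then have "\<not> inj (\<lambda>k::nat. zm (int k) x)" using finite_imageD infinite_UNIV_nat by blast
    then obtain k l :: nat where "k \<noteq> l" "zm (int k) x = zm (int l) x" unfolding inj_def by blast
    then obtain k l :: nat where kl: "k < l" "zm (int k) x = zm (int l) x" by (metis nat_neq_iff)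
    have "zm (int l) x = add (zm (int k) x) (zm (int (l - k)) x)"
      using kl(1) zm_add[OF xC, of "int k" "int (l - k)"] by simp
    then have "add (neg (zm (int k) x)) (zm (int k) x) = add (neg (zm (int k) x)) (add (zm (int k) x) (zm (int (l - k)) x))"
      using kl(2) by simp
    then have "zm (int (l - k)) x = z" using zm_closed[OF xC, of "int k"] zm_closed[OF xC, of "int (l - k)"] by simp
    then show ?thesis using kl(1) by (intro exI[of _ "l - k"]) simp
  qed
  then obtain n :: "'a \<Rightarrow> nat" where n: "\<And>x. x \<in> J \<Longrightarrow> n x > 0 \<and> zm (int (n x)) x = z" by metis
  define q where "q = (\<Prod>x\<in>J. n x)"
  have "zm (int q) x = z" if x: "x \<in> J" for x
  proof -
    have xC: "x \<in> C" by (rule asubD(3)[OF J(1) x])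
    have "n x dvd q" unfolding q_def using J(2) x by (rule dvd_prodI)
    then obtain k where "q = n x * k" by (elim dvdE)
    then have "zm (int q) x = zm (int k) (zm (int (n x)) x)" by (simp only: zm_zm[OF xC] of_nat_mult)
    also have "\<dots> = z" using n[OF x] A.grp.int_pow_one by simp
    finally show ?thesis .
  qed
  moreover have "q > 0" unfolding q_def using n by (intro prod_pos) blast
  ultimately show ?thesis by blast
qed

section \<open>Multiplicative powers, and ideals of finite index avoiding a finite ideal\<close>

definition pw :: "'a \<Rightarrow> nat \<Rightarrow> 'a" where "pw a k = a [^]\<^bsub>M.G\<^esub> k"

lemma pw_closed [simp, intro]: "a \<in> C \<Longrightarrow> pw a k \<in> C"
  unfolding pw_def by (rule M.grp.nat_pow_closed)

lemma pw_0 [simp]: "pw a 0 = z"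
  by (simp add: pw_def)

lemma pw_Suc: "pw a (Suc k) = mul (pw a k) a"
  unfolding pw_def by (simp only: nat_pow_Suc monoid.select_convs)

lemma pw_Suc2: "a \<in> C \<Longrightarrow> pw a (Suc k) = mul a (pw a k)"
  unfolding pw_def by (rule M.grp.nat_pow_Suc2)

lemma pw_add: "a \<in> C \<Longrightarrow> pw a (k + l) = mul (pw a k) (pw a l)"
  unfolding pw_def by (rule M.grp.nat_pow_mult[symmetric])

lemma pw_pw: "a \<in> C \<Longrightarrow> pw (pw a k) l = pw a (k * l)"
  unfolding pw_def by (rule M.grp.nat_pow_pow)

lemma pw_soc: "x \<in> soc \<Longrightarrow> pw x n = zm (int n) x"
  unfolding pw_def by (rule soc_pow)

lemma pw_in_ideal: assumes "is_ideal C add mul I" "a \<in> I" shows "pw a k \<in> I"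
proof (induction k)
  case 0
  then show ?case using idealD(3)[OF assms(1)] by simp
next
  case (Suc k)
  have C: "pw a k \<in> C" "a \<in> C" using idealD(4)[OF assms(1)] Suc assms(2) by blast+
  have "mul (pw a k) a = add (pw a k) (lam (pw a k) a)" by (rule mul_lam[OF C])
  then show ?case unfolding pw_Suc using idealD(5)[OF assms(1) Suc idealD(9)[OF assms(1) C(1) assms(2)]] by simp
qed

lemma tht_cancel: "a \<in> C \<Longrightarrow> b \<in> C \<Longrightarrow> tht (iv a) (tht a b) = b"
  by (simp add: tht_mul[symmetric])

text \<open>J has only finitely many self-maps, so two powers of a act alike on it through both
  actions; cancelling the smaller one leaves a positive power that fixes J pointwise.\<close>

lemma power_fixes_finite_ideal:
  assumes J: "is_ideal C add mul J" "finite J" and a: "a \<in> C"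
  shows "\<exists>t>0. \<forall>j\<in>J. lam (pw a t) j = j \<and> tht (pw a t) j = j"
proof -
  have tJ: "tht b j \<in> J" if "b \<in> C" "j \<in> J" for b j
    using idealD(7)[OF J(1) that(1) idealD(9)[OF J(1) that]] that idealD(4)[OF J(1)] by (simp add: tht_lam)
  define F where "F k = (restrict (lam (pw a k)) J, restrict (tht (pw a k)) J)" for k
  have "range F \<subseteq> (J \<rightarrow>\<^sub>E J) \<times> (J \<rightarrow>\<^sub>E J)"
    unfolding F_def using idealD(9)[OF J(1)] tJ pw_closed[OF a] by auto
  moreover have "finite ((J \<rightarrow>\<^sub>E J) \<times> (J \<rightarrow>\<^sub>E J))" using J(2) by (intro finite_cartesian_product finite_PiE) auto
  ultimately have "finite (range F)" using finite_subset by blast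
  then have "\<not> inj F" using finite_imageD infinite_UNIV_nat by blast
  then obtain k l where "k \<noteq> l" "F k = F l" unfolding inj_def by blast
  then obtain k l where kl: "k < l" "F k = F l" by (metis nat_neq_iff)
  have pl: "pw a l = mul (pw a k) (pw a (l - k))" using pw_add[OF a, of k "l - k"] kl(1) by simp
  have "lam (pw a (l - k)) j = j \<and> tht (pw a (l - k)) j = j" if j: "j \<in> J" for j
  proof -
    have jC: "j \<in> C" by (rule idealD(4)[OF J(1) j])
    have P: "pw a k \<in> C" "pw a (l - k) \<in> C" using a by auto
    have "lam (pw a k) j = lam (pw a l) j"
      using fun_cong[OF arg_cong[OF kl(2), of fst], of j] j unfolding F_def by simp
    then have "lam (pw a k) j = lam (pw a k) (lam (pw a (l - k)) j)" unfolding pl lam_mul[OF P jC] .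
    then have "lam (iv (pw a k)) (lam (pw a k) j) = lam (iv (pw a k)) (lam (pw a k) (lam (pw a (l - k)) j))" by (rule arg_cong)
    then have 1: "lam (pw a (l - k)) j = j" using P jC by simp
    have "tht (pw a k) j = tht (pw a l) j"
      using fun_cong[OF arg_cong[OF kl(2), of snd], of j] j unfolding F_def by simp
    then have "tht (pw a k) j = tht (pw a k) (tht (pw a (l - k)) j)" unfolding pl tht_mul[OF P jC] .
    then have "tht (iv (pw a k)) (tht (pw a k) j) = tht (iv (pw a k)) (tht (pw a k) (tht (pw a (l - k)) j))" by (rule arg_cong)
    then have "tht (pw a (l - k)) j = j" using P jC by (simp add: tht_cancel)
    with 1 show ?thesis ..
  qed
  then show ?thesis using kl(1) by (intro exI[of _ "l - k"]) simp
qed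

text \<open>A power of \<open>a\<close> shifts every \<open>c\<close> by an element of \<open>J\<close> it fixes, so its
  \<open>exponent\<close>-th power acts trivially.\<close>
lemma power_in_soc:
  assumes J: "is_ideal C add mul J" "finite J" and K: "is_ideal C add mul K" "J \<subseteq> K" "in_soc_mod C add mul J K"
    and a: "a \<in> K"
  shows "\<exists>m>0. pw a m \<in> soc"
proof -
  have aC: "a \<in> C" by (rule idealD(4)[OF K(1) a])
  obtain t where t: "t > 0" "\<forall>j\<in>J. lam (pw a t) j = j \<and> tht (pw a t) j = j"
    using power_fixes_finite_ideal[OF J aC] by blast
  define b where "b = pw a t"
  have bC: "b \<in> C" and bK: "b \<in> K" unfolding b_def using aC pw_in_ideal[OF K(1) a] by auto
  have fix_b: "lam b j = j" "tht b j = j" if "j \<in> J" for j using t(2) that unfolding b_def by blast+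
  obtain q :: nat where q: "q > 0" "\<forall>x\<in>J. zm (int q) x = z"
    using finite_exponent[OF idealD(1)[OF J(1)] J(2)] by blast
  obtain C' :: "'a set" and add' mul' h where h: "bhom C add mul C' add' mul' h"
    and ker: "\<And>x. x \<in> C \<Longrightarrow> h x = gid C' add' \<longleftrightarrow> x \<in> J" by (fact quotientE[OF J(1)])
  interpret H: bhom C add mul C' add' mul' h by (rule h)
  have "h ` K \<subseteq> H.B'.soc" using H.in_soc_mod_iff[OF ker idealD(2)[OF K(1)]] K(3) by blast
  then have hb: "h b \<in> H.B'.soc" using bK by blast
  have iter: "(f ^^ n) c = add c (zm (int n) (add (neg c) (f c)))"
    if f: "\<And>x y. x \<in> C \<Longrightarrow> y \<in> C \<Longrightarrow> f (add x y) = add (f x) (f y)" "f c \<in> C" "\<And>j. j \<in> J \<Longrightarrow> f j = j"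
      and c: "c \<in> C" and d: "add (neg c) (f c) \<in> J" for f c n
  proof (induction n)
    case 0
    then show ?case using c by simp
  next
    case (Suc n)
    define \<delta> where "\<delta> = add (neg c) (f c)"
    have dJ: "zm (int n) \<delta> \<in> J" unfolding \<delta>_def by (rule asub_zm[OF idealD(1)[OF J(1)] d])
    have dC: "\<delta> \<in> C" unfolding \<delta>_def using c f(2) by simp
    have fc: "f c = add c \<delta>" unfolding \<delta>_def using c f(2) by simp
    have "(f ^^ Suc n) c = f (add c (zm (int n) \<delta>))" using Suc unfolding \<delta>_def by simp
    also have "\<dots> = add (add c \<delta>) (zm (int n) \<delta>)" using f(1)[OF c zm_closed[OF dC]] f(3)[OF dJ] fc by simp
    also have "\<dots> = add c (zm (int (Suc n)) \<delta>)"
      using c dC zm_add[OF dC, of 1 "int n"] by (simp add: A.grp.m_assoc)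
    finally show ?case unfolding \<delta>_def .
  qed
  have pl: "lam (pw b n) c = (lam b ^^ n) c" if c: "c \<in> C" for n c
  proof (induction n)
    case (Suc n)
    have "pw b (Suc n) = mul b (pw b n)" by (rule pw_Suc2[OF bC])
    then show ?case using Suc lam_mul[OF bC pw_closed[OF bC] c] by simp
  qed (use c in simp)
  have pt: "tht (pw b n) c = (tht b ^^ n) c" if c: "c \<in> C" for n c
  proof (induction n)
    case (Suc n)
    have "pw b (Suc n) = mul b (pw b n)" by (rule pw_Suc2[OF bC])
    then show ?case using Suc tht_mul[OF bC pw_closed[OF bC] c] by simp
  qed (use c in simp)
  have "lam (pw b q) c = c \<and> tht (pw b q) c = c" if c: "c \<in> C" for c
  proof -
    have "h (lam b c) = h c" using hb c bC H.h_lam[OF bC c] H.B'.socD(2) by simp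
    then have d1: "add (neg c) (lam b c) \<in> J"
      using H.h_eq_iff[of c "lam b c"] ker[of "add (neg c) (lam b c)"] c bC by simp
    have "h (tht b c) = h c"
      using hb c bC H.h_tht[OF bC c] H.B'.soc_iff_tht by simp
    then have d2: "add (neg c) (tht b c) \<in> J"
      using H.h_eq_iff[of c "tht b c"] ker[of "add (neg c) (tht b c)"] c bC by simp
    have "(lam b ^^ q) c = c"
      using iter[of "lam b", OF lam_add[OF bC] lam_closed[OF bC c] fix_b(1) c d1, of q] q(2) d1 c by simp
    moreover have "(tht b ^^ q) c = c"
      using iter[of "tht b", OF tht_add[OF bC] tht_closed[OF bC c] fix_b(2) c d2, of q] q(2) d2 c by simp
    ultimately show ?thesis using pl[OF c] pt[OF c] by simp
  qed
  then have "pw b q \<in> soc" unfolding soc_iff_tht using bC by simp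
  moreover have "pw b q = pw a (t * q)" unfolding b_def by (rule pw_pw[OF aC])
  ultimately show ?thesis using t(1) q(1) by (intro exI[of _ "t * q"]) simp
qed

lemma in_soc_mod_mono:
  assumes "in_soc_mod C add mul I J" "I \<subseteq> I'" "J' \<subseteq> J"
  shows "in_soc_mod C add mul I' J'"
  using assms unfolding in_soc_mod_def by (meson subsetD)

lemma fg_mod_mono:
  assumes "fg_mod C add I J" "I \<subseteq> I'"
  shows "fg_mod C add I' J"
proof -
  obtain F where F: "finite F" "F \<subseteq> J" "J \<subseteq> gen (F \<union> I)" using assms(1) unfolding fg_mod_def by blast
  have "gen (F \<union> I) \<subseteq> gen (F \<union> I')" using assms(2) by (intro gen_mono) blast
  then show ?thesis unfolding fg_mod_def using F by (intro exI[of _ F]) simp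
qed

lemma additive_zm:
  fixes \<phi> :: "'a \<Rightarrow> zvec"
  assumes J: "asub J" and add: "\<And>x y. x \<in> J \<Longrightarrow> y \<in> J \<Longrightarrow> \<phi> (add x y) = \<phi> x + \<phi> y" and x: "x \<in> J"
  shows "\<phi> (zm n x) = zsm n (\<phi> x)"
proof (induction n rule: int_induct[of _ 0])
  case base
  have "\<phi> (add z z) = \<phi> z + \<phi> z" by (intro add asubD(2)[OF J])
  then show ?case by simp
next
  case (step1 i)
  have "zm (i + 1) x = add (zm i x) x" using zm_add[OF asubD(3)[OF J x], of i 1] asubD(3)[OF J x] by simp
  then show ?case using add[OF asub_zm[OF J x] x] step1 by (simp add: zsm_add_left)
next
  case (step2 i)
  have "zm i x = add (zm (i - 1) x) x" using zm_add[OF asubD(3)[OF J x], of "i - 1" 1] asubD(3)[OF J x] by simp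
  then have "\<phi> (zm i x) = \<phi> (zm (i - 1) x) + \<phi> x" using add[OF asub_zm[OF J x] x] by simp
  then show ?case using step2 by (simp add: zsm_diff_left algebra_simps)
qed

lemma additive_neg:
  fixes \<phi> :: "'a \<Rightarrow> zvec"
  assumes J: "asub J" and add: "\<And>x y. x \<in> J \<Longrightarrow> y \<in> J \<Longrightarrow> \<phi> (add x y) = \<phi> x + \<phi> y" and x: "x \<in> J"
  shows "\<phi> (neg x) = - \<phi> x"
proof -
  have "zm (- 1) x = neg x" using zm_minus[OF asubD(3)[OF J x], of 1] asubD(3)[OF J x] by simp
  then show ?thesis using additive_zm[where \<phi> = \<phi>, OF J add x, of "- 1"] by (simp add: zsm_minus_left)
qed

text \<open>\<open>M\<close> consists of sufficiently divisible multiples of socle elements.\<close>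
lemma avoid_finite_ideal_step:
  assumes J: "is_ideal C add mul J" "finite J" and K: "is_ideal C add mul K" "J \<subseteq> K" "in_soc_mod C add mul J K"
    and fg: "fg_mod C add J K"
  shows "\<exists>M. is_ideal C add mul M \<and> M \<subseteq> K \<and> M \<inter> J = {z} \<and> fin_mod C add M K"
proof -
  have aK: "asub K" by (rule idealD(1)[OF K(1)])
  note KC = asubD[OF aK]
  obtain S :: "nat set" and \<phi> :: "'a \<Rightarrow> zvec" and e where L: "finite S \<and> e > 0 \<and> (\<forall>x\<in>K. \<forall>i. i \<notin> S \<longrightarrow> \<phi> x i = 0) \<and>
    (\<forall>x\<in>K. \<forall>y\<in>K. \<phi> (add x y) = \<phi> x + \<phi> y) \<and> (\<forall>x\<in>J. \<phi> x = 0) \<and> (\<forall>x\<in>K. \<phi> x = 0 \<longrightarrow> zm e x \<in> J)"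
    using lattice_embedding_mod[OF J(1) aK K(2,3) fg] by (elim exE)
  then have e: "e > 0" by blast
  have \<phi>_add: "\<And>x y. x \<in> K \<Longrightarrow> y \<in> K \<Longrightarrow> \<phi> (add x y) = \<phi> x + \<phi> y" using L by simp
  have \<phi>_J: "\<And>x. x \<in> J \<Longrightarrow> \<phi> x = 0" using L by simp
  have \<phi>_0: "\<And>x. x \<in> K \<Longrightarrow> \<phi> x = 0 \<Longrightarrow> zm e x \<in> J" using L by simp
  obtain q :: nat where q: "q > 0" "\<forall>x\<in>J. zm (int q) x = z"
    using finite_exponent[OF idealD(1)[OF J(1)] J(2)] by blast
  \<comment> \<open>e carries an element with \<phi> = 0 into J, and q then annihilates it; this
    makes \<open>Mm\<close> meet J trivially.\<close>
  define N where "N = e * int q"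
  have N: "N > 0" using e q(1) by (simp add: N_def)
  define So where "So = soc \<inter> K"
  have So: "is_ideal C add mul So" unfolding So_def by (rule ideal_Int[OF soc_ideal K(1)])
  note SoD = idealD[OF So]
  have Ssoc: "s \<in> soc" "s \<in> K" if "s \<in> So" for s using that unfolding So_def by auto
  define Mm where "Mm = zm N ` So"
  have zmS: "zm n s \<in> So" if "s \<in> So" for s n by (rule asub_zm[OF SoD(1) that])
  have comm: "zm N (add s s') = add (zm N s) (zm N s')" if "s \<in> So" "s' \<in> So" for s s'
    using socD(3)[OF Ssoc(1)[OF that(1)] SoD(4)[OF that(2)]] SoD(4) that by (intro zm_add_commute) auto
  have aM: "asub Mm"
    unfolding asub_def
  proof (intro conjI ballI)
    show "Mm \<subseteq> C" unfolding Mm_def using SoD(4) by auto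
    have "z = zm N z" using A.grp.int_pow_one by simp
    then show "z \<in> Mm" unfolding Mm_def using SoD(3) by (rule image_eqI)
  next
    fix x y assume "x \<in> Mm" "y \<in> Mm"
    then obtain s s' where s: "x = zm N s" "y = zm N s'" "s \<in> So" "s' \<in> So" unfolding Mm_def by blast
    then have "add x y = zm N (add s s')" using comm by simp
    then show "add x y \<in> Mm" unfolding Mm_def using SoD(5)[OF s(3,4)] by (rule image_eqI)
  next
    fix x assume "x \<in> Mm"
    then obtain s where s: "x = zm N s" "s \<in> So" unfolding Mm_def by blast
    have "neg x = zm (- N) s" using s zm_minus[OF SoD(4)[OF s(2)]] by simp
    also have "\<dots> = zm N (zm (- 1) s)" using zm_zm[OF SoD(4)[OF s(2)]] by simp
    finally show "neg x \<in> Mm" unfolding Mm_def using zmS[OF s(2)] by (rule image_eqI)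
  qed
  have MSo: "Mm \<subseteq> So" unfolding Mm_def using zmS by blast
  have "lam b x \<in> Mm" if b: "b \<in> C" and x: "x \<in> Mm" for b x
  proof -
    obtain s where s: "x = zm N s" "s \<in> So" using x unfolding Mm_def by blast
    have "lam b x = zm N (lam b s)" unfolding s(1) by (rule lam_zm[OF b SoD(4)[OF s(2)]])
    then show ?thesis unfolding Mm_def using SoD(9)[OF b s(2)] by (rule image_eqI)
  qed
  moreover have "Mm \<subseteq> soc" using MSo Ssoc(1) by blast
  ultimately have M: "is_ideal C add mul Mm" using soc_sub_ideal[OF aM] by blast
  have MK: "Mm \<subseteq> K" using MSo Ssoc(2) by blast
  have int: "Mm \<inter> J = {z}"
  proof
    show "{z} \<subseteq> Mm \<inter> J" using asubD(2)[OF aM] idealD(3)[OF J(1)] by blast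
    show "Mm \<inter> J \<subseteq> {z}"
    proof
      fix x assume "x \<in> Mm \<inter> J"
      then obtain s where s: "x = zm N s" "s \<in> So" "x \<in> J" unfolding Mm_def by blast
      have sK: "s \<in> K" "s \<in> C" using Ssoc(2)[OF s(2)] SoD(4)[OF s(2)] .
      have "zsm N (\<phi> s) = 0" using \<phi>_J[OF s(3)] additive_zm[where \<phi> = \<phi>, OF aK \<phi>_add sK(1)] s(1) by simp
      then have "\<phi> s = 0" using N by (simp add: zsm_eq_0)
      then have "zm e s \<in> J" using \<phi>_0 sK(1) by blast
      then have "zm (int q) (zm e s) = z" using q(2) by blast
      then have "x = z" unfolding s(1) N_def using zm_zm[OF sK(2)] by simp
      then show "x \<in> {z}" by simp
    qed
  qed
  define Q where "Q = isum J Mm"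
  have Q: "is_ideal C add mul Q" unfolding Q_def by (rule isum_ideal[OF J(1) M])
  have QK: "Q \<subseteq> K" unfolding Q_def by (rule isum_least[OF aK K(2) MK])
  have JQ: "J \<subseteq> Q" "Mm \<subseteq> Q" unfolding Q_def using isum_upper[OF J(1) M] by auto
  obtain C' :: "'a set" and add' mul' h where h: "bhom C add mul C' add' mul' h"
    and ker: "\<And>x. x \<in> C \<Longrightarrow> h x = gid C' add' \<longleftrightarrow> x \<in> J" by (fact quotientE[OF J(1)])
  interpret H: bhom C add mul C' add' mul' h by (rule h)
  have hK: "h ` K \<subseteq> H.B'.soc" using H.in_soc_mod_iff[OF ker KC(1)] K(3) by blast
  have hpw: "h (pw a m) = H.B'.pw (h a) m" if "a \<in> C" for a and m :: nat
  proof (induction m)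
    case (Suc m)
    then show ?case using H.h_mul[OF pw_closed[OF that] that] by (simp add: H.B'.pw_Suc pw_Suc)
  qed simp
  \<comment> \<open>A power a^m lies in the socle. Modulo J, where a itself is in the socle, a^m
    equals m a; so N m a differs from an element of \<open>Mm\<close> by an element of J.\<close>
  have tor: "\<exists>n>0. zm n a \<in> Q" if a: "a \<in> K" for a
  proof -
    have aC: "a \<in> C" by (rule KC(3)[OF a])
    obtain m where m: "m > 0" "pw a m \<in> soc" using power_in_soc[OF J K a] by blast
    have pS: "pw a m \<in> So" unfolding So_def using m(2) pw_in_ideal[OF K(1) a] by blast
    have pM: "zm N (pw a m) \<in> Mm" unfolding Mm_def using pS by (rule imageI)
    have C: "zm N (pw a m) \<in> C" "zm (N * int m) a \<in> C" using aC by auto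
    have "h (pw a m) = H.B'.zm (int m) (h a)" unfolding hpw[OF aC] using H.B'.pw_soc hK a by blast
    then have "h (zm N (pw a m)) = H.B'.zm N (H.B'.zm (int m) (h a))" using H.h_zm[OF pw_closed[OF aC]] by simp
    also have "\<dots> = h (zm (N * int m) a)"
      using H.B'.zm_zm[OF H.h_in[OF aC], where n = N and k = "int m"] H.h_zm[OF aC] by (simp add: mult.commute)
    finally have "add (neg (zm N (pw a m))) (zm (N * int m) a) \<in> J"
      using H.h_eq_iff[OF C] ker[of "add (neg (zm N (pw a m))) (zm (N * int m) a)"] C by simp
    then have "add (zm N (pw a m)) (add (neg (zm N (pw a m))) (zm (N * int m) a)) \<in> Q"
      using idealD(5)[OF Q subsetD[OF JQ(2) pM] subsetD[OF JQ(1)]] by blast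
    then have "zm (N * int m) a \<in> Q" using C by simp
    then show ?thesis using N m(1) by (intro exI[of _ "N * int m"]) simp
  qed
  have 1: "fin_mod C add Q K"
    by (rule fin_mod_torsion[OF Q aK QK in_soc_mod_mono[OF K(3) JQ(1) order_refl] fg_mod_mono[OF fg JQ(1)] tor])
  have 2: "fin_mod C add Mm Q"
    unfolding fin_mod_def
  proof (intro exI[of _ J] conjI ballI J(2) JQ(1))
    fix x assume "x \<in> Q"
    then obtain j i where ji: "x = add j i" "j \<in> J" "i \<in> Mm" unfolding Q_def isum_def by blast
    then have "add (neg j) x = i" using idealD(4)[OF J(1)] asubD(3)[OF aM] by simp
    then show "\<exists>f\<in>J. add (neg f) x \<in> Mm" using ji by blast
  qed
  have "fin_mod C add Mm K" by (rule fin_mod_trans[OF aK QK _ 2 1]) (rule idealD(2)[OF Q])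
  then show ?thesis using M MK int by blast
qed

end

text \<open>Residual finiteness relative to a finite ideal. The induction climbs the chain above J:
  over a finite factor K is finite, so K itself is avoided; over a socle factor one divides by an
  ideal that meets J trivially and has finite index in K, after which the image of K is
  finite.\<close>

lemma avoid_finite_ideal:
  fixes C :: "'a set"
  assumes "brace C add mul" "is_ideal C add mul J" "finite J" "apc C add mul n J"
  shows "\<exists>N. is_ideal C add mul N \<and> fin_mod C add N C \<and> N \<inter> J = {gid C add}"
  using assms
proof (induction n arbitrary: C add mul J)
  case 0
  interpret brace C add mul by fact
  have JC: "J = C" using 0(4) by cases simp
  have "fin_mod C add {z} C"
  proof -
    have "add (neg x) x = z" if "x \<in> C" for x using that by simp
    then show ?thesis unfolding fin_mod_def using 0(3) JC by blast
  qed
  then show ?case using ideal_zero JC by (intro exI[of _ "{z}"]) auto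
next
  case (Suc n)
  interpret brace C add mul by fact
  obtain K where K: "is_ideal C add mul K" "J \<subseteq> K"
    "(in_soc_mod C add mul J K \<and> fg_mod C add J K) \<or> fin_mod C add J K" "apc C add mul n K"
    using Suc.prems(4) by cases auto
  note J = Suc.prems(2,3)
  from K(3) show ?case
  proof
    assume "fin_mod C add J K"
    then have "finite (cosets add K J)" using finite_cosets_iff[OF idealD(1)[OF J(1)] idealD(2)[OF K(1)]] by blast
    moreover have "finite c" if "c \<in> cosets add K J" for c using that J(2) unfolding cosets_def by auto
    moreover have "K \<subseteq> \<Union> (cosets add K J)"
    proof
      fix x assume x: "x \<in> K"
      have "x = add x z" using idealD(4)[OF K(1) x] by simp
      then have "x \<in> add x ` J" using idealD(3)[OF J(1)] by (rule image_eqI)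
      then show "x \<in> \<Union> (cosets add K J)" unfolding cosets_def using x by blast
    qed
    ultimately have "finite K" by (meson finite_Union finite_subset)
    then obtain N where "is_ideal C add mul N" "fin_mod C add N C" "N \<inter> K = {z}"
      using Suc.IH[OF Suc.prems(1) K(1) _ K(4)] by blast
    moreover from this have "N \<inter> J = {z}" using K(2) idealD(3)[OF J(1)] by blast
    ultimately show ?thesis by blast
  next
    assume s: "in_soc_mod C add mul J K \<and> fg_mod C add J K"
    obtain Mm where M: "is_ideal C add mul Mm" "Mm \<subseteq> K" "Mm \<inter> J = {z}" "fin_mod C add Mm K"
      using avoid_finite_ideal_step[OF J K(1,2)] s by blast
    obtain C' :: "'a set" and add' mul' h where h: "bhom C add mul C' add' mul' h"
      and ker: "\<And>x. x \<in> C \<Longrightarrow> h x = gid C' add' \<longleftrightarrow> x \<in> Mm" by (fact quotientE[OF M(1)])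
    interpret H: bhom C add mul C' add' mul' h by (rule h)
    have "finite (h ` K)" using H.fin_mod_kernel_iff[OF ker idealD(2)[OF K(1)]] M(4) by blast
    then obtain N' where N': "is_ideal C' add' mul' N'" "fin_mod C' add' N' C'" "N' \<inter> h ` K = {H.B'.z}"
      using Suc.IH[OF H.B'.brace_axioms H.image_ideal[OF K(1)] _ H.apc_image[OF K(4)]] by blast
    define N where "N = {x \<in> C. h x \<in> N'}"
    have N: "is_ideal C add mul N" "fin_mod C add N C"
      unfolding N_def using H.preimage_ideal[OF N'(1)] H.fin_mod_preimage[OF N'(2)] by auto
    have "N \<inter> J = {z}"
    proof
      show "{z} \<subseteq> N \<inter> J" using idealD(3)[OF N(1)] idealD(3)[OF J(1)] by blast
      show "N \<inter> J \<subseteq> {z}"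
      proof
        fix x assume x: "x \<in> N \<inter> J"
        then have "x \<in> C" "h x \<in> N'" "x \<in> K" using K(2) unfolding N_def by auto
        then have "h x = H.B'.z" using N'(3) by blast
        then have "x \<in> Mm" using ker[OF \<open>x \<in> C\<close>] by blast
        then show "x \<in> {z}" using x M(3) by blast
      qed
    qed
    then show ?thesis using N by blast
  qed
qed

section \<open>From ideals of prime order in finite quotients to a supersoluble chain\<close>

context brace
begin

definition pstep :: "'a set \<Rightarrow> 'a set \<Rightarrow> bool" where
  "pstep I K \<longleftrightarrow> is_ideal C add mul K \<and> I \<subseteq> K \<and> (\<exists>g p. g \<in> K \<and> g \<notin> I \<and> prime (p::nat) \<and>
    zm (int p) g \<in> I \<and> (\<forall>x\<in>K. \<exists>n. add (neg (zm n g)) x \<in> I))"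

definition icstep :: "'a set \<Rightarrow> 'a set \<Rightarrow> bool" where
  "icstep I K \<longleftrightarrow> is_ideal C add mul K \<and> I \<subseteq> K \<and> in_soc_mod C add mul I K \<and>
    (\<exists>g\<in>K. (\<forall>x\<in>K. \<exists>n. add (neg (zm n g)) x \<in> I) \<and> (\<forall>n. n \<noteq> 0 \<longrightarrow> zm n g \<notin> I))"

abbreviation sreach :: "'a set \<Rightarrow> 'a set \<Rightarrow> bool" where
  "sreach \<equiv> (\<lambda>I K. pstep I K \<or> icstep I K)\<^sup>*\<^sup>*"

text \<open>The link between the two certificates: it follows from the positive one, and the
  negative one witnesses its failure.\<close>

definition prime_quotients :: bool where
  "prime_quotients \<longleftrightarrow> (\<forall>N. is_ideal C add mul N \<longrightarrow> fin_mod C add N C \<longrightarrow> N \<noteq> C \<longrightarrow> (\<exists>K. pstep N K))"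

lemma finite_between:
  assumes I: "asub I" and J: "J \<subseteq> C" "fin_mod C add I J"
  shows "finite {N. asub N \<and> I \<subseteq> N \<and> N \<subseteq> J}"
proof -
  have fin: "finite (cosets add J I)" using finite_cosets_iff[OF I J(1)] J(2) by blast
  have un: "\<Union> (cosets add N I) = N" if N: "asub N" "I \<subseteq> N" for N
  proof
    show "\<Union> (cosets add N I) \<subseteq> N"
    proof
      fix x assume "x \<in> \<Union> (cosets add N I)"
      then obtain y i where "y \<in> N" "i \<in> I" "x = add y i" unfolding cosets_def by blast
      then show "x \<in> N" using asubD(4)[OF N(1) _ subsetD[OF N(2)]] by simp
    qed
    show "N \<subseteq> \<Union> (cosets add N I)"
    proof
      fix x assume x: "x \<in> N"
      have "x = add x z" using asubD(3)[OF N(1) x] by simp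
      then have "x \<in> add x ` I" using asubD(2)[OF I] by (rule image_eqI)
      then show "x \<in> \<Union> (cosets add N I)" unfolding cosets_def using x by blast
    qed
  qed
  have "{N. asub N \<and> I \<subseteq> N \<and> N \<subseteq> J} \<subseteq> \<Union> ` Pow (cosets add J I)"
  proof
    fix N assume N: "N \<in> {N. asub N \<and> I \<subseteq> N \<and> N \<subseteq> J}"
    then have "cosets add N I \<in> Pow (cosets add J I)" unfolding cosets_def by blast
    moreover have "N = \<Union> (cosets add N I)" using un[of N] N by simp
    ultimately show "N \<in> \<Union> ` Pow (cosets add J I)" by blast
  qed
  then show ?thesis using fin by (meson finite_Pow_iff finite_surj)
qed

lemma avoid_finite_mod:
  assumes I: "is_ideal C add mul I" and J: "is_ideal C add mul J" "I \<subseteq> J" "fin_mod C add I J" "apc C add mul n J"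
  shows "\<exists>N. is_ideal C add mul N \<and> fin_mod C add N C \<and> N \<inter> J = I"
proof -
  obtain C' :: "'a set" and add' mul' h where h: "bhom C add mul C' add' mul' h"
    and ker: "\<And>x. x \<in> C \<Longrightarrow> h x = gid C' add' \<longleftrightarrow> x \<in> I" by (fact quotientE[OF I])
  interpret H: bhom C add mul C' add' mul' h by (rule h)
  have "finite (h ` J)" using H.fin_mod_kernel_iff[OF ker idealD(2)[OF J(1)]] J(3) by blast
  then obtain N' where N': "is_ideal C' add' mul' N'" "fin_mod C' add' N' C'" "N' \<inter> h ` J = {H.B'.z}"
    using avoid_finite_ideal[OF H.B'.brace_axioms H.image_ideal[OF J(1)] _ H.apc_image[OF J(4)]] by blast
  define N where "N = {x \<in> C. h x \<in> N'}"
  have "is_ideal C add mul N" "fin_mod C add N C"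
    unfolding N_def using H.preimage_ideal[OF N'(1)] H.fin_mod_preimage[OF N'(2)] by auto
  moreover have "N \<inter> J = I"
  proof
    show "N \<inter> J \<subseteq> I"
    proof
      fix x assume x: "x \<in> N \<inter> J"
      then have xC: "x \<in> C" "h x \<in> N' \<inter> h ` J" unfolding N_def by auto
      then have "h x = H.B'.z" using N'(3) by blast
      then show "x \<in> I" using ker[OF xC(1)] by blast
    qed
    show "I \<subseteq> N \<inter> J"
    proof
      fix x assume x: "x \<in> I"
      have xC: "x \<in> C" by (rule idealD(4)[OF I x])
      have "h x = H.B'.z" using ker[OF xC] x by blast
      then have "h x \<in> N'" using N'(3) by blast
      then show "x \<in> N \<inter> J" unfolding N_def using xC x J(2) by blast
    qed
  qed
  ultimately show ?thesis by blast
qed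

text \<open>In a quotient by an ideal \<open>N\<close> maximal subject to \<open>N \<inter> J = I\<close>, an ideal of prime order
  must meet the image of \<open>J\<close>.\<close>
lemma prime_step_in:
  assumes hp: prime_quotients and I: "is_ideal C add mul I"
    and J: "is_ideal C add mul J" "I \<subseteq> J" "I \<noteq> J" "fin_mod C add I J" "apc C add mul n J"
  shows "\<exists>K. pstep I K \<and> K \<subseteq> J"
proof -
  obtain N0 where N0: "is_ideal C add mul N0" "fin_mod C add N0 C" "N0 \<inter> J = I"
    using avoid_finite_mod[OF I J(1,2,4,5)] by blast
  \<comment> \<open>All candidates lie between \<open>N0\<close>, of finite index, and C; they are
    finitely many, so a maximal one exists.\<close>
  define fam where "fam = {N. is_ideal C add mul N \<and> N0 \<subseteq> N \<and> N \<inter> J = I}"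
  have "fam \<subseteq> {N. asub N \<and> N0 \<subseteq> N \<and> N \<subseteq> C}" unfolding fam_def using idealD(1,2) by blast
  then have "finite fam" using finite_between[OF idealD(1)[OF N0(1)] order_refl N0(2)] finite_subset by blast
  moreover have "N0 \<in> fam" unfolding fam_def using N0 by blast
  ultimately obtain N where N: "N \<in> fam" "\<And>M. M \<in> fam \<Longrightarrow> N \<subseteq> M \<Longrightarrow> N = M"
    using finite_has_maximal[of fam] by blast
  have Nid: "is_ideal C add mul N" "N0 \<subseteq> N" "N \<inter> J = I" using N(1) unfolding fam_def by blast+
  have "N \<noteq> C" using Nid(3) J(2,3) idealD(2)[OF J(1)] by blast
  then obtain K where K: "pstep N K"
    using hp fin_mod_mono[OF N0(2) Nid(2)] Nid(1) unfolding prime_quotients_def by blast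
  then obtain g p where g: "g \<in> K" "g \<notin> N" "prime (p::nat)" "zm (int p) g \<in> N"
    "\<forall>x\<in>K. \<exists>n. add (neg (zm n g)) x \<in> N" and Kid: "is_ideal C add mul K" "N \<subseteq> K"
    unfolding pstep_def by blast
  have gC: "g \<in> C" by (rule idealD(4)[OF Kid(1) g(1)])
  define K1 where "K1 = K \<inter> J"
  have K1: "is_ideal C add mul K1" unfolding K1_def by (rule ideal_Int[OF Kid(1) J(1)])
  have IK1: "I \<subseteq> K1" unfolding K1_def using Nid(3) Kid(2) by blast
  have "K1 \<noteq> I"
  proof
    assume "K1 = I"
    then have "K \<in> fam" unfolding fam_def K1_def using Kid Nid(2) by blast
    then have "N = K" using N(2)[of K] Kid(2) by blast
    then show False using g(1,2) by blast
  qed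
  then obtain g1 where g1: "g1 \<in> K1" "g1 \<notin> I" using IK1 by blast
  have g1': "g1 \<in> K" "g1 \<in> J" "g1 \<in> C" "g1 \<notin> N"
    using g1 Nid(3) idealD(4)[OF J(1)] unfolding K1_def by blast+
  obtain C' :: "'a set" and add' mul' h where h: "bhom C add mul C' add' mul' h"
    and ker: "\<And>x. x \<in> C \<Longrightarrow> h x = gid C' add' \<longleftrightarrow> x \<in> N" by (fact quotientE[OF Nid(1)])
  interpret H: bhom C add mul C' add' mul' h by (rule h)
  have cyc: "\<exists>n. h x = H.B'.zm n (h g)" if x: "x \<in> K" for x
  proof -
    obtain n where n: "add (neg (zm n g)) x \<in> N" using g(5) x by blast
    have xC: "x \<in> C" by (rule idealD(4)[OF Kid(1) x])
    have "h (zm n g) = h x"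
      using H.h_eq_iff[OF zm_closed[OF gC] xC, of n] ker[of "add (neg (zm n g)) x"] n xC zm_closed[OF gC, of n] by simp
    then show ?thesis using H.h_zm[OF gC] by metis
  qed
  have pg: "H.B'.zm (int p) (h g) = H.B'.z"
    using ker[OF zm_closed[OF gC, of "int p"]] g(4) H.h_zm[OF gC] by simp
  obtain n where n: "h g1 = H.B'.zm n (h g)" using cyc[OF g1'(1)] by blast
  have hgC: "h g \<in> C'" using gC by (rule H.h_in)
  have "\<not> int p dvd n"
  proof
    assume "int p dvd n"
    then obtain k where "n = int p * k" by (elim dvdE)
    then have "h g1 = H.B'.zm k (H.B'.zm (int p) (h g))" unfolding n by (simp only: H.B'.zm_zm[OF hgC])
    then have "h g1 = H.B'.z" unfolding pg using H.B'.A.grp.int_pow_one by simp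
    then show False using ker[OF g1'(3)] g1'(4) by blast
  qed
  then have "coprime (int p) n" using g(3) prime_imp_coprime[of "int p" n] by simp
  then obtain u y where uy: "u * int p + y * n = 1" using bezout_int[of "int p" n] by auto
  \<comment> \<open>\<open>h g1\<close> is a nonzero element of a group of prime order, so it
    generates it and \<open>h g\<close> is one of its multiples.\<close>
  have hg: "h g = H.B'.zm y (h g1)"
  proof -
    have "h g = H.B'.zm (int p * u + n * y) (h g)" using uy hgC by (simp add: mult.commute)
    also have "\<dots> = add' (H.B'.zm u (H.B'.zm (int p) (h g))) (H.B'.zm y (H.B'.zm n (h g)))"
      by (simp only: H.B'.zm_add[OF hgC] H.B'.zm_zm[OF hgC])
    also have "\<dots> = H.B'.zm y (h g1)" unfolding pg n using H.B'.A.grp.int_pow_one hgC by simp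
    finally show ?thesis .
  qed
  have hg1C: "h g1 \<in> C'" using g1'(3) by (rule H.h_in)
  have "\<exists>n. add (neg (zm n g1)) x \<in> I" if x: "x \<in> K1" for x
  proof -
    have x': "x \<in> K" "x \<in> J" "x \<in> C" using x idealD(4)[OF J(1)] unfolding K1_def by blast+
    obtain k where "h x = H.B'.zm k (h g)" using cyc[OF x'(1)] by blast
    then have "h x = H.B'.zm (y * k) (h g1)" unfolding hg by (simp only: H.B'.zm_zm[OF hg1C])
    then have "h (zm (y * k) g1) = h x" using H.h_zm[OF g1'(3)] by simp
    then have "add (neg (zm (y * k) g1)) x \<in> N"
      using H.h_eq_iff[OF zm_closed[OF g1'(3)] x'(3)] ker[of "add (neg (zm (y * k) g1)) x"] x'(3) zm_closed[OF g1'(3)] by simp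
    moreover have "add (neg (zm (y * k) g1)) x \<in> J"
      using idealD(5)[OF J(1) idealD(6)[OF J(1) asub_zm[OF idealD(1)[OF J(1)] g1'(2)]] x'(2)] .
    ultimately show ?thesis using Nid(3) by blast
  qed
  moreover have "zm (int p) g1 \<in> I"
  proof -
    have "h (zm (int p) g1) = H.B'.zm n (H.B'.zm (int p) (h g))"
      unfolding H.h_zm[OF g1'(3)] n by (simp only: H.B'.zm_zm[OF hgC] mult.commute)
    also have "\<dots> = H.B'.z" unfolding pg using H.B'.A.grp.int_pow_one by simp
    finally have "zm (int p) g1 \<in> N" using ker[OF zm_closed[OF g1'(3)]] by blast
    then show ?thesis using asub_zm[OF idealD(1)[OF J(1)] g1'(2)] Nid(3) by blast
  qed
  ultimately have "pstep I K1" unfolding pstep_def using K1 IK1 g1 g(3) by blast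
  moreover have "K1 \<subseteq> J" unfolding K1_def by blast
  ultimately show ?thesis by blast
qed

text \<open>Steps of prime order are repeated inside J; the number of additive subgroups between I
  and J is finite and drops each time.\<close>

lemma finite_reach:
  assumes hp: prime_quotients and J: "is_ideal C add mul J" "apc C add mul n J"
    and I: "is_ideal C add mul I" "I \<subseteq> J" "fin_mod C add I J"
  shows "sreach I J"
  using I
proof (induction "card {N. asub N \<and> I \<subseteq> N \<and> N \<subseteq> J}" arbitrary: I rule: less_induct)
  case less
  show ?case
  proof (cases "I = J")
    case False
    obtain K where K: "pstep I K" "K \<subseteq> J"
      using prime_step_in[OF hp less.prems(1) J(1) less.prems(2) False less.prems(3) J(2)] by blast
    have Kid: "is_ideal C add mul K" "I \<subseteq> K" using K(1) unfolding pstep_def by blast+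
    have ne: "K \<noteq> I" using K(1) unfolding pstep_def by blast
    have "{N. asub N \<and> K \<subseteq> N \<and> N \<subseteq> J} \<subset> {N. asub N \<and> I \<subseteq> N \<and> N \<subseteq> J}"
    proof
      show "{N. asub N \<and> K \<subseteq> N \<and> N \<subseteq> J} \<subseteq> {N. asub N \<and> I \<subseteq> N \<and> N \<subseteq> J}" using Kid(2) by blast
      have "I \<in> {N. asub N \<and> I \<subseteq> N \<and> N \<subseteq> J}" using idealD(1)[OF less.prems(1)] less.prems(2) by blast
      moreover have "I \<notin> {N. asub N \<and> K \<subseteq> N \<and> N \<subseteq> J}" using ne Kid(2) by blast
      ultimately show "{N. asub N \<and> K \<subseteq> N \<and> N \<subseteq> J} \<noteq> {N. asub N \<and> I \<subseteq> N \<and> N \<subseteq> J}" by blast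
    qed
    moreover have "finite {N. asub N \<and> I \<subseteq> N \<and> N \<subseteq> J}"
      by (rule finite_between[OF idealD(1)[OF less.prems(1)] idealD(2)[OF J(1)] less.prems(3)])
    ultimately have "card {N. asub N \<and> K \<subseteq> N \<and> N \<subseteq> J} < card {N. asub N \<and> I \<subseteq> N \<and> N \<subseteq> J}"
      by (rule psubset_card_mono[rotated])
    then have "sreach K J" using less.hyps Kid(1) K(2) fin_mod_mono[OF less.prems(3) Kid(2)] by blast
    with disjI1[OF K(1)] show ?thesis by (rule converse_rtranclp_into_rtranclp)
  qed simp
qed

text \<open>The coordinates \<open>S\<close> measure the rank of \<open>J / I\<close>; each common eigenvector eliminates one.\<close>
lemma soc_reach_aux:
  fixes \<phi> :: "'a \<Rightarrow> zvec"
  assumes hp: prime_quotients and J: "is_ideal C add mul J" "apc C add mul n J"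
    and S: "finite S"
    and I: "is_ideal C add mul I" "I \<subseteq> J" "in_soc_mod C add mul I J" "fg_mod C add I J"
    and "e > 0" "\<And>x i. x \<in> J \<Longrightarrow> i \<notin> S \<Longrightarrow> \<phi> x i = 0"
    "\<And>x y. x \<in> J \<Longrightarrow> y \<in> J \<Longrightarrow> \<phi> (add x y) = \<phi> x + \<phi> y" "\<And>x. x \<in> I \<Longrightarrow> \<phi> x = 0"
    "\<And>x. x \<in> J \<Longrightarrow> \<phi> x = 0 \<Longrightarrow> zm e x \<in> I"
  shows "sreach I J"
  using S I assms(9-)
proof (induction "card S" arbitrary: S I \<phi> e rule: less_induct)
  case less
  note I = less.prems(2-5)
  note e = less.prems(6) and supp = less.prems(7) and padd = less.prems(8) and pI = less.prems(9) and pker = less.prems(10)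
  have aJ: "asub J" by (rule idealD(1)[OF J(1)])
  note JC = asubD[OF aJ]
  have pz: "\<phi> (zm n x) = zsm n (\<phi> x)" if "x \<in> J" for n x
    by (rule additive_zm[where \<phi> = \<phi>, OF aJ padd that])
  have pn: "\<phi> (neg x) = - \<phi> x" if "x \<in> J" for x
    by (rule additive_neg[where \<phi> = \<phi>, OF aJ padd that])
  have pdiff: "\<phi> (add (neg x) y) = \<phi> y - \<phi> x" if "x \<in> J" "y \<in> J" for x y
    using padd[OF JC(5)[OF that(1)] that(2)] pn[OF that(1)] by simp
  have sub_ideal: "is_ideal C add mul K" if K: "asub K" "I \<subseteq> K" "K \<subseteq> J" "\<And>b x. b \<in> C \<Longrightarrow> x \<in> K \<Longrightarrow> lam b x \<in> K" for K
    by (rule soc_mod_ideal[OF I(1) K(1,2) in_soc_mod_mono[OF I(3) order_refl K(3)] K(4)])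
  have lamJ: "lam b x \<in> J" if "b \<in> C" "x \<in> J" for b x by (rule idealD(9)[OF J(1) that])
  \<comment> \<open>The torsion part of J over I. It is passed first, through
    \<open>finite_reach\<close>; modulo T the map \<phi> is injective on J.\<close>
  define T where "T = {x \<in> J. \<phi> x = 0}"
  have aT: "asub T"
    unfolding asub_def T_def using JC padd pn pI idealD(3)[OF I(1)] by auto
  have IT: "I \<subseteq> T" unfolding T_def using I(2) pI by blast
  have TJ: "T \<subseteq> J" unfolding T_def by blast
  have lamT: "lam b x \<in> T" if b: "b \<in> C" and x: "x \<in> T" for b x
  proof -
    have xJ: "x \<in> J" "\<phi> x = 0" using x unfolding T_def by auto
    have "zm e (lam b x) = lam b (zm e x)" by (rule lam_zm[OF b JC(3)[OF xJ(1)], symmetric])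
    also have "\<dots> \<in> I" by (rule idealD(9)[OF I(1) b pker[OF xJ]])
    finally have "\<phi> (zm e (lam b x)) = 0" by (rule pI)
    then have "zsm e (\<phi> (lam b x)) = 0" unfolding pz[OF lamJ[OF b xJ(1)]] .
    then show ?thesis unfolding T_def using e lamJ[OF b xJ(1)] by (simp add: zsm_eq_0)
  qed
  have T: "is_ideal C add mul T" by (rule sub_ideal[OF aT IT TJ lamT])
  have TsJ: "in_soc_mod C add mul T J" "fg_mod C add T J"
    using in_soc_mod_mono[OF I(3) IT order_refl] fg_mod_mono[OF I(4) IT] by auto
  \<comment> \<open>\<open>Q\<close> is I + eJ. J/Q is finitely generated torsion, hence finite; and
    Q meets T in I, since e x in T forces \<phi> x = 0 and so e x in I. Thus T/I embeds into
    J/Q.\<close>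
  have "fin_mod C add I T"
  proof -
    obtain C' :: "'a set" and add' mul' h where h: "bhom C add mul C' add' mul' h"
      and ker: "\<And>x. x \<in> C \<Longrightarrow> h x = gid C' add' \<longleftrightarrow> x \<in> I" by (fact quotientE[OF I(1)])
    interpret H: bhom C add mul C' add' mul' h by (rule h)
    have hJ: "h ` J \<subseteq> H.B'.soc" using H.in_soc_mod_iff[OF ker JC(1)] I(3) by blast
    have hcomm: "add' (h x) (h y) = add' (h y) (h x)" if "x \<in> J" "y \<in> J" for x y
      using H.B'.socD(3)[of "h x" "h y"] hJ that JC(3) by blast
    define Q where "Q = {y \<in> J. \<exists>x\<in>J. h y = H.B'.zm e (h x)}"
    have aQ: "asub Q"
      unfolding asub_def
    proof (intro conjI ballI)
      show "Q \<subseteq> C" unfolding Q_def using JC(3) by blast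
      have "h z = H.B'.zm e (h z)" using H.B'.A.grp.int_pow_one by simp
      then show "z \<in> Q" unfolding Q_def using JC(2) by blast
    next
      fix x y assume "x \<in> Q" "y \<in> Q"
      then obtain x' y' where xy: "x \<in> J" "y \<in> J" "x' \<in> J" "y' \<in> J" "h x = H.B'.zm e (h x')" "h y = H.B'.zm e (h y')"
        unfolding Q_def by blast
      have "H.B'.zm e (add' (h x') (h y')) = add' (H.B'.zm e (h x')) (H.B'.zm e (h y'))"
        using xy JC(3) by (intro H.B'.zm_add_commute hcomm) auto
      then have "h (add x y) = H.B'.zm e (h (add x' y'))" using xy JC(3) by (simp add: H.h_add)
      then show "add x y \<in> Q" unfolding Q_def using JC(4) xy by blast
    next
      fix x assume "x \<in> Q"
      then obtain x' where xy: "x \<in> J" "x' \<in> J" "h x = H.B'.zm e (h x')" unfolding Q_def by blast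
      have x'C: "h x' \<in> C'" using JC(3)[OF xy(2)] by (rule H.h_in)
      have "h (neg x) = H.B'.zm (- e) (h x')"
        using H.h_neg[OF JC(3)[OF xy(1)]] xy(3) H.B'.zm_minus[OF x'C] by simp
      also have "\<dots> = H.B'.zm e (H.B'.zm (- 1) (h x'))" by (simp add: H.B'.zm_zm[OF x'C])
      also have "\<dots> = H.B'.zm e (h (neg x'))"
        using H.B'.zm_minus[OF x'C, of 1] x'C H.h_neg[OF JC(3)[OF xy(2)]] by simp
      finally show "neg x \<in> Q" unfolding Q_def using JC(5) xy by blast
    qed
    have IQ: "I \<subseteq> Q"
    proof
      fix x assume x: "x \<in> I"
      then have "h x = H.B'.z" using ker[OF idealD(4)[OF I(1) x]] by blast
      then have "h x = H.B'.zm e (h z)" using H.B'.A.grp.int_pow_one by simp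
      then show "x \<in> Q" unfolding Q_def using x I(2) JC(2) by blast
    qed
    have QJ: "Q \<subseteq> J" unfolding Q_def by blast
    have "lam b x \<in> Q" if b: "b \<in> C" and x: "x \<in> Q" for b x
    proof -
      obtain x' where xy: "x \<in> J" "x' \<in> J" "h x = H.B'.zm e (h x')" using x unfolding Q_def by blast
      have C: "x \<in> C" "x' \<in> C" using xy JC(3) by blast+
      have "h (lam b x) = H.B'.zm e (h (lam b x'))"
        using H.h_lam[OF b C(1)] H.h_lam[OF b C(2)] H.B'.lam_zm[OF H.h_in[OF b] H.h_in[OF C(2)]] xy(3) by simp
      then show ?thesis unfolding Q_def using lamJ[OF b] xy by blast
    qed
    then have Q: "is_ideal C add mul Q" by (rule sub_ideal[OF aQ IQ QJ])
    have "zm e a \<in> Q" if a: "a \<in> J" for a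
    proof -
      have "h (zm e a) = H.B'.zm e (h a)" by (rule H.h_zm[OF JC(3)[OF a]])
      then show ?thesis unfolding Q_def using asub_zm[OF aJ a] a by blast
    qed
    then have tor: "\<exists>n>0. zm n a \<in> Q" if "a \<in> J" for a using e that by blast
    have "fin_mod C add Q J"
      by (rule fin_mod_torsion[OF Q aJ QJ in_soc_mod_mono[OF I(3) IQ order_refl] fg_mod_mono[OF I(4) IQ] tor])
    then have "fin_mod C add Q T" by (rule fin_mod_subset[OF aQ TJ JC(1)])
    then obtain F where F: "finite F" "F \<subseteq> T" "\<forall>x\<in>T. \<exists>f\<in>F. add (neg f) x \<in> Q" unfolding fin_mod_def by blast
    have QT: "y \<in> I" if y: "y \<in> Q" "y \<in> T" for y
    proof -
      obtain x where x: "x \<in> J" "h y = H.B'.zm e (h x)" using y(1) unfolding Q_def by blast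
      have yJ: "y \<in> J" "\<phi> y = 0" using y(2) unfolding T_def by auto
      have C: "zm e x \<in> C" "y \<in> C" using x(1) yJ(1) JC(3) by auto
      have "h (zm e x) = h y" using x H.h_zm[OF JC(3)[OF x(1)]] by simp
      then have d: "add (neg (zm e x)) y \<in> I" using H.h_eq_iff[OF C] ker[of "add (neg (zm e x)) y"] C by simp
      then have "\<phi> y - \<phi> (zm e x) = 0" using pI pdiff[OF asub_zm[OF aJ x(1)] yJ(1)] by metis
      then have "zsm e (\<phi> x) = 0" using yJ(2) pz[OF x(1)] by simp
      then have "\<phi> x = 0" using e by (simp add: zsm_eq_0)
      then have "zm e x \<in> I" by (rule pker[OF x(1)])
      then have "add (zm e x) (add (neg (zm e x)) y) \<in> I" using idealD(5)[OF I(1) _ d] by blast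
      then show ?thesis using C by simp
    qed
    have "\<exists>f\<in>F. add (neg f) x \<in> I" if x: "x \<in> T" for x
    proof -
      obtain f where f: "f \<in> F" "add (neg f) x \<in> Q" using F(3) x by blast
      have "add (neg f) x \<in> T" using asubD(4)[OF aT asubD(5)[OF aT subsetD[OF F(2) f(1)]] x] .
      then show ?thesis using QT f by blast
    qed
    then show ?thesis unfolding fin_mod_def using F(1,2) by blast
  qed
  moreover have "apc C add mul (Suc n) T" using apc.apc_step[OF J(1) TJ _ J(2)] TsJ by blast
  ultimately have rT: "sreach I T" using finite_reach[OF hp T _ I(1) IT] by blast
  show ?case
  proof (cases "T = J")
    case True
    then show ?thesis using rT by simp
  next
    case False
    define X where "X = \<phi> ` J"
    \<comment> \<open>\<lambda>_b transported along \<phi> by a chosen preimage; the choice does not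
      matter because T is \<lambda>-stable.\<close>
    define act where "act b v = \<phi> (lam b (SOME x. x \<in> J \<and> \<phi> x = v))" for b v
    have act: "act b (\<phi> x) = \<phi> (lam b x)" if b: "b \<in> C" and x: "x \<in> J" for b x
    proof -
      define y where "y = (SOME y. y \<in> J \<and> \<phi> y = \<phi> x)"
      have y: "y \<in> J \<and> \<phi> y = \<phi> x" unfolding y_def by (rule someI[of _ x]) (use x in blast)
      have "add (neg x) y \<in> T" unfolding T_def using pdiff[OF x] y JC(4)[OF JC(5)[OF x]] by simp
      then have "lam b (add (neg x) y) \<in> T" by (rule lamT[OF b])
      moreover have "lam b (add (neg x) y) = add (neg (lam b x)) (lam b y)"
        using b x y JC(3) by (simp add: lam_add lam_neg)
      ultimately have "\<phi> (lam b y) - \<phi> (lam b x) = 0"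
        using pdiff[OF lamJ[OF b x] lamJ[OF b]] y unfolding T_def by simp
      then show ?thesis unfolding act_def y_def[symmetric] by simp
    qed
    have zX: "zsub X"
      unfolding zsub_def
    proof (intro conjI ballI)
      have "\<phi> z = 0" using pI idealD(3)[OF I(1)] by blast
      then show "0 \<in> X" unfolding X_def using JC(2) by (metis imageI)
      fix u v assume "u \<in> X" "v \<in> X"
      then obtain x y where xy: "x \<in> J" "y \<in> J" "u = \<phi> x" "v = \<phi> y" unfolding X_def by blast
      then have "u - v = \<phi> (add (neg y) x)" using pdiff by simp
      then show "u - v \<in> X" unfolding X_def using JC(4)[OF JC(5)[OF xy(2)] xy(1)] by (rule image_eqI)
    qed
    interpret LA: lattice_action S X C mul iv act
    proof
      show "finite S" by (rule less.prems(1))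
      show "zsub X" by (rule zX)
      show "v i = 0" if "v \<in> X" "i \<notin> S" for v i using that supp unfolding X_def by blast
      show "zadd X (act g)" if g: "g \<in> C" for g
        unfolding zadd_def
      proof (intro conjI ballI)
        fix u assume "u \<in> X"
        then obtain x where x: "x \<in> J" "u = \<phi> x" unfolding X_def by blast
        show "act g u \<in> X" unfolding x(2) act[OF g x(1)] X_def using lamJ[OF g x(1)] by (rule imageI)
        fix v assume "v \<in> X"
        then obtain y where y: "y \<in> J" "v = \<phi> y" unfolding X_def by blast
        have "act g (u + v) = \<phi> (lam g (add x y))" unfolding x(2) y(2) padd[OF x(1) y(1), symmetric]
          by (rule act[OF g JC(4)[OF x(1) y(1)]])
        also have "\<dots> = \<phi> (lam g x) + \<phi> (lam g y)"
          unfolding lam_add[OF g JC(3)[OF x(1)] JC(3)[OF y(1)]] by (rule padd[OF lamJ[OF g x(1)] lamJ[OF g y(1)]])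
        finally show "act g (u + v) = act g u + act g v" unfolding x(2) y(2) act[OF g x(1)] act[OF g y(1)] .
      qed
      show "mul g h \<in> C" if "g \<in> C" "h \<in> C" for g h using that by simp
      show "act (mul g h) x = act g (act h x)" if g: "g \<in> C" and h: "h \<in> C" and x: "x \<in> X" for g h x
      proof -
        obtain y where y: "y \<in> J" "x = \<phi> y" using x unfolding X_def by blast
        show ?thesis unfolding y(2) act[OF h y(1)] act[OF g lamJ[OF h y(1)]] act[OF M.grp.m_closed[OF g h] y(1)]
            lam_mul[OF g h JC(3)[OF y(1)]] ..
      qed
      show "iv g \<in> C" if "g \<in> C" for g using that by simp
      show "act (iv g) (act g x) = x" "act g (act (iv g) x) = x" if g: "g \<in> C" and x: "x \<in> X" for g x
      proof -
        obtain y where y: "y \<in> J" "x = \<phi> y" using x unfolding X_def by blast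
        have ig: "iv g \<in> C" using g by simp
        show "act (iv g) (act g x) = x" "act g (act (iv g) x) = x"
          unfolding y(2) act[OF g y(1)] act[OF ig y(1)] act[OF ig lamJ[OF g y(1)]] act[OF g lamJ[OF ig y(1)]]
          using g JC(3)[OF y(1)] by simp_all
      qed
    qed
    obtain x0 where x0: "x0 \<in> J" "\<phi> x0 \<noteq> 0" using False unfolding T_def by blast
    \<comment> \<open>A stable L containing pX pulls back to an ideal K of finite index in J. An
      ideal of prime order over K, inside J, supplies the vector on which all \<lambda>_b are scalar
      modulo L.\<close>
    have step: "\<forall>L. LA.inv_sub L \<longrightarrow> L \<noteq> X \<longrightarrow> (\<forall>x\<in>X. zsm p x \<in> L) \<longrightarrow>
        (\<exists>v\<in>X - L. \<forall>g\<in>C. \<exists>c. act g v - zsm c v \<in> L)" if p: "prime p" for p :: int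
    proof (intro allI impI)
      fix L assume L: "LA.inv_sub L" "L \<noteq> X" "\<forall>x\<in>X. zsm p x \<in> L"
      have Ls: "zsub L" "L \<subseteq> X" "\<And>g x. g \<in> C \<Longrightarrow> x \<in> L \<Longrightarrow> act g x \<in> L"
        using L(1) unfolding LA.inv_sub_def by blast+
      define K where "K = {x \<in> J. \<phi> x \<in> L}"
      have aK: "asub K"
        unfolding asub_def K_def
        using JC padd pn pI[OF idealD(3)[OF I(1)]] zsub_0[OF Ls(1)] zsub_add[OF Ls(1)] zsub_minus[OF Ls(1)] by auto
      have IK: "I \<subseteq> K" unfolding K_def using I(2) pI zsub_0[OF Ls(1)] by auto
      have KJ: "K \<subseteq> J" unfolding K_def by blast
      have lamK: "lam b x \<in> K" if b: "b \<in> C" and x: "x \<in> K" for b x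
        using Ls(3)[OF b, of "\<phi> x"] act[OF b, of x] lamJ[OF b, of x] x unfolding K_def by simp
      have K: "is_ideal C add mul K" by (rule sub_ideal[OF aK IK KJ lamK])
      have "zm p a \<in> K" if a: "a \<in> J" for a
        unfolding K_def using asub_zm[OF aJ a] pz[OF a] L(3) a unfolding X_def by auto
      then have tor: "\<exists>n>0. zm n a \<in> K" if "a \<in> J" for a using that p prime_gt_0_int by blast
      have fin: "fin_mod C add K J"
        by (rule fin_mod_torsion[OF K aJ KJ in_soc_mod_mono[OF I(3) IK order_refl] fg_mod_mono[OF I(4) IK] tor])
      have "K \<noteq> J"
      proof
        assume "K = J"
        then have "X \<subseteq> L" unfolding X_def K_def by blast
        then show False using L(2) Ls(2) by blast
      qed
      then obtain K2 where K2: "pstep K K2" "K2 \<subseteq> J" using prime_step_in[OF hp K J(1) KJ _ fin J(2)] by blast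
      then obtain g where g: "g \<in> K2" "g \<notin> K" "\<forall>x\<in>K2. \<exists>n. add (neg (zm n g)) x \<in> K" and K2id: "is_ideal C add mul K2"
        unfolding pstep_def by blast
      have gJ: "g \<in> J" using g(1) K2(2) by blast
      have "\<exists>c. act b (\<phi> g) - zsm c (\<phi> g) \<in> L" if b: "b \<in> C" for b
      proof -
        have lg: "lam b g \<in> K2" by (rule idealD(9)[OF K2id b g(1)])
        then obtain n where n: "add (neg (zm n g)) (lam b g) \<in> K" using g(3) by blast
        have "\<phi> (add (neg (zm n g)) (lam b g)) = \<phi> (lam b g) - zsm n (\<phi> g)"
          using pdiff[OF asub_zm[OF aJ gJ] lamJ[OF b gJ]] pz[OF gJ] by simp
        then have "\<phi> (lam b g) - zsm n (\<phi> g) \<in> L" using n unfolding K_def by simp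
        then show ?thesis unfolding act[OF b gJ] by blast
      qed
      moreover have "\<phi> g \<in> X - L" using g(2) gJ unfolding K_def X_def by blast
      ultimately show "\<exists>v\<in>X - L. \<forall>g\<in>C. \<exists>c. act g v - zsm c v \<in> L" by blast
    qed
    have "\<phi> x0 \<in> X" unfolding X_def using x0(1) by (rule imageI)
    then obtain v where v: "v \<in> X" "v \<noteq> 0" "\<forall>g\<in>C. \<exists>c. act g v = zsm c v"
      using LA.common_eigenvector[OF _ x0(2) step] by blast
    then obtain g where g: "g \<in> J" "v = \<phi> g" unfolding X_def by blast
    have g0: "\<phi> g \<noteq> 0" using v(2) g(2) by simp
    \<comment> \<open>The integer multiples of the common eigenvector, pulled back to J: K/T is
      infinite cyclic, generated by g.\<close>
    define K where "K = {x \<in> J. \<exists>n. \<phi> x = zsm n (\<phi> g)}"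
    have aK: "asub K"
      unfolding asub_def
    proof (intro conjI ballI)
      show "K \<subseteq> C" unfolding K_def using JC(3) by blast
      have "\<phi> z = zsm 0 (\<phi> g)" using pI[OF idealD(3)[OF I(1)]] by simp
      then show "z \<in> K" unfolding K_def using JC(2) by blast
    next
      fix x y assume "x \<in> K" "y \<in> K"
      then obtain k l where kl: "x \<in> J" "y \<in> J" "\<phi> x = zsm k (\<phi> g)" "\<phi> y = zsm l (\<phi> g)" unfolding K_def by blast
      then have "\<phi> (add x y) = zsm (k + l) (\<phi> g)" using padd by (simp add: zsm_add_left)
      then show "add x y \<in> K" unfolding K_def using JC(4)[OF kl(1,2)] by blast
    next
      fix x assume "x \<in> K"
      then obtain k where k: "x \<in> J" "\<phi> x = zsm k (\<phi> g)" unfolding K_def by blast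
      then have "\<phi> (neg x) = zsm (- k) (\<phi> g)" using pn by (simp add: zsm_minus_left)
      then show "neg x \<in> K" unfolding K_def using JC(5)[OF k(1)] by blast
    qed
    have TK: "T \<subseteq> K"
    proof
      fix x assume "x \<in> T"
      then have "x \<in> J" "\<phi> x = zsm 0 (\<phi> g)" unfolding T_def by auto
      then show "x \<in> K" unfolding K_def by blast
    qed
    have KJ: "K \<subseteq> J" unfolding K_def by blast
    have IK: "I \<subseteq> K" using IT TK by blast
    have lamK: "lam b x \<in> K" if b: "b \<in> C" and x: "x \<in> K" for b x
    proof -
      obtain k where k: "x \<in> J" "\<phi> x = zsm k (\<phi> g)" using x unfolding K_def by blast
      obtain c where c: "act b (\<phi> g) = zsm c (\<phi> g)" using v(3) b g(2) by blast
      have "\<phi> x = \<phi> (zm k g)" using k(2) pz[OF g(1)] by simp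
      then have "\<phi> (lam b x) = act b (\<phi> (zm k g))" using act[OF b k(1)] by simp
      also have "\<dots> = \<phi> (zm k (lam b g))" using act[OF b asub_zm[OF aJ g(1)]] lam_zm[OF b JC(3)[OF g(1)]] by simp
      also have "\<dots> = zsm k (act b (\<phi> g))" unfolding pz[OF lamJ[OF b g(1)]] act[OF b g(1)] ..
      finally have "\<phi> (lam b x) = zsm (k * c) (\<phi> g)" unfolding c by simp
      then show ?thesis unfolding K_def using lamJ[OF b k(1)] by blast
    qed
    have K: "is_ideal C add mul K" by (rule sub_ideal[OF aK IK KJ lamK])
    have gK: "g \<in> K"
    proof -
      have "\<phi> g = zsm 1 (\<phi> g)" by simp
      then show ?thesis unfolding K_def using g(1) by blast
    qed
    have "\<exists>n. add (neg (zm n g)) x \<in> T" if x: "x \<in> K" for x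
    proof -
      obtain k where k: "x \<in> J" "\<phi> x = zsm k (\<phi> g)" using x unfolding K_def by blast
      have "\<phi> (add (neg (zm k g)) x) = 0" using pdiff[OF asub_zm[OF aJ g(1)] k(1)] pz[OF g(1)] k(2) by simp
      then show ?thesis unfolding T_def using JC(4)[OF JC(5)[OF asub_zm[OF aJ g(1)]] k(1)] by blast
    qed
    moreover have "zm n g \<notin> T" if "n \<noteq> 0" for n
      unfolding T_def using pz[OF g(1)] that g0 by (simp add: zsm_eq_0)
    ultimately have ic: "icstep T K"
      unfolding icstep_def using K TK in_soc_mod_mono[OF TsJ(1) order_refl KJ] gK by blast
    obtain s where s: "\<phi> g s \<noteq> 0" using g0 by (auto simp: fun_eq_iff zero_fun_apply)
    define a where "a = \<phi> g s"
    \<comment> \<open>A homomorphism that vanishes on K and has coordinate \<open>s\<close> zero, so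
      it lives on S without s. Where it vanishes on J, the multiple a x lies in K; hence |a| is the
      new exponent.\<close>
    define \<psi> where "\<psi> x = zsm a (\<phi> x) - zsm (\<phi> x s) (\<phi> g)" for x
    have sS: "s \<in> S" using supp[OF g(1)] s by blast
    have "sreach K J"
    proof (rule less.hyps[of "S - {s}" K "\<bar>a\<bar>" \<psi>])
      show "card (S - {s}) < card S" using less.prems(1) sS by (meson card_Diff1_less)
      show "finite (S - {s})" using less.prems(1) by simp
      show "in_soc_mod C add mul K J" "fg_mod C add K J"
        using in_soc_mod_mono[OF I(3) IK order_refl] fg_mod_mono[OF I(4) IK] by auto
      show "\<bar>a\<bar> > 0" using s by (simp add: a_def)
      show "\<psi> x i = 0" if "x \<in> J" "i \<notin> S - {s}" for x i
        using supp[OF that(1), of i] supp[OF g(1), of i] that(2)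
        by (cases "i = s") (auto simp: \<psi>_def a_def zvec_apply)
      show "\<psi> (add x y) = \<psi> x + \<psi> y" if "x \<in> J" "y \<in> J" for x y
        unfolding \<psi>_def padd[OF that] by (simp add: zsm_add_right zsm_add_left plus_fun_apply)
      show "\<psi> x = 0" if "x \<in> K" for x
        using that unfolding K_def \<psi>_def by (auto simp: a_def zsm_apply mult.commute)
      show "zm \<bar>a\<bar> x \<in> K" if x: "x \<in> J" "\<psi> x = 0" for x
      proof -
        have "zsm a (\<phi> x) = zsm (\<phi> x s) (\<phi> g)" using x(2) unfolding \<psi>_def by simp
        then have "\<phi> (zm a x) = zsm (\<phi> x s) (\<phi> g)" using pz[OF x(1)] by simp
        then have "zm a x \<in> K" unfolding K_def using asub_zm[OF aJ x(1)] by blast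
        then have "zm (sgn a) (zm a x) \<in> K" by (rule asub_zm[OF aK])
        then show ?thesis unfolding zm_zm[OF JC(3)[OF x(1)]] by (simp add: mult_sgn_abs abs_sgn)
      qed
    qed (rule K, rule KJ)
    with disjI2[OF ic] have "sreach T J" by (rule converse_rtranclp_into_rtranclp)
    with rT show ?thesis by (rule rtranclp_trans)
  qed
qed

lemma soc_reach:
  assumes hp: prime_quotients and J: "is_ideal C add mul J" "apc C add mul n J"
    and I: "is_ideal C add mul I" "I \<subseteq> J" "in_soc_mod C add mul I J" "fg_mod C add I J"
  shows "sreach I J"
proof -
  obtain S :: "nat set" and \<phi> :: "'a \<Rightarrow> zvec" and e where L: "finite S \<and> e > 0 \<and> (\<forall>x\<in>J. \<forall>i. i \<notin> S \<longrightarrow> \<phi> x i = 0) \<and>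
    (\<forall>x\<in>J. \<forall>y\<in>J. \<phi> (add x y) = \<phi> x + \<phi> y) \<and> (\<forall>x\<in>I. \<phi> x = 0) \<and> (\<forall>x\<in>J. \<phi> x = 0 \<longrightarrow> zm e x \<in> I)"
    using lattice_embedding_mod[OF I(1) idealD(1)[OF J(1)] I(2-4)] by (elim exE)
  show ?thesis
    by (rule soc_reach_aux[where \<phi> = \<phi> and S = S and e = e, OF hp J _ I]) (use L in simp_all)
qed

theorem apc_reach:
  assumes hp: prime_quotients and "apc C add mul n I" "is_ideal C add mul I"
  shows "sreach I C"
  using assms(2,3)
proof induction
  case (apc_step K J n)
  have "sreach J K"
    using apc_step.hyps(3)
  proof
    assume "in_soc_mod C add mul J K \<and> fg_mod C add J K"
    then show ?thesis using soc_reach[OF hp apc_step.hyps(1,4) apc_step.prems apc_step.hyps(2)] by blast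
  next
    assume "fin_mod C add J K"
    then show ?thesis by (rule finite_reach[OF hp apc_step.hyps(1,4) apc_step.prems apc_step.hyps(2)])
  qed
  also have "sreach K C" by (rule apc_step.IH[OF apc_step.hyps(1)])
  finally show ?case .
qed simp

end

section \<open>Chains of ideals and cyclic factors of prime order\<close>

lemma ideal_chain_iff:
  "ideal_chain C add mul step \<longleftrightarrow>
    is_ideal C add mul {gid C add} \<and>
    (\<lambda>I J. is_ideal C add mul J \<and> I \<subseteq> J \<and> step I J)\<^sup>*\<^sup>* {gid C add} C"
  (is "_ \<longleftrightarrow> _ \<and> ?R\<^sup>*\<^sup>* _ _")
proof
  assume "ideal_chain C add mul step"
  then obtain L where L: "L \<noteq> []" "hd L = {gid C add}" "last L = C" "\<forall>I\<in>set L. is_ideal C add mul I"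
    "\<forall>i. Suc i < length L \<longrightarrow> L ! i \<subseteq> L ! Suc i \<and> step (L ! i) (L ! Suc i)"
    unfolding ideal_chain_def by blast
  have "i < length L \<longrightarrow> ?R\<^sup>*\<^sup>* (L ! 0) (L ! i)" for i
  proof (induction i)
    case (Suc i)
    show ?case
    proof
      assume i: "Suc i < length L"
      then have "?R\<^sup>*\<^sup>* (L ! 0) (L ! i)" using Suc by simp
      moreover have "?R (L ! i) (L ! Suc i)" using L(4,5) i by simp
      ultimately show "?R\<^sup>*\<^sup>* (L ! 0) (L ! Suc i)" by (rule rtranclp.rtrancl_into_rtrancl)
    qed
  qed simp
  from this[of "length L - 1"] have "?R\<^sup>*\<^sup>* (hd L) (last L)"
    using L(1) by (simp add: hd_conv_nth last_conv_nth)
  moreover have "is_ideal C add mul (hd L)" using L(1,4) by simp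
  ultimately show "is_ideal C add mul {gid C add} \<and> ?R\<^sup>*\<^sup>* {gid C add} C" unfolding L(2,3) by blast
next
  assume A: "is_ideal C add mul {gid C add} \<and> ?R\<^sup>*\<^sup>* {gid C add} C"
  have "\<exists>L. L \<noteq> [] \<and> hd L = I \<and> last L = J \<and> (\<forall>I\<in>set L. is_ideal C add mul I) \<and>
      (\<forall>i. Suc i < length L \<longrightarrow> L ! i \<subseteq> L ! Suc i \<and> step (L ! i) (L ! Suc i))"
    if "?R\<^sup>*\<^sup>* I J" "is_ideal C add mul I" for I J
    using that
  proof (induction rule: converse_rtranclp_induct)
    case base
    then show ?case by (intro exI[of _ "[J]"]) auto
  next
    case (step I K)
    then obtain L where L: "L \<noteq> []" "hd L = K" "last L = J" "\<forall>I\<in>set L. is_ideal C add mul I"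
      "\<forall>i. Suc i < length L \<longrightarrow> L ! i \<subseteq> L ! Suc i \<and> step (L ! i) (L ! Suc i)" by blast
    have "(I # L) ! i \<subseteq> (I # L) ! Suc i \<and> step ((I # L) ! i) ((I # L) ! Suc i)" if "Suc i < length (I # L)" for i
      using that L step.hyps(1) by (cases i) (auto simp: hd_conv_nth)
    then show ?case using L step.prems by (intro exI[of _ "I # L"]) auto
  qed
  then show "ideal_chain C add mul step" unfolding ideal_chain_def using A by blast
qed

lemma card_image_same_kernel:
  assumes "\<And>x y. x \<in> J \<Longrightarrow> y \<in> J \<Longrightarrow> f x = f y \<longleftrightarrow> g x = g y"
  shows "card (f ` J) = card (g ` J)"
proof -
  define k where "k v = f (inv_into J g v)" for v
  have k: "k (g x) = f x" if "x \<in> J" for x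
    unfolding k_def using assms[of "inv_into J g (g x)" x] that by (simp add: inv_into_into f_inv_into_f)
  have "k ` (g ` J) = f ` J" using k by force
  moreover have "inj_on k (g ` J)" using k assms by (auto simp: inj_on_def)
  ultimately show ?thesis using card_image by metis
qed

context bhom
begin

lemma h_eq_iff_kernel:
  assumes ker: "\<And>x. x \<in> C \<Longrightarrow> h x = B'.z \<longleftrightarrow> x \<in> I" and "x \<in> C" "y \<in> C"
  shows "h x = h y \<longleftrightarrow> add (B.neg x) y \<in> I"
  using h_eq_iff[OF assms(2,3)] ker[of "add (B.neg x) y"] assms(2,3) by simp

lemma card_cosets:
  assumes ker: "\<And>x. x \<in> C \<Longrightarrow> h x = B'.z \<longleftrightarrow> x \<in> I" and I: "B.asub I" and J: "J \<subseteq> C"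
  shows "card (cosets add J I) = card (h ` J)"
  unfolding cosets_def
proof (rule card_image_same_kernel)
  fix x y assume "x \<in> J" "y \<in> J"
  then have C: "x \<in> C" "y \<in> C" using J by blast+
  have "(add x ` I = add y ` I) \<longleftrightarrow> h y = h x"
    using B.coset_eq_iff[OF I C] h_eq_iff_kernel[OF ker C(2,1)] by blast
  then show "(add x ` I = add y ` I) \<longleftrightarrow> h x = h y" by auto
qed

end

context brace
begin

lemma zm_eq_z_coprime:
  assumes g: "g \<in> C" and "zm p g = z" "zm n g = z" "coprime p n"
  shows "g = z"
proof -
  obtain u y where uy: "u * p + y * n = 1" using bezout_int[of p n] assms(4) by auto
  have "g = zm (p * u + n * y) g" using uy g by (simp add: mult.commute)
  also have "\<dots> = add (zm u (zm p g)) (zm y (zm n g))"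
    by (simp only: zm_add[OF g] zm_zm[OF g])
  also have "\<dots> = z" unfolding assms(2,3) using A.grp.int_pow_one by simp
  finally show ?thesis .
qed

lemma asub_zm_range:
  assumes g: "g \<in> C"
  shows "asub (range (\<lambda>n. zm n g))"
  unfolding asub_def
proof (intro conjI ballI)
  show "range (\<lambda>n. zm n g) \<subseteq> C" using g by auto
  show "z \<in> range (\<lambda>n. zm n g)" using rangeI[of "\<lambda>n. zm n g" 0] by simp
next
  fix a b assume "a \<in> range (\<lambda>n. zm n g)" "b \<in> range (\<lambda>n. zm n g)"
  then obtain i j where "a = zm i g" "b = zm j g" by blast
  then have "add a b = zm (i + j) g" using zm_add[OF g] by simp
  then show "add a b \<in> range (\<lambda>n. zm n g)" by blast
next
  fix a assume "a \<in> range (\<lambda>n. zm n g)"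
  then obtain i where "a = zm i g" by blast
  then have "neg a = zm (- i) g" using zm_minus[OF g] by simp
  then show "neg a \<in> range (\<lambda>n. zm n g)" by blast
qed

lemma card_asub_dvd:
  assumes K: "asub K" and Y: "asub Y" and fin: "finite K" and sub: "Y \<subseteq> K"
  shows "card Y dvd card K"
proof -
  let ?P = "(\<lambda>x. add x ` Y) ` K"
  have U: "\<Union> ?P = K"
  proof
    show "\<Union> ?P \<subseteq> K" using asubD(4)[OF K] sub by blast
    show "K \<subseteq> \<Union> ?P"
    proof
      fix x assume x: "x \<in> K"
      have "add x z \<in> add x ` Y" using asubD(2)[OF Y] by (rule imageI)
      then show "x \<in> \<Union> ?P" using x asubD(3)[OF K x] by auto
    qed
  qed
  have "card Y * card ?P = card (\<Union> ?P)"
  proof (rule card_partition)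
    show "finite ?P" using fin by simp
    show "finite (\<Union> ?P)" unfolding U by (rule fin)
  next
    fix c assume "c \<in> ?P"
    then obtain x where x: "x \<in> K" "c = add x ` Y" by blast
    have "inj_on (add x) Y"
      using asubD(3)[OF K x(1)] asubD(3)[OF Y] by (intro inj_onI) (metis add_neg_cancel(2))
    then show "card c = card Y" unfolding x(2) by (rule card_image)
  next
    fix c d assume "c \<in> ?P" "d \<in> ?P" and ne: "c \<noteq> d"
    then obtain x y where xy: "x \<in> K" "y \<in> K" "c = add x ` Y" "d = add y ` Y" by blast
    note C = asubD(3)[OF K xy(1)] asubD(3)[OF K xy(2)]
    show "c \<inter> d = {}"
    proof (rule ccontr)
      assume "c \<inter> d \<noteq> {}"
      then obtain u w where uw: "u \<in> Y" "w \<in> Y" "add x u = add y w" unfolding xy(3,4) by blast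
      note D = asubD(3)[OF Y uw(1)] asubD(3)[OF Y uw(2)]
      have "add (neg x) y = add (neg x) (add (add y w) (neg w))" using C D by simp
      also have "\<dots> = add u (neg w)" unfolding uw(3)[symmetric] using C D by (simp add: A.grp.m_assoc)
      also have "\<dots> \<in> Y" using asubD(4)[OF Y uw(1) asubD(5)[OF Y uw(2)]] .
      finally show False using coset_eq_iff[OF Y C(2,1)] ne xy(3,4) by blast
    qed
  qed
  then show ?thesis unfolding U by (metis dvd_triv_left)
qed

lemma zm_range_eq:
  assumes g: "g \<in> C" and d: "d > 0" "zm (int d) g = z"
  shows "range (\<lambda>n. zm n g) = (\<lambda>n. zm (int n) g) ` {..<d}"
proof
  show "range (\<lambda>n. zm n g) \<subseteq> (\<lambda>n. zm (int n) g) ` {..<d}"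
  proof
    fix x assume "x \<in> range (\<lambda>n. zm n g)"
    then obtain n where n: "x = zm n g" by blast
    have d0: "int d > 0" using d(1) by simp
    have "n = int d * (n div int d) + n mod int d" by simp
    then have "x = add (zm (n div int d) (zm (int d) g)) (zm (n mod int d) g)"
      unfolding n by (simp only: zm_zm[OF g] zm_add[OF g, symmetric])
    then have "x = zm (int (nat (n mod int d))) g" unfolding d(2) using A.grp.int_pow_one g d0 by simp
    moreover have "nat (n mod int d) < d" using d0 by (simp add: nat_less_iff)
    ultimately show "x \<in> (\<lambda>n. zm (int n) g) ` {..<d}" by blast
  qed
qed blast

lemma zm_diff_eq_z:
  assumes g: "g \<in> C" and "k < l" "zm (int k) g = zm (int l) g"
  shows "zm (int (l - k)) g = z"
proof -
  have "zm (int l) g = add (zm (int k) g) (zm (int (l - k)) g)"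
    using assms(2) zm_add[OF g, of "int k" "int (l - k)"] by simp
  then have "add (neg (zm (int k) g)) (zm (int k) g) = add (neg (zm (int k) g)) (add (zm (int k) g) (zm (int (l - k)) g))"
    using assms(3) by simp
  then show ?thesis
    using zm_closed[OF g, of "int k"] zm_closed[OF g, of "int (l - k)"] g by simp
qed

lemma zm_card_range:
  assumes g: "g \<in> C" and fin: "finite Y" and Y: "Y = range (\<lambda>n. zm n g)"
  shows "zm (int (card Y)) g = z"
proof -
  have "\<not> inj_on (\<lambda>n. zm (int n) g) {..card Y}"
  proof
    assume "inj_on (\<lambda>n. zm (int n) g) {..card Y}"
    then have "card {..card Y} \<le> card Y" by (rule card_inj_on_le[OF _ _ fin]) (use Y in blast)
    then show False by simp
  qed
  then obtain k l where "k \<le> card Y" "l \<le> card Y" "k \<noteq> l" "zm (int k) g = zm (int l) g" unfolding inj_on_def by auto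
  then obtain k l where kl: "k < l" "l \<le> card Y" "zm (int k) g = zm (int l) g" by (metis nat_neq_iff)
  note e = zm_diff_eq_z[OF g kl(1,3)]
  have "card Y \<le> l - k"
    unfolding Y zm_range_eq[OF g zero_less_diff[THEN iffD2, OF kl(1)] e]
    using card_image_le[of "{..<l - k}" "\<lambda>n. zm (int n) g"] by simp
  then have "l - k = card Y" using kl by linarith
  then show ?thesis using e by simp
qed

lemma card_cyclic_prime:
  assumes p: "prime (p::nat)" and g: "g \<in> C" "g \<noteq> z" "zm (int p) g = z"
    and K: "\<And>x. x \<in> K \<longleftrightarrow> (\<exists>n. x = zm n g)"
  shows "card K = p"
proof -
  have "K = range (\<lambda>n. zm n g)" using K by blast
  then have "K = (\<lambda>n. zm (int n) g) ` {..<p}"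
    using zm_range_eq[OF g(1) prime_gt_0_nat[OF p] g(3)] by simp
  moreover have "inj_on (\<lambda>n. zm (int n) g) {..<p}"
  proof -
    have "False" if kl: "k < l" "l < p" "zm (int k) g = zm (int l) g" for k l
    proof -
      have "zm (int (l - k)) g = z" by (rule zm_diff_eq_z[OF g(1) kl(1,3)])
      moreover have "\<not> p dvd l - k" using kl by (auto dest: dvd_imp_le)
      then have "coprime (int p) (int (l - k))" using p prime_imp_coprime by (metis coprime_int_iff)
      ultimately have "g = z" using zm_eq_z_coprime[OF g(1,3)] by blast
      then show False using g(2) by blast
    qed
    then show ?thesis unfolding inj_on_def by (metis lessThan_iff nat_neq_iff)
  qed
  ultimately show ?thesis using card_image by fastforce
qed

lemma pstep_imp_prime_card:
  assumes I: "is_ideal C add mul I" and "pstep I K"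
  shows "prime (card (cosets add K I))"
proof -
  obtain g p where g: "g \<in> K" "g \<notin> I" "prime (p::nat)" "zm (int p) g \<in> I"
    "\<forall>x\<in>K. \<exists>n. add (neg (zm n g)) x \<in> I" and K: "is_ideal C add mul K" "I \<subseteq> K"
    using assms(2) unfolding pstep_def by blast
  obtain C' :: "'a set" and add' mul' h where h: "bhom C add mul C' add' mul' h"
    and ker: "\<And>x. x \<in> C \<Longrightarrow> h x = gid C' add' \<longleftrightarrow> x \<in> I" by (fact quotientE[OF I])
  interpret H: bhom C add mul C' add' mul' h by (rule h)
  have gC: "g \<in> C" by (rule idealD(4)[OF K(1) g(1)])
  have "card (h ` K) = p"
  proof (rule H.B'.card_cyclic_prime[OF g(3) H.h_in[OF gC]])
    show "h g \<noteq> H.B'.z" using ker[OF gC] g(2) by blast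
    show "H.B'.zm (int p) (h g) = H.B'.z" using ker[OF zm_closed[OF gC]] g(4) H.h_zm[OF gC] by metis
    show "x \<in> h ` K \<longleftrightarrow> (\<exists>n. x = H.B'.zm n (h g))" for x
    proof
      assume "x \<in> h ` K"
      then obtain y where y: "y \<in> K" "x = h y" by blast
      obtain n where "add (neg (zm n g)) y \<in> I" using g(5) y(1) by blast
      then have "h (zm n g) = h y" using H.h_eq_iff_kernel[OF ker zm_closed[OF gC] idealD(4)[OF K(1) y(1)]] by blast
      then show "\<exists>n. x = H.B'.zm n (h g)" unfolding y(2) H.h_zm[OF gC] by metis
    next
      assume "\<exists>n. x = H.B'.zm n (h g)"
      then obtain n where "x = h (zm n g)" using H.h_zm[OF gC] by metis
      then show "x \<in> h ` K" using asub_zm[OF idealD(1)[OF K(1)] g(1)] by blast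
    qed
  qed
  moreover have "card (cosets add K I) = card (h ` K)"
    by (rule H.card_cosets[OF ker idealD(1)[OF I] idealD(2)[OF K(1)]])
  ultimately show ?thesis using g(3) by simp
qed

theorem sreach_imp_supersoluble:
  assumes "sreach {z} C"
  shows "supersoluble C add mul"
proof -
  let ?step = "\<lambda>I J. (inf_cyclic_mod C add I J \<and> in_soc_mod C add mul I J) \<or> prime (card (cosets add J I))"
  have "is_ideal C add mul J \<and> (\<lambda>I J. is_ideal C add mul J \<and> I \<subseteq> J \<and> ?step I J)\<^sup>*\<^sup>* {z} J" if "sreach {z} J" for J
    using that
  proof (induction rule: rtranclp_induct)
    case base
    then show ?case using ideal_zero by blast
  next
    case (step I J)
    have I: "is_ideal C add mul I" using step.IH by blast
    have J: "is_ideal C add mul J" "I \<subseteq> J" using step.hyps(2) unfolding pstep_def icstep_def by blast+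
    have "?step I J"
      using step.hyps(2)
    proof
      assume "pstep I J"
      then show ?thesis using pstep_imp_prime_card[OF I] by blast
    next
      assume ic: "icstep I J"
      then obtain g where g: "g \<in> J" "\<forall>x\<in>J. \<exists>n. add (neg (zm n g)) x \<in> I" "\<forall>n. n \<noteq> 0 \<longrightarrow> zm n g \<notin> I"
        unfolding icstep_def by blast
      have "inf_cyclic_mod C add I J"
        unfolding inf_cyclic_mod_def using g idealD(4)[OF J(1) g(1)] by (intro bexI[of _ g]) (simp_all add: A.gipow_eq)
      moreover have "in_soc_mod C add mul I J" using ic unfolding icstep_def by blast
      ultimately show ?thesis by blast
    qed
    then show ?case using step.IH J by (auto intro: rtranclp.rtrancl_into_rtrancl)
  qed
  then show ?thesis unfolding supersoluble_def ideal_chain_iff using assms ideal_zero by blast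
qed

theorem almost_polycyclic_imp_apc:
  assumes "almost_polycyclic C add mul"
  shows "\<exists>n. apc C add mul n {z}"
proof -
  let ?R = "\<lambda>I J. is_ideal C add mul J \<and> I \<subseteq> J \<and> ((in_soc_mod C add mul I J \<and> fg_mod C add I J) \<or> finite (cosets add J I))"
  have R: "?R\<^sup>*\<^sup>* {z} C" using assms unfolding almost_polycyclic_def ideal_chain_iff by blast
  have "is_ideal C add mul I \<Longrightarrow> \<exists>n. apc C add mul n I" if "?R\<^sup>*\<^sup>* I C" for I
    using that
  proof (induction rule: converse_rtranclp_induct)
    case base
    then show ?case using apc.apc_top by blast
  next
    case (step I J)
    then obtain n where n: "apc C add mul n J" by blast
    have J: "is_ideal C add mul J" "I \<subseteq> J" using step.hyps(1) by blast+
    have "(in_soc_mod C add mul I J \<and> fg_mod C add I J) \<or> fin_mod C add I J"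
      using step.hyps(1) finite_cosets_iff[OF idealD(1)[OF step.prems] idealD(2)[OF J(1)]] by blast
    then show ?case using apc.apc_step[OF J _ n] by blast
  qed
  then show ?thesis using R ideal_zero by blast
qed

text \<open>The steps that a certificate can verify: the socle case does not claim that \<open>J / I\<close> is infinite,
  the other case does not claim that \<open>J \<noteq> I\<close>.\<close>
definition wstep_by :: "'a \<Rightarrow> 'a set \<Rightarrow> 'a set \<Rightarrow> bool" where
  "wstep_by g I J \<longleftrightarrow> is_ideal C add mul J \<and> I \<subseteq> J \<and> g \<in> J \<and> (\<forall>x\<in>J. \<exists>n. add (neg (zm n g)) x \<in> I) \<and>
    (in_soc_mod C add mul I J \<or> (\<exists>p. prime (p::nat) \<and> zm (int p) g \<in> I))"

abbreviation wreach :: "'a set \<Rightarrow> 'a set \<Rightarrow> bool" where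
  "wreach \<equiv> (\<lambda>I J. \<exists>g. wstep_by g I J)\<^sup>*\<^sup>*"

text \<open>By Lagrange the multiples of any element outside I already exhaust the factor, which
  yields both the generator and the exponent.\<close>

lemma prime_card_imp_wstep:
  assumes I: "is_ideal C add mul I" and J: "is_ideal C add mul J" "I \<subseteq> J" and p: "prime (card (cosets add J I))"
  shows "\<exists>g. wstep_by g I J"
proof -
  obtain C' :: "'a set" and add' mul' h where h: "bhom C add mul C' add' mul' h"
    and ker: "\<And>x. x \<in> C \<Longrightarrow> h x = gid C' add' \<longleftrightarrow> x \<in> I" by (fact quotientE[OF I])
  interpret H: bhom C add mul C' add' mul' h by (rule h)
  define P where "P = card (h ` J)"
  have P: "prime P" using p H.card_cosets[OF ker idealD(1)[OF I] idealD(2)[OF J(1)]] unfolding P_def by simp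
  have fin: "finite (h ` J)" using P unfolding P_def by (metis card.infinite not_prime_0)
  note aJ = H.B'.asubD[OF H.asub_image[OF idealD(1)[OF J(1)]]]
  have "\<not> J \<subseteq> I"
  proof
    assume "J \<subseteq> I"
    then have "h ` J \<subseteq> {H.B'.z}" using ker idealD(4)[OF J(1)] by blast
    then have "P \<le> 1" unfolding P_def using card_mono[of "{H.B'.z}" "h ` J"] by simp
    then show False using prime_gt_1_nat[OF P] by linarith
  qed
  then obtain g where g: "g \<in> J" "g \<notin> I" by blast
  have gC: "g \<in> C" by (rule idealD(4)[OF J(1) g(1)])
  have hg: "h g \<in> C'" "h g \<noteq> H.B'.z" using gC ker[OF gC] g(2) by auto
  define Y where "Y = range (\<lambda>n::int. H.B'.zm n (h g))"
  have YJ: "Y \<subseteq> h ` J" unfolding Y_def using H.B'.asub_zm[OF H.asub_image[OF idealD(1)[OF J(1)]]] g(1) by blast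
  have "card Y dvd P"
    unfolding P_def
    by (rule H.B'.card_asub_dvd[OF H.asub_image[OF idealD(1)[OF J(1)]] _ fin YJ])
      (use H.B'.asub_zm_range[OF hg(1)] Y_def in simp)
  moreover have "card Y \<noteq> 1"
  proof
    assume "card Y = 1"
    moreover have "h g \<in> Y" "H.B'.z \<in> Y"
      unfolding Y_def using rangeI[of "\<lambda>n::int. H.B'.zm n (h g)" 1] rangeI[of "\<lambda>n::int. H.B'.zm n (h g)" 0] hg(1) by auto
    ultimately show False using hg(2) by (metis card_1_singletonE singletonD)
  qed
  ultimately have "card Y = P" using P by (metis prime_nat_iff)
  then have YE: "Y = h ` J" using YJ fin unfolding P_def by (metis card_subset_eq)
  have "\<exists>n. add (neg (zm n g)) x \<in> I" if x: "x \<in> J" for x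
  proof -
    obtain n where n: "h x = H.B'.zm n (h g)" using YE x unfolding Y_def by blast
    then have "h (zm n g) = h x" using H.h_zm[OF gC] by simp
    then show ?thesis using H.h_eq_iff_kernel[OF ker zm_closed[OF gC] idealD(4)[OF J(1) x]] by blast
  qed
  moreover have "zm (int P) g \<in> I"
  proof -
    have "H.B'.zm (int (card Y)) (h g) = H.B'.z"
      by (rule H.B'.zm_card_range[OF hg(1) _ Y_def]) (use YE fin in simp)
    then have "H.B'.zm (int P) (h g) = H.B'.z" unfolding YE P_def .
    then have "h (zm (int P) g) = H.B'.z" using H.h_zm[OF gC] by simp
    then show ?thesis using ker[OF zm_closed[OF gC]] by blast
  qed
  ultimately have "wstep_by g I J" unfolding wstep_by_def using J g(1) P by blast
  then show ?thesis by blast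
qed

theorem supersoluble_imp_wreach:
  assumes "supersoluble C add mul"
  shows "wreach {z} C"
proof -
  let ?step = "\<lambda>I J. (inf_cyclic_mod C add I J \<and> in_soc_mod C add mul I J) \<or> prime (card (cosets add J I))"
  have R: "(\<lambda>I J. is_ideal C add mul J \<and> I \<subseteq> J \<and> ?step I J)\<^sup>*\<^sup>* {z} C"
    using assms unfolding supersoluble_def ideal_chain_iff by blast
  have "is_ideal C add mul J \<and> wreach {z} J"
    if "(\<lambda>I J. is_ideal C add mul J \<and> I \<subseteq> J \<and> ?step I J)\<^sup>*\<^sup>* {z} J" for J
    using that
  proof (induction rule: rtranclp_induct)
    case base
    then show ?case using ideal_zero by blast
  next
    case (step I J)
    have J: "is_ideal C add mul J" "I \<subseteq> J" and I: "is_ideal C add mul I" using step by blast+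
    have "?step I J" using step.hyps(2) by blast
    then have "\<exists>g. wstep_by g I J"
    proof
      assume s: "inf_cyclic_mod C add I J \<and> in_soc_mod C add mul I J"
      then obtain g where g: "g \<in> J" "\<forall>x\<in>J. \<exists>n::int. add (neg (gipow C add g n)) x \<in> I"
        unfolding inf_cyclic_mod_def by blast
      have "\<forall>x\<in>J. \<exists>n. add (neg (zm n g)) x \<in> I" using g(2) A.gipow_eq[OF idealD(4)[OF J(1) g(1)]] by simp
      then have "wstep_by g I J" unfolding wstep_by_def using J g(1) s by blast
      then show ?thesis by blast
    next
      assume "prime (card (cosets add J I))"
      then show ?thesis by (rule prime_card_imp_wstep[OF I J])
    qed
    then show ?case using step.IH J(1) by (auto intro: rtranclp.rtrancl_into_rtrancl)
  qed
  from this[OF R] show ?thesis by blast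
qed

lemma finite_order_mod:
  assumes N: "asub N" "fin_mod C add N C" and g: "g \<in> C"
  shows "\<exists>n::nat. n > 0 \<and> zm (int n) g \<in> N"
proof -
  obtain F where F: "finite F" "F \<subseteq> C" "\<forall>x\<in>C. \<exists>f\<in>F. add (neg f) x \<in> N" using N(2) unfolding fin_mod_def by blast
  have "\<forall>k::nat. \<exists>f. f \<in> F \<and> add (neg f) (zm (int k) g) \<in> N" using F(3) zm_closed[OF g] by blast
  then obtain f where f: "\<And>k::nat. f k \<in> F \<and> add (neg (f k)) (zm (int k) g) \<in> N" by metis
  have "finite (range f)" using f F(1) finite_subset[of "range f" F] by blast
  then have "\<not> inj f" using finite_imageD infinite_UNIV_nat by blast
  then obtain k l where "k \<noteq> l" "f k = f l" unfolding inj_def by blast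
  then obtain k l where kl: "k < l" "f k = f l" by (metis nat_neq_iff)
  have C: "f k \<in> C" "zm (int k) g \<in> C" "zm (int l) g \<in> C" using f F(2) g by auto
  have "add (neg (zm (int k) g)) (zm (int l) g) \<in> N"
    using coset_trans[OF N(1) C(2,1,3) coset_sym[OF N(1) C(1,2)]] f[of k] f[of l] kl(2) by simp
  also have "add (neg (zm (int k) g)) (zm (int l) g) = zm (int (l - k)) g"
    using kl(1) zm_add[OF g, of "- int k" "int l"] zm_minus[OF g, of "int k"] by (simp add: of_nat_diff)
  finally show ?thesis using kl(1) by (intro exI[of _ "l - k"]) simp
qed

text \<open>For N of finite index, some step from I to J of the chain starts inside N and leaves it,
  and its generator g is outside N. If p g lies in I, then J + N has prime order over N. In the
  socle case g is in the socle modulo N and each \<lambda>_b multiplies it by an integer, so a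
  multiple of g of prime order modulo N spans an ideal.\<close>

theorem wreach_imp_prime_quotients:
  assumes "wreach {z} C"
  shows prime_quotients
  unfolding prime_quotients_def
proof (intro allI impI)
  fix N assume N: "is_ideal C add mul N" "fin_mod C add N C" "N \<noteq> C"
  have nC: "\<not> C \<subseteq> N" using N(3) idealD(2)[OF N(1)] by blast
  have "\<exists>I J g. wstep_by g I J \<and> I \<subseteq> N \<and> \<not> J \<subseteq> N" if "wreach I C" "I \<subseteq> N" for I
    using that
  proof (induction rule: converse_rtranclp_induct)
    case base
    then show ?case using nC by blast
  next
    case (step I J)
    then show ?case by blast
  qed
  from this[OF assms] have "\<exists>I J g. wstep_by g I J \<and> I \<subseteq> N \<and> \<not> J \<subseteq> N" using idealD(3)[OF N(1)] by simp
  then obtain I J g where st: "wstep_by g I J" "I \<subseteq> N" "\<not> J \<subseteq> N" by (elim exE conjE)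
  have J: "is_ideal C add mul J" "I \<subseteq> J" "g \<in> J" "\<forall>x\<in>J. \<exists>n. add (neg (zm n g)) x \<in> I"
    "in_soc_mod C add mul I J \<or> (\<exists>p. prime (p::nat) \<and> zm (int p) g \<in> I)"
    using st(1) unfolding wstep_by_def by blast+
  have gC: "g \<in> C" by (rule idealD(4)[OF J(1,3)])
  have aN: "asub N" by (rule idealD(1)[OF N(1)])
  have gN: "g \<notin> N"
  proof
    assume g: "g \<in> N"
    have "J \<subseteq> N"
    proof
      fix x assume x: "x \<in> J"
      obtain n where n: "add (neg (zm n g)) x \<in> I" using J(4) x by blast
      have "add (zm n g) (add (neg (zm n g)) x) \<in> N"
        using asubD(4)[OF aN asub_zm[OF aN g] subsetD[OF st(2) n]] .
      then show "x \<in> N" using gC idealD(4)[OF J(1) x] by simp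
    qed
    then show False using st(3) by blast
  qed
  from J(5) show "\<exists>K. pstep N K"
  proof
    assume "\<exists>p. prime (p::nat) \<and> zm (int p) g \<in> I"
    then obtain p where p: "prime (p::nat)" "zm (int p) g \<in> I" by blast
    define K where "K = isum J N"
    have K: "is_ideal C add mul K" "N \<subseteq> K" "J \<subseteq> K" unfolding K_def using isum_ideal[OF J(1) N(1)] isum_upper[OF J(1) N(1)] by auto
    have "\<exists>n. add (neg (zm n g)) x \<in> N" if x: "x \<in> K" for x
    proof -
      obtain j i where ji: "x = add j i" "j \<in> J" "i \<in> N" using x unfolding K_def isum_def by blast
      obtain n where n: "add (neg (zm n g)) j \<in> I" using J(4) ji(2) by blast
      have C: "j \<in> C" "i \<in> C" using ji idealD(4)[OF J(1)] idealD(4)[OF N(1)] by blast+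
      have "add (neg (zm n g)) x = add (add (neg (zm n g)) j) i" unfolding ji(1) using C gC by (simp add: A.grp.m_assoc)
      then show ?thesis using asubD(4)[OF aN subsetD[OF st(2) n] ji(3)] by metis
    qed
    then have "pstep N K" unfolding pstep_def using K J(3) gN p st(2) by blast
    then show ?thesis by blast
  next
    assume soc_IJ: "in_soc_mod C add mul I J"
    obtain C' :: "'a set" and add' mul' h where h: "bhom C add mul C' add' mul' h"
      and ker: "\<And>x. x \<in> C \<Longrightarrow> h x = gid C' add' \<longleftrightarrow> x \<in> N" by (fact quotientE[OF N(1)])
    interpret H: bhom C add mul C' add' mul' h by (rule h)
    have hJ: "h ` J \<subseteq> H.B'.soc"
      using H.in_soc_mod_iff[OF ker idealD(2)[OF J(1)]] in_soc_mod_mono[OF soc_IJ st(2) order_refl] by blast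
    define P where "P n \<longleftrightarrow> n > 0 \<and> zm (int n) g \<in> N" for n :: nat
    obtain n where n: "P n" "\<And>m. m < n \<Longrightarrow> \<not> P m"
      using finite_order_mod[OF aN N(2) gC] exists_least_iff[of P] unfolding P_def by blast
    have "n \<noteq> 1" using n(1) gN gC unfolding P_def by auto
    then obtain p where p: "prime p" "p dvd n" using prime_factor_nat by blast
    then obtain k where k: "n = p * k" by (elim dvdE)
    have k0: "k > 0" "k < n" using n(1) k p(1) prime_gt_1_nat[OF p(1)] unfolding P_def by (auto simp: zero_less_mult_iff)
    define g1 where "g1 = zm (int k) g"
    have g1C: "g1 \<in> C" unfolding g1_def using gC by simp
    have g1N: "g1 \<notin> N" using n(2)[OF k0(2)] k0(1) unfolding P_def g1_def by blast
    have pg1: "zm (int p) g1 \<in> N" using n(1) unfolding P_def k g1_def zm_zm[OF gC] by (simp add: mult.commute)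
    have hg: "h g \<in> H.B'.soc" using hJ J(3) by blast
    have hg1: "h g1 = H.B'.zm (int k) (h g)" unfolding g1_def by (rule H.h_zm[OF gC])
    have hgC: "h g \<in> C'" "h g1 \<in> C'" using gC g1C by auto
    have hg1s: "h g1 \<in> H.B'.soc" unfolding hg1 by (rule H.B'.asub_zm[OF H.B'.asub_soc hg])
    define L where "L = range (\<lambda>n::int. H.B'.zm n (h g1))"
    have aL: "H.B'.asub L" unfolding L_def by (rule H.B'.asub_zm_range[OF hgC(2)])
    have "L \<subseteq> H.B'.soc" unfolding L_def using H.B'.asub_zm[OF H.B'.asub_soc hg1s] by blast
    moreover have "H.B'.lam b' x \<in> L" if b': "b' \<in> C'" and x: "x \<in> L" for b' x
    proof -
      obtain b where b: "b \<in> C" "b' = h b" using b' H.h_onto by blast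
      obtain i where i: "x = H.B'.zm i (h g1)" using x unfolding L_def by blast
      have lgJ: "lam b g \<in> J" by (rule idealD(9)[OF J(1) b(1) J(3)])
      then obtain c where c: "add (neg (zm c g)) (lam b g) \<in> I" using J(4) by blast
      have "h (zm c g) = h (lam b g)"
        using H.h_eq_iff_kernel[OF ker zm_closed[OF gC] idealD(4)[OF J(1) lgJ]] c st(2) by blast
      then have lam_hg: "H.B'.lam b' (h g) = H.B'.zm c (h g)" unfolding b(2) using H.h_lam[OF b(1) gC] H.h_zm[OF gC] by simp
      have "H.B'.lam b' x = H.B'.zm i (H.B'.zm (int k) (H.B'.lam b' (h g)))"
        unfolding i hg1 using H.B'.lam_zm[OF b'] hgC(1) by simp
      also have "\<dots> = H.B'.zm (c * i) (h g1)"
        unfolding lam_hg hg1 by (simp add: H.B'.zm_zm[OF hgC(1)] mult_ac)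
      finally show ?thesis unfolding L_def by blast
    qed
    ultimately have Lid: "is_ideal C' add' mul' L" using H.B'.soc_sub_ideal[OF aL] by blast
    define K where "K = {x \<in> C. h x \<in> L}"
    have K: "is_ideal C add mul K" unfolding K_def by (rule H.preimage_ideal[OF Lid])
    have "N \<subseteq> K"
    proof
      fix x assume x: "x \<in> N"
      have "h x = H.B'.z" using ker[OF idealD(4)[OF N(1) x]] x by blast
      then show "x \<in> K" unfolding K_def using H.B'.asubD(2)[OF aL] idealD(4)[OF N(1) x] by simp
    qed
    moreover have "g1 \<in> K" unfolding K_def L_def using rangeI[of "\<lambda>n::int. H.B'.zm n (h g1)" 1] g1C hgC by simp
    moreover have "\<exists>n. add (neg (zm n g1)) x \<in> N" if x: "x \<in> K" for x
    proof -
      have xC: "x \<in> C" using x unfolding K_def by blast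
      obtain i where "h x = H.B'.zm i (h g1)" using x unfolding K_def L_def by blast
      then have "h (zm i g1) = h x" using H.h_zm[OF g1C] by simp
      then show ?thesis using H.h_eq_iff_kernel[OF ker zm_closed[OF g1C] xC] by blast
    qed
    ultimately have "pstep N K" unfolding pstep_def using K g1N p(1) pg1 by blast
    then show ?thesis by blast
  qed
qed

section \<open>Finite certificates for weak chains\<close>

abbreviation mgen where "mgen \<equiv> gen_subgroup C mul"

definition stable :: "'a set \<Rightarrow> 'a \<Rightarrow> 'a \<Rightarrow> bool" where
  "stable K b g \<longleftrightarrow> lam b g \<in> K \<and> lam (iv b) g \<in> K \<and>
    add (add b g) (neg b) \<in> K \<and> add (add (neg b) g) b \<in> K \<and>
    mul (mul b g) (iv b) \<in> K \<and> mul (mul (iv b) g) b \<in> K"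

text \<open>The middle condition says that \<lambda>_g fixes g modulo the preceding span; it is what
  allows additive and multiplicative spans to be identified. A socle factor satisfies it by
  definition, a factor of prime exponent by \<open>lam_self_trivial_mod_prime\<close>.\<close>

definition cert_at :: "'a list \<Rightarrow> nat \<Rightarrow> bool" where
  "cert_at gs i \<longleftrightarrow>
    (\<forall>b\<in>set gs. stable (gen (set (take (Suc i) gs))) b (gs ! i)) \<and>
    add (neg (gs ! i)) (lam (gs ! i) (gs ! i)) \<in> gen (set (take i gs)) \<and>
    ((\<forall>b\<in>set gs. add (neg b) (lam (gs ! i) b) \<in> gen (set (take i gs)) \<and>
        add (add (gs ! i) b) (neg (add b (gs ! i))) \<in> gen (set (take i gs))) \<or>
      (\<exists>p. prime (p::nat) \<and> zm (int p) (gs ! i) \<in> gen (set (take i gs))))"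

definition cert :: "'a list \<Rightarrow> bool" where
  "cert gs \<longleftrightarrow> set gs \<subseteq> C \<and> (\<forall>i<length gs. cert_at gs i)"

definition brace_generates :: "'a set \<Rightarrow> bool" where
  "brace_generates X \<longleftrightarrow> (\<forall>S. X \<subseteq> S \<longrightarrow> z \<in> S \<longrightarrow> (\<forall>a\<in>S. \<forall>b\<in>S. add a b \<in> S \<and> mul a b \<in> S) \<longrightarrow>
    (\<forall>a\<in>S. neg a \<in> S \<and> iv a \<in> S) \<longrightarrow> C \<subseteq> S)"

lemma mgen_carrier:
  assumes "F \<subseteq> C" and "x \<in> mgen F"
  shows "x \<in> C"
  using assms(2) by induction (use assms(1) in auto)

lemma mgen_mono:
  assumes "F \<subseteq> F'" and "x \<in> mgen F"
  shows "x \<in> mgen F'"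
  using assms(2)
proof induction
  case gid_in
  then show ?case by (rule gen_subgroup.gid_in)
next
  case (gen_in s)
  then show ?case using assms(1) by (auto intro: gen_subgroup.gen_in)
qed (auto intro: gen_subgroup.intros)

lemma z_mgen: "z \<in> mgen F"
  using gen_subgroup.gid_in[of C mul F] by simp

lemma nth_gen_take: "k < i \<Longrightarrow> k < length gs \<Longrightarrow> gs ! k \<in> set (take i gs)"
  using in_set_conv_nth[of "gs ! k" "take i gs"] by auto

lemma gen_take_mono: "i \<le> j \<Longrightarrow> gen (set (take i gs)) \<subseteq> gen (set (take j gs))"
  by (intro gen_mono set_take_subset_set_take)

context
  fixes gs assumes cert: "cert gs"
begin

abbreviation (input) "A i \<equiv> gen (set (take i gs))"
abbreviation (input) "H i \<equiv> mgen (set (take i gs))"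

lemma gs_C: "set gs \<subseteq> C" "\<And>i. set (take i gs) \<subseteq> C"
  using cert set_take_subset[of _ gs] unfolding cert_def by blast+

lemma aA: "asub (A i)"
  by (rule asub_gen[OF gs_C(2)])

lemma HC: "x \<in> H i \<Longrightarrow> x \<in> C"
  by (rule mgen_carrier[OF gs_C(2)])

lemma H_mono: "i \<le> j \<Longrightarrow> x \<in> H i \<Longrightarrow> x \<in> H j"
  by (rule mgen_mono[OF set_take_subset_set_take])

lemma cert_nth:
  assumes "x \<in> set (take i gs)"
  obtains k where "k < length gs" "x = gs ! k" "A (Suc k) \<subseteq> A i" "Suc k \<le> i"
proof -
  obtain k where "k < length gs" "k < i" "x = gs ! k" using assms by (auto simp: in_set_conv_nth)
  then show ?thesis using that gen_take_mono[of "Suc k" i gs] by simp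
qed

lemma certD:
  assumes "k < length gs" "b \<in> set gs"
  shows "lam b (gs ! k) \<in> A (Suc k)" "lam (iv b) (gs ! k) \<in> A (Suc k)"
    "add (add b (gs ! k)) (neg b) \<in> A (Suc k)" "add (add (neg b) (gs ! k)) b \<in> A (Suc k)"
    "mul (mul b (gs ! k)) (iv b) \<in> A (Suc k)" "mul (mul (iv b) (gs ! k)) b \<in> A (Suc k)"
  using assms cert unfolding cert_def cert_at_def stable_def by blast+

lemma asub_lam_preimage:
  assumes "b \<in> C" "asub K"
  shows "asub {x \<in> C. lam b x \<in> K}"
  unfolding asub_def using assms(1) asubD[OF assms(2)] by (auto simp: lam_add lam_neg)

lemma asub_conj_preimage:
  assumes b: "b \<in> C" and K: "asub K"
  shows "asub {x \<in> C. add (add b x) (neg b) \<in> K}"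
  unfolding asub_def
proof (intro conjI ballI)
  show "z \<in> {x \<in> C. add (add b x) (neg b) \<in> K}" using b asubD(2)[OF K] by simp
next
  fix x y assume x: "x \<in> {x \<in> C. add (add b x) (neg b) \<in> K}" and y: "y \<in> {x \<in> C. add (add b x) (neg b) \<in> K}"
  then have "add (add (add b x) (neg b)) (add (add b y) (neg b)) \<in> K" using asubD(4)[OF K] by blast
  then show "add x y \<in> {x \<in> C. add (add b x) (neg b) \<in> K}" using b x y by (simp add: A.grp.m_assoc)
next
  fix x assume x: "x \<in> {x \<in> C. add (add b x) (neg b) \<in> K}"
  then have "neg (add (add b x) (neg b)) \<in> K" using asubD(5)[OF K] by blast
  then show "neg x \<in> {x \<in> C. add (add b x) (neg b) \<in> K}"
    using b x by (simp add: A.grp.m_assoc A.grp.inv_mult_group)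
qed blast

lemma lam_gs:
  assumes b: "b \<in> set gs" and x: "x \<in> A i"
  shows "lam b x \<in> A i" "lam (iv b) x \<in> A i"
proof -
  have bC: "b \<in> C" "iv b \<in> C" using gs_C(1) b by auto
  have "A i \<subseteq> {x \<in> C. lam b x \<in> A i}"
    by (rule gen_subset[OF asub_lam_preimage[OF bC(1) aA]]) (use certD(1)[OF _ b] gs_C(2) in \<open>blast elim: cert_nth\<close>)
  then show "lam b x \<in> A i" using x by blast
  have "A i \<subseteq> {x \<in> C. lam (iv b) x \<in> A i}"
    by (rule gen_subset[OF asub_lam_preimage[OF bC(2) aA]]) (use certD(2)[OF _ b] gs_C(2) in \<open>blast elim: cert_nth\<close>)
  then show "lam (iv b) x \<in> A i" using x by blast
qed

lemma conj_gs:
  assumes b: "b \<in> set gs" and x: "x \<in> A i"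
  shows "add (add b x) (neg b) \<in> A i" "add (add (neg b) x) b \<in> A i"
proof -
  have bC: "b \<in> C" "neg b \<in> C" using gs_C(1) b by auto
  have "A i \<subseteq> {x \<in> C. add (add b x) (neg b) \<in> A i}"
    by (rule gen_subset[OF asub_conj_preimage[OF bC(1) aA]]) (use certD(3)[OF _ b] gs_C(2) in \<open>blast elim: cert_nth\<close>)
  then show "add (add b x) (neg b) \<in> A i" using x by blast
  have "A i \<subseteq> {x \<in> C. add (add (neg b) x) (neg (neg b)) \<in> A i}"
    by (rule gen_subset[OF asub_conj_preimage[OF bC(2) aA]])
      (use certD(4)[OF _ b] subsetD[OF gs_C(1) nth_mem] bC(1) in \<open>auto elim!: cert_nth\<close>)
  then show "add (add (neg b) x) b \<in> A i" using x bC(1) by auto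
qed

text \<open>\<lambda> is a homomorphism on the multiplicative group, so stability under the listed
  elements passes to the multiplicative subgroup that they generate, not at once to the additive
  one. Hence the need to identify \<open>A i\<close> with \<open>H i\<close>.\<close>

lemma lam_H:
  assumes "b \<in> mgen (set gs)" "x \<in> A i"
  shows "lam b x \<in> A i" "lam (iv b) x \<in> A i"
proof -
  have "\<forall>x\<in>A i. lam b x \<in> A i \<and> lam (iv b) x \<in> A i"
    using assms(1)
  proof induction
    case gid_in
    then show ?case using asubD(3)[OF aA] M.grp.inv_one by auto
  next
    case (gen_in s)
    then show ?case using lam_gs by blast
  next
    case (add_in a b)
    have C: "a \<in> C" "b \<in> C" using add_in.hyps mgen_carrier[OF gs_C(1)] by blast+
    show ?case
    proof
      fix x assume x: "x \<in> A i"
      then show "lam (mul a b) x \<in> A i \<and> lam (iv (mul a b)) x \<in> A i"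
        using add_in.IH C asubD(3)[OF aA x] by (simp add: lam_mul M.grp.inv_mult_group)
    qed
  next
    case (inv_in a)
    have "a \<in> C" using inv_in.hyps mgen_carrier[OF gs_C(1)] by blast
    then show ?case using inv_in.IH by simp
  qed
  then show "lam b x \<in> A i" "lam (iv b) x \<in> A i" using assms(2) by blast+
qed

lemma H_subset_gs: "x \<in> H i \<Longrightarrow> x \<in> mgen (set gs)"
  by (rule mgen_mono[OF set_take_subset])

lemma H_sub_A:
  assumes "x \<in> H i" shows "x \<in> A i"
  using assms
proof induction
  case gid_in
  then show ?case using asubD(2)[OF aA] by simp
next
  case (gen_in s)
  then show ?case by (rule gen_subgroup.gen_in)
next
  case (add_in a b)
  then show ?case
    using mul_lam[of a b] HC asubD(4)[OF aA add_in.IH(1) lam_H(1)[OF H_subset_gs[OF add_in.hyps(1)] add_in.IH(2)]] by simp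
next
  case (inv_in a)
  then show ?case
    using iv_eq[of a] HC asubD(5)[OF aA lam_H(2)[OF H_subset_gs[OF inv_in.hyps] inv_in.IH]] by simp
qed

text \<open>With \<open>N = A i\<close> and \<open>g\<close> the next generator, the elements \<open>u\<close> of \<open>H (Suc i)\<close> whose \<open>lam\<close> fixes \<open>g\<close>
  modulo \<open>N\<close> form a multiplicative subgroup \<open>U\<close>, and \<open>U + N\<close> is stable under adding \<open>g\<close>, \<open>-g\<close> and
  elements of \<open>N\<close>; thus it contains \<open>A (Suc i)\<close>.\<close>
lemma A_sub_H_step:
  assumes i: "i < length gs" and IH: "A i \<subseteq> H i"
  shows "A (Suc i) \<subseteq> H (Suc i)"
proof -
  let ?g = "gs ! i" and ?N = "A i"
  have g: "?g \<in> set gs" using i by simp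
  have gC: "?g \<in> C" using g gs_C(1) by blast
  note aN = aA[of i]
  note NC = asubD(3)[OF aN]
  note addN = asubD(4)[OF aN] and negN = asubD(5)[OF aN]
  define U where "U = {u \<in> H (Suc i). (\<exists>a\<in>?N. lam u ?g = add ?g a) \<and> (\<exists>a\<in>?N. lam (iv u) ?g = add ?g a)}"
  have UH: "u \<in> H (Suc i)" "u \<in> C" "u \<in> mgen (set gs)" if "u \<in> U" for u
    using that HC H_subset_gs unfolding U_def by blast+
  have "add (neg ?g) (lam ?g ?g) \<in> ?N" using cert i unfolding cert_def cert_at_def by blast
  then obtain a0 where a0: "a0 \<in> ?N" "lam ?g ?g = add ?g a0"
    using gC by (metis add_neg_cancel(1) lam_closed)
  have gH: "?g \<in> H (Suc i)" using nth_gen_take[of i "Suc i" gs] i by (auto intro: gen_subgroup.gen_in)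
  have gU: "?g \<in> U"
  proof -
    have "add (lam (iv ?g) ?g) (lam (iv ?g) a0) = lam (iv ?g) (lam ?g ?g)"
      unfolding a0(2) using gC NC[OF a0(1)] by (simp add: lam_add)
    then have "add (lam (iv ?g) ?g) (lam (iv ?g) a0) = ?g" using gC by simp
    then have "add (add (lam (iv ?g) ?g) (lam (iv ?g) a0)) (neg (lam (iv ?g) a0)) = add ?g (neg (lam (iv ?g) a0))"
      by simp
    then have "lam (iv ?g) ?g = add ?g (neg (lam (iv ?g) a0))" using gC NC[OF a0(1)] by simp
    moreover have "neg (lam (iv ?g) a0) \<in> ?N" by (rule negN[OF lam_gs(2)[OF g a0(1)]])
    ultimately show ?thesis unfolding U_def using gH a0 by blast
  qed
  have Ulam: "\<exists>a\<in>?N. lam (mul v u) ?g = add ?g a"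
    if C: "u \<in> C" "v \<in> C" and v: "\<And>x. x \<in> ?N \<Longrightarrow> lam v x \<in> ?N"
      and e: "\<exists>a\<in>?N. lam u ?g = add ?g a" "\<exists>a\<in>?N. lam v ?g = add ?g a" for u v
  proof -
    obtain a a' where a: "a \<in> ?N" "lam u ?g = add ?g a" "a' \<in> ?N" "lam v ?g = add ?g a'" using e by blast
    have "lam (mul v u) ?g = add ?g (add a' (lam v a))"
      using C gC NC[OF a(1)] NC[OF a(3)] by (simp add: lam_mul lam_add a A.grp.m_assoc)
    then show ?thesis using addN[OF a(3) v[OF a(1)]] by blast
  qed
  have mulU: "mul u v \<in> U" if "u \<in> U" "v \<in> U" for u v
  proof -
    have C: "u \<in> C" "v \<in> C" "iv u \<in> C" "iv v \<in> C" using UH that by auto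
    have "\<exists>a\<in>?N. lam (mul u v) ?g = add ?g a"
      by (rule Ulam[OF C(2,1) lam_H(1)[OF UH(3)[OF that(1)]]]) (use that in \<open>auto simp: U_def\<close>)
    moreover have "\<exists>a\<in>?N. lam (mul (iv v) (iv u)) ?g = add ?g a"
      by (rule Ulam[OF C(3,4) lam_H(2)[OF UH(3)[OF that(2)]]]) (use that in \<open>auto simp: U_def\<close>)
    moreover have "mul u v \<in> H (Suc i)" by (rule gen_subgroup.add_in[OF UH(1)[OF that(1)] UH(1)[OF that(2)]])
    ultimately show ?thesis by (simp add: U_def M.grp.inv_mult_group[OF C(1,2)])
  qed
  have ivU: "iv u \<in> U" if "u \<in> U" for u
    using that UH(2)[OF that] unfolding U_def by (auto intro: gen_subgroup.inv_in)
  define V where "V = {add u a | u a. u \<in> U \<and> a \<in> ?N}"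
  have VC: "v \<in> C" if "v \<in> V" for v using that UH(2) NC unfolding V_def by auto
  have UV: "u \<in> V" if "u \<in> U" for u
    unfolding V_def using that UH(2)[OF that] asubD(2)[OF aN] by (intro CollectI exI[of _ u] exI[of _ z]) simp
  have VN: "add v a \<in> V" if v: "v \<in> V" and a: "a \<in> ?N" for v a
  proof -
    obtain u b where ub: "v = add u b" "u \<in> U" "b \<in> ?N" using v unfolding V_def by blast
    have "add v a = add u (add b a)" unfolding ub(1) using UH(2)[OF ub(2)] NC[OF ub(3)] NC[OF a] by (simp add: A.grp.m_assoc)
    then show ?thesis unfolding V_def using ub(2) addN[OF ub(3) a] by blast
  qed
  have Ug: "add u ?g \<in> V" "add u (neg ?g) \<in> V" if u: "u \<in> U" for u
  proof -
    note uC = UH(2)[OF u]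
    obtain a where a: "a \<in> ?N" "lam u ?g = add ?g a" using u unfolding U_def by blast
    have "add u ?g = add (mul u ?g) (neg a)"
      using uC gC NC[OF a(1)] by (simp add: mul_lam a(2) A.grp.m_assoc)
    then show "add u ?g \<in> V" using VN[OF UV[OF mulU[OF u gU]] negN[OF a(1)]] by simp
    \<comment> \<open>To subtract g, write u = w g = w + g + b with w in U; then u - g is w followed
      by the conjugate g + b - g of b, which stays in the preceding span.\<close>
    define w where "w = mul u (iv ?g)"
    have w: "w \<in> U" unfolding w_def by (rule mulU[OF u ivU[OF gU]])
    note wC = UH(2)[OF w]
    obtain b where b: "b \<in> ?N" "lam w ?g = add ?g b" using w unfolding U_def by blast
    have "u = mul w ?g" unfolding w_def using uC gC by simp
    also have "\<dots> = add w (add ?g b)" using wC gC by (simp add: mul_lam b(2))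
    finally have "add u (neg ?g) = add w (add (add ?g b) (neg ?g))"
      using wC gC NC[OF b(1)] by (simp add: A.grp.m_assoc)
    then show "add u (neg ?g) \<in> V" using VN[OF UV[OF w] conj_gs(1)[OF g b(1)]] by simp
  qed
  have Vg: "add v ?g \<in> V" "add v (neg ?g) \<in> V" if v: "v \<in> V" for v
  proof -
    obtain u a where ua: "v = add u a" "u \<in> U" "a \<in> ?N" using v unfolding V_def by blast
    note C = UH(2)[OF ua(2)] NC[OF ua(3)]
    have "add v ?g = add (add u ?g) (add (add (neg ?g) a) ?g)"
      unfolding ua(1) using C gC by (simp add: A.grp.m_assoc)
    then show "add v ?g \<in> V" using VN[OF Ug(1)[OF ua(2)] conj_gs(2)[OF g ua(3)]] by simp
    have "add v (neg ?g) = add (add u (neg ?g)) (add (add ?g a) (neg ?g))"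
      unfolding ua(1) using C gC by (simp add: A.grp.m_assoc)
    then show "add v (neg ?g) \<in> V" using VN[OF Ug(2)[OF ua(2)] conj_gs(1)[OF g ua(3)]] by simp
  qed
  \<comment> \<open>The x for which right addition of x and of -x preserves V form a subgroup. It
    contains the generators, so adding to zero shows that all of \<open>A (Suc i)\<close> lies in
    V.\<close>
  define W where "W = {x \<in> C. \<forall>v\<in>V. add v x \<in> V \<and> add v (neg x) \<in> V}"
  have "asub W"
    unfolding asub_def
  proof (intro conjI ballI)
    show "W \<subseteq> C" unfolding W_def by blast
    show "z \<in> W" unfolding W_def using VC A.grp.inv_one by auto
  next
    fix x y assume x: "x \<in> W" and y: "y \<in> W"
    have C: "x \<in> C" "y \<in> C" using x y unfolding W_def by blast+
    have "add v (add x y) \<in> V \<and> add v (neg (add x y)) \<in> V" if v: "v \<in> V" for v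
    proof -
      have "add (add v x) y \<in> V" using x y v unfolding W_def by blast
      moreover have "add (add v (neg y)) (neg x) \<in> V" using x y v unfolding W_def by blast
      ultimately show ?thesis using C VC[OF v] by (simp add: A.grp.m_assoc A.grp.inv_mult_group)
    qed
    then show "add x y \<in> W" using C unfolding W_def by blast
  next
    fix x assume "x \<in> W"
    then show "neg x \<in> W" unfolding W_def by auto
  qed
  moreover have "set (take (Suc i) gs) \<subseteq> W"
  proof
    fix x assume "x \<in> set (take (Suc i) gs)"
    then have "x \<in> set (take i gs) \<or> x = ?g" using i by (auto simp: take_Suc_conv_app_nth)
    then show "x \<in> W"
    proof
      assume "x \<in> set (take i gs)"
      then have "x \<in> ?N" by (rule gen_subgroup.gen_in)
      then show ?thesis unfolding W_def using VN negN NC by blast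
    next
      assume "x = ?g"
      then show ?thesis unfolding W_def using Vg gC by blast
    qed
  qed
  ultimately have AW: "A (Suc i) \<subseteq> W" by (rule gen_subset)
  have zU: "z \<in> U" using mulU[OF gU ivU[OF gU]] gC by simp
  show ?thesis
  proof
    fix x assume x: "x \<in> A (Suc i)"
    have "add z x \<in> V" using AW x UV[OF zU] unfolding W_def by blast
    then have "x \<in> V" using asubD(3)[OF aA x] by simp
    then obtain u a where ua: "x = add u a" "u \<in> U" "a \<in> ?N" unfolding V_def by blast
    have "lam (iv u) a \<in> H (Suc i)"
      using IH lam_H(2)[OF UH(3)[OF ua(2)] ua(3)] H_mono[of i "Suc i"] by auto
    then have "mul u (lam (iv u) a) \<in> H (Suc i)" by (rule gen_subgroup.add_in[OF UH(1)[OF ua(2)]])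
    then show "x \<in> H (Suc i)" using ua(1) UH(2)[OF ua(2)] NC[OF ua(3)] by (simp add: mul_lam)
  qed
qed

lemma A_sub_H: "i \<le> length gs \<Longrightarrow> A i \<subseteq> H i"
proof (induction i)
  case 0
  have "A 0 \<subseteq> {z}" using gen_subset[OF idealD(1)[OF ideal_zero], of "{}"] by simp
  then show ?case using z_mgen by auto
next
  case (Suc i)
  then show ?case using A_sub_H_step by simp
qed

lemma A_eq_H: "i \<le> length gs \<Longrightarrow> A i = H i"
  using A_sub_H H_sub_A by blast

context
  fixes X assumes X: "X \<subseteq> gen (set gs)" "brace_generates X"
begin

text \<open>At full length the additive and the multiplicative span coincide, so this set is closed
  under all four operations and contains generators of the brace.\<close>

lemma carrier_eq: "C = gen (set gs)" "C = mgen (set gs)"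
proof -
  have e: "gen (set gs) = mgen (set gs)" using A_eq_H[of "length gs"] by simp
  have a: "asub (gen (set gs))" by (rule asub_gen[OF gs_C(1)])
  have "C \<subseteq> gen (set gs)"
  proof (rule X(2)[unfolded brace_generates_def, rule_format])
    fix a b assume "a \<in> gen (set gs)" "b \<in> gen (set gs)"
    then show "add a b \<in> gen (set gs) \<and> mul a b \<in> gen (set gs)"
      using gen_subgroup.add_in[of _ C mul "set gs"] gen_subgroup.add_in[of _ C add "set gs"] unfolding e[symmetric] by blast
  next
    fix a assume "a \<in> gen (set gs)"
    then show "neg a \<in> gen (set gs) \<and> iv a \<in> gen (set gs)"
      using gen_subgroup.inv_in[of _ C mul "set gs"] gen_subgroup.inv_in[of _ C add "set gs"] unfolding e[symmetric] by blast
  qed (use X(1) asubD(2)[OF a] in auto)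
  then show "C = gen (set gs)" using asubD(1)[OF a] by (rule equalityI)
  then show "C = mgen (set gs)" using e by simp
qed

lemma A_conj:
  assumes a: "a \<in> C" and x: "x \<in> A i"
  shows "add (add a x) (neg a) \<in> A i"
proof -
  have "a \<in> gen (set gs)" using a carrier_eq(1) by simp
  then have "\<forall>x\<in>A i. add (add a x) (neg a) \<in> A i \<and> add (add (neg a) x) a \<in> A i"
  proof induction
    case gid_in
    then show ?case using asubD(3)[OF aA] A.grp.inv_one by auto
  next
    case (gen_in s)
    then show ?case using conj_gs by blast
  next
    case (add_in a b)
    have C: "a \<in> C" "b \<in> C" using add_in.hyps asubD(3)[OF asub_gen[OF gs_C(1)]] by blast+
    show ?case
    proof
      fix x assume x: "x \<in> A i"
      note xC = asubD(3)[OF aA x]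
      have "add (add a (add (add b x) (neg b))) (neg a) \<in> A i" "add (add (neg b) (add (add (neg a) x) a)) b \<in> A i"
        using add_in.IH x by blast+
      then show "add (add (add a b) x) (neg (add a b)) \<in> A i \<and> add (add (neg (add a b)) x) (add a b) \<in> A i"
        using C xC by (simp add: A.grp.m_assoc A.grp.inv_mult_group)
    qed
  next
    case (inv_in a)
    have "a \<in> C" using inv_in.hyps asubD(3)[OF asub_gen[OF gs_C(1)]] by blast
    then show ?case using inv_in.IH by simp
  qed
  then show ?thesis using x by blast
qed

text \<open>Conjugation respects products, so the induction runs along \<open>H i\<close>, which is
  \<open>A i\<close>.\<close>

lemma mul_conj_gs:
  assumes b: "b \<in> set gs" and i: "i \<le> length gs" and x: "x \<in> A i"
  shows "mul (mul b x) (iv b) \<in> A i" "mul (mul (iv b) x) b \<in> A i"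
proof -
  have bC: "b \<in> C" using gs_C(1) b by auto
  have clo: "u \<in> A i \<Longrightarrow> v \<in> A i \<Longrightarrow> mul u v \<in> A i" "u \<in> A i \<Longrightarrow> iv u \<in> A i" for u v
    unfolding A_eq_H[OF i] by (auto intro: gen_subgroup.intros)
  have "x \<in> H i" using x A_eq_H[OF i] by simp
  then have "mul (mul b x) (iv b) \<in> A i \<and> mul (mul (iv b) x) b \<in> A i"
  proof induction
    case gid_in
    then show ?case using asubD(2)[OF aA] bC by simp
  next
    case (gen_in s)
    then obtain k where k: "k < length gs" "s = gs ! k" "A (Suc k) \<subseteq> A i" by (rule cert_nth)
    show ?case unfolding k(2) using certD(5,6)[OF k(1) b] k(3) by blast
  next
    case (add_in u v)
    have C: "u \<in> C" "v \<in> C" using add_in.hyps HC by blast+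
    have "mul (mul b (mul u v)) (iv b) = mul (mul (mul b u) (iv b)) (mul (mul b v) (iv b))"
      "mul (mul (iv b) (mul u v)) b = mul (mul (mul (iv b) u) b) (mul (mul (iv b) v) b)"
      using C bC by (simp_all add: M.grp.m_assoc)
    then show ?case using clo(1) add_in.IH by simp
  next
    case (inv_in u)
    have C: "u \<in> C" using inv_in.hyps HC by blast
    have "mul (mul b (iv u)) (iv b) = iv (mul (mul b u) (iv b))"
      "mul (mul (iv b) (iv u)) b = iv (mul (mul (iv b) u) b)"
      using C bC by (simp_all add: M.grp.m_assoc M.grp.inv_mult_group)
    then show ?case using clo(2) inv_in.IH by simp
  qed
  then show "mul (mul b x) (iv b) \<in> A i" "mul (mul (iv b) x) b \<in> A i" by blast+
qed

lemma A_mul_conj: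
  assumes i: "i \<le> length gs" and a: "a \<in> C" and x: "x \<in> A i"
  shows "mul (mul a x) (iv a) \<in> A i"
proof -
  have "a \<in> mgen (set gs)" using a carrier_eq(2) by simp
  then have "\<forall>x\<in>A i. mul (mul a x) (iv a) \<in> A i \<and> mul (mul (iv a) x) a \<in> A i"
  proof induction
    case gid_in
    then show ?case using asubD(3)[OF aA] M.grp.inv_one by auto
  next
    case (gen_in s)
    then show ?case using mul_conj_gs[OF _ i] by blast
  next
    case (add_in a b)
    have C: "a \<in> C" "b \<in> C" using add_in.hyps mgen_carrier[OF gs_C(1)] by blast+
    show ?case
    proof
      fix x assume x: "x \<in> A i"
      note xC = asubD(3)[OF aA x]
      have "mul (mul a (mul (mul b x) (iv b))) (iv a) \<in> A i" "mul (mul (iv b) (mul (mul (iv a) x) a)) b \<in> A i"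
        using add_in.IH x by blast+
      then show "mul (mul (mul a b) x) (iv (mul a b)) \<in> A i \<and> mul (mul (iv (mul a b)) x) (mul a b) \<in> A i"
        using C xC by (simp add: M.grp.m_assoc M.grp.inv_mult_group)
    qed
  next
    case (inv_in a)
    have "a \<in> C" using inv_in.hyps mgen_carrier[OF gs_C(1)] by blast
    then show ?case using inv_in.IH by simp
  qed
  then show ?thesis using x by blast
qed

lemma A_ideal: "i \<le> length gs \<Longrightarrow> is_ideal C add mul (A i)"
  unfolding ideal_iff
  using aA A_conj A_mul_conj lam_H(1) carrier_eq(2) by simp

lemma A_wstep:
  assumes i: "i < length gs"
  shows "wstep_by (gs ! i) (A i) (A (Suc i))"
proof -
  let ?g = "gs ! i" and ?N = "A i"
  have N: "is_ideal C add mul ?N" and J: "is_ideal C add mul (A (Suc i))" using A_ideal i by simp_all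
  have gJ: "?g \<in> A (Suc i)" using nth_gen_take[of i "Suc i" gs] i by (auto intro: gen_subgroup.gen_in)
  have gC: "?g \<in> C" using gs_C(1) i by auto
  obtain C' :: "'a set" and add' mul' h where h: "bhom C add mul C' add' mul' h"
    and ker: "\<And>x. x \<in> C \<Longrightarrow> h x = gid C' add' \<longleftrightarrow> x \<in> ?N" by (fact quotientE[OF N])
  interpret Q: bhom C add mul C' add' mul' h by (rule h)
  have take: "x \<in> ?N \<or> x = ?g" if "x \<in> set (take (Suc i) gs)" for x
    using that i gen_subgroup.gen_in[of x "set (take i gs)" C add] by (auto simp: take_Suc_conv_app_nth)
  have pre: "asub {x \<in> C. h x \<in> K}" if K: "Q.B'.asub K" for K
    unfolding asub_def using Q.B'.asubD[OF K] by (auto simp: Q.h_add Q.h_neg)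
  have sub: "A (Suc i) \<subseteq> {x \<in> C. h x \<in> K}" if K: "Q.B'.asub K" "h ?g \<in> K" for K
  proof (rule gen_subset[OF pre[OF K(1)]])
    show "set (take (Suc i) gs) \<subseteq> {x \<in> C. h x \<in> K}"
    proof
      fix x assume x: "x \<in> set (take (Suc i) gs)"
      have xC: "x \<in> C" using gs_C(2) x by blast
      from take[OF x] have "h x \<in> K"
      proof
        assume "x \<in> ?N"
        then have "h x = Q.B'.z" using ker[OF xC] by blast
        then show ?thesis using Q.B'.asubD(2)[OF K(1)] by simp
      qed (use K(2) in simp)
      then show "x \<in> {x \<in> C. h x \<in> K}" using xC by blast
    qed
  qed
  have "\<exists>n. add (neg (zm n ?g)) x \<in> ?N" if x: "x \<in> A (Suc i)" for x
  proof -
    have "h ?g \<in> range (\<lambda>n. Q.B'.zm n (h ?g))"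
      using rangeI[of "\<lambda>n. Q.B'.zm n (h ?g)" 1] Q.h_in[OF gC] by simp
    then have "h x \<in> range (\<lambda>n. Q.B'.zm n (h ?g))"
      using sub[OF Q.B'.asub_zm_range[OF Q.h_in[OF gC]]] x by blast
    then obtain n where "h x = Q.B'.zm n (h ?g)" by blast
    then have "h (zm n ?g) = h x" using Q.h_zm[OF gC] by simp
    then show ?thesis using Q.h_eq_iff_kernel[OF ker zm_closed[OF gC] idealD(4)[OF J x]] by blast
  qed
  moreover have "in_soc_mod C add mul ?N (A (Suc i))"
    if s: "\<forall>b\<in>set gs. add (neg b) (lam ?g b) \<in> ?N \<and> add (add ?g b) (neg (add b ?g)) \<in> ?N"
  proof -
    \<comment> \<open>The elements fixed by \<lambda>_(h g) and commuting additively with h g form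
      an additive subgroup, so the socle conditions hold everywhere once they hold on additive
      generators.\<close>
    let ?Z = "{y \<in> C'. Q.B'.lam (h ?g) y = y \<and> add' (h ?g) y = add' y (h ?g)}"
    have "asub {b \<in> C. h b \<in> ?Z}"
    proof (rule pre)
      have hgC: "h ?g \<in> C'" using gC by simp
      show "Q.B'.asub ?Z"
        unfolding Q.B'.asub_def
      proof (intro conjI ballI)
        show "Q.B'.z \<in> ?Z" using hgC by simp
      next
        fix x y assume "x \<in> ?Z"
          "y \<in> ?Z"
        then have xy: "x \<in> C'" "y \<in> C'" "Q.B'.lam (h ?g) x = x" "Q.B'.lam (h ?g) y = y"
          "add' (h ?g) x = add' x (h ?g)" "add' (h ?g) y = add' y (h ?g)" by blast+
        have "add' (h ?g) (add' x y) = add' (add' x (h ?g)) y"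
          using xy(1,2) hgC by (simp add: Q.B'.A.grp.m_assoc[symmetric] xy(5))
        also have "\<dots> = add' (add' x y) (h ?g)"
          using xy(1,2) hgC by (simp add: Q.B'.A.grp.m_assoc xy(6))
        finally show "add' x y \<in> ?Z"
          using xy hgC by (simp add: Q.B'.lam_add)
      next
        fix x assume "x \<in> ?Z"
        then have x: "x \<in> C'" "Q.B'.lam (h ?g) x = x" "add' (h ?g) x = add' x (h ?g)" by blast+
        have "add' (add' (Q.B'.neg x) (add' x (h ?g))) (Q.B'.neg x) = add' (add' (Q.B'.neg x) (add' (h ?g) x)) (Q.B'.neg x)"
          unfolding x(3) ..
        then have "add' (h ?g) (Q.B'.neg x) = add' (Q.B'.neg x) (h ?g)"
          using x(1) hgC by (simp add: Q.B'.A.grp.m_assoc)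
        then show "Q.B'.neg x \<in> ?Z"
          using x hgC by (simp add: Q.B'.lam_neg)
      qed blast
    qed
    then have "gen (set gs) \<subseteq> {b \<in> C. h b \<in> ?Z}"
    proof (rule gen_subset)
      show "set gs \<subseteq> {b \<in> C. h b \<in> ?Z}"
      proof
        fix b assume b: "b \<in> set gs"
        have bC: "b \<in> C" using gs_C(1) b by blast
        have "h b = h (lam ?g b)" using Q.h_eq_iff_kernel[OF ker bC lam_closed[OF gC bC]] s b by blast
        moreover have "h (add ?g b) = h (add b ?g)"
          using Q.h_eq_iff'[of "add ?g b" "add b ?g"] ker[of "add (add ?g b) (neg (add b ?g))"] s b bC gC by simp
        ultimately show "b \<in> {b \<in> C. h b \<in> ?Z}"
          using bC gC by (simp add: Q.h_add Q.h_lam)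
      qed
    qed
    then have all: "Q.B'.lam (h ?g) (h b) = h b \<and> add' (h ?g) (h b) = add' (h b) (h ?g)" if "b \<in> C" for b
      using that carrier_eq(1) by blast
    have "h ?g \<in> Q.B'.soc"
      unfolding Q.B'.soc_def using gC all Q.h_onto by auto
    from sub[OF Q.B'.asub_soc this] have "h ` A (Suc i) \<subseteq> Q.B'.soc" by blast
    then show ?thesis using Q.in_soc_mod_iff[OF ker idealD(2)[OF J]] by blast
  qed
  moreover have "(\<forall>b\<in>set gs. add (neg b) (lam ?g b) \<in> ?N \<and> add (add ?g b) (neg (add b ?g)) \<in> ?N) \<or>
      (\<exists>p. prime (p::nat) \<and> zm (int p) ?g \<in> ?N)"
    using cert i unfolding cert_def cert_at_def by blast
  ultimately show ?thesis
    unfolding wstep_by_def using J gJ gen_take_mono[of i "Suc i" gs] by auto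
qed

lemma cert_wreach: "wreach {z} C"
proof -
  have "i \<le> length gs \<Longrightarrow> wreach {z} (A i)" for i
  proof (induction i)
    case 0
    have "A 0 \<subseteq> {z}" using gen_subset[OF idealD(1)[OF ideal_zero], of "{}"] by simp
    then have "A 0 = {z}" using asubD(2)[OF aA, of 0] by auto
    then show ?case by simp
  next
    case (Suc i)
    have "\<exists>g. wstep_by g (A i) (A (Suc i))" using A_wstep[of i] Suc.prems by auto
    then show ?case using Suc by (auto intro: rtranclp.rtrancl_into_rtrancl)
  qed
  from this[of "length gs"] show ?thesis using carrier_eq(1) by simp
qed

end

end

text \<open>Suppose c differs from 1 modulo p and choose l with l (1 - c) = 1 modulo p. Then the
  product of g and l g is g + c l g = l g, which forces g to be zero.\<close>

lemma lam_self_trivial_mod_prime: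
  assumes g: "g \<in> C" and p: "prime (p::nat)" "zm (int p) g = z" and c: "lam g g = zm c g"
  shows "lam g g = g"
proof (cases "int p dvd 1 - c")
  case True
  then obtain k where k: "1 - c = int p * k" by (elim dvdE)
  have "g = zm (c + int p * k) g" using k g by (metis add_diff_cancel_left' diff_add_cancel zm_1 add.commute)
  also have "\<dots> = add (zm c g) (zm k (zm (int p) g))" using zm_add[OF g] zm_zm[OF g] by simp
  also have "\<dots> = zm c g" unfolding p(2) using g A.grp.int_pow_one by simp
  finally show ?thesis using c by simp
next
  case False
  then have "coprime (int p) (1 - c)" using p(1) by (simp add: prime_imp_coprime)
  then obtain u l where ul: "u * int p + l * (1 - c) = 1" using bezout_int[of "int p" "1 - c"] by auto
  have e: "1 + c * l = l + int p * u" using ul by (simp add: algebra_simps)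
  have "mul g (zm l g) = add g (zm l (lam g g))" using g by (simp add: mul_lam lam_zm)
  also have "\<dots> = zm (1 + c * l) g" unfolding c using zm_add[OF g, of 1 "c * l"] zm_zm[OF g] g by simp
  also have "\<dots> = add (zm l g) (zm u (zm (int p) g))" unfolding e using zm_add[OF g] zm_zm[OF g] by simp
  also have "\<dots> = zm l g" unfolding p(2) using g A.grp.int_pow_one by simp
  finally have "mul (mul g (zm l g)) (iv (zm l g)) = mul (zm l g) (iv (zm l g))" by simp
  then have "g = z" using g by simp
  then show ?thesis using g by simp
qed

text \<open>The generators of the successive steps are listed in order, so that the spans of the
  prefixes are exactly the ideals of the chain; most conditions of the certificate are then
  instances of the ideal and socle properties.\<close>

lemma wreach_cert:
  assumes "wreach {z} C"
  shows "\<exists>gs. cert gs \<and> gen (set gs) = C"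
proof -
  have "is_ideal C add mul J \<and> (\<exists>gs. set gs \<subseteq> C \<and> gen (set gs) = J \<and>
      (\<forall>i\<le>length gs. is_ideal C add mul (gen (set (take i gs)))) \<and>
      (\<forall>i<length gs. wstep_by (gs ! i) (gen (set (take i gs))) (gen (set (take (Suc i) gs)))))"
    if "wreach {z} J" for J
    using that
  proof (induction rule: rtranclp_induct)
    case base
    have a: "asub (gen {})" by (rule asub_gen) simp
    have "gen {} \<subseteq> {z}" using gen_subset[OF idealD(1)[OF ideal_zero], of "{}"] by simp
    then have "gen {} = {z}" using asubD(2)[OF a] by auto
    then show ?case using ideal_zero by (intro conjI exI[of _ "[]"]) auto
  next
    case (step I J)
    then obtain gs where gs: "set gs \<subseteq> C" "gen (set gs) = I"
      "\<forall>i\<le>length gs. is_ideal C add mul (gen (set (take i gs)))"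
      "\<forall>i<length gs. wstep_by (gs ! i) (gen (set (take i gs))) (gen (set (take (Suc i) gs)))" by blast
    obtain g where g: "wstep_by g I J" using step.hyps(2) by blast
    have J: "is_ideal C add mul J" "I \<subseteq> J" "g \<in> J" "\<forall>x\<in>J. \<exists>n. add (neg (zm n g)) x \<in> I"
      using g unfolding wstep_by_def by blast+
    have gC: "g \<in> C" by (rule idealD(4)[OF J(1,3)])
    have gsg: "set (gs @ [g]) \<subseteq> C" using gs(1) gC by simp
    have gI: "x \<in> I" if "x \<in> set gs" for x using that gs(2) gen_subgroup.gen_in[of x "set gs" C add] by blast
    have "gen (set (gs @ [g])) = J"
    proof
      show "gen (set (gs @ [g])) \<subseteq> J"
        by (rule gen_subset[OF idealD(1)[OF J(1)]]) (use gI J(2,3) in auto)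
      show "J \<subseteq> gen (set (gs @ [g]))"
      proof
        fix x assume x: "x \<in> J"
        note a = asub_gen[OF gsg]
        obtain n where "add (neg (zm n g)) x \<in> I" using J(4) x by blast
        then have "add (neg (zm n g)) x \<in> gen (set (gs @ [g]))"
          unfolding gs(2)[symmetric] using gen_mono[of "set gs" "set (gs @ [g])"] by auto
        moreover have "zm n g \<in> gen (set (gs @ [g]))"
          by (rule asub_zm[OF a]) (simp add: gen_subgroup.gen_in)
        ultimately have "add (zm n g) (add (neg (zm n g)) x) \<in> gen (set (gs @ [g]))" using asubD(4)[OF a] by blast
        then show "x \<in> gen (set (gs @ [g]))" using gC idealD(4)[OF J(1) x] by simp
      qed
    qed
    moreover have "is_ideal C add mul (gen (set (take i (gs @ [g]))))" if "i \<le> length (gs @ [g])" for i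
    proof (cases "i \<le> length gs")
      case True
      then show ?thesis using gs(3) by simp
    next
      case False
      then have "take i (gs @ [g]) = gs @ [g]" using that by simp
      then show ?thesis using calculation J(1) by simp
    qed
    moreover have "wstep_by ((gs @ [g]) ! i) (gen (set (take i (gs @ [g])))) (gen (set (take (Suc i) (gs @ [g]))))"
      if "i < length (gs @ [g])" for i
    proof (cases "i < length gs")
      case True
      then show ?thesis using gs(4) by (simp add: nth_append)
    next
      case False
      then have "i = length gs" using that by simp
      then show ?thesis using calculation(1) gs(2) g by simp
    qed
    ultimately show ?case using J(1) gsg by (intro conjI exI[of _ "gs @ [g]"]) blast+
  qed
  from this[OF assms] obtain gs where gs: "set gs \<subseteq> C" "gen (set gs) = C"
      "\<forall>i\<le>length gs. is_ideal C add mul (gen (set (take i gs)))"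
      "\<forall>i<length gs. wstep_by (gs ! i) (gen (set (take i gs))) (gen (set (take (Suc i) gs)))" by blast
  have "cert_at gs i" if i: "i < length gs" for i
  proof -
    let ?g = "gs ! i" and ?I = "gen (set (take i gs))" and ?J = "gen (set (take (Suc i) gs))"
    have I: "is_ideal C add mul ?I" and J: "is_ideal C add mul ?J" using gs(3) i by simp_all
    have st: "?g \<in> ?J" "\<forall>x\<in>?J. \<exists>n. add (neg (zm n ?g)) x \<in> ?I"
      "in_soc_mod C add mul ?I ?J \<or> (\<exists>p. prime (p::nat) \<and> zm (int p) ?g \<in> ?I)"
      using gs(4) i unfolding wstep_by_def by blast+
    have gC: "?g \<in> C" using gs(1) i by auto
    have soc: "add (neg b) (lam ?g b) \<in> ?I \<and> add (add ?g b) (neg (add b ?g)) \<in> ?I"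
      if "in_soc_mod C add mul ?I ?J" "b \<in> C" for b
      using that st(1) unfolding in_soc_mod_def by blast
    have "add (neg ?g) (lam ?g ?g) \<in> ?I"
      using st(3)
    proof
      assume "\<exists>p. prime (p::nat) \<and> zm (int p) ?g \<in> ?I"
      then obtain p where p: "prime (p::nat)" "zm (int p) ?g \<in> ?I" by blast
      obtain C' :: "'a set" and add' mul' h where h: "bhom C add mul C' add' mul' h"
        and ker: "\<And>x. x \<in> C \<Longrightarrow> h x = gid C' add' \<longleftrightarrow> x \<in> ?I" by (fact quotientE[OF I])
      interpret Q: bhom C add mul C' add' mul' h by (rule h)
      have lC: "lam ?g ?g \<in> C" using gC by simp
      obtain c where "add (neg (zm c ?g)) (lam ?g ?g) \<in> ?I" using st(2) idealD(9)[OF J gC st(1)] by blast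
      then have "h (zm c ?g) = h (lam ?g ?g)" using Q.h_eq_iff_kernel[OF ker zm_closed[OF gC] lC] by blast
      then have "Q.B'.lam (h ?g) (h ?g) = Q.B'.zm c (h ?g)" using gC by (simp add: Q.h_lam Q.h_zm)
      moreover have "Q.B'.zm (int p) (h ?g) = Q.B'.z"
        using ker[OF zm_closed[OF gC]] p(2) Q.h_zm[OF gC] by metis
      ultimately have "Q.B'.lam (h ?g) (h ?g) = h ?g"
        using Q.B'.lam_self_trivial_mod_prime[OF Q.h_in[OF gC] p(1)] by blast
      then have "h ?g = h (lam ?g ?g)" using gC by (simp add: Q.h_lam)
      then show ?thesis using Q.h_eq_iff_kernel[OF ker gC lC] by blast
    qed (use soc[OF _ gC] in blast)
    moreover have "(\<forall>b\<in>set gs. add (neg b) (lam ?g b) \<in> ?I \<and> add (add ?g b) (neg (add b ?g)) \<in> ?I) \<or>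
      (\<exists>p. prime (p::nat) \<and> zm (int p) ?g \<in> ?I)" using st(3) soc gs(1) by blast
    moreover have "stable ?J b ?g" if "b \<in> set gs" for b
    proof -
      have b: "b \<in> C" "iv b \<in> C" using that gs(1) by auto
      show ?thesis
        unfolding stable_def
        using idealD(9)[OF J b(1) st(1)] idealD(9)[OF J b(2) st(1)] idealD(7)[OF J b(1) st(1)]
          ideal_conj_neg[OF J b(1) st(1)] idealD(8)[OF J b(1) st(1)] ideal_conj_iv[OF J b(1) st(1)] by blast
    qed
    ultimately show ?thesis unfolding cert_at_def by blast
  qed
  then show ?thesis unfolding cert_def using gs(1,2) by blast
qed

theorem wreach_iff_cert:
  assumes "brace_generates X" "X \<subseteq> C"
  shows "wreach {z} C \<longleftrightarrow> (\<exists>gs. cert gs \<and> X \<subseteq> gen (set gs))"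
  using wreach_cert cert_wreach[OF _ _ assms(1)] assms(2) by metis

end

section \<open>The presented brace\<close>

lemma bcong_wf: "bcong m rels a b \<Longrightarrow> wf m a \<and> wf m b"
  by (induction rule: bcong.induct) auto

lemma bcls_eq_iff:
  assumes "wf m a"
  shows "bcls m rels a = bcls m rels b \<longleftrightarrow> bcong m rels a b"
proof
  assume "bcls m rels a = bcls m rels b"
  moreover have "a \<in> bcls m rels a" unfolding bcls_def using bcong.refl[OF assms] by simp
  ultimately have "bcong m rels b a" unfolding bcls_def by simp
  then show "bcong m rels a b" by (rule bcong.sym)
next
  assume "bcong m rels a b"
  then show "bcls m rels a = bcls m rels b"
    unfolding bcls_def by (auto intro: bcong.trans bcong.sym)
qed

lemma bcong_some:
  assumes "wf m a"
  shows "bcong m rels a (SOME w. w \<in> bcls m rels a)"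
proof -
  have "a \<in> bcls m rels a" unfolding bcls_def using bcong.refl[OF assms] by simp
  then have "(SOME w. w \<in> bcls m rels a) \<in> bcls m rels a" by (rule someI)
  then show ?thesis unfolding bcls_def by simp
qed

locale presentation =
  fixes m :: nat and rels :: "bword list"
  assumes valid: "valid_pres m rels"
begin

abbreviation "W \<equiv> {w. wf m w}"
abbreviation "K \<equiv> bcls m rels"
abbreviation "PC \<equiv> pres_carrier m rels"
abbreviation "padd \<equiv> pres_add m rels"
abbreviation "pmul \<equiv> pres_mul m rels"

lemma K_eq_iff: "wf m a \<Longrightarrow> K a = K b \<longleftrightarrow> bcong m rels a b"
  by (rule bcls_eq_iff)

lemma K_in [simp, intro]: "wf m a \<Longrightarrow> K a \<in> PC"
  unfolding pres_carrier_def by simp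

lemma PC_cases: assumes "X \<in> PC" obtains a where "wf m a" "X = K a"
  using assms unfolding pres_carrier_def by auto

lemma padd_K [simp]: "wf m a \<Longrightarrow> wf m b \<Longrightarrow> padd (K a) (K b) = K (BAdd a b)"
  unfolding pres_add_def
  by (subst K_eq_iff) (auto intro!: bcong.sym[OF bcong.cAdd] bcong_some bcong_wf[OF bcong_some, THEN conjunct2])

lemma pmul_K [simp]: "wf m a \<Longrightarrow> wf m b \<Longrightarrow> pmul (K a) (K b) = K (BMul a b)"
  unfolding pres_mul_def
  by (subst K_eq_iff) (auto intro!: bcong.sym[OF bcong.cMul] bcong_some bcong_wf[OF bcong_some, THEN conjunct2])

lemma K_axioms:
  assumes "wf m a" "wf m b" "wf m c"
  shows "K (BAdd (BAdd a b) c) = K (BAdd a (BAdd b c))"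
    "K (BMul (BMul a b) c) = K (BMul a (BMul b c))"
    "K (BAdd Emp a) = K a" "K (BAdd a Emp) = K a" "K (BMul Emp a) = K a" "K (BMul a Emp) = K a"
    "K (BAdd (BNeg a) a) = K Emp" "K (BAdd a (BNeg a)) = K Emp"
    "K (BMul (BInv a) a) = K Emp" "K (BMul a (BInv a)) = K Emp"
    "K (BMul a (BAdd b c)) = K (BAdd (BAdd (BMul a b) (BNeg a)) (BMul a c))"
  using assms by (simp_all add: K_eq_iff bcong.intros)

lemma pres_id:
  assumes "X \<in> PC"
  shows "padd (K Emp) X = X" "padd X (K Emp) = X" "pmul (K Emp) X = X" "pmul X (K Emp) = X"
proof -
  obtain a where "wf m a" "X = K a" using assms by (rule PC_cases)
  then show "padd (K Emp) X = X" "padd X (K Emp) = X" "pmul (K Emp) X = X" "pmul X (K Emp) = X"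
    by (simp_all add: K_axioms)
qed

lemma pres_group: "is_group PC padd" "is_group PC pmul"
proof -
  have e: "K Emp \<in> PC" by simp
  show "is_group PC padd"
    unfolding is_group_def
  proof (intro conjI)
    show "\<forall>X\<in>PC. \<forall>Y\<in>PC. padd X Y \<in> PC"
    proof (intro ballI)
      fix X Y assume "X \<in> PC" "Y \<in> PC"
      then obtain a b where "wf m a" "X = K a" "wf m b" "Y = K b" by (elim PC_cases)
      then show "padd X Y \<in> PC" by simp
    qed
    show "\<forall>X\<in>PC. \<forall>Y\<in>PC. \<forall>Z\<in>PC. padd (padd X Y) Z = padd X (padd Y Z)"
    proof (intro ballI)
      fix X Y Z assume "X \<in> PC" "Y \<in> PC" "Z \<in> PC"
      then obtain a b c where "wf m a" "X = K a" "wf m b" "Y = K b" "wf m c" "Z = K c" by (elim PC_cases)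
      then show "padd (padd X Y) Z = padd X (padd Y Z)" by (simp add: K_axioms)
    qed
    show "\<exists>e\<in>PC. (\<forall>X\<in>PC. padd e X = X \<and> padd X e = X) \<and> (\<forall>X\<in>PC. \<exists>Y\<in>PC. padd X Y = e \<and> padd Y X = e)"
    proof (rule bexI[OF _ e], intro conjI ballI)
      fix X assume "X \<in> PC"
      then obtain a where a: "wf m a" "X = K a" by (rule PC_cases)
      show "\<exists>Y\<in>PC. padd X Y = K Emp \<and> padd Y X = K Emp"
        using a by (intro bexI[of _ "K (BNeg a)"]) (simp_all add: K_axioms)
    qed (rule pres_id, assumption)+
  qed
  show "is_group PC pmul"
    unfolding is_group_def
  proof (intro conjI)
    show "\<forall>X\<in>PC. \<forall>Y\<in>PC. pmul X Y \<in> PC"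
    proof (intro ballI)
      fix X Y assume "X \<in> PC" "Y \<in> PC"
      then obtain a b where "wf m a" "X = K a" "wf m b" "Y = K b" by (elim PC_cases)
      then show "pmul X Y \<in> PC" by simp
    qed
    show "\<forall>X\<in>PC. \<forall>Y\<in>PC. \<forall>Z\<in>PC. pmul (pmul X Y) Z = pmul X (pmul Y Z)"
    proof (intro ballI)
      fix X Y Z assume "X \<in> PC" "Y \<in> PC" "Z \<in> PC"
      then obtain a b c where "wf m a" "X = K a" "wf m b" "Y = K b" "wf m c" "Z = K c" by (elim PC_cases)
      then show "pmul (pmul X Y) Z = pmul X (pmul Y Z)" by (simp add: K_axioms)
    qed
    show "\<exists>e\<in>PC. (\<forall>X\<in>PC. pmul e X = X \<and> pmul X e = X) \<and> (\<forall>X\<in>PC. \<exists>Y\<in>PC. pmul X Y = e \<and> pmul Y X = e)"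
    proof (rule bexI[OF _ e], intro conjI ballI)
      fix X assume "X \<in> PC"
      then obtain a where a: "wf m a" "X = K a" by (rule PC_cases)
      show "\<exists>Y\<in>PC. pmul X Y = K Emp \<and> pmul Y X = K Emp"
        using a by (intro bexI[of _ "K (BInv a)"]) (simp_all add: K_axioms)
    qed (rule pres_id, assumption)+
  qed
qed

sublocale GA: cgroup PC padd by unfold_locales (rule pres_group)
sublocale GM: cgroup PC pmul by unfold_locales (rule pres_group)

lemma gid_K: "gid PC padd = K Emp"
  by (rule GA.gid_eqI) (simp_all add: pres_id del: GA.grp.r_cancel_one GA.grp.l_cancel_one GA.grp.r_cancel_one' GA.grp.l_cancel_one')

lemma gid_mul_K: "gid PC pmul = K Emp"
  by (rule GM.gid_eqI) (simp_all add: pres_id del: GM.grp.r_cancel_one GM.grp.l_cancel_one GM.grp.r_cancel_one' GM.grp.l_cancel_one')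

lemma neg_K [simp]: "wf m a \<Longrightarrow> ginv PC padd (K a) = K (BNeg a)"
  by (rule GA.grp.inv_equality) (simp_all add: gid_K K_axioms)

lemma iv_K [simp]: "wf m a \<Longrightarrow> ginv PC pmul (K a) = K (BInv a)"
  by (rule GM.grp.inv_equality) (simp_all add: gid_mul_K K_axioms)

lemma pres_brace: "is_brace PC padd pmul"
  unfolding is_brace_def
proof (intro conjI ballI)
  fix X Y Z assume "X \<in> PC" "Y \<in> PC" "Z \<in> PC"
  then obtain a b c where "wf m a" "X = K a" "wf m b" "Y = K b" "wf m c" "Z = K c" by (elim PC_cases)
  then show "pmul X (padd Y Z) = padd (padd (pmul X Y) (ginv PC padd X)) (pmul X Z)"
    by (simp add: K_axioms)
qed (rule pres_group)+

sublocale B: brace PC padd pmul by unfold_locales (rule pres_brace)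

lemma lam_K [simp]: "wf m a \<Longrightarrow> wf m b \<Longrightarrow> B.lam (K a) (K b) = K (BAdd (BNeg a) (BMul a b))"
  by (simp add: blam_def)

definition "gens = (\<lambda>k. K (Gen k)) ` {..<m}"

lemma gens_PC: "gens \<subseteq> PC"
  unfolding gens_def by auto

lemma gens_generate: "B.brace_generates gens"
  unfolding B.brace_generates_def
proof (intro allI impI subsetI)
  fix S X assume S: "gens \<subseteq> S" "B.z \<in> S" "\<forall>a\<in>S. \<forall>b\<in>S. padd a b \<in> S \<and> pmul a b \<in> S"
    "\<forall>a\<in>S. B.neg a \<in> S \<and> B.iv a \<in> S" and X: "X \<in> PC"
  have "wf m w \<longrightarrow> K w \<in> S" for w
  proof (induction w)
    case Emp
    then show ?case using S(2) gid_K by simp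
  next
    case (Gen i)
    then show ?case using S(1) unfolding gens_def by auto
  next
    case (BMul a b)
    show ?case
    proof
      assume "wf m (BMul a b)"
      then have w: "wf m a" "wf m b" by simp_all
      then have "pmul (K a) (K b) \<in> S" using BMul.IH S(3) by blast
      then show "K (BMul a b) \<in> S" using w by simp
    qed
  next
    case (BAdd a b)
    show ?case
    proof
      assume "wf m (BAdd a b)"
      then have w: "wf m a" "wf m b" by simp_all
      then have "padd (K a) (K b) \<in> S" using BAdd.IH S(3) by blast
      then show "K (BAdd a b) \<in> S" using w by simp
    qed
  next
    case (BNeg a)
    show ?case
    proof
      assume "wf m (BNeg a)"
      then have w: "wf m a" by simp
      then have "B.neg (K a) \<in> S" using BNeg.IH S(4) by blast
      then show "K (BNeg a) \<in> S" using w by simp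
    qed
  next
    case (BInv a)
    show ?case
    proof
      assume "wf m (BInv a)"
      then have w: "wf m a" by simp
      then have "B.iv (K a) \<in> S" using BInv.IH S(4) by blast
      then show "K (BInv a) \<in> S" using w by simp
    qed
  qed
  then show "X \<in> S" using X by (auto elim!: PC_cases)
qed

end

section \<open>Codes of words\<close>

abbreviation "eE \<equiv> pr 0 0"
abbreviation "eG i \<equiv> pr 1 i"
abbreviation "eM a b \<equiv> pr 2 (pr a b)"
abbreviation "eA a b \<equiv> pr 3 (pr a b)"
abbreviation "eN a \<equiv> pr 4 a"
abbreviation "eI a \<equiv> pr 5 a"

lemma pr_eq_iff: "pr a b = pr c d \<longleftrightarrow> a = c \<and> b = d"
  by (metis pfst_pr psnd_pr)

lemma enc_simps:
  "enc_word Emp = eE" "enc_word (Gen i) = eG i" "enc_word (BMul a b) = eM (enc_word a) (enc_word b)"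
  "enc_word (BAdd a b) = eA (enc_word a) (enc_word b)" "enc_word (BNeg a) = eN (enc_word a)"
  "enc_word (BInv a) = eI (enc_word a)"
  by simp_all

declare enc_word.simps [simp del]
declare enc_simps [simp]

lemma enc_inj: "enc_word a = enc_word b \<Longrightarrow> a = b"
proof (induction a arbitrary: b)
  case Emp
  then show ?case by (cases b) (auto simp: pr_eq_iff)
next
  case (Gen i)
  then show ?case by (cases b) (auto simp: pr_eq_iff)
next
  case (BMul a1 a2)
  then show ?case by (cases b) (auto simp: pr_eq_iff)
next
  case (BAdd a1 a2)
  then show ?case by (cases b) (auto simp: pr_eq_iff)
next
  case (BNeg a)
  then show ?case by (cases b) (auto simp: pr_eq_iff)
next
  case (BInv a)
  then show ?case by (cases b) (auto simp: pr_eq_iff)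
qed

lemma enc_eq_iff [simp]: "enc_word a = enc_word b \<longleftrightarrow> a = b"
  using enc_inj by blast

lemma enc_dest:
  "enc_word w = eE \<longleftrightarrow> w = Emp"
  "enc_word w = eG i \<longleftrightarrow> w = Gen i"
  "enc_word w = eM u v \<longleftrightarrow> (\<exists>a b. w = BMul a b \<and> u = enc_word a \<and> v = enc_word b)"
  "enc_word w = eA u v \<longleftrightarrow> (\<exists>a b. w = BAdd a b \<and> u = enc_word a \<and> v = enc_word b)"
  "enc_word w = eN u \<longleftrightarrow> (\<exists>a. w = BNeg a \<and> u = enc_word a)"
  "enc_word w = eI u \<longleftrightarrow> (\<exists>a. w = BInv a \<and> u = enc_word a)"
  by (cases w; auto simp: pr_eq_iff)+

section \<open>Enumerating equality of words and additive membership\<close>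

definition nc_base :: "nat \<Rightarrow> nat \<Rightarrow> bool" where
  "nc_base p x \<longleftrightarrow> x = pr eE eE \<or> (\<exists>i<pfst p. x = pr (eG i) (eG i)) \<or>
    (\<exists>i. dropc (psnd p) i \<noteq> 0 \<and> x = pr (nthc (psnd p) i) eE)"

text \<open>From \<open>a \<sim> b\<close>, hence well-formed \<open>a\<close>, and \<open>c \<sim> d\<close>.\<close>
definition nc_rule :: "nat \<Rightarrow> nat \<Rightarrow> nat \<Rightarrow> nat \<Rightarrow> nat \<Rightarrow> bool" where
  "nc_rule x a b c d \<longleftrightarrow>
    x = pr b a \<or> (b = c \<and> x = pr a d) \<or>
    x = pr (eM a c) (eM b d) \<or> x = pr (eA a c) (eA b d) \<or> x = pr (eN a) (eN b) \<or> x = pr (eI a) (eI b) \<or>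
    x = pr (eA eE a) a \<or> x = pr (eA a eE) a \<or> x = pr (eA (eN a) a) eE \<or> x = pr (eA a (eN a)) eE \<or>
    x = pr (eM eE a) a \<or> x = pr (eM a eE) a \<or> x = pr (eM (eI a) a) eE \<or> x = pr (eM a (eI a)) eE \<or>
    (\<exists>u v w. a = eA (eA u v) w \<and> x = pr a (eA u (eA v w))) \<or>
    (\<exists>u v w. a = eM (eM u v) w \<and> x = pr a (eM u (eM v w))) \<or>
    (\<exists>u v w. a = eM u (eA v w) \<and> x = pr a (eA (eA (eM u v) (eN u)) (eM u w)))"

definition nc_step :: "nat \<Rightarrow> nat \<Rightarrow> nat \<Rightarrow> nat \<Rightarrow> bool" where
  "nc_step p x y z \<longleftrightarrow> nc_rule x (pfst y) (psnd y) (pfst z) (psnd z)"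

definition NC :: "nat \<Rightarrow> nat \<Rightarrow> nat \<Rightarrow> bool" where
  "NC p a b \<longleftrightarrow> deriv nc_base nc_step p (pr a b)"

lemma RE_NC [RE_intros]: "cf f \<Longrightarrow> cf g \<Longrightarrow> cf h \<Longrightarrow> RE (\<lambda>x. NC (f x) (g x) (h x))"
  unfolding NC_def nc_base_def nc_step_def nc_rule_def
  by (intro RE_deriv RE_intros cf_intros)

text \<open>q packs the presentation, the list of words and the length of the prefix. Closure of
  \<open>sp_step\<close> under \<open>NC\<close> makes membership independent of the representing
  word.\<close>

definition sp_base :: "nat \<Rightarrow> nat \<Rightarrow> bool" where
  "sp_base q x \<longleftrightarrow> x = eE \<or> (\<exists>k<psnd (psnd q). x = nthc (pfst (psnd q)) k)"

definition sp_step :: "nat \<Rightarrow> nat \<Rightarrow> nat \<Rightarrow> nat \<Rightarrow> bool" where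
  "sp_step q x y z \<longleftrightarrow> x = eA y z \<or> x = eN y \<or> NC (pfst q) y x"

text \<open>\<open>w\<close> lies in the additive subgroup generated by the first \<open>i\<close> words of the list \<open>G\<close>.\<close>
definition SP :: "nat \<Rightarrow> nat \<Rightarrow> nat \<Rightarrow> nat \<Rightarrow> bool" where
  "SP p G i w \<longleftrightarrow> deriv sp_base sp_step (pr p (pr G i)) w"

lemma RE_SP [RE_intros]:
  "cf f \<Longrightarrow> cf g \<Longrightarrow> cf h \<Longrightarrow> cf k \<Longrightarrow> RE (\<lambda>x. SP (f x) (g x) (h x) (k x))"
  unfolding SP_def sp_base_def sp_step_def
  by (intro RE_deriv RE_intros cf_intros)

context presentation
begin

definition "code = enc_pres m rels"

lemma pfst_code [simp]: "pfst code = m"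
  unfolding code_def enc_pres_def by simp

lemma rel_code: "dropc (psnd code) i \<noteq> 0 \<longleftrightarrow> i < length rels"
  "i < length rels \<Longrightarrow> nthc (psnd code) i = enc_word (rels ! i)"
  unfolding code_def enc_pres_def by (simp_all add: dropc_list_encode_eq_0 nthc_list_encode not_le)

lemma wf_rel: "i < length rels \<Longrightarrow> wf m (rels ! i)"
  using valid unfolding valid_pres_def by simp

lemma nc_base_code: "nc_base code x \<longleftrightarrow> x = pr eE eE \<or> (\<exists>i<m. x = pr (eG i) (eG i)) \<or>
    (\<exists>r\<in>set rels. x = pr (enc_word r) eE)"
  unfolding nc_base_def pfst_code in_set_conv_nth using rel_code by (auto simp: Bex_def in_set_conv_nth)

lemma NC_step:
  assumes "NC code a b" "NC code c d" "nc_rule (pr u v) a b c d"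
  shows "NC code u v"
  unfolding NC_def by (rule deriv.step[of _ _ _ "pr a b" "pr c d"]) (use assms in \<open>simp_all add: NC_def nc_step_def\<close>)

lemma NC_refl: "wf m w \<Longrightarrow> NC code (enc_word w) (enc_word w)"
proof (induction w)
  case Emp
  show ?case unfolding NC_def by (rule deriv.base) (simp add: nc_base_code)
next
  case (Gen i)
  then show ?case unfolding NC_def by (intro deriv.base) (auto simp: nc_base_code)
next
  case (BMul a b)
  then have "NC code (enc_word a) (enc_word a)" "NC code (enc_word b) (enc_word b)" by simp_all
  then show ?case by (rule NC_step) (simp add: nc_rule_def)
next
  case (BAdd a b)
  then have "NC code (enc_word a) (enc_word a)" "NC code (enc_word b) (enc_word b)" by simp_all
  then show ?case by (rule NC_step) (simp add: nc_rule_def)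
next
  case (BNeg a)
  then have "NC code (enc_word a) (enc_word a)" by simp
  from this this show ?case by (rule NC_step) (simp add: nc_rule_def)
next
  case (BInv a)
  then have "NC code (enc_word a) (enc_word a)" by simp
  from this this show ?case by (rule NC_step) (simp add: nc_rule_def)
qed

lemma NC_one:
  assumes "wf m a" "nc_rule (pr u v) (enc_word a) (enc_word a) (enc_word a) (enc_word a)"
  shows "NC code u v"
  by (rule NC_step[OF NC_refl[OF assms(1)] NC_refl[OF assms(1)] assms(2)])

lemma bcong_NC: "bcong m rels a b \<Longrightarrow> NC code (enc_word a) (enc_word b)"
proof (induction rule: bcong.induct)
  case (refl a)
  then show ?case by (rule NC_refl)
next
  case (sym a b)
  show ?case by (rule NC_step[OF sym.IH sym.IH]) (simp add: nc_rule_def)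
next
  case (trans a b c)
  show ?case by (rule NC_step[OF trans.IH]) (simp add: nc_rule_def)
next
  case (cMul a a' b b')
  show ?case by (rule NC_step[OF cMul.IH]) (simp add: nc_rule_def)
next
  case (cAdd a a' b b')
  show ?case by (rule NC_step[OF cAdd.IH]) (simp add: nc_rule_def)
next
  case (cNeg a a')
  show ?case by (rule NC_step[OF cNeg.IH cNeg.IH]) (simp add: nc_rule_def)
next
  case (cInv a a')
  show ?case by (rule NC_step[OF cInv.IH cInv.IH]) (simp add: nc_rule_def)
next
  case (add_assoc a b c)
  then show ?case by (intro NC_one[of "BAdd (BAdd a b) c"]) (simp_all add: nc_rule_def pr_eq_iff)
next
  case (mul_assoc a b c)
  then show ?case by (intro NC_one[of "BMul (BMul a b) c"]) (simp_all add: nc_rule_def pr_eq_iff)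
next
  case (brace a b c)
  then show ?case by (intro NC_one[of "BMul a (BAdd b c)"]) (simp_all add: nc_rule_def pr_eq_iff)
next
  case (rel r)
  then show ?case unfolding NC_def by (intro deriv.base) (auto simp: nc_base_code)
qed (rule NC_one, assumption, simp add: nc_rule_def)+

lemma nc_rule_bcong:
  assumes "nc_rule x (enc_word a) (enc_word b) (enc_word c) (enc_word d)" "bcong m rels a b" "bcong m rels c d"
  shows "\<exists>u v. x = pr (enc_word u) (enc_word v) \<and> bcong m rels u v"
proof -
  have w: "wf m a" "wf m b" "wf m c" "wf m d" using assms(2,3) bcong_wf by blast+
  have I: "bcong m rels u v \<Longrightarrow> x = pr (enc_word u) (enc_word v) \<Longrightarrow> ?thesis" for u v by blast
  from assms(1)[unfolded nc_rule_def] show ?thesis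
  proof (elim disjE exE conjE)
    assume "x = pr (enc_word b) (enc_word a)"
    then show ?thesis by (intro I[OF bcong.sym[OF assms(2)]])
  next
    assume "enc_word b = enc_word c" "x = pr (enc_word a) (enc_word d)"
    then show ?thesis using assms(2,3) by (intro I[of a d] bcong.trans[of m rels a b d]) simp_all
  next
    fix u v s assume e: "enc_word a = eA (eA u v) s" and x: "x = pr (enc_word a) (eA u (eA v s))"
    obtain t1 t2 t3 where t: "a = BAdd (BAdd t1 t2) t3" "u = enc_word t1" "v = enc_word t2" "s = enc_word t3"
      using e unfolding enc_dest by (metis enc_dest(4))
    show ?thesis by (rule I[OF bcong.add_assoc[of m t1 t2 t3]]) (use w t x in simp_all)
  next
    fix u v s assume e: "enc_word a = eM (eM u v) s" and x: "x = pr (enc_word a) (eM u (eM v s))"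
    obtain t1 t2 t3 where t: "a = BMul (BMul t1 t2) t3" "u = enc_word t1" "v = enc_word t2" "s = enc_word t3"
      using e unfolding enc_dest by (metis enc_dest(3))
    show ?thesis by (rule I[OF bcong.mul_assoc[of m t1 t2 t3]]) (use w t x in simp_all)
  next
    fix u v s assume e: "enc_word a = eM u (eA v s)" and x: "x = pr (enc_word a) (eA (eA (eM u v) (eN u)) (eM u s))"
    obtain t1 t2 t3 where t: "a = BMul t1 (BAdd t2 t3)" "u = enc_word t1" "v = enc_word t2" "s = enc_word t3"
      using e unfolding enc_dest by (metis enc_dest(4))
    show ?thesis by (rule I[OF bcong.brace[of m t1 t2 t3]]) (use w t x in simp_all)
  qed (rule I[OF bcong.cMul[OF assms(2,3)]] I[OF bcong.cAdd[OF assms(2,3)]] I[OF bcong.cNeg[OF assms(2)]] I[OF bcong.cInv[OF assms(2)]] I[OF bcong.add_lid[OF w(1)]] I[OF bcong.add_rid[OF w(1)]] I[OF bcong.add_linv[OF w(1)]] I[OF bcong.add_rinv[OF w(1)]] I[OF bcong.mul_lid[OF w(1)]] I[OF bcong.mul_rid[OF w(1)]] I[OF bcong.mul_linv[OF w(1)]] I[OF bcong.mul_rinv[OF w(1)]], (simp; fail))+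
qed

lemma NC_bcong:
  assumes "NC code x y"
  shows "\<exists>a b. x = enc_word a \<and> y = enc_word b \<and> bcong m rels a b"
proof -
  have "\<exists>a b. t = pr (enc_word a) (enc_word b) \<and> bcong m rels a b" if "deriv nc_base nc_step code t" for t
    using that
  proof (induction rule: deriv.induct)
    case (base x)
    then consider "x = pr eE eE" | i where "i < m" "x = pr (eG i) (eG i)" | r where "r \<in> set rels" "x = pr (enc_word r) eE"
      unfolding nc_base_code by blast
    then show ?case
    proof cases
      case 1
      then show ?thesis by (intro exI[of _ Emp]) (simp add: bcong.refl)
    next
      case 2
      then show ?thesis by (intro exI[of _ "Gen i"]) (simp add: bcong.refl)
    next
      case 3
      then show ?thesis using valid unfolding valid_pres_def by (intro exI[of _ r] exI[of _ Emp]) (simp add: bcong.rel)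
    qed
  next
    case (step y z x)
    obtain a b c d where "y = pr (enc_word a) (enc_word b)" "bcong m rels a b"
      "z = pr (enc_word c) (enc_word d)" "bcong m rels c d" using step.IH by blast
    then show ?case using step.hyps(3) nc_rule_bcong[of x a b c d] unfolding nc_step_def by simp
  qed
  from this[OF assms[unfolded NC_def]] show ?thesis by (auto simp: pr_eq_iff)
qed

lemma NC_iff: "wf m a \<Longrightarrow> NC code (enc_word a) (enc_word b) \<longleftrightarrow> K a = K b"
  using NC_bcong[of "enc_word a" "enc_word b"] bcong_NC[of a b] K_eq_iff[of a b] by auto

text \<open>Reflexivity in the enumerated congruence serves as the test that a number codes a
  well-formed word.\<close>

lemma NC_wf_iff: "NC code x x \<longleftrightarrow> (\<exists>a. wf m a \<and> x = enc_word a)"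
  using NC_bcong[of x x] NC_refl bcong_wf by blast

context
  fixes G n gs
  assumes G: "\<And>i. i < n \<Longrightarrow> nthc G i = enc_word (gs ! i)" "length gs = n" "\<And>w. w \<in> set gs \<Longrightarrow> wf m w"
begin

lemma SP_sound:
  assumes "i \<le> n" "SP code G i x"
  shows "\<exists>w. wf m w \<and> x = enc_word w \<and> K w \<in> B.gen (set (take i (map K gs)))"
  using assms(2) unfolding SP_def
proof (induction rule: deriv.induct)
  case (base x)
  then consider "x = eE" | k where "k < i" "x = nthc G k" unfolding sp_base_def by auto
  then show ?case
  proof cases
    case 1
    then show ?thesis using gen_subgroup.gid_in[of PC padd] gid_K by (intro exI[of _ Emp]) simp
  next
    case 2
    have "K (gs ! k) \<in> set (take i (map K gs))"
      using 2(1) assms(1) G(2) B.nth_gen_take[of k i "map K gs"] by simp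
    then show ?thesis using 2 assms(1) G by (intro exI[of _ "gs ! k"]) (auto intro: gen_subgroup.gen_in)
  qed
next
  case (step y z x)
  obtain a b where a: "wf m a" "y = enc_word a" "K a \<in> B.gen (set (take i (map K gs)))"
    and b: "wf m b" "z = enc_word b" "K b \<in> B.gen (set (take i (map K gs)))" using step.IH by blast
  from step.hyps(3) consider "x = eA y z" | "x = eN y" | "NC code y x" unfolding sp_step_def by auto
  then show ?case
  proof cases
    case 1
    then show ?thesis using a b gen_subgroup.add_in[OF a(3) b(3)] by (intro exI[of _ "BAdd a b"]) simp
  next
    case 2
    then show ?thesis using a gen_subgroup.inv_in[OF a(3)] by (intro exI[of _ "BNeg a"]) simp
  next
    case 3
    then obtain c where c: "x = enc_word c" "bcong m rels a c" using NC_bcong[OF 3] a(2) by auto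
    then show ?thesis using a bcong_wf[OF c(2)] K_eq_iff[of a c] by (intro exI[of _ c]) simp
  qed
qed

lemma SP_complete:
  assumes "i \<le> n" "X \<in> B.gen (set (take i (map K gs)))"
  shows "\<exists>w. wf m w \<and> X = K w \<and> SP code G i (enc_word w)"
  using assms(2)
proof induction
  case gid_in
  have "SP code G i eE" unfolding SP_def by (rule deriv.base) (simp add: sp_base_def)
  then show ?case using gid_K by (intro exI[of _ Emp]) simp
next
  case (gen_in s)
  then obtain k where k: "k < i" "k < n" "s = K (gs ! k)" using G(2) by (auto simp: in_set_conv_nth)
  have "SP code G i (nthc G k)" unfolding SP_def by (rule deriv.base) (use k(1) in \<open>auto simp: sp_base_def\<close>)
  then show ?case using k G by (intro exI[of _ "gs ! k"]) simp
next
  case (add_in X Y)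
  from add_in.IH(1) obtain a where a: "wf m a" "X = K a" "SP code G i (enc_word a)" by (elim exE conjE)
  from add_in.IH(2) obtain b where b: "wf m b" "Y = K b" "SP code G i (enc_word b)" by (elim exE conjE)
  have "SP code G i (eA (enc_word a) (enc_word b))"
    unfolding SP_def by (rule deriv.step[OF a(3)[unfolded SP_def] b(3)[unfolded SP_def]]) (simp add: sp_step_def)
  then show ?case using a(1,2) b(1,2) by (intro exI[of _ "BAdd a b"]) simp
next
  case (inv_in X)
  from inv_in.IH obtain a where a: "wf m a" "X = K a" "SP code G i (enc_word a)" by (elim exE conjE)
  have "SP code G i (eN (enc_word a))"
    unfolding SP_def by (rule deriv.step[OF a(3)[unfolded SP_def] a(3)[unfolded SP_def]]) (simp add: sp_step_def)
  then show ?case using a(1,2) by (intro exI[of _ "BNeg a"]) simp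
qed

lemma SP_iff:
  assumes "i \<le> n" "wf m w"
  shows "SP code G i (enc_word w) \<longleftrightarrow> K w \<in> B.gen (set (take i (map K gs)))"
proof
  assume "SP code G i (enc_word w)"
  from SP_sound[OF assms(1) this] show "K w \<in> B.gen (set (take i (map K gs)))" by simp
next
  assume "K w \<in> B.gen (set (take i (map K gs)))"
  from SP_complete[OF assms(1) this] obtain a where a: "wf m a" "K w = K a" "SP code G i (enc_word a)" by (elim exE conjE)
  then have "NC code (enc_word a) (enc_word w)" using NC_iff by simp
  then show "SP code G i (enc_word w)"
    unfolding SP_def by (intro deriv.step[OF a(3)[unfolded SP_def] a(3)[unfolded SP_def]]) (simp add: sp_step_def)
qed

end

end

section \<open>The positive certificate on codes\<close>

abbreviation "lamw a b \<equiv> eA (eN a) (eM a b)"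

definition mulw :: "nat \<Rightarrow> nat \<Rightarrow> nat" where
  "mulw q g = rec_nat eE (\<lambda>_ t. eA g t) q"

lemma cf_mulw [cf_intros]:
  assumes "cf f" "cf g"
  shows "cf (\<lambda>x. mulw (f x) (g x))"
  unfolding mulw_def by (intro cf_intros assms[THEN cf_comp])

text \<open>Only bounded quantifiers and comparisons of computable terms occur on the right, as the
  closure rules for \<open>RE\<close> require.\<close>

lemma prime_iff_bounded: "prime q \<longleftrightarrow> 1 < q \<and> (\<forall>a<q. \<forall>b<q. a * b \<noteq> q)" for q :: nat
proof
  assume q: "prime q"
  have "a * b \<noteq> q" if ab: "a < q" "b < q" for a b
  proof
    assume e: "a * b = q"
    then have "a = 1 \<or> b = 1" using prime_product[of a b] q by simp
    then show False using e ab by auto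
  qed
  then show "1 < q \<and> (\<forall>a<q. \<forall>b<q. a * b \<noteq> q)" using prime_gt_1_nat[OF q] by blast
next
  assume q: "1 < q \<and> (\<forall>a<q. \<forall>b<q. a * b \<noteq> q)"
  have "d = 1 \<or> d = q" if d: "d dvd q" for d
  proof -
    obtain e where e: "q = d * e" using d by (elim dvdE)
    have "e dvd q" unfolding e by simp
    then have "d \<le> q" "e \<le> q" using q d dvd_imp_le[of d q] dvd_imp_le[of e q] by simp_all
    then have "d = q \<or> e = q" using e q by (metis le_neq_implies_less)
    then show ?thesis using e q by auto
  qed
  then show "prime q" using q by (simp add: prime_nat_iff)
qed

definition stablew :: "nat \<Rightarrow> nat \<Rightarrow> nat \<Rightarrow> nat \<Rightarrow> nat \<Rightarrow> bool" where
  "stablew p G i b g \<longleftrightarrow> SP p G i (lamw b g) \<and> SP p G i (lamw (eI b) g) \<and>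
    SP p G i (eA (eA b g) (eN b)) \<and> SP p G i (eA (eA (eN b) g) b) \<and>
    SP p G i (eM (eM b g) (eI b)) \<and> SP p G i (eM (eM (eI b) g) b)"

text \<open>\<open>cert_at\<close> with membership in the spans replaced by \<open>SP\<close>. G is
  an arbitrary number, whose first n entries are tested for being codes of words in
  \<open>POS\<close>.\<close>

definition POS_at :: "nat \<Rightarrow> nat \<Rightarrow> nat \<Rightarrow> nat \<Rightarrow> bool" where
  "POS_at p G n i \<longleftrightarrow>
    (\<forall>j<n. stablew p G (Suc i) (nthc G j) (nthc G i)) \<and>
    SP p G i (eA (eN (nthc G i)) (lamw (nthc G i) (nthc G i))) \<and>
    ((\<forall>j<n. SP p G i (eA (eN (nthc G j)) (lamw (nthc G i) (nthc G j))) \<and>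
        SP p G i (eA (eA (nthc G i) (nthc G j)) (eN (eA (nthc G j) (nthc G i))))) \<or>
      (\<exists>q. (1 < q \<and> (\<forall>a<q. \<forall>b<q. a * b \<noteq> q)) \<and> SP p G i (mulw q (nthc G i))))"

definition POS :: "nat \<Rightarrow> bool" where
  "POS p \<longleftrightarrow> (\<exists>G n. (\<forall>i<n. NC p (nthc G i) (nthc G i) \<and> POS_at p G n i) \<and> (\<forall>k<pfst p. SP p G n (eG k)))"

lemma RE_POS: "RE POS"
proof -
  have "RE (\<lambda>p. POS p)"
    unfolding POS_def POS_at_def stablew_def by (intro RE_intros cf_intros)
  then show ?thesis by simp
qed

context presentation
begin

definition wpow :: "nat \<Rightarrow> bword \<Rightarrow> bword" where
  "wpow q w = rec_nat Emp (\<lambda>_ t. BAdd w t) q"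

lemma wpow:
  assumes "wf m w"
  shows "wf m (wpow q w) \<and> enc_word (wpow q w) = mulw q (enc_word w) \<and> K (wpow q w) = B.zm (int q) (K w)"
proof (induction q)
  case 0
  then show ?case by (simp add: wpow_def mulw_def gid_K)
next
  case (Suc q)
  have "K (wpow (Suc q) w) = K (BAdd w (wpow q w))" by (simp add: wpow_def)
  also have "\<dots> = padd (K w) (K (wpow q w))" using padd_K[OF assms] Suc by metis
  also have "\<dots> = B.zm (1 + int q) (K w)" using Suc assms B.zm_add[of "K w" 1 "int q"] by simp
  finally show ?case using Suc assms by (simp add: wpow_def mulw_def)
qed

lemma cert_at_iff:
  assumes G: "\<And>i. i < n \<Longrightarrow> nthc G i = enc_word (gs ! i)" "length gs = n" "\<And>w. w \<in> set gs \<Longrightarrow> wf m w"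
    and i: "i < n"
  shows "B.cert_at (map K gs) i \<longleftrightarrow> POS_at code G n i"
proof -
  have wf: "wf m (gs ! j)" if "j < n" for j using that G(2,3) by simp
  have sp: "SP code G k (enc_word w) \<longleftrightarrow> K w \<in> B.gen (set (take k (map K gs)))" if "k \<le> n" "wf m w" for k w
    by (rule SP_iff[OF G that])
  have all: "(\<forall>b\<in>set (map K gs). P b) \<longleftrightarrow> (\<forall>j<n. P (K (gs ! j)))" for P
    using G(2) by (auto simp: all_set_conv_all_nth)
  have gi: "map K gs ! i = K (gs ! i)" using i G(2) by simp
  let ?g = "gs ! i"
  have 1: "B.stable (B.gen (set (take (Suc i) (map K gs)))) (K (gs ! j)) (K ?g) \<longleftrightarrow>
      stablew code G (Suc i) (nthc G j) (nthc G i)" if j: "j < n" for j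
    using wf[OF i] wf[OF j] i j by (simp add: B.stable_def stablew_def G(1) sp enc_simps[symmetric] del: enc_simps take_Suc)
  have 2: "padd (B.neg (K ?g)) (B.lam (K ?g) (K ?g)) \<in> B.gen (set (take i (map K gs))) \<longleftrightarrow>
      SP code G i (eA (eN (nthc G i)) (lamw (nthc G i) (nthc G i)))"
    using wf[OF i] i by (simp add: G(1) sp enc_simps[symmetric] del: enc_simps)
  have 3: "(padd (B.neg (K (gs ! j))) (B.lam (K ?g) (K (gs ! j))) \<in> B.gen (set (take i (map K gs))) \<and>
        padd (padd (K ?g) (K (gs ! j))) (B.neg (padd (K (gs ! j)) (K ?g))) \<in> B.gen (set (take i (map K gs)))) \<longleftrightarrow>
      (SP code G i (eA (eN (nthc G j)) (lamw (nthc G i) (nthc G j))) \<and>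
        SP code G i (eA (eA (nthc G i) (nthc G j)) (eN (eA (nthc G j) (nthc G i)))))" if j: "j < n" for j
    using wf[OF i] wf[OF j] i j by (simp add: G(1) sp enc_simps[symmetric] del: enc_simps)
  have 4: "B.zm (int q) (K ?g) \<in> B.gen (set (take i (map K gs))) \<longleftrightarrow> SP code G i (mulw q (nthc G i))" for q
    using wpow[OF wf[OF i], of q] sp[of i "wpow q ?g"] i by (simp add: G(1))
  have 5: "prime (q::nat) \<longleftrightarrow> 1 < q \<and> (\<forall>a<q. \<forall>b<q. a * b \<noteq> q)" for q by (rule prime_iff_bounded)
  show ?thesis
    unfolding B.cert_at_def POS_at_def all gi 2 4 5
    by (simp only: 1 3 cong: imp_cong)
qed

lemma POS_iff: "POS code \<longleftrightarrow> B.wreach {B.z} PC"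
proof -
  have "POS code \<longleftrightarrow> (\<exists>gs. B.cert gs \<and> gens \<subseteq> B.gen (set gs))"
  proof
    assume "POS code"
    then obtain G n where P: "\<forall>i<n. NC code (nthc G i) (nthc G i) \<and> POS_at code G n i" "\<forall>k<m. SP code G n (eG k)"
      unfolding POS_def pfst_code by blast
    define gs where "gs = map (\<lambda>i. SOME w. wf m w \<and> nthc G i = enc_word w) [0..<n]"
    have g: "wf m (gs ! i) \<and> nthc G i = enc_word (gs ! i)" if "i < n" for i
    proof -
      have "\<exists>w. wf m w \<and> nthc G i = enc_word w" using P(1) that NC_wf_iff by blast
      from someI_ex[OF this] show ?thesis unfolding gs_def using that by simp
    qed
    have len: "length gs = n" unfolding gs_def by simp
    have gw: "wf m w" if "w \<in> set gs" for w using that g len by (auto simp: in_set_conv_nth)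
    have G: "\<And>i. i < n \<Longrightarrow> nthc G i = enc_word (gs ! i)" using g by blast
    have "B.cert (map K gs)"
      unfolding B.cert_def
    proof (intro conjI allI impI)
      show "set (map K gs) \<subseteq> PC" using gw by auto
      fix i assume "i < length (map K gs)"
      then have i: "i < n" using len by simp
      then show "B.cert_at (map K gs) i" using cert_at_iff[OF G len gw i] P(1) by simp
    qed
    moreover have "gens \<subseteq> B.gen (set (map K gs))"
    proof
      fix X assume "X \<in> gens"
      then obtain k where k: "k < m" "X = K (Gen k)" unfolding gens_def by blast
      have "K (Gen k) \<in> B.gen (set (take n (map K gs)))"
        using SP_iff[OF G len gw order_refl, of "Gen k"] P(2) k(1) by simp
      then show "X \<in> B.gen (set (map K gs))" unfolding k(2) using len by simp
    qed
    ultimately show "\<exists>gs. B.cert gs \<and> gens \<subseteq> B.gen (set gs)" by blast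
  next
    assume "\<exists>gs. B.cert gs \<and> gens \<subseteq> B.gen (set gs)"
    then obtain gs' where gs': "B.cert gs'" "gens \<subseteq> B.gen (set gs')" by blast
    define r where "r X = (SOME w. wf m w \<and> X = K w)" for X
    have r: "wf m (r X) \<and> X = K (r X)" if "X \<in> PC" for X
    proof -
      have "\<exists>w. wf m w \<and> X = K w" using that by (auto elim: PC_cases)
      from someI_ex[OF this] show ?thesis unfolding r_def .
    qed
    define gs where "gs = map r gs'"
    define n where "n = length gs"
    define G where "G = list_encode (map enc_word gs)"
    have s: "set gs' \<subseteq> PC" using gs'(1) unfolding B.cert_def by blast
    have mk: "map K gs = gs'" unfolding gs_def using r s by (auto intro!: map_idI simp: subset_iff)
    have gw: "wf m w" if "w \<in> set gs" for w using that r s unfolding gs_def by auto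
    have len: "length gs = n" unfolding n_def ..
    have G: "\<And>i. i < n \<Longrightarrow> nthc G i = enc_word (gs ! i)" unfolding G_def n_def by (simp add: nthc_list_encode)
    have "NC code (nthc G i) (nthc G i) \<and> POS_at code G n i" if i: "i < n" for i
    proof
      show "NC code (nthc G i) (nthc G i)" unfolding G[OF i] by (rule NC_refl) (use gw i len in simp)
      have "B.cert_at gs' i" using gs'(1) i unfolding B.cert_def n_def gs_def by simp
      then have "B.cert_at (map K gs) i" unfolding mk .
      then show "POS_at code G n i" using cert_at_iff[OF G len gw i] by simp
    qed
    moreover have "SP code G n (eG k)" if k: "k < m" for k
    proof -
      have "K (Gen k) \<in> B.gen (set (take n (map K gs)))"
        using gs'(2) k len unfolding gens_def mk[symmetric] by auto
      then show ?thesis using SP_iff[OF G len gw order_refl, of "Gen k"] k by simp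
    qed
    ultimately show "POS code" unfolding POS_def pfst_code by blast
  qed
  then show ?thesis using B.wreach_iff_cert[OF gens_generate gens_PC] by simp
qed

end

section \<open>Finite quotients as tables\<close>

context bhom
begin

lemma pstep_kernel_iff:
  assumes ker: "\<And>x. x \<in> C \<Longrightarrow> h x = B'.z \<longleftrightarrow> x \<in> I" and I: "I \<subseteq> C"
  shows "(\<exists>K. B.pstep I K) \<longleftrightarrow> (\<exists>L. B'.pstep {B'.z} L)"
proof
  assume "\<exists>K. B.pstep I K"
  then obtain K g p where K: "is_ideal C add mul K" and g: "g \<in> K" "g \<notin> I" "prime (p::nat)" "B.zm (int p) g \<in> I"
    "\<forall>x\<in>K. \<exists>n. add (B.neg (B.zm n g)) x \<in> I" unfolding B.pstep_def by blast
  have gC: "g \<in> C" by (rule B.idealD(4)[OF K g(1)])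
  have L: "is_ideal C' add' mul' (h ` K)" by (rule image_ideal[OF K])
  have "B'.pstep {B'.z} (h ` K)"
    unfolding B'.pstep_def
  proof (intro conjI exI)
    show "is_ideal C' add' mul' (h ` K)" by (rule L)
    show "{B'.z} \<subseteq> h ` K" using B'.idealD(3)[OF L] by simp
    show "h g \<in> h ` K" using g(1) by (rule imageI)
    show "h g \<notin> {B'.z}" using ker[OF gC] g(2) by simp
    show "prime p" by (rule g(3))
    show "B'.zm (int p) (h g) \<in> {B'.z}" using ker[OF B.zm_closed[OF gC]] g(4) h_zm[OF gC] by simp
    show "\<forall>x\<in>h ` K. \<exists>n. add' (B'.neg (B'.zm n (h g))) x \<in> {B'.z}"
    proof
      fix x assume "x \<in> h ` K"
      then obtain y where y: "y \<in> K" "x = h y" by blast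
      have yC: "y \<in> C" by (rule B.idealD(4)[OF K y(1)])
      obtain n where n: "add (B.neg (B.zm n g)) y \<in> I" using g(5) y(1) by blast
      have "h (add (B.neg (B.zm n g)) y) = B'.z" using ker[OF subsetD[OF I n]] n by simp
      then have "add' (B'.neg (B'.zm n (h g))) x = B'.z" using gC yC y(2) by (simp add: h_add h_neg h_zm)
      then show "\<exists>n. add' (B'.neg (B'.zm n (h g))) x \<in> {B'.z}" by blast
    qed
  qed
  then show "\<exists>L. B'.pstep {B'.z} L" by blast
next
  assume "\<exists>L. B'.pstep {B'.z} L"
  then obtain L g' p where L: "is_ideal C' add' mul' L" and g': "g' \<in> L" "g' \<noteq> B'.z" "prime (p::nat)" "B'.zm (int p) g' = B'.z"
    "\<forall>x\<in>L. \<exists>n. add' (B'.neg (B'.zm n g')) x = B'.z" unfolding B'.pstep_def by auto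
  obtain g where g: "g \<in> C" "g' = h g" using h_onto B'.idealD(4)[OF L g'(1)] by blast
  have zL: "B'.z \<in> L" by (rule B'.idealD(3)[OF L])
  have "B.pstep I {x \<in> C. h x \<in> L}"
    unfolding B.pstep_def
  proof (intro conjI exI)
    show "is_ideal C add mul {x \<in> C. h x \<in> L}" by (rule preimage_ideal[OF L])
    show "I \<subseteq> {x \<in> C. h x \<in> L}"
    proof
      fix x assume x: "x \<in> I"
      then have "h x = B'.z" using ker[OF subsetD[OF I x]] by blast
      then show "x \<in> {x \<in> C. h x \<in> L}" using zL subsetD[OF I x] by simp
    qed
    show "g \<in> {x \<in> C. h x \<in> L}" using g g'(1) by simp
    show "g \<notin> I" using ker[OF g(1)] g'(2) g(2) by simp
    show "prime p" by (rule g'(3))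
    show "B.zm (int p) g \<in> I" using ker[OF B.zm_closed[OF g(1)]] g'(4) h_zm[OF g(1)] g(2) by simp
    show "\<forall>x\<in>{x \<in> C. h x \<in> L}. \<exists>n. add (B.neg (B.zm n g)) x \<in> I"
    proof
      fix x assume "x \<in> {x \<in> C. h x \<in> L}"
      then have x: "x \<in> C" "h x \<in> L" by blast+
      obtain n where "add' (B'.neg (B'.zm n g')) (h x) = B'.z" using g'(5) x(2) by blast
      then have "h (add (B.neg (B.zm n g)) x) = B'.z" using x(1) g by (simp add: h_add h_neg h_zm)
      then have "add (B.neg (B.zm n g)) x \<in> I" using ker[of "add (B.neg (B.zm n g)) x"] x(1) g(1) by simp
      then show "\<exists>n. add (B.neg (B.zm n g)) x \<in> I" by blast
    qed
  qed
  then show "\<exists>K. B.pstep I K" by blast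
qed

end

definition smul :: "(nat \<Rightarrow> nat \<Rightarrow> nat) \<Rightarrow> nat \<Rightarrow> nat \<Rightarrow> nat" where
  "smul A k g = rec_nat 0 (\<lambda>_ t. A g t) k"

definition table_brace :: "nat \<Rightarrow> (nat \<Rightarrow> nat \<Rightarrow> nat) \<Rightarrow> (nat \<Rightarrow> nat \<Rightarrow> nat) \<Rightarrow> (nat \<Rightarrow> nat) \<Rightarrow> (nat \<Rightarrow> nat) \<Rightarrow> bool" where
  "table_brace n A M N I \<longleftrightarrow> 1 < n \<and>
    (\<forall>x<n. N x < n \<and> I x < n \<and> A 0 x = x \<and> A x 0 = x \<and> M 0 x = x \<and> M x 0 = x \<and>
      A x (N x) = 0 \<and> A (N x) x = 0 \<and> M x (I x) = 0 \<and> M (I x) x = 0 \<and>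
      (\<forall>y<n. A x y < n \<and> M x y < n \<and>
        (\<forall>w<n. A (A x y) w = A x (A y w) \<and> M (M x y) w = M x (M y w) \<and>
          M x (A y w) = A (A (M x y) (N x)) (M x w))))"

text \<open>An ideal of prime order p consists of the multiples l g of any of its nonzero elements,
  with l < p \<le> n. So for each g either no prime up to n annihilates it, or \<lambda>_b or a
  conjugation takes some multiple outside the multiples. The negation is spelled out with bounded
  quantifiers because enumerable predicates are not closed under complement.\<close>

definition no_prime_ideal :: "nat \<Rightarrow> (nat \<Rightarrow> nat \<Rightarrow> nat) \<Rightarrow> (nat \<Rightarrow> nat \<Rightarrow> nat) \<Rightarrow> (nat \<Rightarrow> nat) \<Rightarrow> (nat \<Rightarrow> nat) \<Rightarrow> bool" where
  "no_prime_ideal n A M N I \<longleftrightarrow> (\<forall>g<n. g = 0 \<or>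
    (\<forall>p<Suc n. p < 2 \<or> (\<exists>a<p. \<exists>b<p. a * b = p) \<or> smul A p g \<noteq> 0) \<or>
    (\<exists>b<n. \<exists>k<n. (\<forall>l<n. smul A l g \<noteq> A (N b) (M b (smul A k g))) \<or>
      (\<forall>l<n. smul A l g \<noteq> A (A b (smul A k g)) (N b)) \<or>
      (\<forall>l<n. smul A l g \<noteq> M (M b (smul A k g)) (I b))))"

locale numbered_brace = brace "{..<n}" A M for n :: nat and A M +
  fixes N I :: "nat \<Rightarrow> nat"
  assumes z0: "gid {..<n} A = 0"
    and negN: "x < n \<Longrightarrow> ginv {..<n} A x = N x"
    and ivI: "x < n \<Longrightarrow> ginv {..<n} M x = I x"
begin

lemma smul_zm:
  assumes "g < n" shows "smul A k g = zm (int k) g"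
proof (induction k)
  case 0
  then show ?case by (simp add: smul_def z0)
next
  case (Suc k)
  have "smul A (Suc k) g = A g (zm (int k) g)" using Suc by (simp add: smul_def)
  also have "\<dots> = zm (1 + int k) g" using zm_add[of g 1 "int k"] assms by simp
  finally show ?case by simp
qed

lemma no_prime_ideal_iff: "no_prime_ideal n A M N I \<longleftrightarrow> \<not> (\<exists>K. pstep {0} K)"
proof
  assume np: "no_prime_ideal n A M N I"
  show "\<not> (\<exists>K. pstep {0} K)"
  proof
    assume "\<exists>K. pstep {0} K"
    then obtain K g p where K: "is_ideal {..<n} A M K" and g: "g \<in> K" "g \<noteq> 0" "prime (p::nat)" "zm (int p) g = 0"
      "\<forall>x\<in>K. \<exists>l. A (neg (zm l g)) x = 0" unfolding pstep_def by auto
    have gC: "g \<in> {..<n}" by (rule idealD(4)[OF K g(1)])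
    have Kiff: "x \<in> K \<longleftrightarrow> (\<exists>l. x = zm l g)" for x
    proof
      assume x: "x \<in> K"
      note xC = idealD(4)[OF K x]
      obtain l where l: "A (neg (zm l g)) x = 0" using g(5) x by blast
      have "A (zm l g) (A (neg (zm l g)) x) = x" by (rule add_neg_cancel(1)[OF zm_closed[OF gC] xC])
      then have "x = zm l g" unfolding l using A.grp.r_one[OF zm_closed[OF gC, of l]] z0 by simp
      then show "\<exists>l. x = zm l g" by blast
    next
      assume "\<exists>l. x = zm l g"
      then show "x \<in> K" using asub_zm[OF idealD(1)[OF K] g(1)] by blast
    qed
    have "card K = p" by (rule card_cyclic_prime[OF g(3) gC _ _ Kiff]) (use g z0 in simp_all)
    moreover have "card K \<le> card {..<n}" by (rule card_mono[OF _ idealD(2)[OF K]]) simp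
    ultimately have pn: "p \<le> n" by simp
    have Ksm: "\<exists>l<n. smul A l g = x" if x: "x \<in> K" for x
    proof -
      have "x \<in> range (\<lambda>l. zm l g)" using x Kiff by blast
      also have "range (\<lambda>l. zm l g) = (\<lambda>l. zm (int l) g) ` {..<p}"
        by (rule zm_range_eq[OF gC prime_gt_0_nat[OF g(3)]]) (use g(4) z0 in simp)
      finally obtain l where "l < p" "x = zm (int l) g" by blast
      then show ?thesis using pn smul_zm[of g l] gC by (intro exI[of _ l]) auto
    qed
    have smK: "smul A k g \<in> K" for k using smul_zm[of g k] gC Kiff by auto
    have gn: "g < n" using gC by simp
    from np[unfolded no_prime_ideal_def, rule_format, OF gn] show False
    proof (elim disjE)
      assume "g = 0" then show False using g(2) by blast
    next
      assume "\<forall>p<Suc n. p < 2 \<or> (\<exists>a<p. \<exists>b<p. a * b = p) \<or> smul A p g \<noteq> 0"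
      then have "p < 2 \<or> (\<exists>a<p. \<exists>b<p. a * b = p) \<or> smul A p g \<noteq> 0" using pn by simp
      moreover have "\<not> p < 2" using prime_ge_2_nat[OF g(3)] by simp
      moreover have "smul A p g = 0" using smul_zm[OF gn] g(4) by simp
      moreover have "\<not> (\<exists>a<p. \<exists>b<p. a * b = p)"
        using g(3) unfolding prime_iff_bounded by blast
      ultimately show False by blast
    next
      assume "\<exists>b<n. \<exists>k<n. (\<forall>l<n. smul A l g \<noteq> A (N b) (M b (smul A k g))) \<or>
        (\<forall>l<n. smul A l g \<noteq> A (A b (smul A k g)) (N b)) \<or> (\<forall>l<n. smul A l g \<noteq> M (M b (smul A k g)) (I b))"
      then obtain b k where bk: "b < n" "k < n" "(\<forall>l<n. smul A l g \<noteq> A (N b) (M b (smul A k g))) \<or>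
        (\<forall>l<n. smul A l g \<noteq> A (A b (smul A k g)) (N b)) \<or> (\<forall>l<n. smul A l g \<noteq> M (M b (smul A k g)) (I b))" by blast
      have bC: "b \<in> {..<n}" using bk(1) by simp
      have "A (N b) (M b (smul A k g)) \<in> K" "A (A b (smul A k g)) (N b) \<in> K" "M (M b (smul A k g)) (I b) \<in> K"
        using idealD(9)[OF K bC smK] idealD(7)[OF K bC smK] idealD(8)[OF K bC smK] negN[OF bk(1)] ivI[OF bk(1)]
        by (simp_all add: blam_def)
      then show False using bk(3) Ksm by blast
    qed
  qed
next
  assume ps: "\<not> (\<exists>K. pstep {0} K)"
  show "no_prime_ideal n A M N I"
    unfolding no_prime_ideal_def
  proof (intro allI impI)
    fix g assume gn: "g < n"
    show "g = 0 \<or> (\<forall>p<Suc n. p < 2 \<or> (\<exists>a<p. \<exists>b<p. a * b = p) \<or> smul A p g \<noteq> 0) \<or>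
      (\<exists>b<n. \<exists>k<n. (\<forall>l<n. smul A l g \<noteq> A (N b) (M b (smul A k g))) \<or>
        (\<forall>l<n. smul A l g \<noteq> A (A b (smul A k g)) (N b)) \<or> (\<forall>l<n. smul A l g \<noteq> M (M b (smul A k g)) (I b)))"
    proof (rule ccontr)
      assume neg_all: "\<not> ?thesis"
      then obtain p where g0: "g \<noteq> 0" and p: "p < Suc n" "\<not> p < 2" "\<not> (\<exists>a<p. \<exists>b<p. a * b = p)" "smul A p g = 0"
        by blast
      have id: "\<exists>l<n. smul A l g = A (N b) (M b (smul A k g))" "\<exists>l<n. smul A l g = A (A b (smul A k g)) (N b)"
        "\<exists>l<n. smul A l g = M (M b (smul A k g)) (I b)" if "b < n" "k < n" for b k
        using neg_all that by blast+
      have pp: "prime p"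
        unfolding prime_iff_bounded using p(2,3) by auto
      have gC: "g \<in> {..<n}" using gn by simp
      have zp: "zm (int p) g = z" using smul_zm[OF gn, of p] p(4) z0 by simp
      define K where "K = range (\<lambda>l. zm l g)"
      have aK: "asub K" unfolding K_def by (rule asub_zm_range[OF gC])
      have Ksm: "\<exists>k<n. x = smul A k g" if "x \<in> K" for x
      proof -
        have "x \<in> (\<lambda>l. zm (int l) g) ` {..<p}"
          using that unfolding K_def zm_range_eq[OF gC prime_gt_0_nat[OF pp] zp] .
        then obtain l where l: "l < p" "x = zm (int l) g" by blast
        then show ?thesis using p(1) smul_zm[OF gn, of l] by (intro exI[of _ l]) simp
      qed
      have smK: "smul A k g \<in> K" for k unfolding K_def smul_zm[OF gn] by blast
      have "is_ideal {..<n} A M K"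
        unfolding ideal_iff
      proof (intro conjI ballI aK)
        fix b x assume b: "b \<in> {..<n}" and x: "x \<in> K"
        obtain k where k: "k < n" "x = smul A k g" using Ksm[OF x] by blast
        have bn: "b < n" using b by simp
        show "A (A b x) (neg b) \<in> K" using id(2)[OF bn k(1)] smK negN[OF bn] k(2) by metis
        show "M (M b x) (iv b) \<in> K" using id(3)[OF bn k(1)] smK ivI[OF bn] k(2) by metis
        show "lam b x \<in> K" unfolding blam_def using id(1)[OF bn k(1)] smK negN[OF bn] k(2) by metis
      qed
      then have "pstep {0} K"
        unfolding pstep_def
      proof (intro conjI exI)
        show "{0} \<subseteq> K" using asubD(2)[OF aK] z0 by simp
        have "zm 1 g \<in> K" unfolding K_def by blast
        then show "g \<in> K" using zm_1[OF gC] by simp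
        show "g \<notin> {0}" using g0 by simp
        show "prime p" by (rule pp)
        show "zm (int p) g \<in> {0}" using zp z0 by simp
        show "\<forall>x\<in>K. \<exists>l. A (neg (zm l g)) x \<in> {0}"
        proof
          fix x assume "x \<in> K"
          then obtain l where l: "x = zm l g" unfolding K_def by blast
          have "A (neg (zm l g)) x = 0" unfolding l using A.grp.l_inv[OF zm_closed[OF gC, of l]] z0 by simp
          then show "\<exists>l. A (neg (zm l g)) x \<in> {0}" by blast
        qed
      qed
      then show False using ps by blast
    qed
  qed
qed

end

section \<open>Evaluation of words in a table\<close>

primrec evw :: "(nat \<Rightarrow> nat \<Rightarrow> nat) \<Rightarrow> (nat \<Rightarrow> nat \<Rightarrow> nat) \<Rightarrow> (nat \<Rightarrow> nat) \<Rightarrow> (nat \<Rightarrow> nat) \<Rightarrow> (nat \<Rightarrow> nat) \<Rightarrow> bword \<Rightarrow> nat" where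
  "evw A M N I V Emp = 0"
| "evw A M N I V (Gen i) = V i"
| "evw A M N I V (BMul a b) = M (evw A M N I V a) (evw A M N I V b)"
| "evw A M N I V (BAdd a b) = A (evw A M N I V a) (evw A M N I V b)"
| "evw A M N I V (BNeg a) = N (evw A M N I V a)"
| "evw A M N I V (BInv a) = I (evw A M N I V a)"

abbreviation tb :: "nat \<Rightarrow> nat \<Rightarrow> nat \<Rightarrow> nat \<Rightarrow> nat" where
  "tb n T x y \<equiv> nthc T (n * x + y)"

abbreviation "dat m n A M N I V \<equiv> pr (pr m n) (pr (pr A M) (pr (pr N I) V))"

definition ev_base :: "nat \<Rightarrow> nat \<Rightarrow> bool" where
  "ev_base q x \<longleftrightarrow> x = pr eE 0 \<or>
    (\<exists>i<pfst (pfst q). x = pr (eG i) (nthc (psnd (psnd (psnd q))) i))"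

definition ev_step :: "nat \<Rightarrow> nat \<Rightarrow> nat \<Rightarrow> nat \<Rightarrow> bool" where
  "ev_step q x y z \<longleftrightarrow>
    x = pr (eM (pfst y) (pfst z)) (tb (psnd (pfst q)) (psnd (pfst (psnd q))) (psnd y) (psnd z)) \<or>
    x = pr (eA (pfst y) (pfst z)) (tb (psnd (pfst q)) (pfst (pfst (psnd q))) (psnd y) (psnd z)) \<or>
    x = pr (eN (pfst y)) (nthc (pfst (pfst (psnd (psnd q)))) (psnd y)) \<or>
    x = pr (eI (pfst y)) (nthc (psnd (pfst (psnd (psnd q)))) (psnd y))"

text \<open>Evaluation is presented by its graph, as a derivation system, so that recursion over
  words reduces to \<open>RE_deriv\<close>; the graph contains codes of well-formed words
  only.\<close>

definition EV :: "nat \<Rightarrow> nat \<Rightarrow> nat \<Rightarrow> bool" where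
  "EV q w v \<longleftrightarrow> deriv ev_base ev_step q (pr w v)"

lemma RE_EV [RE_intros]: "cf f \<Longrightarrow> cf g \<Longrightarrow> cf h \<Longrightarrow> RE (\<lambda>x. EV (f x) (g x) (h x))"
  unfolding EV_def ev_base_def ev_step_def
  by (intro RE_deriv RE_intros cf_intros)

lemma EV_iff:
  "EV (dat m n A M N I V) x v \<longleftrightarrow>
    (\<exists>w. wf m w \<and> x = enc_word w \<and> v = evw (tb n A) (tb n M) (nthc N) (nthc I) (nthc V) w)"
  (is "?E x v \<longleftrightarrow> (\<exists>w. wf m w \<and> x = enc_word w \<and> v = ?ev w)")
proof
  assume "?E x v"
  have "\<exists>w. wf m w \<and> t = pr (enc_word w) (?ev w)" if "deriv ev_base ev_step (dat m n A M N I V) t" for t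
    using that
  proof (induction rule: deriv.induct)
    case (base x)
    then consider "x = pr eE 0" | i where "i < m" "x = pr (eG i) (nthc V i)" unfolding ev_base_def by auto
    then show ?case
    proof cases
      case 1
      then show ?thesis by (intro exI[of _ Emp]) simp
    next
      case 2
      then show ?thesis by (intro exI[of _ "Gen i"]) simp
    qed
  next
    case (step y z x)
    from step.IH(1) obtain a where a: "wf m a" "y = pr (enc_word a) (?ev a)" by (elim exE conjE)
    from step.IH(2) obtain b where b: "wf m b" "z = pr (enc_word b) (?ev b)" by (elim exE conjE)
    from step.hyps(3) consider "x = pr (enc_word (BMul a b)) (?ev (BMul a b))" | "x = pr (enc_word (BAdd a b)) (?ev (BAdd a b))"
      | "x = pr (enc_word (BNeg a)) (?ev (BNeg a))" | "x = pr (enc_word (BInv a)) (?ev (BInv a))"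
      unfolding ev_step_def a(2) b(2) by auto
    then show ?case
    proof cases
      case 1
      then show ?thesis using a(1) b(1) by (intro exI[of _ "BMul a b"]) simp
    next
      case 2
      then show ?thesis using a(1) b(1) by (intro exI[of _ "BAdd a b"]) simp
    next
      case 3
      then show ?thesis using a(1) by (intro exI[of _ "BNeg a"]) simp
    next
      case 4
      then show ?thesis using a(1) by (intro exI[of _ "BInv a"]) simp
    qed
  qed
  from this[OF \<open>?E x v\<close>[unfolded EV_def]] show "\<exists>w. wf m w \<and> x = enc_word w \<and> v = ?ev w" by (auto simp: pr_eq_iff)
next
  have st: "?E u c" if "?E x v" "?E y w" "ev_step (dat m n A M N I V) (pr u c) (pr x v) (pr y w)" for x v y w u c
    using that unfolding EV_def by (rule deriv.step)
  have "wf m w \<Longrightarrow> ?E (enc_word w) (?ev w)" for w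
  proof (induction w)
    case Emp
    show ?case unfolding EV_def by (rule deriv.base) (simp add: ev_base_def)
  next
    case (Gen i)
    then show ?case unfolding EV_def by (intro deriv.base) (auto simp: ev_base_def)
  next
    case (BMul a b)
    then have "?E (enc_word a) (?ev a)" "?E (enc_word b) (?ev b)" by simp_all
    then show ?case by (rule st) (simp add: ev_step_def)
  next
    case (BAdd a b)
    then have "?E (enc_word a) (?ev a)" "?E (enc_word b) (?ev b)" by simp_all
    then show ?case by (rule st) (simp add: ev_step_def)
  next
    case (BNeg a)
    then have "?E (enc_word a) (?ev a)" by simp
    from this this show ?case by (rule st) (simp add: ev_step_def)
  next
    case (BInv a)
    then have "?E (enc_word a) (?ev a)" by simp
    from this this show ?case by (rule st) (simp add: ev_step_def)
  qed
  moreover assume "\<exists>w. wf m w \<and> x = enc_word w \<and> v = ?ev w"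
  ultimately show "?E x v" by auto
qed

text \<open>A list code bounds the length of its list, so \<open>psnd p\<close> bounds the number of
  relators; indices past the end are recognised by \<open>dropc\<close>. The last clause makes
  evaluation surjective, so that the whole table is a quotient of the presented brace.\<close>

definition NEG :: "nat \<Rightarrow> bool" where
  "NEG p \<longleftrightarrow> (\<exists>n A M N I V.
    table_brace n (tb n A) (tb n M) (nthc N) (nthc I) \<and> no_prime_ideal n (tb n A) (tb n M) (nthc N) (nthc I) \<and>
    (\<forall>i<pfst p. nthc V i < n) \<and>
    (\<forall>i<psnd p. dropc (psnd p) i = 0 \<or> EV (dat (pfst p) n A M N I V) (nthc (psnd p) i) 0) \<and>
    (\<forall>v<n. \<exists>w. EV (dat (pfst p) n A M N I V) w v))"

lemma RE_NEG: "RE NEG"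
proof -
  have "RE (\<lambda>p. NEG p)"
    unfolding NEG_def table_brace_def no_prime_ideal_def smul_def by (intro RE_intros cf_intros)
  then show ?thesis by simp
qed

context presentation
begin

lemma NEG_iff_tables:
  "NEG code \<longleftrightarrow> (\<exists>n A M N I V.
    table_brace n (tb n A) (tb n M) (nthc N) (nthc I) \<and> no_prime_ideal n (tb n A) (tb n M) (nthc N) (nthc I) \<and>
    (\<forall>i<m. nthc V i < n) \<and>
    (\<forall>r\<in>set rels. evw (tb n A) (tb n M) (nthc N) (nthc I) (nthc V) r = 0) \<and>
    (\<forall>v<n. \<exists>w. wf m w \<and> v = evw (tb n A) (tb n M) (nthc N) (nthc I) (nthc V) w))"
proof -
  have len: "length rels \<le> psnd code"
    unfolding code_def enc_pres_def using length_le_list_encode[of "map enc_word rels"] by simp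
  have "(\<forall>i<psnd code. dropc (psnd code) i = 0 \<or> EV (dat m n A M N I V) (nthc (psnd code) i) 0) \<longleftrightarrow>
    (\<forall>r\<in>set rels. evw (tb n A) (tb n M) (nthc N) (nthc I) (nthc V) r = 0)" (is "?L \<longleftrightarrow> ?R") for n A M N I V
  proof -
    have "?L \<longleftrightarrow> (\<forall>i<length rels. EV (dat m n A M N I V) (enc_word (rels ! i)) 0)"
      using rel_code len by (metis (no_types, lifting) order_less_le_trans)
    also have "\<dots> \<longleftrightarrow> ?R"
      unfolding EV_iff in_set_conv_nth using wf_rel by (auto simp: all_set_conv_all_nth)
    finally show ?thesis .
  qed
  moreover have "(\<exists>w. EV (dat m n A M N I V) w v) \<longleftrightarrow>
    (\<exists>w. wf m w \<and> v = evw (tb n A) (tb n M) (nthc N) (nthc I) (nthc V) w)" for n A M N I V v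
    unfolding EV_iff by blast
  ultimately show ?thesis unfolding NEG_def pfst_code by simp
qed

end

lemma table_braceD:
  assumes "table_brace n A M N I"
  shows "1 < n" "\<And>x. x < n \<Longrightarrow> N x < n \<and> I x < n \<and> A 0 x = x \<and> A x 0 = x \<and> M 0 x = x \<and> M x 0 = x \<and>
      A x (N x) = 0 \<and> A (N x) x = 0 \<and> M x (I x) = 0 \<and> M (I x) x = 0"
  using assms unfolding table_brace_def by blast+

lemma table_brace_imp_hom:
  assumes "brace C add mul" "h ` C = {..<n}" "table_brace n A M N I"
    and ha: "\<And>x y. x \<in> C \<Longrightarrow> y \<in> C \<Longrightarrow> h (add x y) = A (h x) (h y)"
    and hm: "\<And>x y. x \<in> C \<Longrightarrow> y \<in> C \<Longrightarrow> h (mul x y) = M (h x) (h y)"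
  shows "bhom C add mul {..<n} A M h" "numbered_brace n A M N I"
proof -
  show hom: "bhom C add mul {..<n} A M h" by (rule is_brace_image[OF assms(1,2)]) (erule (1) ha, erule (1) hm)
  interpret H: bhom C add mul "{..<n}" A M h by (rule hom)
  note t = table_braceD[OF assms(3)]
  have z: "gid {..<n} A = 0" by (rule H.B'.A.gid_eqI) (use t in auto)
  show "numbered_brace n A M N I"
  proof unfold_locales
    show "gid {..<n} A = 0" by (rule z)
    fix x assume x: "x < n"
    show "ginv {..<n} A x = N x" by (rule H.B'.A.grp.inv_equality) (use t(2)[OF x] x z in auto)
    show "ginv {..<n} M x = I x" by (rule H.B'.M.grp.inv_equality) (use t(2)[OF x] x z H.B'.gid_mul in auto)
  qed
qed

lemma brace_imp_table_brace:
  assumes "brace {..<n} A M" "1 < n" and z: "gid {..<n} A = 0"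
    and N: "\<And>x. x < n \<Longrightarrow> N x = ginv {..<n} A x" and I: "\<And>x. x < n \<Longrightarrow> I x = ginv {..<n} M x"
  shows "table_brace n A M N I"
proof -
  interpret B: brace "{..<n}" A M by (rule assms(1))
  have "N x < n \<and> I x < n \<and> A 0 x = x \<and> A x 0 = x \<and> M 0 x = x \<and> M x 0 = x \<and>
      A x (N x) = 0 \<and> A (N x) x = 0 \<and> M x (I x) = 0 \<and> M (I x) x = 0" if x: "x < n" for x
  proof -
    have xC: "x \<in> {..<n}" using x by simp
    have "N x \<in> {..<n}" "I x \<in> {..<n}" unfolding N[OF x] I[OF x] using B.A.grp.inv_closed[OF xC] B.M.grp.inv_closed[OF xC] by blast+
    moreover have "A 0 x = x" "A x 0 = x" "M 0 x = x" "M x 0 = x"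
      using B.A.grp.l_one[OF xC] B.A.grp.r_one[OF xC] B.z_mul[OF xC] B.mul_z[OF xC] unfolding z by blast+
    moreover have "A x (N x) = 0" "A (N x) x = 0" "M x (I x) = 0" "M (I x) x = 0"
      unfolding N[OF x] I[OF x] using B.A.grp.r_inv[OF xC] B.A.grp.l_inv[OF xC] B.mul_iv[OF xC] unfolding z by blast+
    ultimately show ?thesis by simp
  qed
  moreover have "A x y < n \<and> M x y < n" if "x < n" "y < n" for x y
    using B.A.grp.m_closed[of x y] B.M.grp.m_closed[of x y] that by simp
  moreover have "A (A x y) w = A x (A y w) \<and> M (M x y) w = M x (M y w) \<and> M x (A y w) = A (A (M x y) (N x)) (M x w)"
    if "x < n" "y < n" "w < n" for x y w
    using B.A.grp.m_assoc[of x y w] B.M.grp.m_assoc[of x y w] B.brace_law[of x y w] N that by simp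
  ultimately show ?thesis unfolding table_brace_def using assms(2) by simp
qed

lemma evw_less:
  assumes t: "table_brace n A M N I" and V: "\<forall>i<m. V i < n"
  shows "wf m w \<Longrightarrow> evw A M N I V w < n"
  by (induction w) (use t V in \<open>simp_all add: table_brace_def\<close>)

lemma evw_bcong:
  assumes t: "table_brace n A M N I" and V: "\<forall>i<m. V i < n" and R: "\<forall>r\<in>set rels. evw A M N I V r = 0"
    and "bcong m rels a b"
  shows "evw A M N I V a = evw A M N I V b"
proof -
  note l = evw_less[OF t V]
  note t1 = table_braceD(2)[OF t]
  have t3: "\<And>x y w. x < n \<Longrightarrow> y < n \<Longrightarrow> w < n \<Longrightarrow> A (A x y) w = A x (A y w) \<and> M (M x y) w = M x (M y w) \<and>
          M x (A y w) = A (A (M x y) (N x)) (M x w)"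
    using t unfolding table_brace_def by blast+
  show ?thesis
    using assms(4)
  proof (induction rule: bcong.induct)
    case (add_assoc a b c)
    then show ?case using t3[OF l l l] by simp
  next
    case (mul_assoc a b c)
    then show ?case using t3[OF l l l] by simp
  next
    case (brace a b c)
    then show ?case using t3[OF l[of a] l[of b] l[of c]] by simp
  next
    case (rel r)
    then show ?case using R by simp
  qed (use t1[OF l] in simp_all)
qed

lemma numbering_with_zero:
  assumes "finite C" "c \<in> C"
  shows "\<exists>f. bij_betw f C {..<card C} \<and> f c = (0::nat)"
proof -
  have "card (C - {c}) = card {1..<card C}" using assms by simp
  then obtain f where f: "bij_betw f (C - {c}) {1..<card C}"
    using finite_same_card_bij[of "C - {c}" "{1..<card C}"] assms(1) by auto
  have f0: "f x \<noteq> 0" if "x \<in> C" "x \<noteq> c" for x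
    using bij_betw_apply[OF f, of x] that by simp
  define f' where "f' x = (if x = c then 0 else f x)" for x
  have C: "C = insert c (C - {c})" using assms(2) by blast
  have "0 < card C" using assms card_gt_0_iff by blast
  then have i: "{..<card C} = insert 0 {1..<card C}" by auto
  have e: "f' ` (C - {c}) = f ` (C - {c})" unfolding f'_def by (intro image_cong) auto
  have "f' ` C = insert (f' c) (f' ` (C - {c}))" by (subst C) (rule image_insert)
  also have "\<dots> = {..<card C}" unfolding e i using f unfolding bij_betw_def by (simp add: f'_def)
  finally have "f' ` C = {..<card C}" .
  moreover have "inj_on f' C"
    using f f0 unfolding bij_betw_def inj_on_def f'_def by (auto split: if_splits)
  ultimately show ?thesis unfolding bij_betw_def by (intro exI[of _ f']) (simp add: f'_def)
qed

context presentation
begin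

text \<open>The table satisfies the brace axioms and the relators, so evaluation is constant on
  congruence classes and gives a surjective homomorphism; its kernel is the ideal over which no
  ideal of prime order exists.\<close>

lemma NEG_imp_not_prime_quotients:
  assumes "NEG code"
  shows "\<not> B.prime_quotients"
proof -
  from assms[unfolded NEG_iff_tables] obtain n A M N I V where
    t: "table_brace n (tb n A) (tb n M) (nthc N) (nthc I)" and
    np: "no_prime_ideal n (tb n A) (tb n M) (nthc N) (nthc I)" and
    V: "\<forall>i<m. nthc V i < n" and
    R: "\<forall>r\<in>set rels. evw (tb n A) (tb n M) (nthc N) (nthc I) (nthc V) r = 0" and
    S: "\<forall>v<n. \<exists>w. wf m w \<and> v = evw (tb n A) (tb n M) (nthc N) (nthc I) (nthc V) w"
    by (elim exE conjE)
  let ?A = "tb n A" and ?M = "tb n M" and ?ev = "evw (tb n A) (tb n M) (nthc N) (nthc I) (nthc V)"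
  have n1: "1 < n" using t unfolding table_brace_def by blast
  note evn = evw_less[OF t V] and evc = evw_bcong[OF t V R]
  define h where "h X = ?ev (SOME w. w \<in> X)" for X
  have hK: "h (K a) = ?ev a" if "wf m a" for a
    unfolding h_def using evc[OF bcong_some[OF that]] by simp
  have onto: "h ` PC = {..<n}"
  proof
    show "h ` PC \<subseteq> {..<n}"
    proof
      fix v assume "v \<in> h ` PC"
      then obtain X where X: "v = h X" "X \<in> PC" by (elim imageE)
      obtain a where "wf m a" "X = K a" using X(2) by (rule PC_cases)
      then show "v \<in> {..<n}" using evn[of a] hK[of a] X(1) by simp
    qed
    show "{..<n} \<subseteq> h ` PC"
    proof
      fix v assume "v \<in> {..<n}"
      then obtain w where w: "wf m w" "v = ?ev w" using S by auto
      show "v \<in> h ` PC" unfolding w(2) hK[OF w(1), symmetric] using w(1) by blast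
    qed
  qed
  have ha: "h (padd X Y) = ?A (h X) (h Y)" "h (pmul X Y) = ?M (h X) (h Y)" if XY: "X \<in> PC" "Y \<in> PC" for X Y
  proof -
    obtain a where a: "wf m a" "X = K a" using XY(1) by (rule PC_cases)
    obtain b where b: "wf m b" "Y = K b" using XY(2) by (rule PC_cases)
    show "h (padd X Y) = ?A (h X) (h Y)" "h (pmul X Y) = ?M (h X) (h Y)" using a b by (simp_all add: hK)
  qed
  have hom: "bhom PC padd pmul {..<n} ?A ?M h" "numbered_brace n ?A ?M (nthc N) (nthc I)"
    by (rule table_brace_imp_hom[OF B.brace_axioms onto t], erule (1) ha(1), erule (1) ha(2))+
  interpret H: bhom PC padd pmul "{..<n}" ?A ?M h by (rule hom(1))
  interpret T: numbered_brace n ?A ?M "nthc N" "nthc I" by (rule hom(2))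
  define Ker where "Ker = {X \<in> PC. h X = H.B'.z}"
  have ker: "h X = H.B'.z \<longleftrightarrow> X \<in> Ker" if "X \<in> PC" for X unfolding Ker_def using that by blast
  have id: "is_ideal PC padd pmul Ker" unfolding Ker_def by (rule H.kernel_ideal)
  have fin: "fin_mod PC padd Ker PC" using H.fin_mod_kernel_iff[OF ker order_refl] onto by simp
  have ne: "Ker \<noteq> PC"
  proof
    assume "Ker = PC"
    then have "h ` PC \<subseteq> {0}" unfolding Ker_def T.z0 by auto
    then have "1 \<in> {0::nat}" using onto n1 by auto
    then show False by simp
  qed
  have "\<not> (\<exists>L. B.pstep Ker L)"
    using H.pstep_kernel_iff[OF ker B.idealD(2)[OF id]] T.no_prime_ideal_iff np T.z0 by simp
  then show ?thesis unfolding B.prime_quotients_def using id fin ne by blast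
qed

text \<open>The offending finite quotient is numbered with its zero first; its operations, inverses
  and images of the generators are then finite functions, which list codes can store.\<close>

lemma not_prime_quotients_imp_NEG:
  assumes "\<not> B.prime_quotients"
  shows "NEG code"
proof -
  obtain Nn where Nn: "is_ideal PC padd pmul Nn" "fin_mod PC padd Nn PC" "Nn \<noteq> PC" "\<not> (\<exists>L. B.pstep Nn L)"
    using assms unfolding B.prime_quotients_def by blast
  obtain C' :: "bword set set" and add' mul' h where h: "bhom PC padd pmul C' add' mul' h"
    and ker: "\<And>x. x \<in> PC \<Longrightarrow> h x = gid C' add' \<longleftrightarrow> x \<in> Nn" by (fact B.quotientE[OF Nn(1)])
  interpret Q: bhom PC padd pmul C' add' mul' h by (rule h)
  have finC: "finite C'" using Q.fin_mod_kernel_iff[OF ker order_refl] Nn(2) Q.h_onto by simp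
  define n where "n = card C'"
  obtain f where f: "bij_betw f C' {..<n}" "f Q.B'.z = 0"
    unfolding n_def using numbering_with_zero[OF finC Q.B'.A.grp.one_closed] by blast
  define fi where "fi = inv_into C' f"
  have fi: "fi (f x) = x" if "x \<in> C'" for x
    unfolding fi_def using bij_betw_inv_into_left[OF f(1) that] .
  have fn: "f x < n" if "x \<in> C'" for x using f(1) that unfolding bij_betw_def by blast
  define k where "k X = f (h X)" for X
  have onto: "k ` PC = {..<n}"
  proof -
    have "k ` PC = f ` (h ` PC)" unfolding k_def by auto
    then show ?thesis using Q.h_onto f(1) unfolding bij_betw_def by simp
  qed
  have kn: "k X < n" if "X \<in> PC" for X using onto that by blast
  obtain A where A: "\<forall>i<n * n. nthc A i = f (add' (fi (i div n)) (fi (i mod n)))"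
    using nthc_surj[of "n * n" "\<lambda>i. f (add' (fi (i div n)) (fi (i mod n)))"] by blast
  obtain M where M: "\<forall>i<n * n. nthc M i = f (mul' (fi (i div n)) (fi (i mod n)))"
    using nthc_surj[of "n * n" "\<lambda>i. f (mul' (fi (i div n)) (fi (i mod n)))"] by blast
  have idx: "n * x + y < n * n" "(n * x + y) div n = x" "(n * x + y) mod n = y" if "x < n" "y < n" for x y
  proof -
    have "n * x + y < n * Suc x" using that by simp
    also have "\<dots> \<le> n * n" using that by (intro mult_le_mono2) simp
    finally show "n * x + y < n * n" .
    show "(n * x + y) div n = x" "(n * x + y) mod n = y" using that by simp_all
  qed
  let ?A = "tb n A" and ?M = "tb n M"
  have kA: "k (padd X Y) = ?A (k X) (k Y)" and kM: "k (pmul X Y) = ?M (k X) (k Y)" if XY: "X \<in> PC" "Y \<in> PC" for X Y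
    using A M idx[OF kn[OF XY(1)] kn[OF XY(2)]] XY unfolding k_def by (simp_all add: fi Q.h_add Q.h_mul)
  interpret R: bhom PC padd pmul "{..<n}" ?A ?M k by (rule is_brace_image[OF B.brace_axioms onto]) (erule (1) kA, erule (1) kM)
  have z0: "R.B'.z = 0" using R.h_z f(2) unfolding k_def by simp
  obtain N where N: "\<forall>i<n. nthc N i = R.B'.neg i" using nthc_surj[of n R.B'.neg] by blast
  obtain I where I: "\<forall>i<n. nthc I i = R.B'.iv i" using nthc_surj[of n R.B'.iv] by blast
  obtain V where V: "\<forall>i<m. nthc V i = k (K (Gen i))" using nthc_surj[of m "\<lambda>i. k (K (Gen i))"] by blast
  have kker: "k x = R.B'.z \<longleftrightarrow> x \<in> Nn" if "x \<in> PC" for x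
  proof -
    have "k x = 0 \<longleftrightarrow> h x = Q.B'.z"
      using f(2) bij_betw_imp_inj_on[OF f(1)] Q.h_in[OF that] Q.B'.A.grp.one_closed
      unfolding k_def inj_on_def by metis
    then show ?thesis using ker[OF that] z0 by simp
  qed
  have n1: "1 < n"
  proof (rule ccontr)
    assume "\<not> 1 < n"
    then have "k X = 0" if "X \<in> PC" for X using kn[OF that] by simp
    then have "PC \<subseteq> Nn" using kker z0 by auto
    then show False using Nn(3) B.idealD(2)[OF Nn(1)] by blast
  qed
  have t: "table_brace n ?A ?M (nthc N) (nthc I)"
    by (rule brace_imp_table_brace[OF R.B'.brace_axioms n1 z0]) (use N I in simp_all)
  interpret T: numbered_brace n ?A ?M "nthc N" "nthc I"
    by unfold_locales (use z0 N I in simp_all)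
  have np: "no_prime_ideal n ?A ?M (nthc N) (nthc I)"
    using T.no_prime_ideal_iff R.pstep_kernel_iff[OF kker B.idealD(2)[OF Nn(1)]] Nn(4) z0 by simp
  have ev: "wf m w \<Longrightarrow> evw ?A ?M (nthc N) (nthc I) (nthc V) w = k (K w)" for w
  proof (induction w)
    case Emp
    then show ?case using R.h_z z0 gid_K by simp
  next
    case (Gen i)
    then show ?case using V by simp
  next
    case (BMul a b)
    then show ?case using kM[of "K a" "K b"] by simp
  next
    case (BAdd a b)
    then show ?case using kA[of "K a" "K b"] by simp
  next
    case (BNeg a)
    then show ?case using R.h_neg[of "K a"] N kn[of "K a"] by simp
  next
    case (BInv a)
    then show ?case using R.h_iv[of "K a"] I kn[of "K a"] by simp
  qed
  have "evw ?A ?M (nthc N) (nthc I) (nthc V) r = 0" if r: "r \<in> set rels" for r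
  proof -
    have w: "wf m r" using r valid unfolding valid_pres_def by blast
    have "K r = K Emp" using K_eq_iff[OF w] bcong.rel[OF r w] by blast
    then show ?thesis using ev[OF w] R.h_z z0 gid_K by simp
  qed
  moreover have "\<exists>w. wf m w \<and> v = evw ?A ?M (nthc N) (nthc I) (nthc V) w" if v: "v < n" for v
  proof -
    have "v \<in> k ` PC" unfolding onto using v by simp
    then obtain X where X: "v = k X" "X \<in> PC" by (elim imageE)
    obtain w where "wf m w" "X = K w" using X(2) by (rule PC_cases)
    then show ?thesis using ev X(1) by (intro exI[of _ w]) simp
  qed
  moreover have "nthc V i < n" if "i < m" for i using V that kn by simp
  ultimately show ?thesis unfolding NEG_iff_tables using t np by blast
qed

text \<open>The circle is closed here: supersoluble, positive certificate,
  \<open>prime_quotients\<close>, and, climbing the almost polycyclic chain, supersoluble again. So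
  both certificates are exact.\<close>

theorem supersoluble_iff:
  assumes "almost_polycyclic PC padd pmul"
  shows "supersoluble PC padd pmul \<longleftrightarrow> POS code" "supersoluble PC padd pmul \<longleftrightarrow> \<not> NEG code"
proof -
  have 1: "supersoluble PC padd pmul \<Longrightarrow> POS code" unfolding POS_iff by (rule B.supersoluble_imp_wreach)
  have 2: "POS code \<Longrightarrow> B.prime_quotients" unfolding POS_iff by (rule B.wreach_imp_prime_quotients)
  have 3: "B.prime_quotients \<longleftrightarrow> \<not> NEG code"
    using NEG_imp_not_prime_quotients not_prime_quotients_imp_NEG by blast
  have 4: "B.prime_quotients \<Longrightarrow> supersoluble PC padd pmul"
  proof -
    assume p: B.prime_quotients
    obtain n where "apc PC padd pmul n {B.z}" using B.almost_polycyclic_imp_apc[OF assms] by blast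
    then show ?thesis using B.sreach_imp_supersoluble B.apc_reach[OF p _ B.ideal_zero] by blast
  qed
  show "supersoluble PC padd pmul \<longleftrightarrow> POS code" using 1 2 4 by blast
  show "supersoluble PC padd pmul \<longleftrightarrow> \<not> NEG code" using 1 2 3 4 by blast
qed

end

theorem theorem3p52:
  shows "\<exists>f::recf. \<forall>m rels.
           valid_pres m rels \<and>
           almost_polycyclic (pres_carrier m rels) (pres_add m rels) (pres_mul m rels) \<longrightarrow>
           reval f [enc_pres m rels]
             (if supersoluble (pres_carrier m rels) (pres_add m rels) (pres_mul m rels) then 1 else 0)"
proof -
  \<comment> \<open>Where both or neither of \<open>POS\<close> and \<open>NEG\<close> hold, nothing
    is claimed of \<open>r\<close>; the promise on the presentation excludes this.\<close>
  obtain r where r: "\<And>x. (POS x \<longleftrightarrow> \<not> NEG x) \<Longrightarrow> reval r [x] (if POS x then 1 else 0)"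
    using RE_decide[OF RE_POS RE_NEG] by blast
  have "reval r [enc_pres m rels]
      (if supersoluble (pres_carrier m rels) (pres_add m rels) (pres_mul m rels) then 1 else 0)"
    if v: "valid_pres m rels" and ap: "almost_polycyclic (pres_carrier m rels) (pres_add m rels) (pres_mul m rels)" for m rels
  proof -
    interpret presentation m rels by unfold_locales (rule v)
    show ?thesis using r[of code] supersoluble_iff[OF ap] unfolding code_def by simp
  qed
  then show ?thesis by blast
qed

end
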